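(* Let $1<p<2$ and $T>0$. Let $u_0\in H^2(0,+\infty)$, $v_{0,+}\in W^{2,p}([0,+\infty)\times(0,+\infty))$, $v_{0,-}\in W^{2,p}((-\infty,0]\times(0,+\infty))$, and define $v_0(x,z):=v_{0,+}(x,z)$ for $x>0$, $v_0(x,z):=v_{0,-}(x,z)$ for $x<0$; assume $v_0\in L^p(\mathbb{R}\times(0,+\infty))$. Assume the jump conditions $$[v_0]_{x=0}\neq 0,\qquad [\partial_x v_0]_{x=0}=0.$$ Let $\mathbf v^0(t,x,z):=\big(u_0(z),\, v_0(x-tu_0(z),z),\,0\big)$, which is a distributional solution on $(0,T)$ of the depleted Euler equations $\partial_t u^0=0$, $\partial_t v^0+u^0\partial_x v^0=0$ with $\mathbf v^0|_{t=0}=(u_0,v_0,0)$. Then there exist smooth solutions $\mathbf v^\epsilon=(u^\epsilon(t,z),v^\epsilon(t,x,z))$ (with suitably chosen initial data) of the depleted Navier–Stokes system $$\partial_t u^\epsilon=\epsilon\partial_z^2u^\epsilon,\qquad \partial_t v^\epsilon+u^\epsilon\partial_x v^\epsilon=\epsilon(\partial_x^2+\partial_z^2)v^\epsilon,\qquad (x,z)\in\mathbb{R}\times(0,+\infty),$$ with the no-slip condition $(u^\epsilon,v^\epsilon)|_{z=0}=0$, such that as $\epsilon\to0$, $$\mathbf v^\epsilon\to\mathbf v^0\quad\text{in } L^\infty\big(0,T;L^2(\mathbb{R}_+)\times L^p(\mathbb{R}\times\mathbb{R}_+)\big).$$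
   Context: For a function $f$ defined on both sides of $\{x=0\}$, $[f]_{x=0}:=\lim_{x\to0^+}f(x,\cdot)-\lim_{x\to0^-}f(x,\cdot)$. $W^{2,p}$ is the Sobolev space of order 2 over $L^p$, and $H^2=W^{2,2}$. The plane-parallel flow $(u(t,z),v(t,x,z),0)$ is automatically divergence free and the 3D Navier–Stokes (resp. Euler) system reduces to the displayed depleted system (resp. its $\epsilon=0$ version) with zero pressure. *)

theory Defs
  imports "HOL-Analysis.Analysis" "HOL-Probability.Probability"
begin

definition pd :: "('a::euclidean_space \<Rightarrow> real) \<Rightarrow> 'a \<Rightarrow> 'a \<Rightarrow> real" where
  "pd f i x = frechet_derivative f (at x) i"

fun Ck :: "nat \<Rightarrow> 'a::euclidean_space set \<Rightarrow> ('a \<Rightarrow> real) \<Rightarrow> bool" where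
  "Ck 0 U f = continuous_on U f"
| "Ck (Suc k) U f = ((\<forall>x\<in>U. f differentiable (at x)) \<and> continuous_on U f \<and>
                      (\<forall>i\<in>Basis. Ck k U (pd f i)))"

definition smooth_on :: "'a::euclidean_space set \<Rightarrow> ('a \<Rightarrow> real) \<Rightarrow> bool" where
  "smooth_on U f = (\<forall>k. Ck k U f)"

definition test_fun :: "'a::euclidean_space set \<Rightarrow> ('a \<Rightarrow> real) \<Rightarrow> bool" where
  "test_fun U \<phi> = (smooth_on UNIV \<phi> \<and> compact (closure {x. \<phi> x \<noteq> 0})
                    \<and> closure {x. \<phi> x \<noteq> 0} \<subseteq> U)"

definition Lp_pow :: "real \<Rightarrow> 'a::euclidean_space set \<Rightarrow> ('a \<Rightarrow> real) \<Rightarrow> ennreal" where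
  "Lp_pow p U f = (\<integral>\<^sup>+ x. indicator U x * ennreal (\<bar>f x\<bar> powr p) \<partial>lborel)"

definition Lp_norm :: "real \<Rightarrow> 'a::euclidean_space set \<Rightarrow> ('a \<Rightarrow> real) \<Rightarrow> ennreal" where
  "Lp_norm p U f = (if Lp_pow p U f < \<top> then ennreal (enn2real (Lp_pow p U f) powr (1 / p)) else \<top>)"

definition Lp :: "real \<Rightarrow> 'a::euclidean_space set \<Rightarrow> ('a \<Rightarrow> real) \<Rightarrow> bool" where
  "Lp p U f = (set_borel_measurable lborel U f \<and> Lp_pow p U f < \<top>)"

definition loc_integrable :: "'a::euclidean_space set \<Rightarrow> ('a \<Rightarrow> real) \<Rightarrow> bool" where
  "loc_integrable U f = (\<forall>K. compact K \<and> K \<subseteq> U \<longrightarrow> set_integrable lborel K f)"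

definition weak_pd :: "'a::euclidean_space set \<Rightarrow> 'a \<Rightarrow> ('a \<Rightarrow> real) \<Rightarrow> ('a \<Rightarrow> real) \<Rightarrow> bool" where
  "weak_pd U i f g = (loc_integrable U f \<and> loc_integrable U g \<and>
     (\<forall>\<phi>. test_fun U \<phi> \<longrightarrow>
        (LINT x:U|lborel. f x * pd \<phi> i x) = - (LINT x:U|lborel. g x * \<phi> x)))"

fun Sobolev :: "nat \<Rightarrow> real \<Rightarrow> 'a::euclidean_space set \<Rightarrow> ('a \<Rightarrow> real) \<Rightarrow> bool" where
  "Sobolev 0 p U f = Lp p U f"
| "Sobolev (Suc k) p U f = (Lp p U f \<and> (\<forall>i\<in>Basis. \<exists>g. weak_pd U i f g \<and> Sobolev k p U g))"

definition trace_right :: "real \<Rightarrow> (real \<times> real \<Rightarrow> real) \<Rightarrow> (real \<Rightarrow> real) \<Rightarrow> bool" where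
  "trace_right p f g = (\<exists>N. N \<in> null_sets lborel \<and>
     ((\<lambda>x. Lp_norm p {0<..} (\<lambda>z. f (x, z) - g z)) \<longlongrightarrow> 0) (at 0 within ({0<..} - N)))"

definition trace_left :: "real \<Rightarrow> (real \<times> real \<Rightarrow> real) \<Rightarrow> (real \<Rightarrow> real) \<Rightarrow> bool" where
  "trace_left p f g = (\<exists>N. N \<in> null_sets lborel \<and>
     ((\<lambda>x. Lp_norm p {0<..} (\<lambda>z. f (x, z) - g z)) \<longlongrightarrow> 0) (at 0 within ({..<0} - N)))"

definition depleted_NS_sol :: "real \<Rightarrow> real \<Rightarrow> (real \<Rightarrow> real \<Rightarrow> real) \<Rightarrow> (real \<Rightarrow> real \<Rightarrow> real \<Rightarrow> real) \<Rightarrow> bool" where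
  "depleted_NS_sol \<epsilon> T u v =
    (smooth_on ({0<..<T} \<times> {0<..}) (\<lambda>(t, z). u t z) \<and>
     smooth_on ({0<..<T} \<times> (UNIV \<times> {0<..})) (\<lambda>(t, x, z). v t x z) \<and>
     continuous_on ({0<..<T} \<times> {0..}) (\<lambda>(t, z). u t z) \<and>
     continuous_on ({0<..<T} \<times> (UNIV \<times> {0..})) (\<lambda>(t, x, z). v t x z) \<and>
     (\<forall>t\<in>{0<..<T}. \<forall>z>0.
        deriv (\<lambda>s. u s z) t = \<epsilon> * deriv (deriv (\<lambda>y. u t y)) z) \<and>
     (\<forall>t\<in>{0<..<T}. \<forall>x. \<forall>z>0.
        deriv (\<lambda>s. v s x z) t + u t z * deriv (\<lambda>y. v t y z) x
          = \<epsilon> * (deriv (deriv (\<lambda>y. v t y z)) x + deriv (deriv (\<lambda>y. v t x y)) z)) \<and>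
     (\<forall>t\<in>{0<..<T}. u t 0 = 0 \<and> (\<forall>x. v t x 0 = 0)))"

end

theory Submission
  imports Defs "HOL-Complex_Analysis.Complex_Analysis"
begin

text \<open>
  Only \<open>u\<^sub>0 \<in> L\<^sup>2\<close> and \<open>v\<^sub>0 \<in> L\<^sup>p\<close> matter. The initial data of the viscous solutions are free, so both
  functions may be replaced by step functions and these by smooth data obtained by running the heat flow
  for a short time \<open>a\<close>: an odd profile for \<open>u\<^sub>0\<close>, and sums of products \<open>F(x) q(z)\<close> with odd \<open>q\<close> for \<open>v\<^sub>0\<close>.
  The heat equation turns the odd profile into \<open>u\<close>, which vanishes on the wall. For the product datum
  \<open>v = (\<Sum>n. \<partial>\<^sub>x\<^sup>n F(a + \<epsilon>t, x) w\<^sub>n(t, z))\<close> solves the second equation as soon as \<open>w\<^sub>0\<close> solves the heat equation and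
  \<open>\<partial>\<^sub>t w\<^sub>n\<^sub>+\<^sub>1 = \<epsilon> \<partial>\<^sub>z\<^sup>2 w\<^sub>n\<^sub>+\<^sub>1 - u w\<^sub>n\<close>, because each \<open>\<partial>\<^sub>x\<^sup>n F\<close> satisfies the heat equation.
  All terms extend holomorphically to \<open>t\<close> and \<open>z\<close> in sectors around the half-line and to entire \<open>x\<close>.
  There \<open>w\<^sub>n\<close> is of size \<open>C\<^sup>n / n!\<close> (iterated Duhamel integrals) and \<open>\<partial>\<^sub>x\<^sup>n F\<close> of size \<open>n! / r\<^sup>n\<close> with \<open>r\<close>
  as large as one likes (Cauchy estimates), so the series converges and \<open>v\<close> is smooth. As \<open>\<epsilon> \<rightarrow> 0\<close> it becomes
  the Taylor series of \<open>F(a, x - t u(z)) q(z)\<close>, and exponential bounds uniform in \<open>\<epsilon>\<close> give convergence in \<open>L\<^sup>p\<close>.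
\<close>

subsection \<open>Holomorphic dependence on parameters\<close>

text \<open>Expanding v in x-derivatives loses one derivative per order. Analyticity in x pays for
  this: the n! of Cauchy's estimate is the n! that the iterated time integrals gain. Complex t and z
  serve a second purpose: a locally bounded function that is holomorphic in each variable has a
  smooth real part, and by Cauchy's estimate a majorant of an integrand or of a series also
  majorises its derivatives. The delicate point is the Duhamel kernel, whose heat time \<epsilon> (t
  - s) tends to 0 as s tends to t: on the cone in z its bound must not deteriorate there, which is
  achieved by turning the contour onto the ray through z. Uniformity in t comes from sequences of
  pairs (\<epsilon>, t) and compactness of [0, T]. The approximations are made in a forced order:
  step function for the initial v, tolerance for the velocity, step function for the initial u,
  smoothing time a, and only then \<epsilon>.\<close>

lemma deriv_bound_ball:
  fixes f :: "complex \<Rightarrow> complex"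
  assumes "f holomorphic_on ball z r" "0 < r" "\<And>w. w \<in> ball z r \<Longrightarrow> norm (f w) \<le> B"
  shows "norm (deriv f z) \<le> B / (r / 2)"
proof -
  have "norm ((deriv ^^ 1) f z) \<le> fact 1 * B / (r/2)^1"
  proof (rule Cauchy_inequality)
    show "f holomorphic_on ball z (r/2)"
      by (rule holomorphic_on_subset[OF assms(1)]) (use assms(2) in auto)
    have "cball z (r/2) \<subseteq> ball z r" using assms(2) by auto
    then show "continuous_on (cball z (r/2)) f"
      using assms(1) holomorphic_on_imp_continuous_on continuous_on_subset by blast
    show "norm (f x) \<le> B" if "norm (z - x) = r/2" for x
      using that assms(2,3) by (auto simp: dist_norm)
  qed (use assms(2) in auto)
  then show ?thesis by simp
qed

lemma DERIV_sequentiallyI: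
  fixes f :: "'a::real_normed_field \<Rightarrow> 'a"
  assumes "\<And>X. (\<And>n. X n \<noteq> 0) \<Longrightarrow> X \<longlonglongrightarrow> 0 \<Longrightarrow> (\<lambda>n. (f (z + X n) - f z) / X n) \<longlonglongrightarrow> D"
  shows "(f has_field_derivative D) (at z)"
  unfolding DERIV_def
  by (subst tendsto_at_iff_sequentially) (use assms in \<open>auto simp: o_def\<close>)

text \<open>Every point of the half ball is the centre of a ball of radius r/2 on which the bound B
  holds, so Cauchy's estimate bounds the derivative by B / (r/4), and convexity turns this into a
  Lipschitz constant. A sup bound thus controls difference quotients.\<close>

lemma difference_quotient_bound:
  fixes f :: "complex \<Rightarrow> complex"
  assumes "f holomorphic_on ball z r" "0 < r" "\<And>w. w \<in> ball z r \<Longrightarrow> norm (f w) \<le> B"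
    and w: "w1 \<in> ball z (r/2)" "w2 \<in> ball z (r/2)"
  shows "norm (f w1 - f w2) \<le> B / (r / 4) * norm (w1 - w2)"
proof (rule field_differentiable_bound[OF convex_ball[of z "r/2"], where f' = "deriv f"])
  fix w assume w: "w \<in> ball z (r/2)"
  have sub: "ball w (r/2) \<subseteq> ball z r"
    by (rule subset_trans[OF _ ball_subset_ball_iff[THEN iffD2]])
       (use w assms(2) in \<open>auto simp: dist_norm norm_minus_commute\<close>)
  have "w \<in> ball z r" using w assms(2) by auto
  then have "(f has_field_derivative deriv f w) (at w)"
    by (rule holomorphic_derivI[OF assms(1) open_ball])
  then show "(f has_field_derivative deriv f w) (at w within ball z (r/2))"
    by (rule has_field_derivative_at_within)
  have "norm (deriv f w) \<le> B / (r/2/2)"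
    by (rule deriv_bound_ball) (use assms sub holomorphic_on_subset in \<open>auto\<close>)
  then show "norm (deriv f w) \<le> B / (r/4)" by simp
qed (use w in auto)

text \<open>A majorant of \<open>h\<close> itself is enough: by
  \<open>difference_quotient_bound\<close> it dominates all difference quotients up to the factor 4
  / r. Measurability of the derivative in the parameter comes along, because it is a pointwise limit
  of measurable quotients.\<close>

lemma has_field_derivative_integral_param:
  fixes h :: "complex \<Rightarrow> 'b \<Rightarrow> complex"
  assumes r: "0 < r"
    and hol: "\<And>y. y \<in> space M \<Longrightarrow> (\<lambda>w. h w y) holomorphic_on ball z r"
    and meas: "\<And>w. w \<in> ball z r \<Longrightarrow> h w \<in> borel_measurable M"
    and g: "integrable M g"
    and bd: "\<And>w y. w \<in> ball z r \<Longrightarrow> y \<in> space M \<Longrightarrow> norm (h w y) \<le> g y"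
  shows "integrable M (\<lambda>y. deriv (\<lambda>w. h w y) z)"
    and "((\<lambda>w. \<integral>y. h w y \<partial>M) has_field_derivative (\<integral>y. deriv (\<lambda>w. h w y) z \<partial>M)) (at z)"
    and "\<And>y. y \<in> space M \<Longrightarrow> norm (deriv (\<lambda>w. h w y) z) \<le> g y / (r / 2)"
    and "(\<lambda>y. deriv (\<lambda>w. h w y) z) \<in> borel_measurable M"
proof -
  have int: "integrable M (h w)" if "w \<in> ball z r" for w
    by (rule Bochner_Integration.integrable_bound[OF g meas[OF that]])
       (use bd[OF that] in \<open>auto intro!: AE_I2 order_trans[OF _ abs_ge_self]\<close>)
  have der: "((\<lambda>w. h w y) has_field_derivative deriv (\<lambda>w. h w y) z) (at z)" if "y \<in> space M" for y
    using holomorphic_derivI[OF hol[OF that]] r by auto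
  have quot: "(\<lambda>n. (h (z + X n) y - h z y) / X n) \<longlonglongrightarrow> deriv (\<lambda>w. h w y) z"
    if "y \<in> space M" "\<And>n. X n \<noteq> 0" "X \<longlonglongrightarrow> 0" for X :: "nat \<Rightarrow> complex" and y
    using der[OF that(1)] that(2,3) unfolding DERIV_def
    by (subst (asm) tendsto_at_iff_sequentially) (auto simp: o_def)
  have key: "(\<lambda>y. deriv (\<lambda>w. h w y) z) \<in> borel_measurable M \<and> integrable M (\<lambda>y. deriv (\<lambda>w. h w y) z) \<and>
     (\<lambda>n. \<integral>y. (h (z + X n) y - h z y) / X n \<partial>M) \<longlonglongrightarrow> (\<integral>y. deriv (\<lambda>w. h w y) z \<partial>M)"
    if X: "\<And>n. X n \<noteq> 0" "X \<longlonglongrightarrow> 0" "\<And>n. norm (X n) < r / 2" for X :: "nat \<Rightarrow> complex"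
  proof -
    have in_ball: "z + X n \<in> ball z (r/2)" "z + X n \<in> ball z r" for n
      using X(3)[of n] r by (auto simp: dist_norm)
    have m1: "(\<lambda>y. (h (z + X n) y - h z y) / X n) \<in> borel_measurable M" for n
      using meas[OF in_ball(2)[of n]] meas[of z] r by (auto intro!: borel_measurable_divide borel_measurable_diff)
    have m2: "(\<lambda>y. deriv (\<lambda>w. h w y) z) \<in> borel_measurable M"
      by (rule borel_measurable_LIMSEQ_metric[OF m1 quot[OF _ X(1,2)]])
    have b: "norm ((h (z + X n) y - h z y) / X n) \<le> g y / (r/4)" if y: "y \<in> space M" for n y
    proof -
      have "norm (h (z + X n) y - h z y) \<le> g y / (r/4) * norm (z + X n - z)"
        by (rule difference_quotient_bound[OF hol[OF y] r bd[OF _ y]]) (use in_ball r in auto)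
      then show ?thesis using X(1)[of n] by (simp add: norm_divide field_simps)
    qed
    have gi: "integrable M (\<lambda>y. g y / (r/4))" using g by simp
    show ?thesis
      by (intro conjI m2 integrable_dominated_convergence[OF m2 m1 gi] integral_dominated_convergence[OF m2 m1 gi])
         (rule AE_I2 quot[OF _ X(1,2)] b | assumption)+
  qed
  \<comment> \<open>One explicit null sequence in the half ball; it yields the measurability and
    integrability claims, which mention no sequence.\<close>
  define X0 where "X0 n = complex_of_real (r / 3 / real (Suc n))" for n
  have X0: "X0 n \<noteq> 0" "X0 \<longlonglongrightarrow> 0" "norm (X0 n) < r / 2" for n
  proof -
    show "X0 n \<noteq> 0" using r by (auto simp: X0_def simp del: of_nat_Suc)
    have "(\<lambda>n. complex_of_real (r / 3 * inverse (real (Suc n)))) \<longlonglongrightarrow> complex_of_real (r / 3 * 0)"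
      by (intro tendsto_of_real tendsto_mult tendsto_const LIMSEQ_inverse_real_of_nat)
    moreover have "(\<lambda>n. complex_of_real (r / 3 * inverse (real (Suc n)))) = X0"
      unfolding X0_def by (simp only: divide_inverse)
    ultimately show "X0 \<longlonglongrightarrow> 0" by (simp only: mult_zero_right of_real_0)
    have "norm (X0 n) = r / 3 / real (Suc n)" using r unfolding X0_def norm_of_real by simp
    also have "\<dots> \<le> r / 3 / 1" using r by (intro divide_left_mono) auto
    also have "\<dots> < r / 2" using r by simp
    finally show "norm (X0 n) < r / 2" .
  qed
  show i: "integrable M (\<lambda>y. deriv (\<lambda>w. h w y) z)"
    and "(\<lambda>y. deriv (\<lambda>w. h w y) z) \<in> borel_measurable M"
    using key[OF X0(1,2,3)] by blast+
  show "norm (deriv (\<lambda>w. h w y) z) \<le> g y / (r / 2)" if "y \<in> space M" for y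
    by (rule deriv_bound_ball[OF hol[OF that] r bd[OF _ that]])
  show "((\<lambda>w. \<integral>y. h w y \<partial>M) has_field_derivative (\<integral>y. deriv (\<lambda>w. h w y) z \<partial>M)) (at z)"
  proof (rule DERIV_sequentiallyI)
    fix X :: "nat \<Rightarrow> complex" assume X: "\<And>n. X n \<noteq> 0" "X \<longlonglongrightarrow> 0"
    have "eventually (\<lambda>n. norm (X n) < r/2) sequentially"
      using tendstoD[OF X(2), of "r/2"] r by (simp add: dist_norm)
    then obtain N where N: "\<And>n. n \<ge> N \<Longrightarrow> norm (X n) < r/2" by (auto simp: eventually_sequentially)
    \<comment> \<open>Dropping the first N members brings the whole sequence into the ball of radius
      r/2, where the quotient bound holds.\<close>
    have "(\<lambda>n. \<integral>y. (h (z + X (n + N)) y - h z y) / X (n + N) \<partial>M) \<longlonglongrightarrow> (\<integral>y. deriv (\<lambda>w. h w y) z \<partial>M)"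
      by (rule key[THEN conjunct2, THEN conjunct2])
         (use X(1) N LIMSEQ_ignore_initial_segment[OF X(2), of N] in simp_all)
    moreover have "(\<integral>y. (h (z + X (n + N)) y - h z y) / X (n + N) \<partial>M)
        = ((\<integral>y. h (z + X (n+N)) y \<partial>M) - (\<integral>y. h z y \<partial>M)) / X (n+N)" for n
    proof -
      have "z + X (n + N) \<in> ball z r" using N[of "n+N"] r by (auto simp: dist_norm)
      then have "integrable M (h (z + X (n+N)))" by (rule int)
      moreover have "integrable M (h z)" using r by (intro int) simp
      ultimately have "(\<integral>y. h (z + X (n + N)) y - h z y \<partial>M) = (\<integral>y. h (z + X (n+N)) y \<partial>M) - (\<integral>y. h z y \<partial>M)"
        by (rule Bochner_Integration.integral_diff)
      then show ?thesis by (simp only: integral_divide_zero)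
    qed
    ultimately have "(\<lambda>n. ((\<integral>y. h (z + X (n+N)) y \<partial>M) - (\<integral>y. h z y \<partial>M)) / X (n+N)) \<longlonglongrightarrow> (\<integral>y. deriv (\<lambda>w. h w y) z \<partial>M)"
      by (simp only:)
    then show "(\<lambda>n. ((\<integral>y. h (z + X n) y \<partial>M) - (\<integral>y. h z y \<partial>M)) / X n) \<longlonglongrightarrow> (\<integral>y. deriv (\<lambda>w. h w y) z \<partial>M)"
      by (rule LIMSEQ_offset)
  qed
qed

text \<open>The measure is left general on purpose: the lemma is applied to Lebesgue measure for
  heat integrals, to the unit interval for Duhamel and circle integrals, and to counting measure for
  the series. Second derivatives follow by applying
  \<open>has_field_derivative_integral_param\<close> to the first derivative, which Cauchy's
  estimate dominates on a smaller ball.\<close>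

lemma holomorphic_integral_param:
  fixes h :: "complex \<Rightarrow> 'b \<Rightarrow> complex"
  assumes D: "open D"
    and hol: "\<And>y. y \<in> space M \<Longrightarrow> (\<lambda>w. h w y) holomorphic_on D"
    and meas: "\<And>w. w \<in> D \<Longrightarrow> h w \<in> borel_measurable M"
    and loc: "\<And>z. z \<in> D \<Longrightarrow> \<exists>r>0. \<exists>g. integrable M g \<and>
        (\<forall>w\<in>ball z r \<inter> D. \<forall>y\<in>space M. norm (h w y) \<le> g y)"
  shows "(\<lambda>w. \<integral>y. h w y \<partial>M) holomorphic_on D"
    and "z \<in> D \<Longrightarrow> deriv (\<lambda>w. \<integral>y. h w y \<partial>M) z = (\<integral>y. deriv (\<lambda>w. h w y) z \<partial>M)"
    and "z \<in> D \<Longrightarrow> integrable M (\<lambda>y. deriv (\<lambda>w. h w y) z)"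
    and "z \<in> D \<Longrightarrow> deriv (deriv (\<lambda>w. \<integral>y. h w y \<partial>M)) z = (\<integral>y. deriv (deriv (\<lambda>w. h w y)) z \<partial>M)"
    and "z \<in> D \<Longrightarrow> integrable M (\<lambda>y. deriv (deriv (\<lambda>w. h w y)) z)"
proof -
  have loc': "\<exists>r>0. ball z r \<subseteq> D \<and> (\<exists>g. integrable M g \<and>
        (\<forall>w\<in>ball z r. \<forall>y\<in>space M. norm (h w y) \<le> g y))" if z: "z \<in> D" for z
  proof -
    obtain r g where r: "r > 0" "integrable M g" "\<forall>w\<in>ball z r \<inter> D. \<forall>y\<in>space M. norm (h w y) \<le> g y"
      using loc[OF z] by auto
    obtain r' where r': "r' > 0" "ball z r' \<subseteq> D" using D z open_contains_ball by blast
    show ?thesis using r r' by (intro exI[of _ "min r r'"] conjI exI[of _ g]) auto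
  qed
  have 1: "((\<lambda>w. \<integral>y. h w y \<partial>M) has_field_derivative (\<integral>y. deriv (\<lambda>w. h w y) z \<partial>M)) (at z)
      \<and> integrable M (\<lambda>y. deriv (\<lambda>w. h w y) z) \<and> (\<lambda>y. deriv (\<lambda>w. h w y) z) \<in> borel_measurable M" if z: "z \<in> D" for z
  proof -
    obtain r g where r: "r > 0" "integrable M g" "ball z r \<subseteq> D" "\<And>w y. w\<in>ball z r \<Longrightarrow> y\<in>space M \<Longrightarrow> norm (h w y) \<le> g y"
      using loc'[OF z] by blast
    have "\<And>y. y \<in> space M \<Longrightarrow> (\<lambda>w. h w y) holomorphic_on ball z r"
      using hol r(3) holomorphic_on_subset by blast
    moreover have "\<And>w. w \<in> ball z r \<Longrightarrow> h w \<in> borel_measurable M" using meas r(3) by blast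
    ultimately show ?thesis
      by (intro conjI has_field_derivative_integral_param(1,2,4)[OF r(1) _ _ r(2) r(4)])
  qed
  show "(\<lambda>w. \<integral>y. h w y \<partial>M) holomorphic_on D"
    using 1 by (auto simp: holomorphic_on_open[OF D])
  show d1: "deriv (\<lambda>w. \<integral>y. h w y \<partial>M) z = (\<integral>y. deriv (\<lambda>w. h w y) z \<partial>M)" if "z \<in> D" for z
    using 1[OF that] by (auto intro: DERIV_imp_deriv)
  show "integrable M (\<lambda>y. deriv (\<lambda>w. h w y) z)" if "z \<in> D" for z using 1[OF that] by auto
  have 2: "((\<lambda>w. \<integral>y. deriv (\<lambda>w. h w y) w \<partial>M) has_field_derivative (\<integral>y. deriv (deriv (\<lambda>w. h w y)) z \<partial>M)) (at z)
      \<and> integrable M (\<lambda>y. deriv (deriv (\<lambda>w. h w y)) z)" if z: "z \<in> D" for z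
  proof -
    obtain r g where r: "r > 0" "integrable M g" "ball z r \<subseteq> D" "\<And>w y. w\<in>ball z r \<Longrightarrow> y\<in>space M \<Longrightarrow> norm (h w y) \<le> g y"
      using loc'[OF z] by blast
    have sub: "ball w (r/2) \<subseteq> ball z r" if "w \<in> ball z (r/2)" for w
      by (rule subset_trans[OF _ ball_subset_ball_iff[THEN iffD2]])
         (use that r(1) in \<open>auto simp: dist_norm norm_minus_commute\<close>)
    have hd: "(\<lambda>w. deriv (\<lambda>w. h w y) w) holomorphic_on ball z (r/2)" if "y \<in> space M" for y
      by (rule holomorphic_deriv) (use hol[OF that] r(1,3) in \<open>auto intro!: holomorphic_on_subset[OF hol[OF that]]\<close>)
    have bb: "norm (deriv (\<lambda>w. h w y) w) \<le> g y / (r/2/2)" if "w \<in> ball z (r/2)" "y \<in> space M" for w y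
      by (rule deriv_bound_ball) (use sub[OF that(1)] r that hol[OF that(2)] in \<open>auto intro: holomorphic_on_subset\<close>)
    have sD: "ball z (r/2) \<subseteq> D" using r(1,3) by auto
    have "\<And>w. w \<in> ball z (r/2) \<Longrightarrow> (\<lambda>y. deriv (\<lambda>w. h w y) w) \<in> borel_measurable M" using 1 sD by blast
    then show ?thesis
      by (intro conjI has_field_derivative_integral_param(1,2)[where r = "r/2" and g = "\<lambda>y. g y / (r/2/2)"])
         (use r(1,2) hd bb in auto)
  qed
  show "integrable M (\<lambda>y. deriv (deriv (\<lambda>w. h w y)) z)" if "z \<in> D" for z using 2[OF that] by auto
  show "deriv (deriv (\<lambda>w. \<integral>y. h w y \<partial>M)) z = (\<integral>y. deriv (deriv (\<lambda>w. h w y)) z \<partial>M)" if "z \<in> D" for z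
  proof -
    have "eventually (\<lambda>w. w \<in> D) (nhds z)" using D that by (rule eventually_nhds_in_open)
    then have "eventually (\<lambda>w. deriv (\<lambda>w. \<integral>y. h w y \<partial>M) w = (\<integral>y. deriv (\<lambda>w. h w y) w \<partial>M)) (nhds z)"
      by eventually_elim (rule d1)
    then have "deriv (deriv (\<lambda>w. \<integral>y. h w y \<partial>M)) z = deriv (\<lambda>w. \<integral>y. deriv (\<lambda>w. h w y) w \<partial>M) z"
      by (rule deriv_cong_ev) simp
    also have "\<dots> = (\<integral>y. deriv (deriv (\<lambda>w. h w y)) z \<partial>M)" using 2[OF that] by (auto intro: DERIV_imp_deriv)
    finally show ?thesis .
  qed
qed

section \<open>Cauchy's formula and holomorphy in two variables\<close>

lemma borel_measurable_continuous_on_restrict_lborel: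
  "continuous_on S f \<Longrightarrow> f \<in> borel_measurable (restrict_space lborel S)"
  using borel_measurable_continuous_on_restrict[of S f]
  by (subst measurable_cong_sets[OF sets_restrict_space_cong[OF sets_lborel] refl])

text \<open>Cauchy's formula on a circle, parametrised over [0, 1]. The parameter space is the same
  for every function, so if f depends on a further variable then so does this integral, and
  \<open>holomorphic_integral_param\<close> applies to the derivative.\<close>

lemma deriv_eq_integral_circle:
  assumes f: "f holomorphic_on S" and S: "cball z r \<subseteq> S" and r: "0 < r"
  shows "deriv f z = (\<integral>\<theta>. f (z + of_real r * exp (2 * of_real pi * \<i> * of_real \<theta>)) *
      (exp (- (2 * of_real pi * \<i> * of_real \<theta>)) / of_real r) \<partial>restrict_space lborel {0..1})"
proof -
  let ?e = "\<lambda>\<theta>::real. exp (2 * of_real pi * \<i> * of_real \<theta>) :: complex"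
  let ?G = "\<lambda>\<theta>. f (z + of_real r * ?e \<theta>) * (exp (- (2 * of_real pi * \<i> * of_real \<theta>)) / of_real r)"
  have ne: "norm (?e \<theta>) = 1" for \<theta>
    using norm_exp_i_times[of "2*pi*\<theta>"] by (simp add: mult_ac)
  have inS: "z + of_real r * ?e \<theta> \<in> S" for \<theta>
    using r by (intro subsetD[OF S]) (simp add: dist_norm norm_mult ne)
  have cf: "continuous_on S f" using f by (rule holomorphic_on_imp_continuous_on)
  have "((\<lambda>u. f u / (u-z) ^ (Suc 1)) has_contour_integral ((2 * pi * \<i>) / (fact 1) * (deriv ^^ 1) f z)) (circlepath z r)"
    by (rule Cauchy_has_contour_integral_higher_derivative_circlepath)
       (use S r in \<open>auto intro!: continuous_on_subset[OF cf] holomorphic_on_subset[OF f]\<close>)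
  then have "((\<lambda>x. f (circlepath z r x) / (circlepath z r x - z)^2 * vector_derivative (circlepath z r) (at x within {0..1}))
       has_integral (2 * pi * \<i> * deriv f z)) {0..1}"
    by (simp add: has_contour_integral_def power2_eq_square)
  then have "((\<lambda>x. (2 * pi * \<i>) * ?G x) has_integral (2 * pi * \<i> * deriv f z)) {0..1}"
  proof (rule has_integral_eq[rotated])
    fix x :: real assume x: "x \<in> {0..1}"
    have "vector_derivative (circlepath z r) (at x within {0..1}) = 2 * pi * \<i> * r * ?e x"
      by (rule vector_derivative_circlepath01) (use x in auto)
    moreover have "circlepath z r x = z + of_real r * ?e x"
      by (simp add: circlepath mult_ac)
    ultimately show "f (circlepath z r x) / (circlepath z r x - z)^2 * vector_derivative (circlepath z r) (at x within {0..1})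
       = (2 * pi * \<i>) * ?G x"
      using r by (simp add: exp_minus power2_eq_square field_simps)
  qed
  from has_integral_mult_right[OF this, of "1 / (2 * pi * \<i>)"]
  have 1: "(?G has_integral deriv f z) {0..1}" by simp
  have c: "continuous_on {0..1} ?G"
    using r inS by (intro continuous_intros continuous_on_compose2[OF cf]) auto
  have "set_integrable lborel {0..1} ?G"
    by (rule borel_integrable_compact[OF compact_Icc c, folded set_integrable_def])
  from set_borel_integral_eq_integral(2)[OF this] integral_unique[OF 1]
  have "deriv f z = (LINT x:{0..1}|lborel. ?G x)" by (simp only:)
  also have "\<dots> = (\<integral>\<theta>. ?G \<theta> \<partial>restrict_space lborel {0..1})"
    unfolding set_lebesgue_integral_def by (rule integral_restrict_space[symmetric]) simp
  finally show ?thesis .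
qed

text \<open>Holomorphy in two variables in Osgood's form. Separate holomorphy and local boundedness
  are what parameter integrals deliver directly; joint continuity and mixed derivatives are
  recovered from them by Cauchy's estimates.\<close>

definition sep_hol :: "complex set \<Rightarrow> complex set \<Rightarrow> (complex \<Rightarrow> complex \<Rightarrow> complex) \<Rightarrow> bool" where
  "sep_hol A B W \<longleftrightarrow> (\<forall>x\<in>B. (\<lambda>t. W t x) holomorphic_on A) \<and> (\<forall>t\<in>A. W t holomorphic_on B) \<and>
     (\<forall>t\<in>A. \<forall>x\<in>B. \<exists>d>0. \<exists>K. \<forall>s\<in>ball t d \<inter> A. \<forall>y\<in>ball x d \<inter> B. norm (W s y) \<le> K)"

lemma sep_hol_flip: "sep_hol A B W \<Longrightarrow> sep_hol B A (\<lambda>x t. W t x)"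
  unfolding sep_hol_def by meson

lemma sep_hol_subset:
  assumes W: "sep_hol A B W" and sub: "A' \<subseteq> A" "B' \<subseteq> B"
  shows "sep_hol A' B' W"
  unfolding sep_hol_def
proof (intro conjI ballI)
  show "(\<lambda>t. W t x) holomorphic_on A'" if "x \<in> B'" for x
    using W sub that unfolding sep_hol_def by (blast intro: holomorphic_on_subset)
  show "W t holomorphic_on B'" if "t \<in> A'" for t
    using W sub that unfolding sep_hol_def by (blast intro: holomorphic_on_subset)
  fix t x assume "t \<in> A'" "x \<in> B'"
  then obtain d K where "d > 0" "\<forall>s\<in>ball t d \<inter> A. \<forall>y\<in>ball x d \<inter> B. norm (W s y) \<le> K"
    using W sub unfolding sep_hol_def by blast
  then show "\<exists>d>0. \<exists>K. \<forall>s\<in>ball t d \<inter> A'. \<forall>y\<in>ball x d \<inter> B'. norm (W s y) \<le> K"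
    using sub by (intro exI[of _ d] conjI exI[of _ K]) auto
qed

lemma sep_holE:
  assumes "sep_hol A B W" "open A" "open B" "t \<in> A" "x \<in> B"
  obtains d K where "d > 0" "K \<ge> 0" "cball t d \<subseteq> A" "cball x d \<subseteq> B"
    "\<And>s y. s \<in> cball t d \<Longrightarrow> y \<in> cball x d \<Longrightarrow> norm (W s y) \<le> K"
proof -
  obtain d K where d: "d > 0" "\<forall>s\<in>ball t d \<inter> A. \<forall>y\<in>ball x d \<inter> B. norm (W s y) \<le> K"
    using assms unfolding sep_hol_def by blast
  obtain d1 where d1: "d1 > 0" "cball t d1 \<subseteq> A" using assms open_contains_cball by blast
  obtain d2 where d2: "d2 > 0" "cball x d2 \<subseteq> B" using assms open_contains_cball by blast
  define d' where "d' = min (d/2) (min d1 d2)"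
  have sub: "cball t d' \<subseteq> A" "cball x d' \<subseteq> B" "cball t d' \<subseteq> ball t d" "cball x d' \<subseteq> ball x d" "d' > 0"
    using d1 d2 d(1) by (auto simp: d'_def)
  have *: "norm (W s y) \<le> K" if "s \<in> cball t d'" "y \<in> cball x d'" for s y
    using d(2) that sub by blast
  have "norm (W t x) \<le> K" using *[of t x] sub by auto
  then have "0 \<le> K" using norm_ge_zero order_trans by blast
  then show ?thesis using that[OF sub(5) _ sub(1,2) *] by blast
qed

text \<open>The increment is split into one step in each variable, and each step is estimated by
  \<open>difference_quotient_bound\<close> with the common local bound K.\<close>

lemma sep_hol_lipschitz:
  assumes "sep_hol A B W" "open A" "open B" "t \<in> A" "x \<in> B"
  obtains d L where "d > 0" "L \<ge> 0" "ball t d \<subseteq> A" "ball x d \<subseteq> B"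
    "\<And>s s' y y'. s \<in> ball t d \<Longrightarrow> s' \<in> ball t d \<Longrightarrow> y \<in> ball x d \<Longrightarrow> y' \<in> ball x d \<Longrightarrow>
       norm (W s y - W s' y') \<le> L * (norm (s - s') + norm (y - y'))"
proof -
  obtain d K where d: "d > 0" "K \<ge> 0" "cball t d \<subseteq> A" "cball x d \<subseteq> B"
    "\<And>s y. s \<in> cball t d \<Longrightarrow> y \<in> cball x d \<Longrightarrow> norm (W s y) \<le> K" using sep_holE[OF assms] by metis
  have b: "ball t d \<subseteq> A" "ball x d \<subseteq> B" using d by (meson ball_subset_cball order_trans)+
  have *: "norm (W s y - W s' y') \<le> K / (d/4) * (norm (s - s') + norm (y - y'))"
    if s: "s \<in> ball t (d/2)" "s' \<in> ball t (d/2)" "y \<in> ball x (d/2)" "y' \<in> ball x (d/2)" for s s' y y'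
  proof -
    have in_b: "y \<in> cball x d" "s' \<in> cball t d" using s d(1) by auto
    then have in_AB: "y \<in> B" "s' \<in> A" using d by auto
    have 1: "norm (W s y - W s' y) \<le> K / (d/4) * norm (s - s')"
      by (rule difference_quotient_bound[where f = "\<lambda>s. W s y"])
         (use s d b in_AB in_b assms(1) in \<open>auto simp: sep_hol_def intro: holomorphic_on_subset\<close>)
    have 2: "norm (W s' y - W s' y') \<le> K / (d/4) * norm (y - y')"
      by (rule difference_quotient_bound[where f = "W s'"])
         (use s d b in_AB in_b assms(1) in \<open>auto simp: sep_hol_def intro: holomorphic_on_subset\<close>)
    have "norm (W s y - W s' y') \<le> norm (W s y - W s' y) + norm (W s' y - W s' y')"
      by (metis dist_norm dist_triangle)
    with 1 2 show ?thesis by (simp add: distrib_left)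
  qed
  show ?thesis
    by (rule that[of "d/2" "K/(d/4)"]) (use d b * in \<open>auto intro!: subsetD[OF d(3)] subsetD[OF d(4)]\<close>)
qed

lemma sep_hol_continuous_on:
  assumes "sep_hol A B W" "open A" "open B"
  shows "continuous_on (A \<times> B) (\<lambda>p. W (fst p) (snd p))"
proof -
  have "isCont (\<lambda>p. W (fst p) (snd p)) (t, x)" if tx: "t \<in> A" "x \<in> B" for t x
  proof -
    obtain d L where d: "d > 0" "L \<ge> 0" "\<And>s s' y y'. s \<in> ball t d \<Longrightarrow> s' \<in> ball t d \<Longrightarrow> y \<in> ball x d \<Longrightarrow> y' \<in> ball x d \<Longrightarrow>
       norm (W s y - W s' y') \<le> L * (norm (s - s') + norm (y - y'))"
      using sep_hol_lipschitz[OF assms tx] by metis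
    have ev: "eventually (\<lambda>p. norm (W (fst p) (snd p) - W t x) \<le> L * (norm (fst p - t) + norm (snd p - x))) (at (t,x))"
    proof -
      have "eventually (\<lambda>p. p \<in> ball t d \<times> ball x d) (at (t,x))"
        by (rule eventually_at_in_open') (use d in \<open>auto intro: open_Times\<close>)
      then show ?thesis by eventually_elim (use d in auto)
    qed
    have lim: "((\<lambda>p. L * (norm (fst p - t) + norm (snd p - x))) \<longlongrightarrow> 0) (at (t,x))"
      by (rule tendsto_eq_intros refl | simp)+
    have "((\<lambda>p. W (fst p) (snd p) - W t x) \<longlongrightarrow> 0) (at (t,x))"
      by (rule Lim_null_comparison[OF ev lim])
    then show ?thesis by (simp add: isCont_def Lim_null[symmetric] LIM_zero_iff)
  qed
  then show ?thesis by (auto intro!: continuous_at_imp_continuous_on)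
qed

text \<open>Cauchy's formula in the second variable writes \<open>deriv (W s) z\<close> as a circle
  integral of functions holomorphic in s, so that the derivative in s goes under the integral. The
  second claim keeps the resulting formula because it is also Cauchy's formula for the mixed
  derivative taken in the other order.\<close>

lemma sep_hol_deriv_param:
  assumes W: "sep_hol A B W" "open A" "open B" and t: "t \<in> A" and z: "z \<in> B"
  shows "(\<lambda>s. deriv (W s) z) holomorphic_on A"
    and "\<exists>r>0. cball z r \<subseteq> B \<and> deriv (\<lambda>s. deriv (W s) z) t =
          (\<integral>\<theta>. deriv (\<lambda>s. W s (z + of_real r * exp (2 * of_real pi * \<i> * of_real \<theta>))) t *
      (exp (- (2 * of_real pi * \<i> * of_real \<theta>)) / of_real r) \<partial>restrict_space lborel {0..1})"
proof -
  let ?e = "\<lambda>\<theta>::real. exp (2 * of_real pi * \<i> * of_real \<theta>) :: complex"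
  let ?q = "\<lambda>\<theta>. (exp (- (2 * of_real pi * \<i> * of_real \<theta>)) / of_real r) :: complex"
  have ne: "norm (?e \<theta>) = 1" "norm (exp (- (2 * of_real pi * \<i> * of_real \<theta>))) = 1" for \<theta>
    using norm_exp_i_times[of "2*pi*\<theta>"] norm_exp_i_times[of "-2*pi*\<theta>"] by (simp_all add: mult_ac)
  have loc: "\<exists>d>0. \<exists>r>0. cball t d \<subseteq> A \<and> cball z r \<subseteq> B \<and>
      ((\<lambda>s. deriv (W s) z) holomorphic_on ball t d) \<and>
      deriv (\<lambda>s. deriv (W s) z) t = (\<integral>\<theta>. deriv (\<lambda>s. W s (z + of_real r * ?e \<theta>)) t *
      (exp (- (2 * of_real pi * \<i> * of_real \<theta>)) / of_real r) \<partial>restrict_space lborel {0..1})" if t: "t \<in> A" for t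
  proof -
    obtain r K where r: "r > 0" "K \<ge> 0" "cball t r \<subseteq> A" "cball z r \<subseteq> B"
      "\<And>s y. s \<in> cball t r \<Longrightarrow> y \<in> cball z r \<Longrightarrow> norm (W s y) \<le> K" using sep_holE[OF W t z] by metis
    let ?q = "\<lambda>\<theta>. (exp (- (2 * of_real pi * \<i> * of_real \<theta>)) / of_real r) :: complex"
    let ?h = "\<lambda>s \<theta>. W s (z + of_real r * ?e \<theta>) * ?q \<theta>"
    have bA: "ball t r \<subseteq> A" using r(3) by (meson ball_subset_cball order_trans)
    have inB: "z + of_real r * ?e \<theta> \<in> cball z r" for \<theta> using r(1) by (simp add: dist_norm norm_mult ne)
    then have inB': "z + of_real r * ?e \<theta> \<in> B" for \<theta> using r(4) by blast
    have rep: "deriv (W s) z = (\<integral>\<theta>. ?h s \<theta> \<partial>restrict_space lborel {0..1})" if "s \<in> ball t r" for s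
      by (rule deriv_eq_integral_circle[of _ B]) (use that W bA r in \<open>auto simp: sep_hol_def\<close>)
    have hol: "(\<lambda>s. ?h s \<theta>) holomorphic_on ball t r" for \<theta>
      using W inB' bA by (intro holomorphic_intros) (auto simp: sep_hol_def intro: holomorphic_on_subset)
    have meas: "?h s \<in> borel_measurable (restrict_space lborel {0..1})" if "s \<in> ball t r" for s
    proof (rule borel_measurable_continuous_on_restrict_lborel)
      have "continuous_on B (W s)" using W that bA by (auto simp: sep_hol_def intro!: holomorphic_on_imp_continuous_on)
      then show "continuous_on {0..1} (?h s)"
        using r(1) inB' by (intro continuous_intros) (auto intro!: continuous_on_compose2[of B "W s"] continuous_intros)
    qed
    have g: "integrable (restrict_space lborel {0..1::real}) (\<lambda>_. K / r)"
      by (rule finite_measure.integrable_const, rule finite_measureI) (simp add: emeasure_restrict_space)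
    have bd: "norm (?h s \<theta>) \<le> K / r" if "s \<in> ball t r" for s \<theta>
    proof -
      have "norm (W s (z + of_real r * ?e \<theta>)) \<le> K" by (rule r(5)[OF _ inB]) (use that in simp)
      moreover have "norm (?q \<theta>) = 1 / r" using r(1) by (simp only: norm_divide ne norm_of_real abs_of_pos)
      ultimately show ?thesis using r(1) by (simp only: norm_mult) (simp add: divide_right_mono)
    qed
    note P = holomorphic_integral_param[of "ball t r" "restrict_space lborel {0..1}" ?h]
    have loc: "\<exists>r'>0. \<exists>g. integrable (restrict_space lborel {0..1::real}) g \<and>
        (\<forall>w\<in>ball s r' \<inter> ball t r. \<forall>y\<in>space (restrict_space lborel {0..1}). norm (?h w y) \<le> g y)" for s
      using g bd by (intro exI[of _ 1] conjI exI[of _ "\<lambda>_. K/r"]) auto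
    have P1: "(\<lambda>s. \<integral>\<theta>. ?h s \<theta> \<partial>restrict_space lborel {0..1}) holomorphic_on ball t r"
      by (rule P(1)) (use hol meas loc in auto)
    have P2: "deriv (\<lambda>s. \<integral>\<theta>. ?h s \<theta> \<partial>restrict_space lborel {0..1}) t =
        (\<integral>\<theta>. deriv (\<lambda>s. ?h s \<theta>) t \<partial>restrict_space lborel {0..1})"
      by (rule P(2)) (use hol meas loc r(1) in auto)
    have "deriv (\<lambda>s. deriv (W s) z) t = deriv (\<lambda>s. \<integral>\<theta>. ?h s \<theta> \<partial>restrict_space lborel {0..1}) t"
      by (rule complex_derivative_transform_within_open[OF _ _ open_ball[of t r]])
         (use P1 rep r(1) in \<open>auto intro: holomorphic_transform\<close>)
    also have "\<dots> = (\<integral>\<theta>. deriv (\<lambda>s. W s (z + of_real r * ?e \<theta>)) t * ?q \<theta> \<partial>restrict_space lborel {0..1})"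
      unfolding P2
    proof (rule Bochner_Integration.integral_cong[OF refl])
      fix \<theta>
      have "(\<lambda>s. W s (z + of_real r * ?e \<theta>)) holomorphic_on A" using W inB' by (auto simp: sep_hol_def)
      then have "((\<lambda>s. W s (z + of_real r * ?e \<theta>)) has_field_derivative deriv (\<lambda>s. W s (z + of_real r * ?e \<theta>)) t) (at t)"
        using t W(2) by (auto intro: holomorphic_derivI)
      from DERIV_cmult_right[OF this, of "?q \<theta>"] show "deriv (\<lambda>s. ?h s \<theta>) t = deriv (\<lambda>s. W s (z + of_real r * ?e \<theta>)) t * ?q \<theta>"
        by (rule DERIV_imp_deriv)
    qed
    finally have "deriv (\<lambda>s. deriv (W s) z) t = (\<integral>\<theta>. deriv (\<lambda>s. W s (z + of_real r * ?e \<theta>)) t * ?q \<theta> \<partial>restrict_space lborel {0..1})" .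
    moreover have "(\<lambda>s. deriv (W s) z) holomorphic_on ball t r"
      using P1 rep by (auto intro: holomorphic_transform)
    ultimately show ?thesis using r by blast
  qed
  show "\<exists>r>0. cball z r \<subseteq> B \<and> deriv (\<lambda>s. deriv (W s) z) t =
          (\<integral>\<theta>. deriv (\<lambda>s. W s (z + of_real r * exp (2 * of_real pi * \<i> * of_real \<theta>))) t *
      (exp (- (2 * of_real pi * \<i> * of_real \<theta>)) / of_real r) \<partial>restrict_space lborel {0..1})"
    using loc[OF t] by blast
  show "(\<lambda>s. deriv (W s) z) holomorphic_on A"
    unfolding holomorphic_on_def
  proof
    fix s assume "s \<in> A"
    from loc[OF this] obtain d where "d > 0" "(\<lambda>s. deriv (W s) z) holomorphic_on ball s d" by blast
    then have "(\<lambda>s. deriv (W s) z) field_differentiable (at s)"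
      by (auto intro: holomorphic_on_imp_differentiable_at)
    then show "(\<lambda>s. deriv (W s) z) field_differentiable (at s within A)"
      by (rule field_differentiable_at_within)
  qed
qed

lemma sep_hol_deriv:
  assumes W: "sep_hol A B W" "open A" "open B"
  shows "sep_hol A B (\<lambda>t x. deriv (W t) x)"
  unfolding sep_hol_def
proof (intro conjI ballI)
  show "(\<lambda>t. deriv (W t) x) holomorphic_on A" if "x \<in> B" for x
  proof (cases "A = {}")
    case False then show ?thesis using sep_hol_deriv_param(1)[OF W _ that] by blast
  qed (simp add: holomorphic_on_def)
  show "deriv (W t) holomorphic_on B" if "t \<in> A" for t
    using W that by (auto simp: sep_hol_def intro: holomorphic_deriv)
  fix t x assume tx: "t \<in> A" "x \<in> B"
  obtain r K where r: "r > 0" "K \<ge> 0" "cball t r \<subseteq> A" "cball x r \<subseteq> B"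
    "\<And>s y. s \<in> cball t r \<Longrightarrow> y \<in> cball x r \<Longrightarrow> norm (W s y) \<le> K" using sep_holE[OF W tx] by metis
  have "norm (deriv (W s) y) \<le> K / (r/2/2)" if "s \<in> ball t (r/2) \<inter> A" "y \<in> ball x (r/2) \<inter> B" for s y
  proof -
    have sub: "ball y (r/2) \<subseteq> cball x r"
      by (rule subset_trans[OF _ ball_subset_cball], rule ball_subset_ball_iff[THEN iffD2])
         (use that r(1) in \<open>auto simp: dist_norm norm_minus_commute\<close>)
    show ?thesis
    proof (rule deriv_bound_ball)
      have "W s holomorphic_on B" using W that by (auto simp: sep_hol_def)
      then show "W s holomorphic_on ball y (r/2)" using sub r(4) holomorphic_on_subset by blast
      show "norm (W s w) \<le> K" if "w \<in> ball y (r/2)" for w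
        by (rule r(5)) (use \<open>s \<in> ball t (r/2) \<inter> A\<close> sub that r(1) in auto)
    qed (use r in auto)
  qed
  then show "\<exists>d>0. \<exists>K. \<forall>s\<in>ball t d \<inter> A. \<forall>y\<in>ball x d \<inter> B. norm (deriv (W s) y) \<le> K"
    using r(1) by (intro exI[of _ "r/2"] conjI exI[of _ "K / (r/2/2)"]) auto
qed

lemma sep_hol_deriv':
  assumes W: "sep_hol A B W" "open A" "open B"
  shows "sep_hol A B (\<lambda>t x. deriv (\<lambda>s. W s x) t)"
  using sep_hol_flip[OF sep_hol_deriv[OF sep_hol_flip[OF W(1)] W(3,2)]] by simp

text \<open>Both sides are the same circle integral: the left one by
  \<open>sep_hol_deriv_param\<close>, the right one by Cauchy's formula for
  \<open>\<lambda>y. deriv (\<lambda>s. W s y) t\<close>.\<close>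

lemma sep_hol_deriv_commute:
  assumes W: "sep_hol A B W" "open A" "open B" and t: "t \<in> A" and z: "z \<in> B"
  shows "deriv (\<lambda>s. deriv (W s) z) t = deriv (\<lambda>y. deriv (\<lambda>s. W s y) t) z"
proof -
  obtain r where r: "r > 0" "cball z r \<subseteq> B" and eq: "deriv (\<lambda>s. deriv (W s) z) t =
          (\<integral>\<theta>. deriv (\<lambda>s. W s (z + of_real r * exp (2 * of_real pi * \<i> * of_real \<theta>))) t *
      (exp (- (2 * of_real pi * \<i> * of_real \<theta>)) / of_real r) \<partial>restrict_space lborel {0..1})"
    using sep_hol_deriv_param(2)[OF W t z] by blast
  have "(\<lambda>y. deriv (\<lambda>s. W s y) t) holomorphic_on B"
    using sep_hol_deriv'[OF W] t by (auto simp: sep_hol_def)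
  from deriv_eq_integral_circle[OF this r(2,1)] show ?thesis using eq by simp
qed

subsection \<open>Real smoothness of separately holomorphic functions\<close>

text \<open>The point x + h is reached by changing one coordinate at a time; the mean value theorem
  along each segment and continuity of the partial derivative at x control the error. The induction
  runs over the set of coordinates already changed.\<close>

lemma has_derivative_continuous_partials:
  fixes f :: "'a::euclidean_space \<Rightarrow> real"
  assumes r: "0 < r"
    and der: "\<And>y i. y \<in> ball x r \<Longrightarrow> i \<in> Basis \<Longrightarrow> ((\<lambda>s. f (y + s *\<^sub>R i)) has_real_derivative g i y) (at 0)"
    and cont: "\<And>i. i \<in> Basis \<Longrightarrow> isCont (g i) x"
  shows "(f has_derivative (\<lambda>h. \<Sum>i\<in>Basis. (h \<bullet> i) * g i x)) (at x)"
proof -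
  have *: "\<forall>e>0. \<exists>d>0. \<forall>h. norm h < d \<longrightarrow>
      \<bar>f (x + (\<Sum>i\<in>A. (h \<bullet> i) *\<^sub>R i)) - f x - (\<Sum>i\<in>A. (h \<bullet> i) * g i x)\<bar> \<le> e * norm h"
    if "finite A" "A \<subseteq> Basis" for A
    using that
  proof (induction A rule: finite_induct)
    case empty
    then show ?case by (auto intro!: exI[of _ 1])
  next
    case (insert i A)
    have i: "i \<in> Basis" "norm i = 1" using insert.prems by auto
    show ?case
    proof (intro allI impI)
      fix e :: real assume e: "e > 0"
      obtain d1 where d1: "d1 > 0" "\<And>h. norm h < d1 \<Longrightarrow>
        \<bar>f (x + (\<Sum>i\<in>A. (h \<bullet> i) *\<^sub>R i)) - f x - (\<Sum>i\<in>A. (h \<bullet> i) * g i x)\<bar> \<le> e/2 * norm h"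
        using insert.IH insert.prems e by (meson half_gt_zero insert_subset)
      have "\<exists>d2>0. \<forall>y. norm (y - x) < d2 \<longrightarrow> norm (g i y - g i x) < e/2"
        using cont[OF i(1)] e unfolding continuous_at_eps_delta dist_norm by (meson half_gt_zero)
      then obtain d2 where d2: "d2 > 0" "\<And>y. norm (y - x) < d2 \<Longrightarrow> norm (g i y - g i x) < e/2"
        by blast
      \<comment> \<open>The broken path makes at most \<open>card A + 1\<close> moves, each no
        longer than \<open>norm h\<close>, so it stays within \<open>m * norm h\<close> of
        x.\<close>
      define m where "m = real (card A) + 1"
      have m: "m \<ge> 1" by (simp add: m_def)
      define d where "d = min d1 (min d2 r / m)"
      have d: "d > 0" using d1 d2 r m by (auto simp: d_def)
      have "\<bar>f (x + (\<Sum>j\<in>insert i A. (h \<bullet> j) *\<^sub>R j)) - f x - (\<Sum>j\<in>insert i A. (h \<bullet> j) * g j x)\<bar> \<le> e * norm h"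
        if h: "norm h < d" for h
      proof -
        define y where "y = x + (\<Sum>j\<in>A. (h \<bullet> j) *\<^sub>R j)"
        define a where "a = h \<bullet> i"
        have a: "\<bar>a\<bar> \<le> norm h" unfolding a_def using Basis_le_norm i by blast
        have "norm (\<Sum>j\<in>A. (h \<bullet> j) *\<^sub>R j) \<le> (\<Sum>j\<in>A. norm h)"
          by (rule sum_norm_le) (use insert.prems Basis_le_norm in \<open>auto simp: subset_iff\<close>)
        then have ny: "norm (y - x) \<le> real (card A) * norm h" by (simp add: y_def)
        have near: "norm (y + s *\<^sub>R i - x) < min d2 r" if s: "\<bar>s\<bar> \<le> \<bar>a\<bar>" for s
        proof -
          have "norm (y + s *\<^sub>R i - x) \<le> norm (y - x) + norm (s *\<^sub>R i)"
            by (metis norm_triangle_ineq add_diff_eq diff_add_eq)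
          also have "\<dots> \<le> m * norm h" using ny s a i by (simp add: m_def distrib_right)
          also have "\<dots> < min d2 r"
            using h m by (simp add: d_def mult.commute pos_less_divide_eq)
          finally show ?thesis .
        qed
        have dd: "((\<lambda>s. f (y + s *\<^sub>R i)) has_real_derivative g i (y + s *\<^sub>R i)) (at s)" if s: "\<bar>s\<bar> \<le> \<bar>a\<bar>" for s
        proof -
          have "y + s *\<^sub>R i \<in> ball x r" using near[OF s] by (auto simp: dist_norm norm_minus_commute)
          from der[OF this i(1)] have "((\<lambda>u. f (y + s *\<^sub>R i + u *\<^sub>R i)) has_real_derivative g i (y + s *\<^sub>R i)) (at 0)" .
          then have "((\<lambda>u. f (y + (s + u) *\<^sub>R i)) has_real_derivative g i (y + s *\<^sub>R i)) (at 0)"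
            by (simp add: scaleR_add_left add.assoc)
          then show ?thesis using DERIV_shift[of "\<lambda>u. f (y + u *\<^sub>R i)" _ 0 s] by (simp add: add.commute)
        qed
        have "\<bar>f (y + a *\<^sub>R i) - f y - a * g i x\<bar> \<le> e / 2 * \<bar>a\<bar>"
        proof (cases "a = 0")
          case False
          have "\<exists>s. \<bar>s\<bar> \<le> \<bar>a\<bar> \<and> f (y + a *\<^sub>R i) - f y = a * g i (y + s *\<^sub>R i)"
          proof (cases "a > 0")
            case True
            from MVT2[OF this, of "\<lambda>s. f (y + s *\<^sub>R i)" "\<lambda>s. g i (y + s *\<^sub>R i)"] dd True
            obtain s where "0 < s" "s < a" "f (y + a *\<^sub>R i) - f (y + 0 *\<^sub>R i) = (a - 0) * g i (y + s *\<^sub>R i)"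
              by auto
            then show ?thesis by (intro exI[of _ s]) auto
          next
            case False
            with \<open>a \<noteq> 0\<close> have "a < 0" by simp
            from MVT2[OF this, of "\<lambda>s. f (y + s *\<^sub>R i)" "\<lambda>s. g i (y + s *\<^sub>R i)"] dd \<open>a < 0\<close>
            obtain s where "a < s" "s < 0" "f (y + 0 *\<^sub>R i) - f (y + a *\<^sub>R i) = (0 - a) * g i (y + s *\<^sub>R i)"
              by auto
            then show ?thesis by (intro exI[of _ s]) (auto simp: algebra_simps)
          qed
          then obtain s where s: "\<bar>s\<bar> \<le> \<bar>a\<bar>" "f (y + a *\<^sub>R i) - f y = a * g i (y + s *\<^sub>R i)" by blast
          have "f (y + a *\<^sub>R i) - f y - a * g i x = a * (g i (y + s *\<^sub>R i) - g i x)"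
            using s(2) by (simp add: algebra_simps)
          moreover have "\<bar>g i (y + s *\<^sub>R i) - g i x\<bar> \<le> e/2"
            using d2(2)[of "y + s *\<^sub>R i"] near[OF s(1)] by auto
          ultimately have "\<bar>f (y + a *\<^sub>R i) - f y - a * g i x\<bar> \<le> \<bar>a\<bar> * (e/2)"
            by (simp only: abs_mult mult_left_mono abs_ge_zero)
          then show ?thesis by (simp only: mult.commute)
        qed simp
        moreover have "\<bar>f y - f x - (\<Sum>j\<in>A. (h \<bullet> j) * g j x)\<bar> \<le> e/2 * norm h"
          unfolding y_def by (rule d1(2)) (use h in \<open>simp add: d_def\<close>)
        moreover have "e / 2 * \<bar>a\<bar> \<le> e/2 * norm h" using a e by simp
        moreover have "x + (\<Sum>j\<in>insert i A. (h \<bullet> j) *\<^sub>R j) = y + a *\<^sub>R i"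
          using insert.hyps by (simp add: y_def a_def add_ac)
        moreover have "(\<Sum>j\<in>insert i A. (h \<bullet> j) * g j x) = a * g i x + (\<Sum>j\<in>A. (h \<bullet> j) * g j x)"
          using insert.hyps by (simp add: a_def)
        ultimately show ?thesis by (simp only:)
      qed
      then show "\<exists>d>0. \<forall>h. norm h < d \<longrightarrow> \<bar>f (x + (\<Sum>j\<in>insert i A. (h \<bullet> j) *\<^sub>R j)) - f x - (\<Sum>j\<in>insert i A. (h \<bullet> j) * g j x)\<bar> \<le> e * norm h"
        using d by blast
    qed
  qed
  show ?thesis
    unfolding has_derivative_at_alt
  proof (intro conjI allI impI)
    show "bounded_linear (\<lambda>h. \<Sum>i\<in>Basis. (h \<bullet> i) * g i x)"
      by (intro bounded_linear_sum bounded_linear_mult_const bounded_linear_inner_left)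
    fix e :: real assume "e > 0"
    then obtain d where d: "d > 0" "\<And>h. norm h < d \<Longrightarrow> \<bar>f (x + (\<Sum>i\<in>Basis. (h \<bullet> i) *\<^sub>R i)) - f x - (\<Sum>i\<in>Basis. (h \<bullet> i) * g i x)\<bar> \<le> e * norm h"
      using *[of Basis] by (meson finite_Basis order_refl)
    have "norm (f y - f x - (\<Sum>i\<in>Basis. ((y - x) \<bullet> i) * g i x)) \<le> e * norm (y - x)" if "norm (y - x) < d" for y
      using d(2)[OF that] by (simp add: euclidean_representation)
    then show "\<exists>d>0. \<forall>y. norm (y - x) < d \<longrightarrow> norm (f y - f x - (\<Sum>i\<in>Basis. ((y - x) \<bullet> i) * g i x)) \<le> e * norm (y - x)"
      using d(1) by blast
  qed
qed

text \<open>A point of the complexification of \<^typ>\<open>'a::euclidean_space\<close> is a pair of its real and imaginary part.\<close>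

definition complex_shift :: "'a::euclidean_space \<times> 'a \<Rightarrow> 'a \<Rightarrow> complex \<Rightarrow> 'a \<times> 'a" where
  "complex_shift p i l = p + (Re l *\<^sub>R i, Im l *\<^sub>R i)"

definition complex_pd :: "('a::euclidean_space \<times> 'a \<Rightarrow> complex) \<Rightarrow> 'a \<Rightarrow> 'a \<times> 'a \<Rightarrow> complex" where
  "complex_pd V i p = deriv (\<lambda>l. V (complex_shift p i l)) 0"

text \<open>The analogue of \<open>sep_hol\<close> over an arbitrary Euclidean space, with one
  complex variable per basis vector, so that a single induction on the order of differentiability
  serves two and three variables.\<close>

definition separately_holomorphic :: "('a::euclidean_space \<times> 'a) set \<Rightarrow> ('a \<times> 'a \<Rightarrow> complex) \<Rightarrow> bool" where
  "separately_holomorphic \<Omega> V \<longleftrightarrow>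
     (\<forall>p\<in>\<Omega>. \<forall>i\<in>Basis. (\<lambda>l. V (complex_shift p i l)) field_differentiable (at 0)) \<and>
     (\<forall>p\<in>\<Omega>. \<exists>d>0. \<exists>K. \<forall>q\<in>ball p d. norm (V q) \<le> K)"

lemma complex_shift_add: "complex_shift (complex_shift p i l) i m = complex_shift p i (l + m)"
  by (simp add: complex_shift_def scaleR_add_left add.assoc)

lemma complex_shift_commute:
  "complex_shift (complex_shift p i l) j m = complex_shift (complex_shift p j m) i l"
  by (simp add: complex_shift_def add_ac)

lemma complex_shift_0 [simp]: "complex_shift p i 0 = p"
  by (simp add: complex_shift_def zero_prod_def[symmetric])

lemma norm_complex_shift: "i \<in> Basis \<Longrightarrow> norm (complex_shift p i l - p) = norm l"
  by (simp add: complex_shift_def norm_Pair cmod_def)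

lemma separately_holomorphic_line:
  assumes V: "separately_holomorphic \<Omega> V" and i: "i \<in> Basis"
    and sub: "\<And>l. l \<in> S \<Longrightarrow> complex_shift p i l \<in> \<Omega>"
  shows "(\<lambda>l. V (complex_shift p i l)) holomorphic_on S"
  unfolding holomorphic_on_def
proof
  fix l assume "l \<in> S"
  then have "complex_shift p i l \<in> \<Omega>" by (rule sub)
  then have "(\<lambda>m. V (complex_shift (complex_shift p i l) i m)) field_differentiable (at 0)"
    using V i by (auto simp: separately_holomorphic_def)
  then obtain D where "((\<lambda>m. V (complex_shift p i (l + m))) has_field_derivative D) (at 0)"
    by (auto simp: complex_shift_add field_differentiable_def)
  then have "((\<lambda>m. V (complex_shift p i m)) has_field_derivative D) (at l)"
    using DERIV_shift[of "\<lambda>m. V (complex_shift p i m)" D 0 l] by (simp add: add.commute)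
  then show "(\<lambda>l. V (complex_shift p i l)) field_differentiable (at l within S)"
    using field_differentiable_def field_differentiable_at_within by blast
qed

text \<open>For a second direction j, the value of V at p shifted by l along i and by m along j is
  \<open>sep_hol\<close> in (l, m) near the origin, both shifts being limited to d / 2, and
  \<open>sep_hol_deriv_param\<close> keeps the l-derivative holomorphic in m. Cauchy's estimate
  gives local boundedness.\<close>

lemma separately_holomorphic_pd:
  assumes V: "separately_holomorphic \<Omega> V" and \<Omega>: "open \<Omega>" and i: "i \<in> Basis"
  shows "separately_holomorphic \<Omega> (complex_pd V i)"
  unfolding separately_holomorphic_def
proof (intro conjI ballI)
  fix p assume p: "p \<in> \<Omega>"
  obtain d0 where d0: "d0 > 0" "ball p d0 \<subseteq> \<Omega>" using \<Omega> p open_contains_ball by blast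
  obtain d1 K where d1: "d1 > 0" "\<forall>q\<in>ball p d1. norm (V q) \<le> K"
    using V p unfolding separately_holomorphic_def by blast
  define d where "d = min d0 d1"
  have d: "d > 0" "ball p d \<subseteq> \<Omega>" "\<And>q. q \<in> ball p d \<Longrightarrow> norm (V q) \<le> K"
    using d0 d1 by (auto simp: d_def)
  {
    fix j :: 'a assume j: "j \<in> Basis"
    define W where "W l m = V (complex_shift (complex_shift p j m) i l)" for l m
    have in_ball: "complex_shift (complex_shift p j m) i l \<in> ball p d" if "l \<in> ball 0 (d/2)" "m \<in> ball 0 (d/2)" for l m
    proof -
      have "norm (complex_shift (complex_shift p j m) i l - complex_shift p j m) < d/2"
        using that i by (simp add: norm_complex_shift)
      moreover have "norm (complex_shift p j m - p) < d/2" using that j by (simp add: norm_complex_shift)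
      ultimately show ?thesis
        by (metis dist_commute dist_norm dist_triangle_half_l mem_ball)
    qed
    have W: "sep_hol (ball 0 (d/2)) (ball 0 (d/2)) W"
      unfolding sep_hol_def
    proof (intro conjI ballI)
      show "(\<lambda>l. W l m) holomorphic_on ball 0 (d/2)" if "m \<in> ball 0 (d/2)" for m
        unfolding W_def by (rule separately_holomorphic_line[OF V i]) (use in_ball that d in blast)
      show "W l holomorphic_on ball 0 (d/2)" if "l \<in> ball 0 (d/2)" for l
        unfolding W_def complex_shift_commute[of p j _ i l]
        by (rule separately_holomorphic_line[OF V j]) (use in_ball[OF that, unfolded complex_shift_commute[of p j _ i l]] d(2) in blast)
      show "\<exists>d'>0. \<exists>K. \<forall>s\<in>ball t d' \<inter> ball 0 (d/2). \<forall>y\<in>ball x d' \<inter> ball 0 (d/2). norm (W s y) \<le> K" for t x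
        using d(3) in_ball by (intro exI[of _ 1] exI[of _ K] conjI) (auto simp: W_def)
    qed
    have "(\<lambda>m. deriv (\<lambda>l. W l m) 0) holomorphic_on ball 0 (d/2)"
      by (rule sep_hol_deriv_param(1)[OF sep_hol_flip[OF W] open_ball open_ball, of 0 0]) (use d(1) in auto)
    then have "(\<lambda>m. deriv (\<lambda>l. W l m) 0) field_differentiable (at 0)"
      using d(1) by (auto intro: holomorphic_on_imp_differentiable_at)
    then show "(\<lambda>l. complex_pd V i (complex_shift p j l)) field_differentiable (at 0)"
      by (simp add: complex_pd_def W_def)
  }
  have "norm (complex_pd V i q) \<le> K / (d/2/2)" if q: "q \<in> ball p (d/2)" for q
    unfolding complex_pd_def
  proof (rule deriv_bound_ball)
    have in_ball: "complex_shift q i l \<in> ball p d" if "l \<in> ball 0 (d/2)" for l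
    proof -
      have "norm (complex_shift q i l - q) < d/2" using that i by (simp add: norm_complex_shift)
      moreover have "norm (q - p) < d/2" using q by (simp add: dist_norm norm_minus_commute)
      ultimately show ?thesis
        by (metis dist_commute dist_norm dist_triangle_half_l mem_ball)
    qed
    show "(\<lambda>l. V (complex_shift q i l)) holomorphic_on ball 0 (d/2)"
      by (rule separately_holomorphic_line[OF V i]) (use in_ball d in blast)
    show "norm (V (complex_shift q i w)) \<le> K" if "w \<in> ball 0 (d/2)" for w
      using in_ball[OF that] d(3) by blast
  qed (use d in auto)
  then show "\<exists>d>0. \<exists>K. \<forall>q\<in>ball p d. norm (complex_pd V i q) \<le> K"
    using d(1) by (intro exI[of _ "d/2"] conjI exI[of _ "K/(d/2/2)"]) auto
qed

text \<open>The constant K is the same for all base points q near p; this allows the coordinates to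
  be moved one after another.\<close>

lemma separately_holomorphic_isCont_slice:
  assumes V: "separately_holomorphic \<Omega> V" and \<Omega>: "open \<Omega>" and i: "i \<in> Basis" and p: "p \<in> \<Omega>"
  obtains d K where "d > 0" "K \<ge> 0"
    "\<And>q l. q \<in> ball p d \<Longrightarrow> norm l < d \<Longrightarrow> norm (V (complex_shift q i l) - V q) \<le> K * norm l"
proof -
  obtain d0 where d0: "d0 > 0" "ball p d0 \<subseteq> \<Omega>" using \<Omega> p open_contains_ball by blast
  obtain d1 K where d1: "d1 > 0" "\<forall>q\<in>ball p d1. norm (V q) \<le> K"
    using V p unfolding separately_holomorphic_def by blast
  define d where "d = min d0 d1"
  have d: "d > 0" "ball p d \<subseteq> \<Omega>" "\<And>q. q \<in> ball p d \<Longrightarrow> norm (V q) \<le> K"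
    using d0 d1 by (auto simp: d_def)
  have K: "K \<ge> 0" using d(3)[of p] d(1) norm_ge_zero order_trans by (metis centre_in_ball)
  show ?thesis
  proof (rule that[of "d/4" "K / (d/2/4)"])
    fix q l assume q: "q \<in> ball p (d/4)" and l: "norm (l::complex) < d/4"
    have in_ball: "complex_shift q i l \<in> ball p d" if "l \<in> ball 0 (d/2)" for l
    proof -
      have "norm (complex_shift q i l - q) < d/2" using that i by (simp add: norm_complex_shift)
      moreover have "norm (q - p) < d/2" using q d(1) by (simp add: dist_norm norm_minus_commute)
      ultimately show ?thesis
        by (metis dist_commute dist_norm dist_triangle_half_l mem_ball)
    qed
    have "norm ((\<lambda>l. V (complex_shift q i l)) l - (\<lambda>l. V (complex_shift q i l)) 0) \<le> K / (d/2/4) * norm (l - 0)"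
    proof (rule difference_quotient_bound)
      show "(\<lambda>l. V (complex_shift q i l)) holomorphic_on ball 0 (d/2)"
        by (rule separately_holomorphic_line[OF V i]) (use in_ball d in blast)
      show "norm (V (complex_shift q i w)) \<le> K" if "w \<in> ball 0 (d/2)" for w
        using in_ball[OF that] d(3) by blast
    qed (use d l in auto)
    then show "norm (V (complex_shift q i l) - V q) \<le> K / (d/2/4) * norm l" by simp
  qed (use d K in auto)
qed

text \<open>Restricted to real points a locally bounded separately holomorphic function is continuous,
  since it is locally Lipschitz along each coordinate.\<close>

lemma separately_holomorphic_isCont_real:
  fixes V :: "('a::euclidean_space \<times> 'a) \<Rightarrow> complex"
  assumes V: "separately_holomorphic \<Omega> V" and \<Omega>: "open \<Omega>" and x: "(x, 0) \<in> \<Omega>"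
  shows "isCont (\<lambda>y. V (y, 0)) x"
proof -
  have *: "((\<lambda>h. V (x + (\<Sum>i\<in>A. (h \<bullet> i) *\<^sub>R i), 0)) \<longlongrightarrow> V (x, 0)) (at 0)"
    if "finite A" "A \<subseteq> Basis" for A using that
  proof (induction A rule: finite_induct)
    case (insert i A)
    have i: "i \<in> Basis" using insert.prems by auto
    obtain d K where d: "d > 0" "K \<ge> 0"
      "\<And>q l. q \<in> ball (x,0) d \<Longrightarrow> norm l < d \<Longrightarrow> norm (V (complex_shift q i l) - V q) \<le> K * norm l"
      using separately_holomorphic_isCont_slice[OF V \<Omega> i x] by metis
    define y where "y h = x + (\<Sum>i\<in>A. (h \<bullet> i) *\<^sub>R i)" for h
    have yl: "(y \<longlongrightarrow> x) (at 0)" unfolding y_def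
      by (rule tendsto_eq_intros refl | simp)+
    have "((\<lambda>h. (y h, 0::'a)) \<longlongrightarrow> (x, 0)) (at 0)" by (intro tendsto_intros yl)
    from tendstoD[OF this d(1)] have e1: "eventually (\<lambda>h. (y h, 0::'a) \<in> ball (x,0) d) (at 0)"
      by (simp only: mem_ball dist_commute)
    have hl: "((\<lambda>h. h \<bullet> i) \<longlongrightarrow> 0) (at 0)" by (rule tendsto_eq_intros refl | simp)+
    then have e2: "eventually (\<lambda>h. norm (complex_of_real (h \<bullet> i)) < d) (at 0)"
      using d(1) by (auto simp: tendsto_iff)
    have "eventually (\<lambda>h. norm (V (y h + (h \<bullet> i) *\<^sub>R i, 0) - V (y h, 0)) \<le> K * \<bar>h \<bullet> i\<bar>) (at 0)"
      using e1 e2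
    proof eventually_elim
      case (elim h)
      from d(3)[OF elim] show ?case by (simp add: complex_shift_def)
    qed
    moreover have "((\<lambda>h. K * \<bar>h \<bullet> i\<bar>) \<longlongrightarrow> 0) (at 0)" using tendsto_mult[OF tendsto_const tendsto_rabs[OF hl]] by simp
    ultimately have "((\<lambda>h. V (y h + (h \<bullet> i) *\<^sub>R i, 0) - V (y h, 0)) \<longlongrightarrow> 0) (at 0)"
      by (rule Lim_null_comparison)
    from tendsto_add[OF this insert.IH[folded y_def]] insert.prems
    have "((\<lambda>h. V (y h + (h \<bullet> i) *\<^sub>R i, 0)) \<longlongrightarrow> V (x, 0)) (at 0)" by simp
    moreover have "x + (\<Sum>i\<in>insert i A. (h \<bullet> i) *\<^sub>R i) = y h + (h \<bullet> i) *\<^sub>R i" for h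
      using insert.hyps by (simp add: y_def add_ac)
    ultimately show ?case by simp
  qed simp
  have "((\<lambda>h. V (x + h, 0)) \<longlongrightarrow> V (x, 0)) (at 0)" using *[of Basis] by (simp add: euclidean_representation)
  then show ?thesis by (simp add: isCont_iff)
qed

text \<open>Complex and real derivatives agree along real directions, so the partial derivatives of
  f are the real parts of \<open>complex_pd V i\<close>. These are separately holomorphic again, and
  the induction on k repeats the argument with them.\<close>

lemma smooth_on_real_part:
  fixes V :: "('a::euclidean_space \<times> 'a) \<Rightarrow> complex"
  assumes V: "separately_holomorphic \<Omega> V" and \<Omega>: "open \<Omega>" and U: "open U" "\<And>x. x \<in> U \<Longrightarrow> (x, 0) \<in> \<Omega>"
    and f: "\<And>x. x \<in> U \<Longrightarrow> f x = Re (V (x, 0))"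
  shows "smooth_on U f"
  unfolding smooth_on_def
proof
  fix k show "Ck k U f" using V f
  proof (induction k arbitrary: V f)
    case (0 V f)
    have "continuous_on U (\<lambda>y. Re (V (y, 0)))"
      by (intro continuous_at_imp_continuous_on ballI isCont_Re separately_holomorphic_isCont_real[OF 0(1) \<Omega> U(2)])
    then show ?case using 0(2) by (simp cong: continuous_on_cong)
  next
    case (Suc k V f)
    have fd: "(f has_derivative (\<lambda>h. \<Sum>i\<in>Basis. (h \<bullet> i) * Re (complex_pd V i (x, 0)))) (at x)" if x: "x \<in> U" for x
    proof -
      obtain r where r: "r > 0" "ball x r \<subseteq> U" using U(1) x open_contains_ball by blast
      have "((\<lambda>y. Re (V (y, 0))) has_derivative (\<lambda>h. \<Sum>i\<in>Basis. (h \<bullet> i) * Re (complex_pd V i (x, 0)))) (at x)"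
      proof (rule has_derivative_continuous_partials[OF r(1)])
        fix y i assume y: "y \<in> ball x r" and i: "(i::'a) \<in> Basis"
        have "(y, 0) \<in> \<Omega>" using y r U by auto
        then have "((\<lambda>l. V (complex_shift (y,0) i l)) has_field_derivative complex_pd V i (y, 0)) (at 0)"
          using Suc.prems(1) i by (auto simp: separately_holomorphic_def complex_pd_def field_differentiable_derivI)
        then have "((\<lambda>l. V (complex_shift (y,0) i l)) has_field_derivative complex_pd V i (y, 0)) (at (of_real 0))"
          by simp
        from has_vector_derivative_real_field[OF this]
        have "((\<lambda>s. V (y + s *\<^sub>R i, 0)) has_vector_derivative complex_pd V i (y, 0)) (at 0)"
          by (simp add: complex_shift_def)
        then have "((\<lambda>s. Re (V (y + s *\<^sub>R i, 0))) has_vector_derivative Re (complex_pd V i (y, 0))) (at 0)"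
          by (rule bounded_linear.has_vector_derivative[OF bounded_linear_Re])
        then show "((\<lambda>s. Re (V (y + s *\<^sub>R i, 0))) has_real_derivative Re (complex_pd V i (y, 0))) (at 0)"
          by (simp add: has_real_derivative_iff_has_vector_derivative)
      next
        fix i :: 'a assume i: "i \<in> Basis"
        show "isCont (\<lambda>y. Re (complex_pd V i (y, 0))) x"
          by (intro isCont_Re separately_holomorphic_isCont_real[OF separately_holomorphic_pd[OF Suc.prems(1) \<Omega> i] \<Omega>] U(2) x)
      qed
      then show ?thesis
        by (rule has_derivative_transform_within_open[OF _ U(1) x]) (use Suc.prems(2) in simp)
    qed
    show ?case unfolding Ck.simps
    proof (intro conjI ballI)
      show "f differentiable at x" if "x \<in> U" for x using fd[OF that] by (auto simp: differentiable_def)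
      then show "continuous_on U f"
        by (intro continuous_at_imp_continuous_on ballI differentiable_imp_continuous_within)
      fix i :: 'a assume i: "i \<in> Basis"
      show "Ck k U (pd f i)"
      proof (rule Suc.IH[OF separately_holomorphic_pd[OF Suc.prems(1) \<Omega> i]])
        fix x assume "x \<in> U"
        have "frechet_derivative f (at x) = (\<lambda>h. \<Sum>i\<in>Basis. (h \<bullet> i) * Re (complex_pd V i (x, 0)))"
          using frechet_derivative_at[OF fd[OF \<open>x \<in> U\<close>]] by simp
        then show "pd f i x = Re (complex_pd V i (x, 0))"
          using i by (simp add: pd_def inner_Basis if_distrib[of "\<lambda>u. u * _"] sum.delta cong: if_cong)
      qed
    qed
  qed
qed

section \<open>Smoothness in two and three real variables\<close>

lemma field_differentiable_shift:
  assumes "f holomorphic_on A" "open A" "a \<in> A"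
  shows "(\<lambda>l. f (a + l)) field_differentiable (at 0)"
proof -
  obtain D where "(f has_field_derivative D) (at a)"
    using assms holomorphic_on_imp_differentiable_at field_differentiable_def by blast
  then have "((\<lambda>l. f (a + l)) has_field_derivative D) (at 0)"
    using DERIV_shift[of f D 0 a] by (simp add: add.commute)
  then show ?thesis by (auto simp: field_differentiable_def)
qed

lemma norm_Complex_diff_le: "norm (Complex a b - Complex a' b') \<le> \<bar>a - a'\<bar> + \<bar>b - b'\<bar>"
  using cmod_le[of "Complex a b - Complex a' b'"] by simp

lemma dist_components_le:
  fixes p q :: "('a::metric_space \<times> 'b::metric_space)"
  shows "dist (fst p) (fst q) \<le> dist p q" "dist (snd p) (snd q) \<le> dist p q"
  using dist_fst_le dist_snd_le by blast+

lemma smooth_on_sep_hol2: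
  assumes W: "sep_hol A B W" and A: "open A" and B: "open B"
    and U: "open U" "\<And>t z. (t, z) \<in> U \<Longrightarrow> of_real t \<in> A \<and> of_real z \<in> B"
    and f: "\<And>t z. (t, z) \<in> U \<Longrightarrow> f (t, z) = Re (W (of_real t) (of_real z))"
  shows "smooth_on U f"
proof (rule smooth_on_real_part[OF _ _ U(1)])
  \<comment> \<open>\<open>fst p\<close> holds the real parts and \<open>snd p\<close> the imaginary
    parts of all coordinates; \<open>c1\<close> and \<open>c2\<close> regroup them into two complex
    numbers.\<close>
  define c1 where "c1 p = Complex (fst (fst p)) (fst (snd p))" for p :: "(real \<times> real) \<times> (real \<times> real)"
  define c2 where "c2 p = Complex (snd (fst p)) (snd (snd p))" for p :: "(real \<times> real) \<times> (real \<times> real)"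
  define V where "V p = W (c1 p) (c2 p)" for p
  define \<Omega> where "\<Omega> = {p. c1 p \<in> A \<and> c2 p \<in> B}"
  have cont: "continuous_on UNIV c1" "continuous_on UNIV c2"
    unfolding c1_def c2_def Complex_eq by (intro continuous_intros)+
  have "\<Omega> = (c1 -` A) \<inter> (c2 -` B)" by (auto simp: \<Omega>_def)
  then show "open \<Omega>" using cont A B by (auto intro!: open_Int open_vimage)
  have sh: "c1 (complex_shift p i l) = c1 p + (fst i) *\<^sub>R l" "c2 (complex_shift p i l) = c2 p + (snd i) *\<^sub>R l" for p i l
    by (auto simp: c1_def c2_def complex_shift_def complex_eq_iff)
  have nr: "norm (c1 p - c1 q) \<le> 2 * norm (p - q)" "norm (c2 p - c2 q) \<le> 2 * norm (p - q)" for p q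
  proof -
    have le: "\<bar>fst (fst p) - fst (fst q)\<bar> \<le> norm (p - q)" "\<bar>snd (fst p) - snd (fst q)\<bar> \<le> norm (p - q)"
      "\<bar>fst (snd p) - fst (snd q)\<bar> \<le> norm (p - q)" "\<bar>snd (snd p) - snd (snd q)\<bar> \<le> norm (p - q)"
      using dist_components_le[of p q] dist_components_le[of "fst p" "fst q"] dist_components_le[of "snd p" "snd q"]
      by (auto simp: dist_norm)
    show "norm (c1 p - c1 q) \<le> 2 * norm (p - q)" "norm (c2 p - c2 q) \<le> 2 * norm (p - q)"
      using norm_Complex_diff_le[of "fst (fst p)" "fst (snd p)" "fst (fst q)" "fst (snd q)"]
        norm_Complex_diff_le[of "snd (fst p)" "snd (snd p)" "snd (fst q)" "snd (snd q)"] le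
      by (auto simp: c1_def c2_def)
  qed
  show "separately_holomorphic \<Omega> V" unfolding separately_holomorphic_def
  proof (intro conjI ballI)
    fix p i assume p: "p \<in> \<Omega>" and i: "(i :: real \<times> real) \<in> Basis"
    have "i = (1, 0) \<or> i = (0, 1)" using i by (auto simp: Basis_prod_def)
    moreover have "(\<lambda>l. W (c1 p + l) (c2 p)) field_differentiable (at 0)"
      by (rule field_differentiable_shift[OF _ A]) (use W p in \<open>auto simp: sep_hol_def \<Omega>_def\<close>)
    moreover have "(\<lambda>l. W (c1 p) (c2 p + l)) field_differentiable (at 0)"
      by (rule field_differentiable_shift[OF _ B]) (use W p in \<open>auto simp: sep_hol_def \<Omega>_def\<close>)
    ultimately show "(\<lambda>l. V (complex_shift p i l)) field_differentiable (at 0)"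
      by (auto simp: V_def sh)
  next
    fix p assume p: "p \<in> \<Omega>"
    then obtain d K where d: "d > 0" "cball (c1 p) d \<subseteq> A" "cball (c2 p) d \<subseteq> B"
      "\<And>s y. s \<in> cball (c1 p) d \<Longrightarrow> y \<in> cball (c2 p) d \<Longrightarrow> norm (W s y) \<le> K"
      using sep_holE[OF W A B, of "c1 p" "c2 p"] unfolding \<Omega>_def by auto metis
    \<comment> \<open>The radius is halved because \<open>c1\<close> and \<open>c2\<close> are
      Lipschitz with constant 2.\<close>
    have "norm (V q) \<le> K" if "q \<in> ball p (d/2)" for q
      unfolding V_def using nr[of p q] that by (intro d(4)) (auto simp: dist_norm)
    then show "\<exists>d>0. \<exists>K. \<forall>q\<in>ball p d. norm (V q) \<le> K"
      using d(1) by (intro exI[of _ "d/2"] conjI exI[of _ K] ballI) simp_all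
  qed
  show "(x, 0) \<in> \<Omega>" if "x \<in> U" for x
    using U(2)[of "fst x" "snd x"] that by (auto simp: \<Omega>_def c1_def c2_def complex_of_real_def)
  show "f x = Re (V (x, 0))" if "x \<in> U" for x
    using f[of "fst x" "snd x"] that by (auto simp: V_def c1_def c2_def complex_of_real_def)
qed

definition sep_hol3 :: "complex set \<Rightarrow> complex set \<Rightarrow> complex set \<Rightarrow> (complex \<Rightarrow> complex \<Rightarrow> complex \<Rightarrow> complex) \<Rightarrow> bool" where
  "sep_hol3 A B C W \<longleftrightarrow> (\<forall>x\<in>B. \<forall>z\<in>C. (\<lambda>t. W t x z) holomorphic_on A) \<and>
     (\<forall>t\<in>A. \<forall>z\<in>C. (\<lambda>x. W t x z) holomorphic_on B) \<and> (\<forall>t\<in>A. \<forall>x\<in>B. W t x holomorphic_on C) \<and>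
     (\<forall>t\<in>A. \<forall>x\<in>B. \<forall>z\<in>C. \<exists>d>0. \<exists>K. \<forall>s\<in>ball t d. \<forall>y\<in>ball x d. \<forall>w\<in>ball z d. norm (W s y w) \<le> K)"

lemma smooth_on_sep_hol3:
  assumes W: "sep_hol3 A B C W" and A: "open A" and B: "open B" and C: "open C"
    and U: "open U" "\<And>t x z. (t, x, z) \<in> U \<Longrightarrow> of_real t \<in> A \<and> of_real x \<in> B \<and> of_real z \<in> C"
    and f: "\<And>t x z. (t, x, z) \<in> U \<Longrightarrow> f (t, x, z) = Re (W (of_real t) (of_real x) (of_real z))"
  shows "smooth_on U f"
proof (rule smooth_on_real_part[OF _ _ U(1)])
  define c1 where "c1 p = Complex (fst (fst p)) (fst (snd p))" for p :: "(real \<times> real \<times> real) \<times> (real \<times> real \<times> real)"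
  define c2 where "c2 p = Complex (fst (snd (fst p))) (fst (snd (snd p)))" for p :: "(real \<times> real \<times> real) \<times> (real \<times> real \<times> real)"
  define c3 where "c3 p = Complex (snd (snd (fst p))) (snd (snd (snd p)))" for p :: "(real \<times> real \<times> real) \<times> (real \<times> real \<times> real)"
  define V where "V p = W (c1 p) (c2 p) (c3 p)" for p
  define \<Omega> where "\<Omega> = {p. c1 p \<in> A \<and> c2 p \<in> B \<and> c3 p \<in> C}"
  have cont: "continuous_on UNIV c1" "continuous_on UNIV c2" "continuous_on UNIV c3"
    unfolding c1_def c2_def c3_def Complex_eq by (intro continuous_intros)+
  have "\<Omega> = (c1 -` A) \<inter> ((c2 -` B) \<inter> (c3 -` C))" by (auto simp: \<Omega>_def)
  then show "open \<Omega>" using cont A B C by (auto intro!: open_Int open_vimage)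
  have sh: "c1 (complex_shift p i l) = c1 p + (fst i) *\<^sub>R l" "c2 (complex_shift p i l) = c2 p + (fst (snd i)) *\<^sub>R l"
     "c3 (complex_shift p i l) = c3 p + (snd (snd i)) *\<^sub>R l" for p i l
    by (auto simp: c1_def c2_def c3_def complex_shift_def complex_eq_iff)
  have nr: "norm (c1 p - c1 q) \<le> 2 * norm (p - q)" "norm (c2 p - c2 q) \<le> 2 * norm (p - q)"
    "norm (c3 p - c3 q) \<le> 2 * norm (p - q)" for p q
  proof -
    note D = dist_components_le
    have 1: "dist (fst p) (fst q) \<le> dist p q" "dist (snd p) (snd q) \<le> dist p q" by (rule D)+
    have 2: "dist (snd (fst p)) (snd (fst q)) \<le> dist p q" "dist (snd (snd p)) (snd (snd q)) \<le> dist p q"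
      using 1 D(2)[of "fst p" "fst q"] D(2)[of "snd p" "snd q"] by linarith+
    have le: "\<bar>fst (fst p) - fst (fst q)\<bar> \<le> norm (p - q)" "\<bar>fst (snd p) - fst (snd q)\<bar> \<le> norm (p - q)"
      using 1 D(1)[of "fst p" "fst q"] D(1)[of "snd p" "snd q"] by (auto simp: dist_norm)
    have le2: "\<bar>fst (snd (fst p)) - fst (snd (fst q))\<bar> \<le> norm (p - q)" "\<bar>snd (snd (fst p)) - snd (snd (fst q))\<bar> \<le> norm (p - q)"
      "\<bar>fst (snd (snd p)) - fst (snd (snd q))\<bar> \<le> norm (p - q)" "\<bar>snd (snd (snd p)) - snd (snd (snd q))\<bar> \<le> norm (p - q)"
      using 2 D[of "snd (fst p)" "snd (fst q)"] D[of "snd (snd p)" "snd (snd q)"] by (auto simp: dist_norm)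
    show "norm (c1 p - c1 q) \<le> 2 * norm (p - q)" "norm (c2 p - c2 q) \<le> 2 * norm (p - q)"
      "norm (c3 p - c3 q) \<le> 2 * norm (p - q)"
      using norm_Complex_diff_le[of "fst (fst p)" "fst (snd p)" "fst (fst q)" "fst (snd q)"]
        norm_Complex_diff_le[of "fst (snd (fst p))" "fst (snd (snd p))" "fst (snd (fst q))" "fst (snd (snd q))"]
        norm_Complex_diff_le[of "snd (snd (fst p))" "snd (snd (snd p))" "snd (snd (fst q))" "snd (snd (snd q))"] le le2
      by (auto simp: c1_def c2_def c3_def)
  qed
  show "separately_holomorphic \<Omega> V" unfolding separately_holomorphic_def
  proof (intro conjI ballI)
    fix p i assume p: "p \<in> \<Omega>" and i: "(i :: real \<times> real \<times> real) \<in> Basis"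
    have "i = (1, 0, 0) \<or> i = (0, 1, 0) \<or> i = (0, 0, 1)" using i by (auto simp: Basis_prod_def zero_prod_def)
    moreover have "(\<lambda>l. W (c1 p + l) (c2 p) (c3 p)) field_differentiable (at 0)"
      by (rule field_differentiable_shift[OF _ A]) (use W p in \<open>auto simp: sep_hol3_def \<Omega>_def\<close>)
    moreover have "(\<lambda>l. W (c1 p) (c2 p + l) (c3 p)) field_differentiable (at 0)"
      by (rule field_differentiable_shift[OF _ B, where f = "\<lambda>x. W (c1 p) x (c3 p)"]) (use W p in \<open>auto simp: sep_hol3_def \<Omega>_def\<close>)
    moreover have "(\<lambda>l. W (c1 p) (c2 p) (c3 p + l)) field_differentiable (at 0)"
      by (rule field_differentiable_shift[OF _ C]) (use W p in \<open>auto simp: sep_hol3_def \<Omega>_def\<close>)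
    ultimately show "(\<lambda>l. V (complex_shift p i l)) field_differentiable (at 0)"
      by (auto simp: V_def sh)
  next
    fix p assume p: "p \<in> \<Omega>"
    then obtain d K where d: "d > 0"
      "\<forall>s\<in>ball (c1 p) d. \<forall>y\<in>ball (c2 p) d. \<forall>w\<in>ball (c3 p) d. norm (W s y w) \<le> K"
      using W unfolding \<Omega>_def sep_hol3_def by blast
    have "norm (V q) \<le> K" if "q \<in> ball p (d/2)" for q
      unfolding V_def using nr[of p q] that by (intro d(2)[rule_format]) (auto simp: dist_norm)
    then show "\<exists>d>0. \<exists>K. \<forall>q\<in>ball p d. norm (V q) \<le> K"
      using d(1) by (intro exI[of _ "d/2"] conjI exI[of _ K] ballI) simp_all
  qed
  show "(x, 0) \<in> \<Omega>" if "x \<in> U" for x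
    using U(2)[of "fst x" "fst (snd x)" "snd (snd x)"] that by (auto simp: \<Omega>_def c1_def c2_def c3_def complex_of_real_def)
  show "f x = Re (V (x, 0))" if "x \<in> U" for x
    using f[of "fst x" "fst (snd x)" "snd (snd x)"] that by (auto simp: V_def c1_def c2_def c3_def complex_of_real_def)
qed

subsection \<open>The heat kernel at complex times and positions\<close>

text \<open>Complex times with argument below pi/4 in modulus: there the real part of 1 / \<tau> is
  comparable to 1 / Re \<tau>, so the Gaussian keeps its decay.\<close>

definition Sec :: "complex set" where "Sec = {\<tau>. 0 < Re \<tau> \<and> \<bar>Im \<tau>\<bar> < Re \<tau>}"

text \<open>The slope 1/8 is small enough that for z in the cone and \<tau> in \<open>Sec\<close>
  the quantity Re (z^2 / \<tau>) is at least half of (Re z)^2 Re (1 / \<tau>).\<close>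

definition Cone :: "complex set" where "Cone = {z. 0 < Re z \<and> \<bar>Im z\<bar> < Re z / 8}"

text \<open>The Gaussian fundamental solution, continued to complex time with the principal square
  root; for \<tau> in \<open>Sec\<close> the radicand stays off the branch cut.\<close>

definition hk :: "complex \<Rightarrow> complex \<Rightarrow> complex" where
  "hk \<tau> X = exp (- (X\<^sup>2) / (4 * \<tau>)) / csqrt (4 * of_real pi * \<tau>)"

definition heat :: "complex \<Rightarrow> (real \<Rightarrow> complex) \<Rightarrow> complex \<Rightarrow> complex" where
  "heat \<tau> \<psi> z = (\<integral>y. hk \<tau> (z - of_real y) * \<psi> y \<partial>lborel)"

definition exp_decay :: "real \<Rightarrow> (real \<Rightarrow> complex) \<Rightarrow> bool" where
  "exp_decay B \<psi> \<longleftrightarrow> \<psi> \<in> borel_measurable borel \<and> (\<forall>y. norm (\<psi> y) \<le> B * exp (- \<bar>y\<bar>))"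

text \<open>Odd reflection reduces the Dirichlet problem on the half-line to the heat flow on the
  whole line. The reflected function takes a complex argument because the data are holomorphic on
  \<open>Cone\<close>.\<close>

definition odd_ext :: "(complex \<Rightarrow> complex) \<Rightarrow> real \<Rightarrow> complex" where
  "odd_ext \<phi> y = (if 0 < y then \<phi> (of_real y) else if y < 0 then - \<phi> (of_real (- y)) else 0)"

lemma open_Sec: "open Sec"
  unfolding Sec_def by (intro open_Collect_conj open_Collect_less continuous_intros)

lemma open_Cone: "open Cone"
  unfolding Cone_def by (intro open_Collect_conj open_Collect_less continuous_intros) auto

lemma convex_Cone: "convex Cone"
proof -
  have eq: "Cone = {z. Re z > 0} \<inter> ({z. inner (Complex (-1/8) 1) z < 0} \<inter> {z. inner (Complex (-1/8) (-1)) z < 0})"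
    by (auto simp: Cone_def inner_complex_def abs_less_iff)
  show ?thesis unfolding eq by (intro convex_Int convex_halfspace_lt convex_halfspace_Re_gt)
qed

lemma Sec_scale: "\<tau> \<in> Sec \<Longrightarrow> 0 < c \<Longrightarrow> of_real c * \<tau> \<in> Sec"
  by (auto simp: Sec_def abs_mult)

lemma Sec_add: "\<tau> \<in> Sec \<Longrightarrow> \<tau>' \<in> Sec \<Longrightarrow> \<tau> + \<tau>' \<in> Sec"
  by (auto simp: Sec_def)

lemma Cone_scale: "z \<in> Cone \<Longrightarrow> 0 < c \<Longrightarrow> z * of_real c \<in> Cone"
  by (auto simp: Cone_def abs_mult field_simps)

lemma of_real_Sec [simp]: "of_real s \<in> Sec \<longleftrightarrow> 0 < s" by (auto simp: Sec_def)
lemma of_real_Cone [simp]: "of_real s \<in> Cone \<longleftrightarrow> 0 < s" "- of_real s \<in> Cone \<longleftrightarrow> s < 0"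
  by (auto simp: Cone_def)

lemma Sec_not_nonpos:
  assumes "\<tau> \<in> Sec" shows "4 * of_real pi * \<tau> \<notin> \<real>\<^sub>\<le>\<^sub>0" "\<tau> \<noteq> 0" "csqrt (4 * of_real pi * \<tau>) \<noteq> 0"
  using assms pi_gt_zero by (auto simp: Sec_def complex_nonpos_Reals_iff mult_le_0_iff simp del: pi_gt_zero)

text \<open>The expression is the real part of 1 / \<tau>. Its comparison with 1 / Re \<tau> uses
  that (Im \<tau>)^2 lies between 0 and (Re \<tau>)^2.\<close>

lemma Re_inverse_Sec:
  assumes "\<tau> \<in> Sec"
  shows "Re \<tau> / (cmod \<tau>)\<^sup>2 \<le> 1 / Re \<tau>" "1 / (2 * Re \<tau>) \<le> Re \<tau> / (cmod \<tau>)\<^sup>2" "0 < Re \<tau> / (cmod \<tau>)\<^sup>2"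
proof -
  have a: "0 < Re \<tau>" "\<bar>Im \<tau>\<bar> < Re \<tau>" using assms by (auto simp: Sec_def)
  have b: "(Im \<tau>)\<^sup>2 \<le> (Re \<tau>)\<^sup>2" using a by (intro abs_le_square_iff[THEN iffD1]) auto
  have n: "(cmod \<tau>)\<^sup>2 = (Re \<tau>)\<^sup>2 + (Im \<tau>)\<^sup>2" by (simp add: cmod_power2)
  have pos: "0 < (cmod \<tau>)\<^sup>2" unfolding n using a by (simp add: add_pos_nonneg)
  show "Re \<tau> / (cmod \<tau>)\<^sup>2 \<le> 1 / Re \<tau>" using a pos n by (simp add: divide_simps power2_eq_square)
  show "1 / (2 * Re \<tau>) \<le> Re \<tau> / (cmod \<tau>)\<^sup>2" using a pos n b by (simp add: divide_simps power2_eq_square)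
  show "0 < Re \<tau> / (cmod \<tau>)\<^sup>2" using a pos by simp
qed

text \<open>When X^2 is multiplied by the conjugate of \<tau>, the mixed term contains Im \<tau>,
  which the sector condition replaces by Re \<tau>; afterwards Re (1 / \<tau>) factors out.\<close>

lemma Re_square_div_ge:
  assumes "\<tau> \<in> Sec"
  shows "Re (X\<^sup>2 / \<tau>) \<ge> Re \<tau> / (cmod \<tau>)\<^sup>2 * ((Re X)\<^sup>2 - (Im X)\<^sup>2 - 2 * \<bar>Re X\<bar> * \<bar>Im X\<bar>)"
proof -
  have a: "0 < Re \<tau>" "\<bar>Im \<tau>\<bar> < Re \<tau>" using assms by (auto simp: Sec_def)
  have "Re (X\<^sup>2 / \<tau>) = Re (X\<^sup>2 * cnj \<tau>) / (cmod \<tau>)\<^sup>2"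
    by (subst complex_div_cnj) (metis Re_divide_of_real of_real_power)
  also have "Re (X\<^sup>2 * cnj \<tau>) = ((Re X)\<^sup>2 - (Im X)\<^sup>2) * Re \<tau> + 2 * Re X * Im X * Im \<tau>"
    by (simp add: power2_eq_square algebra_simps)
  finally have e: "Re (X\<^sup>2 / \<tau>) = (((Re X)\<^sup>2 - (Im X)\<^sup>2) * Re \<tau> + 2 * Re X * Im X * Im \<tau>) / (cmod \<tau>)\<^sup>2" .
  have "\<bar>Re X * Im X * Im \<tau>\<bar> \<le> \<bar>Re X\<bar> * \<bar>Im X\<bar> * Re \<tau>"
    unfolding abs_mult using a by (intro mult_left_mono) auto
  then have "((Re X)\<^sup>2 - (Im X)\<^sup>2) * Re \<tau> + 2 * Re X * Im X * Im \<tau>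
     \<ge> Re \<tau> * ((Re X)\<^sup>2 - (Im X)\<^sup>2 - 2 * \<bar>Re X\<bar> * \<bar>Im X\<bar>)"
    by (simp add: algebra_simps abs_le_iff)
  then show ?thesis unfolding e
    by (metis divide_right_mono times_divide_eq_left zero_le_power2)
qed

lemma norm_hk:
  "norm (hk \<tau> X) = exp (- Re (X\<^sup>2 / \<tau>) / 4) / sqrt (4 * pi * norm \<tau>)"
proof -
  have "- (X\<^sup>2) / (4 * \<tau>) = - ((X\<^sup>2 / \<tau>) / of_real 4)" by simp
  then have "Re (- (X\<^sup>2) / (4 * \<tau>)) = - Re (X\<^sup>2 / \<tau>) / 4" by (simp only: Re_divide_of_real uminus_complex.simps)
  then show ?thesis
    by (simp add: hk_def norm_divide norm_exp_eq_Re norm_mult)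
qed

text \<open>In a strip the worst case of the quadratic form costs only 2 R^2, because (|Re X| - |Im
  X|)^2 is nonnegative. There is no decay in X; the decay of the integrands is left to the
  profile.\<close>

lemma norm_hk_le:
  assumes "\<tau> \<in> Sec" "0 < a" "a \<le> Re \<tau>" "\<bar>Im X\<bar> \<le> R"
  shows "norm (hk \<tau> X) \<le> exp (R\<^sup>2 / (2 * a)) / sqrt (4 * pi * a)"
proof -
  define p where "p = Re \<tau> / (cmod \<tau>)\<^sup>2"
  have p: "0 < p" "p \<le> 1 / Re \<tau>" using Re_inverse_Sec[OF assms(1)] by (auto simp: p_def)
  have pa: "p \<le> 1 / a" using p(2) assms(2,3) by (meson frac_le order_refl order_trans zero_le_one)
  have "(Re X)\<^sup>2 - (Im X)\<^sup>2 - 2 * \<bar>Re X\<bar> * \<bar>Im X\<bar> \<ge> - 2 * R\<^sup>2"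
  proof -
    have "0 \<le> (\<bar>Re X\<bar> - \<bar>Im X\<bar>)\<^sup>2" by simp
    then have "0 \<le> (Re X)\<^sup>2 + (Im X)\<^sup>2 - 2 * \<bar>Re X\<bar> * \<bar>Im X\<bar>" by (simp add: power2_diff)
    moreover have "(Im X)\<^sup>2 \<le> R\<^sup>2" using assms(4) by (metis abs_ge_zero power2_abs power_mono)
    ultimately show ?thesis by simp
  qed
  then have "p * (- 2 * R\<^sup>2) \<le> Re (X\<^sup>2 / \<tau>)"
    using Re_square_div_ge[OF assms(1), of X] p(1) unfolding p_def[symmetric]
    by (meson mult_left_mono order_trans less_imp_le)
  moreover have "p * (2 * R\<^sup>2) \<le> 1 / a * (2 * R\<^sup>2)" using pa by (intro mult_right_mono) auto
  ultimately have "- Re (X\<^sup>2 / \<tau>) / 4 \<le> R\<^sup>2 / (2 * a)" by (simp add: field_simps)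
  moreover have "sqrt (4 * pi * a) \<le> sqrt (4 * pi * norm \<tau>)"
    using assms(3) complex_Re_le_cmod[of \<tau>] by (intro real_sqrt_le_mono mult_left_mono) auto
  ultimately show ?thesis unfolding norm_hk using assms(2)
    by (intro frac_le) auto
qed

lemma holomorphic_csqrt_comp:
  assumes s: "s holomorphic_on L" and sL: "\<And>l. l \<in> L \<Longrightarrow> s l \<in> Sec"
  shows "(\<lambda>l. csqrt (4 * of_real pi * s l)) holomorphic_on L"
proof -
  have "(csqrt \<circ> (\<lambda>l. 4 * of_real pi * s l)) holomorphic_on L"
    by (rule holomorphic_on_compose_gen[of _ _ _ "- \<real>\<^sub>\<le>\<^sub>0"])
       (use s sL Sec_not_nonpos in \<open>auto intro!: holomorphic_intros holomorphic_on_csqrt\<close>)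
  then show ?thesis by (simp add: o_def)
qed

lemma hk_holomorphic:
  assumes s: "s holomorphic_on L" and sL: "\<And>l. l \<in> L \<Longrightarrow> s l \<in> Sec" and X: "X holomorphic_on L"
  shows "(\<lambda>l. hk (s l) (X l)) holomorphic_on L"
  unfolding hk_def
  by (intro holomorphic_intros holomorphic_csqrt_comp s sL X) (use sL Sec_not_nonpos in auto)

text \<open>The factors in the second and third claim coincide for X = z - c: this is the heat
  equation for the kernel, on which \<open>heat_equation\<close> rests.\<close>

lemma hk_has_field_derivatives:
  assumes "\<tau> \<in> Sec"
  shows "((\<lambda>w. hk \<tau> (w - c)) has_field_derivative (- (z - c) / (2 * \<tau>)) * hk \<tau> (z - c)) (at z)"
    and "((\<lambda>w. (- (w - c) / (2 * \<tau>)) * hk \<tau> (w - c)) has_field_derivative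
          (((z - c)\<^sup>2 / (4 * \<tau>\<^sup>2) - 1 / (2 * \<tau>)) * hk \<tau> (z - c))) (at z)"
    and "((\<lambda>\<tau>. hk \<tau> X) has_field_derivative (X\<^sup>2 / (4 * \<tau>\<^sup>2) - 1 / (2 * \<tau>)) * hk \<tau> X) (at \<tau>)"
proof -
  note ne = Sec_not_nonpos[OF assms]
  show 1: "((\<lambda>w. hk \<tau> (w - c)) has_field_derivative (- (z - c) / (2 * \<tau>)) * hk \<tau> (z - c)) (at z)" for z
    unfolding hk_def using ne(2,3)
    by (auto intro!: derivative_eq_intros simp: field_simps power2_eq_square)
  show "((\<lambda>w. (- (w - c) / (2 * \<tau>)) * hk \<tau> (w - c)) has_field_derivative
          (((z - c)\<^sup>2 / (4 * \<tau>\<^sup>2) - 1 / (2 * \<tau>)) * hk \<tau> (z - c))) (at z)"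
    using ne(2) by (auto intro!: derivative_eq_intros 1 simp: field_simps power2_eq_square)
  define q where "q = csqrt (4 * of_real pi * \<tau>)"
  have q: "q \<noteq> 0" "q * q = 4 * of_real pi * \<tau>" using ne(3) power2_csqrt[of "4 * of_real pi * \<tau>"]
    by (auto simp: q_def power2_eq_square)
  have dq: "((\<lambda>\<tau>. csqrt (4 * of_real pi * \<tau>)) has_field_derivative q / (2 * \<tau>)) (at \<tau>)"
  proof -
    have "((\<lambda>\<tau>. csqrt (4 * of_real pi * \<tau>)) has_field_derivative inverse (2 * csqrt (4 * of_real pi * \<tau>)) * (4 * of_real pi)) (at \<tau>)"
      by (rule DERIV_chain2[OF has_field_derivative_csqrt]) (use ne in \<open>auto intro!: derivative_eq_intros\<close>)
    moreover have "inverse (2 * q) * (4 * of_real pi) = q / (2 * \<tau>)"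
      using q ne(2) by (simp add: field_simps)
    ultimately show ?thesis by (simp add: q_def)
  qed
  have de: "((\<lambda>\<tau>. exp (- (X\<^sup>2) / (4 * \<tau>))) has_field_derivative exp (- (X\<^sup>2) / (4 * \<tau>)) * (X\<^sup>2 / (4 * \<tau>\<^sup>2))) (at \<tau>)"
    using ne(2) by (auto intro!: derivative_eq_intros simp: field_simps power2_eq_square)
  have "((\<lambda>\<tau>. hk \<tau> X) has_field_derivative
     (exp (- (X\<^sup>2) / (4 * \<tau>)) * (X\<^sup>2 / (4 * \<tau>\<^sup>2)) * q - exp (- (X\<^sup>2) / (4 * \<tau>)) * (q / (2 * \<tau>))) / (q * q)) (at \<tau>)"
    unfolding hk_def using DERIV_divide[OF de dq] ne(3) by (simp add: q_def)
  moreover have "(exp (- (X\<^sup>2) / (4 * \<tau>)) * (X\<^sup>2 / (4 * \<tau>\<^sup>2)) * q - exp (- (X\<^sup>2) / (4 * \<tau>)) * (q / (2 * \<tau>))) / (q * q)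
     = (X\<^sup>2 / (4 * \<tau>\<^sup>2) - 1 / (2 * \<tau>)) * hk \<tau> X"
  proof -
    have "(E * A * q - E * (q * c)) / (q * q) = (A - c) * (E / q)" for E A c
      using q(1) by (simp add: divide_simps) (simp add: algebra_simps)
    from this[of "exp (- (X\<^sup>2) / (4 * \<tau>))" "X\<^sup>2 / (4 * \<tau>\<^sup>2)" "1 / (2 * \<tau>)"]
    show ?thesis unfolding hk_def q_def[symmetric] by simp
  qed
  ultimately show "((\<lambda>\<tau>. hk \<tau> X) has_field_derivative (X\<^sup>2 / (4 * \<tau>\<^sup>2) - 1 / (2 * \<tau>)) * hk \<tau> X) (at \<tau>)" by simp
qed

lemma continuous_hk:
  assumes "\<tau> \<in> Sec" "continuous_on A f" shows "continuous_on A (\<lambda>y. hk \<tau> (f y))"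
  unfolding hk_def using Sec_not_nonpos[OF assms(1)] by (intro continuous_intros assms) auto

lemma measurable_hk [measurable]: "\<tau> \<in> Sec \<Longrightarrow> (\<lambda>y. hk \<tau> (z - of_real y)) \<in> borel_measurable borel"
  by (intro borel_measurable_continuous_onI continuous_hk continuous_intros)

section \<open>Heat integrals of exponentially decaying profiles\<close>

lemma integrable_exp_abs: "integrable lborel (\<lambda>y::real. exp (- \<bar>y\<bar>))"
proof -
  have "set_integrable lborel {0..} (\<lambda>y::real. exp (- y))"
    using has_bochner_integral_I0i_power_exp_m'[of 0]
    by (auto simp: set_integrable_def has_bochner_integral_iff indicator_times_eq_if mult.commute)
  then have 1: "integrable lborel (\<lambda>y::real. indicator {0..} y *\<^sub>R exp (- y))" by (simp add: set_integrable_def)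
  have "integrable lborel (\<lambda>y::real. indicator {0..} (0 + (-1) * y) *\<^sub>R exp (- (0 + (-1) * y)))"
    by (rule lborel_integrable_real_affine[OF 1]) simp
  then have 2: "integrable lborel (\<lambda>y::real. indicator {0..} (- y) *\<^sub>R exp y)" by simp
  show ?thesis
    by (rule Bochner_Integration.integrable_bound[OF Bochner_Integration.integrable_add[OF 1 2]])
       (auto split: split_indicator)
qed

lemma exp_decay_integrable_hk:
  assumes "exp_decay B \<psi>" "\<tau> \<in> Sec"
  shows "integrable lborel (\<lambda>y. hk \<tau> (z - of_real y) * \<psi> y)"
proof (rule Bochner_Integration.integrable_bound)
  let ?K = "exp (\<bar>Im z\<bar>\<^sup>2 / (2 * Re \<tau>)) / sqrt (4 * pi * Re \<tau>)"
  show "integrable lborel (\<lambda>y. (?K * B) * exp (-\<bar>y\<bar>))" using integrable_exp_abs by simp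
  show "(\<lambda>y. hk \<tau> (z - of_real y) * \<psi> y) \<in> borel_measurable lborel"
    using measurable_hk[OF assms(2), of z] assms(1) unfolding exp_decay_def by (auto intro!: borel_measurable_times)
  have "norm (hk \<tau> (z - of_real y) * \<psi> y) \<le> norm ((?K * B) * exp (-\<bar>y\<bar>))" for y
  proof -
    have "norm (hk \<tau> (z - of_real y)) \<le> ?K"
      by (rule norm_hk_le) (use assms(2) in \<open>auto simp: Sec_def\<close>)
    moreover have "norm (\<psi> y) \<le> B * exp (-\<bar>y\<bar>)" using assms(1) by (auto simp: exp_decay_def)
    ultimately have "norm (hk \<tau> (z - of_real y) * \<psi> y) \<le> ?K * (B * exp (-\<bar>y\<bar>))"
      unfolding norm_mult using assms(2) by (intro mult_mono) (auto simp: Sec_def)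
    then have "norm (hk \<tau> (z - of_real y) * \<psi> y) \<le> (?K * B) * exp (-\<bar>y\<bar>)" by (simp only: mult.assoc)
    then show ?thesis unfolding real_norm_def using abs_ge_self order_trans by blast
  qed
  then show "AE y in lborel. norm (hk \<tau> (z - of_real y) * \<psi> y) \<le> norm ((?K * B) * exp (-\<bar>y\<bar>))" by simp
qed

lemma exp_decay_nonneg: "exp_decay B \<psi> \<Longrightarrow> 0 \<le> B"
  using norm_ge_zero order_trans[of 0 "norm (\<psi> 0)" "B * exp (- \<bar>0\<bar>)"] unfolding exp_decay_def by fastforce

text \<open>Time and profile both depend on the parameter l, as in Duhamel's formula, where t enters
  the heat time and the source alike. The bound B is common to all l, which supplies the integrable
  majorant.\<close>

lemma heat_sep_hol:
  assumes L: "open L" and s: "s holomorphic_on L" and sL: "\<And>l. l \<in> L \<Longrightarrow> s l \<in> Sec"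
    and \<psi>: "\<And>y. (\<lambda>l. \<psi> l y) holomorphic_on L"
    and B: "\<And>l. l \<in> L \<Longrightarrow> exp_decay B (\<psi> l)"
  shows "sep_hol L UNIV (\<lambda>l z. heat (s l) (\<psi> l) z)"
    and "\<And>l z. l \<in> L \<Longrightarrow> deriv (deriv (heat (s l) (\<psi> l))) z =
       (\<integral>y. ((z - of_real y)\<^sup>2 / (4 * (s l)\<^sup>2) - 1 / (2 * s l)) * hk (s l) (z - of_real y) * \<psi> l y \<partial>lborel)"
    and "\<And>l z. l \<in> L \<Longrightarrow> deriv (\<lambda>l. heat (s l) (\<psi> l) z) l =
       (\<integral>y. deriv (\<lambda>l. hk (s l) (z - of_real y) * \<psi> l y) l \<partial>lborel)"
proof -
  have loc: "\<exists>d>0. \<exists>K\<ge>0. \<forall>l'\<in>ball l d \<inter> L. \<forall>z'\<in>ball z d. \<forall>y. norm (hk (s l') (z' - of_real y) * \<psi> l' y) \<le> K * B * exp (- \<bar>y\<bar>)"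
    if l: "l \<in> L" for l z
  proof -
    \<comment> \<open>Half of the real part of the time at l; near l the real part stays above it,
      which gives one kernel bound for a whole neighbourhood.\<close>
    define a where "a = Re (s l) / 2"
    have a: "a > 0" "a < Re (s l)" using sL[OF l] by (auto simp: a_def Sec_def)
    have "isCont s l" using s l L by (auto intro!: continuous_on_interior holomorphic_on_imp_continuous_on simp: interior_open)
    then have "eventually (\<lambda>l'. a < Re (s l')) (at l)"
      using a(2) order_tendstoD(1)[of "\<lambda>l'. Re (s l')" "Re (s l)" "at l" a] by (simp add: isCont_def tendsto_Re)
    then obtain d where d: "d > 0" "\<And>l'. l' \<noteq> l \<Longrightarrow> dist l' l < d \<Longrightarrow> a < Re (s l')"
      unfolding eventually_at by blast
    have d': "a \<le> Re (s l')" if "l' \<in> ball l d" for l'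
      using d(2)[of l'] that a(2) by (cases "l' = l") (auto simp: dist_commute)
    define K where "K = exp ((\<bar>Im z\<bar> + d)\<^sup>2 / (2 * a)) / sqrt (4 * pi * a)"
    have "norm (hk (s l') (z' - of_real y) * \<psi> l' y) \<le> K * (B * exp (- \<bar>y\<bar>))"
      if "l' \<in> ball l d \<inter> L" "z' \<in> ball z d" for l' z' y
      unfolding norm_mult
    proof (rule mult_mono)
      have "\<bar>Im z'\<bar> \<le> \<bar>Im z\<bar> + d" using that(2) abs_Im_le_cmod[of "z - z'"] by (auto simp: dist_norm)
      then show "norm (hk (s l') (z' - of_real y)) \<le> K"
        unfolding K_def using that d' a sL by (intro norm_hk_le) auto
      show "norm (\<psi> l' y) \<le> B * exp (- \<bar>y\<bar>)" using B that by (auto simp: exp_decay_def)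
    qed (use a in \<open>auto simp: K_def\<close>)
    then show ?thesis using d(1) a by (intro exI[of _ d] conjI exI[of _ K]) (auto simp: K_def mult.assoc)
  qed
  have meas: "(\<lambda>y. hk (s l) (z - of_real y) * \<psi> l y) \<in> borel_measurable lborel" if "l \<in> L" for l z
    using measurable_hk[OF sL[OF that], of z] B[OF that] unfolding exp_decay_def by (auto intro!: borel_measurable_times)
  have intg: "integrable lborel (\<lambda>y. K * B * exp (- \<bar>y::real\<bar>))" for K using integrable_exp_abs by simp
  have hl: "(\<lambda>l. hk (s l) (z - of_real y) * \<psi> l y) holomorphic_on L" for z y
    by (intro holomorphic_intros hk_holomorphic s sL \<psi>)
  have hz: "(\<lambda>z. hk (s l) (z - of_real y) * \<psi> l y) holomorphic_on UNIV" if "l \<in> L" for l y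
    by (intro holomorphic_intros hk_holomorphic) (use sL that in auto)
  have ll: "\<exists>r>0. \<exists>g. integrable lborel g \<and> (\<forall>w\<in>ball l r \<inter> L. \<forall>y\<in>space lborel. norm (hk (s w) (z - of_real y) * \<psi> w y) \<le> g y)" if lL: "l \<in> L" for l z
  proof -
    obtain d K where "d > 0" "\<forall>l'\<in>ball l d \<inter> L. \<forall>z'\<in>ball z d. \<forall>y. norm (hk (s l') (z' - of_real y) * \<psi> l' y) \<le> K * B * exp (- \<bar>y\<bar>)"
      using loc[OF lL, of z] by blast
    then show ?thesis using intg[of K] by (intro exI[of _ d] conjI exI[of _ "\<lambda>y. K * B * exp (- \<bar>y\<bar>)"]) auto
  qed
  have lz: "\<exists>r>0. \<exists>g. integrable lborel g \<and> (\<forall>w\<in>ball z r \<inter> UNIV. \<forall>y\<in>space lborel. norm (hk (s l) (w - of_real y) * \<psi> l y) \<le> g y)" if lL: "l \<in> L" for l z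
  proof -
    obtain d K where "d > 0" "\<forall>l'\<in>ball l d \<inter> L. \<forall>z'\<in>ball z d. \<forall>y. norm (hk (s l') (z' - of_real y) * \<psi> l' y) \<le> K * B * exp (- \<bar>y\<bar>)"
      using loc[OF lL, of z] by blast
    then show ?thesis using intg[of K] lL by (intro exI[of _ d] conjI exI[of _ "\<lambda>y. K * B * exp (- \<bar>y\<bar>)"]) auto
  qed
  show "sep_hol L UNIV (\<lambda>l z. heat (s l) (\<psi> l) z)"
    unfolding sep_hol_def
  proof (intro conjI ballI)
    show "(\<lambda>l. heat (s l) (\<psi> l) z) holomorphic_on L" for z
      unfolding heat_def by (rule holomorphic_integral_param(1)[OF L]) (use hl meas ll in auto)
    show "heat (s l) (\<psi> l) holomorphic_on UNIV" if "l \<in> L" for l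
      unfolding heat_def by (rule holomorphic_integral_param(1)[OF open_UNIV]) (use hz[OF that] meas[OF that] lz[OF that] in auto)
    show "\<exists>d>0. \<exists>K. \<forall>l'\<in>ball l d \<inter> L. \<forall>z'\<in>ball z d \<inter> UNIV. norm (heat (s l') (\<psi> l') z') \<le> K" if lL: "l \<in> L" for l z
    proof -
      obtain d K where d: "d > 0" "\<forall>l'\<in>ball l d \<inter> L. \<forall>z'\<in>ball z d. \<forall>y. norm (hk (s l') (z' - of_real y) * \<psi> l' y) \<le> K * B * exp (- \<bar>y\<bar>)"
        using loc[OF lL, of z] by blast
      have "norm (heat (s l') (\<psi> l') z') \<le> (\<integral>y. K * B * exp (- \<bar>y\<bar>) \<partial>lborel)" if "l' \<in> ball l d \<inter> L" "z' \<in> ball z d" for l' z'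
        unfolding heat_def
        by (rule Bochner_Integration.integral_norm_bound_integral[OF exp_decay_integrable_hk[OF B sL] intg]) (use that d(2) in auto)
      then show ?thesis using d(1) by (intro exI[of _ d] conjI exI[of _ "\<integral>y. K * B * exp (- \<bar>y\<bar>) \<partial>lborel"]) auto
    qed
  qed
  show "deriv (deriv (heat (s l) (\<psi> l))) z =
       (\<integral>y. ((z - of_real y)\<^sup>2 / (4 * (s l)\<^sup>2) - 1 / (2 * s l)) * hk (s l) (z - of_real y) * \<psi> l y \<partial>lborel)" if l: "l \<in> L" for l z
  proof -
    have "deriv (deriv (heat (s l) (\<psi> l))) z = (\<integral>y. deriv (deriv (\<lambda>z. hk (s l) (z - of_real y) * \<psi> l y)) z \<partial>lborel)"
      unfolding heat_def by (rule holomorphic_integral_param(4)[OF open_UNIV]) (use hz[OF l] meas[OF l] lz[OF l] in auto)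
    also have "\<dots> = (\<integral>y. ((z - of_real y)\<^sup>2 / (4 * (s l)\<^sup>2) - 1 / (2 * s l)) * hk (s l) (z - of_real y) * \<psi> l y \<partial>lborel)"
    proof (rule Bochner_Integration.integral_cong[OF refl])
      fix y :: real
      have 1: "deriv (\<lambda>z. hk (s l) (z - of_real y) * \<psi> l y) = (\<lambda>z. (- (z - of_real y) / (2 * s l)) * hk (s l) (z - of_real y) * \<psi> l y)"
        by (rule ext, rule DERIV_imp_deriv, rule DERIV_cmult_right, rule hk_has_field_derivatives(1)[OF sL[OF l]])
      show "deriv (deriv (\<lambda>z. hk (s l) (z - of_real y) * \<psi> l y)) z =
        ((z - of_real y)\<^sup>2 / (4 * (s l)\<^sup>2) - 1 / (2 * s l)) * hk (s l) (z - of_real y) * \<psi> l y"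
        unfolding 1 by (rule DERIV_imp_deriv, rule DERIV_cmult_right, rule hk_has_field_derivatives(2)[OF sL[OF l]])
    qed
    finally show ?thesis .
  qed
  show "deriv (\<lambda>l. heat (s l) (\<psi> l) z) l =
       (\<integral>y. deriv (\<lambda>l. hk (s l) (z - of_real y) * \<psi> l y) l \<partial>lborel)" if l: "l \<in> L" for l z
    unfolding heat_def by (rule holomorphic_integral_param(2)[OF L]) (use hl meas ll l in auto)
qed

lemma heat_sep_hol_const:
  assumes "exp_decay B \<psi>"
  shows "sep_hol Sec UNIV (\<lambda>\<tau>. heat \<tau> \<psi>)"
  by (rule heat_sep_hol(1)[OF open_Sec, where B = B]) (use assms in \<open>auto intro!: holomorphic_intros\<close>)

lemma heat_equation:
  assumes \<psi>: "exp_decay B \<psi>" and \<tau>: "\<tau> \<in> Sec"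
  shows "deriv (\<lambda>\<tau>. heat \<tau> \<psi> z) \<tau> = deriv (deriv (heat \<tau> \<psi>)) z"
proof -
  have "deriv (\<lambda>\<tau>. heat \<tau> \<psi> z) \<tau> = (\<integral>y. deriv (\<lambda>\<tau>. hk \<tau> (z - of_real y) * \<psi> y) \<tau> \<partial>lborel)"
    by (rule heat_sep_hol(3)[OF open_Sec, where B = B]) (use \<psi> \<tau> in \<open>auto intro!: holomorphic_intros\<close>)
  also have "\<dots> = (\<integral>y. ((z - of_real y)\<^sup>2 / (4 * \<tau>\<^sup>2) - 1 / (2 * \<tau>)) * hk \<tau> (z - of_real y) * \<psi> y \<partial>lborel)"
    by (rule Bochner_Integration.integral_cong[OF refl], rule DERIV_imp_deriv, rule DERIV_cmult_right,
        rule hk_has_field_derivatives(3)[OF \<tau>])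
  also have "\<dots> = deriv (deriv (heat \<tau> \<psi>)) z"
    by (rule heat_sep_hol(2)[OF open_Sec, where B = B and s = "\<lambda>l. l", symmetric]) (use \<psi> \<tau> in \<open>auto intro!: holomorphic_intros\<close>)
  finally show ?thesis .
qed

text \<open>The substitution y = z + sqrt (2 s) \<eta> writes the heat flow as an average against
  the standard normal law. In this form the limit of s to 0 is plain dominated convergence.\<close>

lemma heat_real:
  assumes s: "0 < s"
  shows "heat (of_real s) \<psi> (of_real z) = (\<integral>\<eta>. std_normal_density \<eta> *\<^sub>R \<psi> (z + sqrt (2 * s) * \<eta>) \<partial>lborel)"
proof -
  let ?c = "sqrt (2 * s)"
  have c: "?c > 0" "?c\<^sup>2 = 2 * s" using s by auto
  have "heat (of_real s) \<psi> (of_real z) = \<bar>?c\<bar> *\<^sub>R (\<integral>\<eta>. hk (of_real s) (of_real z - of_real (z + ?c * \<eta>)) * \<psi> (z + ?c * \<eta>) \<partial>lborel)"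
    unfolding heat_def by (rule lborel_integral_real_affine) (use c in auto)
  also have "\<dots> = (\<integral>\<eta>. ?c *\<^sub>R (hk (of_real s) (of_real z - of_real (z + ?c * \<eta>)) * \<psi> (z + ?c * \<eta>)) \<partial>lborel)"
    using c(1) by (simp del: of_real_add of_real_mult real_sqrt_mult)
  also have "\<dots> = (\<integral>\<eta>. std_normal_density \<eta> *\<^sub>R \<psi> (z + ?c * \<eta>) \<partial>lborel)"
  proof (rule Bochner_Integration.integral_cong[OF refl])
    fix \<eta> :: real
    have "csqrt (4 * of_real pi * of_real s) = of_real (sqrt (4 * pi * s))"
      using s of_real_sqrt[of "4 * pi * s"] by simp
    moreover have "hk (of_real s) (of_real z - of_real (z + ?c * \<eta>)) = of_real (exp (- (?c * \<eta>)\<^sup>2 / (4 * s))) / csqrt (4 * of_real pi * of_real s)"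
      unfolding hk_def by (simp add: exp_of_real[symmetric] del: real_sqrt_mult)
    moreover have "(?c * \<eta>)\<^sup>2 / (4 * s) = \<eta>\<^sup>2 / 2" using c s by (simp add: power_mult_distrib)
    ultimately have "hk (of_real s) (of_real z - of_real (z + ?c * \<eta>)) = of_real (exp (- \<eta>\<^sup>2 / 2) / sqrt (4 * pi * s))"
      by (simp del: real_sqrt_mult)
    moreover have "sqrt (4 * pi * s) = ?c * sqrt (2 * pi)" by (simp add: real_sqrt_mult[symmetric])
    ultimately show "?c *\<^sub>R (hk (of_real s) (of_real z - of_real (z + ?c * \<eta>)) * \<psi> (z + ?c * \<eta>)) = std_normal_density \<eta> *\<^sub>R \<psi> (z + ?c * \<eta>)"
      using c(1) by (simp add: std_normal_density_def scaleR_conv_of_real del: real_sqrt_mult)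
  qed
  finally show ?thesis .
qed

text \<open>Completing the square moves the mean of the Gaussian from x to x - v^2.\<close>

lemma integral_gauss_exp:
  assumes v: "0 < v"
  shows "integrable lborel (\<lambda>y. exp (- (x - y)\<^sup>2 / (2 * v\<^sup>2)) * exp (- y))"
    and "(\<integral>y. exp (- (x - y)\<^sup>2 / (2 * v\<^sup>2)) * exp (- y) \<partial>lborel) = v * sqrt (2 * pi) * exp (- x + v\<^sup>2 / 2)"
proof -
  have e: "exp (- (x - y)\<^sup>2 / (2 * v\<^sup>2)) * exp (- y) = (v * sqrt (2 * pi) * exp (- x + v\<^sup>2 / 2)) * normal_density (x - v\<^sup>2) v y" for y
  proof -
    have "- (x - y)\<^sup>2 / (2 * v\<^sup>2) + (- y) = (- x + v\<^sup>2 / 2) + (- (y - (x - v\<^sup>2))\<^sup>2 / (2 * v\<^sup>2))"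
      using v by (simp add: divide_simps) (simp add: power2_eq_square algebra_simps)
    then have "exp (- (x - y)\<^sup>2 / (2 * v\<^sup>2)) * exp (- y) = exp (- x + v\<^sup>2 / 2) * exp (- (y - (x - v\<^sup>2))\<^sup>2 / (2 * v\<^sup>2))"
      by (simp only: exp_add[symmetric])
    moreover have "sqrt (2 * pi * v\<^sup>2) = v * sqrt (2 * pi)" using v by (simp add: real_sqrt_mult)
    ultimately show ?thesis using v by (simp add: normal_density_def)
  qed
  show "integrable lborel (\<lambda>y. exp (- (x - y)\<^sup>2 / (2 * v\<^sup>2)) * exp (- y))"
    unfolding e using v by (intro Bochner_Integration.integrable_mult_right integrable_normal_density)
  show "(\<integral>y. exp (- (x - y)\<^sup>2 / (2 * v\<^sup>2)) * exp (- y) \<partial>lborel) = v * sqrt (2 * pi) * exp (- x + v\<^sup>2 / 2)"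
    unfolding e using v by (simp add: integral_normal_density)
qed

section \<open>Odd data on the cone: rotation of the contour\<close>

lemma odd_ext_exp_decay:
  assumes \<phi>: "\<phi> holomorphic_on Cone" and B: "\<And>z. z \<in> Cone \<Longrightarrow> norm (\<phi> z) \<le> B * exp (- Re z)"
  shows "exp_decay B (odd_ext \<phi>)"
proof -
  have B0: "0 \<le> B"
  proof -
    have "0 \<le> B * exp (- Re (of_real 1))" using B[of "of_real 1"] norm_ge_zero order_trans by (metis of_real_Cone zero_less_one)
    then show ?thesis by (simp add: zero_le_mult_iff)
  qed
  have c: "continuous_on Cone \<phi>" using \<phi> by (rule holomorphic_on_imp_continuous_on)
  have e: "odd_ext \<phi> = (\<lambda>y. indicator {0<..} y *\<^sub>R \<phi> (of_real y) - indicator {..<0} y *\<^sub>R \<phi> (of_real (- y)))"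
    by (auto simp: odd_ext_def fun_eq_iff)
  have "odd_ext \<phi> \<in> borel_measurable borel" unfolding e
    by (intro borel_measurable_diff borel_measurable_continuous_on_indicator continuous_on_compose2[OF c] continuous_intros)
       (auto simp: Cone_def)
  moreover have "norm (odd_ext \<phi> y) \<le> B * exp (- \<bar>y\<bar>)" for y
    using B[of "of_real y"] B[of "of_real (-y)"] B0 by (auto simp: odd_ext_def)
  ultimately show ?thesis by (simp add: exp_decay_def)
qed

text \<open>On the cone the line of integration is rotated onto the ray through \<open>z\<close>, where the
  integrand decays; both sides are holomorphic in \<open>z\<close> and agree for real \<open>z\<close>.\<close>

lemma heat_odd_ext_rotate:
  assumes \<phi>: "\<phi> holomorphic_on Cone" and B: "\<And>z. z \<in> Cone \<Longrightarrow> norm (\<phi> z) \<le> B * exp (- Re z)"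
    and \<tau>: "\<tau> \<in> Sec" and z: "z \<in> Cone"
  shows "heat \<tau> (odd_ext \<phi>) z = (\<integral>r. z * hk \<tau> (z * of_real (1 - r)) * odd_ext (\<lambda>y. \<phi> (z * y)) r \<partial>lborel)" (is "_ = ?G z")
proof -
  have dec: "exp_decay B (odd_ext \<phi>)" by (rule odd_ext_exp_decay[OF \<phi> B])
  have B0: "0 \<le> B" by (rule exp_decay_nonneg[OF dec])
  let ?h = "\<lambda>z r. z * hk \<tau> (z * of_real (1 - r)) * odd_ext (\<lambda>y. \<phi> (z * y)) r"
  have hk_bd: "norm (hk \<tau> (z * of_real c)) \<le> 1 / sqrt (4 * pi * norm \<tau>)" if z: "z \<in> Cone" for z c
  proof -
    have "0 \<le> (Re z)\<^sup>2 - (Im z)\<^sup>2 - 2 * \<bar>Re z\<bar> * \<bar>Im z\<bar>"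
    proof -
      have i: "0 < Re z" "\<bar>Im z\<bar> \<le> Re z / 8" using z by (auto simp: Cone_def)
      have "(Im z)\<^sup>2 \<le> (Re z / 8)\<^sup>2" using i by (intro abs_le_square_iff[THEN iffD1]) auto
      then have 1: "(Im z)\<^sup>2 \<le> (Re z)\<^sup>2 / 64" by (simp add: power_divide)
      have "\<bar>Re z\<bar> * \<bar>Im z\<bar> \<le> Re z * (Re z / 8)" using i by (intro mult_mono) auto
      then have 2: "\<bar>Re z\<bar> * \<bar>Im z\<bar> \<le> (Re z)\<^sup>2 / 8" by (simp add: power2_eq_square)
      have "0 \<le> (Re z)\<^sup>2" by (rule zero_le_power2)
      with 1 2 show ?thesis by linarith
    qed
    then have "0 \<le> c\<^sup>2 * ((Re z)\<^sup>2 - (Im z)\<^sup>2 - 2 * \<bar>Re z\<bar> * \<bar>Im z\<bar>)" by simp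
    also have "\<dots> = (Re (z * of_real c))\<^sup>2 - (Im (z * of_real c))\<^sup>2 - 2 * \<bar>Re (z * of_real c)\<bar> * \<bar>Im (z * of_real c)\<bar>"
      by (simp add: power2_eq_square abs_mult algebra_simps)
    finally have "0 \<le> Re \<tau> / (cmod \<tau>)\<^sup>2 * ((Re (z * of_real c))\<^sup>2 - (Im (z * of_real c))\<^sup>2 - 2 * \<bar>Re (z * of_real c)\<bar> * \<bar>Im (z * of_real c)\<bar>)"
      using less_imp_le[OF Re_inverse_Sec(3)[OF \<tau>]] by (intro mult_nonneg_nonneg)
    then have "0 \<le> Re ((z * of_real c)\<^sup>2 / \<tau>)" using Re_square_div_ge[OF \<tau>, of "z * of_real c"] by linarith
    then show ?thesis unfolding norm_hk by (intro divide_right_mono) auto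
  qed
  have holG: "?G holomorphic_on Cone"
  proof (rule holomorphic_integral_param(1)[OF open_Cone])
    show "(\<lambda>z. ?h z r) holomorphic_on Cone" for r
    proof -
      have c: "(\<lambda>z. \<phi> (z * of_real c)) holomorphic_on Cone" if "c > 0" for c
      proof -
        have "(\<phi> \<circ> (\<lambda>z. z * of_real c)) holomorphic_on Cone"
          by (rule holomorphic_on_compose_gen[OF _ \<phi>]) (use that Cone_scale in \<open>auto intro!: holomorphic_intros\<close>)
        then show ?thesis by (simp add: o_def)
      qed
      have "(\<lambda>z. odd_ext (\<lambda>y. \<phi> (z * y)) r) holomorphic_on Cone"
        unfolding odd_ext_def using c[of r] c[of "-r"] by (cases r "0::real" rule: linorder_cases) (auto intro!: holomorphic_intros)
      then show ?thesis using \<tau> by (intro holomorphic_intros hk_holomorphic) auto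
    qed
    show "?h z \<in> borel_measurable lborel" if z: "z \<in> Cone" for z
    proof -
      have c: "continuous_on Cone \<phi>" using \<phi> by (rule holomorphic_on_imp_continuous_on)
      have e: "odd_ext (\<lambda>y. \<phi> (z * y)) = (\<lambda>y. indicator {0<..} y *\<^sub>R \<phi> (z * of_real y) - indicator {..<0} y *\<^sub>R \<phi> (z * of_real (- y)))"
        by (auto simp: odd_ext_def fun_eq_iff)
      have "odd_ext (\<lambda>y. \<phi> (z * y)) \<in> borel_measurable borel" unfolding e
        by (intro borel_measurable_diff borel_measurable_continuous_on_indicator continuous_on_compose2[OF c] continuous_intros)
           (auto simp del: of_real_minus intro!: Cone_scale[OF z])
      moreover have "(\<lambda>r. z * hk \<tau> (z * of_real (1 - r))) \<in> borel_measurable borel"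
        by (intro borel_measurable_continuous_onI continuous_hk continuous_intros \<tau>)
      ultimately show ?thesis by simp
    qed
    fix z assume z: "z \<in> Cone"
    \<comment> \<open>Every w in the ball of radius x about z has real part at least x, which fixes
      one decay rate for the majorant.\<close>
    define x where "x = Re z / 2"
    have x: "x > 0" "x < Re z" using z by (auto simp: x_def Cone_def)
    let ?g = "\<lambda>r. ((norm z + x) * (1 / sqrt (4 * pi * norm \<tau>)) * B) * exp (- \<bar>x * r\<bar>)"
    have "integrable lborel (\<lambda>r. exp (- \<bar>0 + x * r\<bar>))"
      by (rule lborel_integrable_real_affine[OF integrable_exp_abs]) (use x in auto)
    then have "integrable lborel ?g" by simp
    moreover have "norm (?h w r) \<le> ?g r" if w: "w \<in> ball z x \<inter> Cone" for w r
    proof -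
      have "x \<le> Re w" using w abs_Re_le_cmod[of "z - w"] by (auto simp: dist_norm x_def)
      moreover have nw: "norm w \<le> norm z + x" using w norm_triangle_ineq2[of w z] by (auto simp: dist_norm norm_minus_commute)
      moreover have "norm (odd_ext (\<lambda>y. \<phi> (w * y)) r) \<le> B * exp (- \<bar>Re w * r\<bar>)"
        using B[OF Cone_scale[of w r]] B[OF Cone_scale[of w "-r"]] w B0
        by (cases r "0::real" rule: linorder_cases) (auto simp: odd_ext_def abs_mult Cone_def)
      moreover have "B * exp (- \<bar>Re w * r\<bar>) \<le> B * exp (- \<bar>x * r\<bar>)"
        using \<open>x \<le> Re w\<close> B0 x by (intro mult_left_mono) (auto simp: abs_mult intro!: mult_right_mono)
      ultimately have o: "norm (odd_ext (\<lambda>y. \<phi> (w * y)) r) \<le> B * exp (- \<bar>x * r\<bar>)" by linarith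
      have "norm (?h w r) \<le> ((norm z + x) * (1 / sqrt (4 * pi * norm \<tau>))) * (B * exp (- \<bar>x * r\<bar>))"
        unfolding norm_mult using nw hk_bd[of w "1 - r", simplified] w o x by (intro mult_mono) auto
      then show ?thesis by (simp add: mult.assoc)
    qed
    ultimately show "\<exists>r>0. \<exists>g. integrable lborel g \<and> (\<forall>w\<in>ball z r \<inter> Cone. \<forall>y\<in>space lborel. norm (?h w y) \<le> g y)"
      using x by (intro exI[of _ x] conjI exI[of _ ?g]) auto
  qed
  have holH: "heat \<tau> (odd_ext \<phi>) holomorphic_on Cone"
    using heat_sep_hol_const[OF dec] \<tau> by (auto simp: sep_hol_def intro: holomorphic_on_subset)
  \<comment> \<open>For real z this is the substitution y = x r; a positive factor does not change
    the sign on which \<open>odd_ext\<close> depends.\<close>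
  have eq: "heat \<tau> (odd_ext \<phi>) (of_real x) = ?G (of_real x)" if x: "x > 0" for x
  proof -
    have "heat \<tau> (odd_ext \<phi>) (of_real x) = \<bar>x\<bar> *\<^sub>R (\<integral>r. hk \<tau> (of_real x - of_real (0 + x * r)) * odd_ext \<phi> (0 + x * r) \<partial>lborel)"
      unfolding heat_def by (rule lborel_integral_real_affine) (use x in auto)
    also have "\<dots> = (\<integral>r. x *\<^sub>R (hk \<tau> (of_real x - of_real (0 + x * r)) * odd_ext \<phi> (0 + x * r)) \<partial>lborel)"
      using x by simp
    also have "\<dots> = ?G (of_real x)"
    proof (rule Bochner_Integration.integral_cong[OF refl])
      fix r
      have "odd_ext \<phi> (0 + x * r) = odd_ext (\<lambda>y. \<phi> (of_real x * y)) r"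
        using x by (auto simp: odd_ext_def zero_less_mult_iff mult_less_0_iff)
      moreover have "of_real x - of_real (0 + x * r) = of_real x * complex_of_real (1 - r)" by (simp add: algebra_simps)
      ultimately show "x *\<^sub>R (hk \<tau> (of_real x - of_real (0 + x * r)) * odd_ext \<phi> (0 + x * r)) = ?h (of_real x) r"
        by (simp add: scaleR_conv_of_real)
    qed
    finally show ?thesis .
  qed
  \<comment> \<open>The identity theorem needs the positive reals to accumulate inside the cone; the
    point 1 is as good as any.\<close>
  have lim: "1 islimpt (of_real ` {0<..} :: complex set)"
    unfolding islimpt_approachable
  proof (intro allI impI)
    fix e :: real assume "e > 0"
    then show "\<exists>x'\<in>of_real ` {0<..}. x' \<noteq> 1 \<and> dist x' (1::complex) < e"
      by (intro bexI[of _ "of_real (1 + e/2)"]) (auto simp: dist_norm simp del: of_real_add, auto)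
  qed
  have "(\<lambda>z. heat \<tau> (odd_ext \<phi>) z - ?G z) z = 0"
    by (rule analytic_continuation[of _ Cone "of_real ` {0<..}" 1])
       (use holG holH open_Cone convex_connected[OF convex_Cone] lim eq z of_real_Cone[of 1] in \<open>auto intro!: holomorphic_on_diff\<close>)
  then show ?thesis by simp
qed

text \<open>The bound stays finite as \<tau> tends to 0. On the rotated ray the kernel is dominated
  by a Gaussian of width v, and the ratio of its mass to sqrt (4 pi |\<tau>|) is at most 2 since
  |\<tau>| is at most 2 Re \<tau>. The remaining factor 9/8 bounds |z| / Re z, and 9/4 is rounded up
  to 3.\<close>

lemma norm_heat_odd_ext_le:
  assumes \<phi>: "\<phi> holomorphic_on Cone" and B: "\<And>z. z \<in> Cone \<Longrightarrow> norm (\<phi> z) \<le> B * exp (- Re z)"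
    and \<tau>: "\<tau> \<in> Sec" and z: "z \<in> Cone"
  shows "norm (heat \<tau> (odd_ext \<phi>) z) \<le> 3 * exp (4 * Re \<tau>) * B * exp (- Re z)"
proof -
  have dec: "exp_decay B (odd_ext \<phi>)" by (rule odd_ext_exp_decay[OF \<phi> B])
  have B0: "0 \<le> B" by (rule exp_decay_nonneg[OF dec])
  define p where "p = Re \<tau> / (cmod \<tau>)\<^sup>2"
  have p: "0 < p" "1 / (2 * Re \<tau>) \<le> p" using Re_inverse_Sec[OF \<tau>] by (auto simp: p_def)
  have R\<tau>: "0 < Re \<tau>" "\<bar>Im \<tau>\<bar> < Re \<tau>" using \<tau> by (auto simp: Sec_def)
  define x where "x = Re z"
  have x: "0 < x" "\<bar>Im z\<bar> < x / 8" using z by (auto simp: x_def Cone_def)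
  \<comment> \<open>On the ray Re (X^2 / \<tau>) is at least p (Re X)^2 / 2, so the kernel decays
    like a Gaussian with variance 4 / p.\<close>
  define v where "v = 2 / sqrt p"
  have v: "0 < v" "v\<^sup>2 = 4 / p" using p by (auto simp: v_def power_divide)
  have nz: "norm z \<le> 9 / 8 * x" using cmod_le[of z] x by (simp add: x_def)
  have hk: "norm (hk \<tau> (z * of_real c)) \<le> exp (- (x * c)\<^sup>2 / (2 * v\<^sup>2)) / sqrt (4 * pi * norm \<tau>)" for c
  proof -
    have "x\<^sup>2 / 2 \<le> (Re z)\<^sup>2 - (Im z)\<^sup>2 - 2 * \<bar>Re z\<bar> * \<bar>Im z\<bar>"
    proof -
      have "(Im z)\<^sup>2 \<le> (x / 8)\<^sup>2" using x by (intro abs_le_square_iff[THEN iffD1]) auto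
      then have 1: "(Im z)\<^sup>2 \<le> x\<^sup>2 / 64" by (simp add: power_divide)
      have "\<bar>Re z\<bar> * \<bar>Im z\<bar> \<le> x * (x / 8)" unfolding x_def using x by (intro mult_mono) (auto simp: x_def)
      then have 2: "\<bar>Re z\<bar> * \<bar>Im z\<bar> \<le> x\<^sup>2 / 8" by (simp add: power2_eq_square)
      have "0 \<le> x\<^sup>2" by (rule zero_le_power2)
      with 1 2 have "x\<^sup>2 / 2 \<le> x\<^sup>2 - (Im z)\<^sup>2 - 2 * \<bar>Re z\<bar> * \<bar>Im z\<bar>" by linarith
      then show ?thesis by (simp only: x_def)
    qed
    then have "c\<^sup>2 * (x\<^sup>2 / 2) \<le> c\<^sup>2 * ((Re z)\<^sup>2 - (Im z)\<^sup>2 - 2 * \<bar>Re z\<bar> * \<bar>Im z\<bar>)" by (rule mult_left_mono) simp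
    also have "\<dots> = (Re (z * of_real c))\<^sup>2 - (Im (z * of_real c))\<^sup>2 - 2 * \<bar>Re (z * of_real c)\<bar> * \<bar>Im (z * of_real c)\<bar>"
      by (simp add: power2_eq_square abs_mult algebra_simps)
    finally have "p * (c\<^sup>2 * (x\<^sup>2 / 2)) \<le> p * ((Re (z * of_real c))\<^sup>2 - (Im (z * of_real c))\<^sup>2 - 2 * \<bar>Re (z * of_real c)\<bar> * \<bar>Im (z * of_real c)\<bar>)"
      using p by (intro mult_left_mono) auto
    then have "p * (c\<^sup>2 * (x\<^sup>2 / 2)) \<le> Re ((z * of_real c)\<^sup>2 / \<tau>)"
      using Re_square_div_ge[OF \<tau>, of "z * of_real c"] unfolding p_def by linarith
    moreover have "(x * c)\<^sup>2 / (2 * v\<^sup>2) = p * (c\<^sup>2 * (x\<^sup>2 / 2)) / 4" using v p by (simp add: power_mult_distrib field_simps)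
    ultimately show ?thesis unfolding norm_hk by (intro divide_right_mono) auto
  qed
  have od: "norm (odd_ext (\<lambda>y. \<phi> (z * y)) r) \<le> B * exp (- (x * r))" for r
  proof -
    have "norm (odd_ext (\<lambda>y. \<phi> (z * y)) r) \<le> B * exp (- \<bar>x * r\<bar>)"
      using B[OF Cone_scale[of z r]] B[OF Cone_scale[of z "-r"]] z B0 x
      by (cases r "0::real" rule: linorder_cases) (auto simp: odd_ext_def abs_mult x_def)
    also have "\<dots> \<le> B * exp (- (x * r))" using B0 by (intro mult_left_mono) auto
    finally show ?thesis .
  qed
  let ?K = "9 / 8 * B / sqrt (4 * pi * norm \<tau>)"
  let ?g = "\<lambda>r. ?K * (x * (exp (- (x - (0 + x * r))\<^sup>2 / (2 * v\<^sup>2)) * exp (- (0 + x * r))))"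
  have gi0: "integrable lborel (\<lambda>r. exp (- (x - (0 + x * r))\<^sup>2 / (2 * v\<^sup>2)) * exp (- (0 + x * r)))"
    by (rule lborel_integrable_real_affine[OF integral_gauss_exp(1)[OF v(1), of x]]) (use x in auto)
  then have gi: "integrable lborel ?g" by (intro Bochner_Integration.integrable_mult_right)
  have gv: "(\<integral>r. ?g r \<partial>lborel) = ?K * (v * sqrt (2 * pi) * exp (- x + v\<^sup>2 / 2))"
  proof -
    have "v * sqrt (2 * pi) * exp (- x + v\<^sup>2 / 2) = \<bar>x\<bar> *\<^sub>R (\<integral>r. exp (- (x - (0 + x * r))\<^sup>2 / (2 * v\<^sup>2)) * exp (- (0 + x * r)) \<partial>lborel)"
      unfolding integral_gauss_exp(2)[OF v(1), of x, symmetric] by (rule lborel_integral_real_affine) (use x in auto)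
    then show ?thesis using x by (simp only: integral_mult_right_zero) simp
  qed
  let ?h = "\<lambda>r. z * hk \<tau> (z * of_real (1 - r)) * odd_ext (\<lambda>y. \<phi> (z * y)) r"
  have hb: "norm (?h r) \<le> ?g r" for r
  proof -
    have "norm (?h r) \<le> (9/8 * x) * (exp (- (x * (1 - r))\<^sup>2 / (2 * v\<^sup>2)) / sqrt (4 * pi * norm \<tau>)) * (B * exp (- (x * r)))"
      unfolding norm_mult using nz hk[of "1 - r"] od[of r] x by (intro mult_mono) auto
    also have "\<dots> = ?g r" by (simp add: algebra_simps)
    finally show ?thesis .
  qed
  have "norm (integral\<^sup>L lborel ?h) \<le> (\<integral>r. ?g r \<partial>lborel)"
  proof (cases "integrable lborel ?h")
    case True
    then show "norm (integral\<^sup>L lborel ?h) \<le> (\<integral>r. ?g r \<partial>lborel)"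
      by (rule Bochner_Integration.integral_norm_bound_integral[OF _ gi]) (use hb in auto)
  next
    case False
    have "0 \<le> (\<integral>r. ?g r \<partial>lborel)" by (rule Bochner_Integration.integral_nonneg) (use hb norm_ge_zero order_trans in blast)
    then show "norm (integral\<^sup>L lborel ?h) \<le> (\<integral>r. ?g r \<partial>lborel)" using not_integrable_integral_eq[OF False] by simp
  qed
  then have "norm (heat \<tau> (odd_ext \<phi>) z) \<le> (\<integral>r. ?g r \<partial>lborel)"
    by (simp only: heat_odd_ext_rotate[OF \<phi> B \<tau> z])
  also have "\<dots> = 9 / 8 * (v * sqrt (2 * pi) / sqrt (4 * pi * norm \<tau>)) * exp (v\<^sup>2 / 2) * (B * exp (- x))"
    unfolding gv by (simp add: exp_add[symmetric] algebra_simps)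
  also have "\<dots> \<le> 9 / 8 * 2 * exp (4 * Re \<tau>) * (B * exp (- x))"
  proof (intro mult_right_mono mult_mono)
    have "v\<^sup>2 / 2 = 2 / p" using v by simp
    also have "\<dots> \<le> 4 * Re \<tau>" using p R\<tau> by (simp add: field_simps)
    finally show "exp (v\<^sup>2 / 2) \<le> exp (4 * Re \<tau>)" by simp
    have "norm \<tau> \<le> 2 * Re \<tau>" using cmod_le[of \<tau>] R\<tau> by simp
    have "norm \<tau> > 0" using R\<tau> complex_Re_le_cmod[of \<tau>] by linarith
    have "(v * sqrt (2 * pi))\<^sup>2 = 4 / p * (2 * pi)" using v by (simp add: power_mult_distrib)
    also have "\<dots> = 8 * pi * (norm \<tau>)\<^sup>2 / Re \<tau>" using R\<tau> \<open>norm \<tau> > 0\<close> by (simp add: p_def)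
    also have "\<dots> \<le> 8 * pi * (norm \<tau> * (2 * Re \<tau>)) / Re \<tau>"
      unfolding power2_eq_square using \<open>norm \<tau> \<le> 2 * Re \<tau>\<close> R\<tau> by (intro divide_right_mono mult_left_mono) auto
    also have "\<dots> = 16 * pi * norm \<tau>" using R\<tau> by simp
    finally have "(v * sqrt (2 * pi))\<^sup>2 \<le> (2 * sqrt (4 * pi * norm \<tau>))\<^sup>2" by (simp add: power_mult_distrib)
    then have "v * sqrt (2 * pi) \<le> 2 * sqrt (4 * pi * norm \<tau>)" by (rule power2_le_imp_le) simp
    then show "v * sqrt (2 * pi) / sqrt (4 * pi * norm \<tau>) \<le> 2" using \<open>norm \<tau> > 0\<close> by (simp add: divide_le_eq)
  qed (use B0 v in auto)
  also have "\<dots> \<le> 3 * exp (4 * Re \<tau>) * B * exp (- Re z)" using B0 by (simp add: x_def mult_ac)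
  finally show ?thesis .
qed

subsection \<open>Duhamel integrals on the half-line\<close>

abbreviation U01 :: "real measure" where "U01 \<equiv> restrict_space lborel {0<..<1}"

lemma space_U01 [simp]: "space U01 = {0<..<1}" by (simp add: space_restrict_space)

lemma finite_measure_U01: "finite_measure U01"
  by (rule finite_measureI) (simp add: emeasure_restrict_space)

lemma integral_const_U01 [simp]: "(\<integral>\<sigma>. c \<partial>U01) = (c :: complex)"
  by (simp add: measure_restrict_space)

lemma integrable_U01_bounded:
  fixes f :: "real \<Rightarrow> complex"
  assumes "f \<in> borel_measurable U01" "\<And>\<sigma>. 0 < \<sigma> \<Longrightarrow> \<sigma> < 1 \<Longrightarrow> norm (f \<sigma>) \<le> K"
  shows "integrable U01 f"
  by (rule finite_measure.integrable_const_bound[OF finite_measure_U01, of _ K])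
     (use assms in \<open>auto intro!: AE_I2\<close>)

text \<open>If f fails to be integrable its Bochner integral is 0 by convention, while g is
  nonnegative as a majorant of a norm.\<close>

lemma norm_integral_U01_le:
  fixes f :: "real \<Rightarrow> complex"
  assumes "\<And>\<sigma>. 0 < \<sigma> \<Longrightarrow> \<sigma> < 1 \<Longrightarrow> norm (f \<sigma>) \<le> g \<sigma>" "integrable U01 g"
  shows "norm (\<integral>\<sigma>. f \<sigma> \<partial>U01) \<le> (\<integral>\<sigma>. g \<sigma> \<partial>U01)"
proof (cases "integrable U01 f")
  case True
  then show ?thesis by (rule Bochner_Integration.integral_norm_bound_integral) (use assms in auto)
next
  case False
  have "0 \<le> (\<integral>\<sigma>. g \<sigma> \<partial>U01)"
  proof (rule Bochner_Integration.integral_nonneg_AE, rule AE_I2)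
    fix \<sigma> assume "\<sigma> \<in> space U01"
    then have "norm (f \<sigma>) \<le> g \<sigma>" using assms(1) by simp
    then show "0 \<le> g \<sigma>" using norm_ge_zero order_trans by blast
  qed
  then show ?thesis using not_integrable_integral_eq[OF False] by simp
qed

text \<open>The factor 1 / (n + 1) is gained once in each Duhamel step and accumulates to 1 /
  n!.\<close>

lemma integral_power_U01:
  "integrable U01 (\<lambda>\<sigma>. \<sigma> ^ n)" "(\<integral>\<sigma>. \<sigma> ^ n \<partial>U01) = 1 / real (Suc n)"
proof -
  show "integrable U01 (\<lambda>\<sigma>. \<sigma> ^ n)"
    by (rule finite_measure.integrable_const_bound[OF finite_measure_U01, of _ 1])
       (auto intro!: AE_I2 power_le_one borel_measurable_continuous_on_restrict_lborel continuous_intros)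
  have 1: "has_bochner_integral lborel (\<lambda>x. x ^ n * indicator {0..1} x) (1 ^ Suc n / real (Suc n) - 0 ^ Suc n / real (Suc n))"
    by (rule has_bochner_integral_FTC_Icc_real)
       (auto intro!: derivative_eq_intros continuous_intros simp del: of_nat_Suc power_Suc)
  have "(\<integral>\<sigma>. \<sigma> ^ n \<partial>U01) = (\<integral>x. indicator {0<..<1} x *\<^sub>R x ^ n \<partial>lborel)"
    by (rule integral_restrict_space) simp
  also have "\<dots> = (\<integral>x. x ^ n * indicator {0..1} x \<partial>lborel)"
  proof (rule Bochner_Integration.integral_cong_AE)
    have "AE x in lborel. x \<noteq> (0::real)" "AE x in lborel. x \<noteq> (1::real)" by (rule AE_lborel_singleton)+
    then show "AE x in lborel. indicator {0<..<1} x *\<^sub>R x ^ n = x ^ n * (indicator {0..1} x :: real)"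
      by eventually_elim (auto split: split_indicator)
  qed auto
  also have "\<dots> = 1 / real (Suc n)" using has_bochner_integral_integral_eq[OF 1] by simp
  finally show "(\<integral>\<sigma>. \<sigma> ^ n \<partial>U01) = 1 / real (Suc n)" .
qed

text \<open>Translates between integrals over real time and the rescaled variable \<sigma> of
  \<open>duh\<close>; cutting the time interval in \<open>duh_pde\<close> is done in real
  time.\<close>

lemma set_integral_affine_U01:
  fixes g :: "real \<Rightarrow> complex"
  assumes c: "0 < c"
  shows "(LINT s:{a<..<a+c}|lborel. g s) = (\<integral>\<sigma>. of_real c * g (a + c * \<sigma>) \<partial>U01)"
proof -
  have "(LINT s:{a<..<a+c}|lborel. g s) = \<bar>c\<bar> *\<^sub>R (\<integral>x. indicator {a<..<a+c} (a + c * x) *\<^sub>R g (a + c * x) \<partial>lborel)"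
    unfolding set_lebesgue_integral_def by (rule lborel_integral_real_affine) (use c in auto)
  also have "\<dots> = (\<integral>x. \<bar>c\<bar> *\<^sub>R (indicator {a<..<a+c} (a + c * x) *\<^sub>R g (a + c * x)) \<partial>lborel)"
    by (rule integral_scaleR_right[symmetric])
  also have "\<dots> = (\<integral>x. indicator {0<..<1} x *\<^sub>R (of_real c * g (a + c * x)) \<partial>lborel)"
    by (rule Bochner_Integration.integral_cong[OF refl])
       (use c in \<open>auto simp: scaleR_conv_of_real indicator_def zero_less_mult_iff\<close>)
  also have "\<dots> = (\<integral>\<sigma>. of_real c * g (a + c * \<sigma>) \<partial>U01)"
    by (rule integral_restrict_space[symmetric]) simp
  finally show ?thesis .
qed

text \<open>The part of the sector with real part below T. With t it contains \<sigma> t for 0 <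
  \<sigma> <= 1, so the source in Duhamel's formula can be evaluated at all earlier points of the
  ray.\<close>

definition St :: "real \<Rightarrow> complex set" where "St T = {t. 0 < Re t \<and> Re t < T \<and> \<bar>Im t\<bar> < Re t}"

lemma open_St: "open (St T)"
  unfolding St_def by (intro open_Collect_conj open_Collect_less continuous_intros)

lemma of_real_St [simp]: "of_real t \<in> St T \<longleftrightarrow> 0 < t \<and> t < T" by (auto simp: St_def)

lemma St_Sec: "t \<in> St T \<Longrightarrow> t \<in> Sec" by (auto simp: St_def Sec_def)

lemma St_scale: "t \<in> St T \<Longrightarrow> 0 < \<sigma> \<Longrightarrow> \<sigma> \<le> 1 \<Longrightarrow> of_real \<sigma> * t \<in> St T"
proof -
  assume t: "t \<in> St T" and \<sigma>: "0 < \<sigma>" "\<sigma> \<le> 1"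
  have "\<sigma> * Re t \<le> 1 * Re t" using t \<sigma> by (intro mult_right_mono) (auto simp: St_def)
  moreover have "Re t < T" using t by (simp add: St_def)
  ultimately have "\<sigma> * Re t < T" by linarith
  then show ?thesis using t \<sigma> by (auto simp: St_def abs_mult)
qed

text \<open>The power of Re t records how often time has been integrated: Duhamel's integral raises
  n by one and divides by n + 1. The decay in Re z survives unchanged.\<close>

definition duh_class :: "real \<Rightarrow> real \<Rightarrow> nat \<Rightarrow> (complex \<Rightarrow> complex \<Rightarrow> complex) \<Rightarrow> bool" where
  "duh_class T B n f \<longleftrightarrow> sep_hol (St T) Cone f \<and> 0 \<le> B \<and>
     (\<forall>t\<in>St T. \<forall>z\<in>Cone. norm (f t z) \<le> B * Re t ^ n * exp (- Re z))"

text \<open>With s = \<sigma> t this is the effect at time t of the source present at time s: the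
  heat time is \<epsilon> (t - s).\<close>

definition duh_kernel :: "real \<Rightarrow> (complex \<Rightarrow> complex \<Rightarrow> complex) \<Rightarrow> complex \<Rightarrow> real \<Rightarrow> complex \<Rightarrow> complex" where
  "duh_kernel \<epsilon> f t \<sigma> z = heat (of_real (\<epsilon> * (1 - \<sigma>)) * t) (odd_ext (f (of_real \<sigma> * t))) z"

text \<open>Duhamel's formula for the half-line heat equation with Dirichlet condition,
  with the time integral rescaled to \<open>(0, 1)\<close> so that the integrand is holomorphic in \<open>t\<close>.\<close>

definition duh :: "real \<Rightarrow> (complex \<Rightarrow> complex \<Rightarrow> complex) \<Rightarrow> complex \<Rightarrow> complex \<Rightarrow> complex" where
  "duh \<epsilon> f t z = (\<integral>\<sigma>. t * duh_kernel \<epsilon> f t \<sigma> z \<partial>U01)"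

lemma heat_odd_0:
  assumes "\<And>y. \<psi> (- y) = - \<psi> y"
  shows "heat \<tau> \<psi> 0 = 0"
proof -
  have "heat \<tau> \<psi> 0 = \<bar>-1\<bar> *\<^sub>R (\<integral>y. hk \<tau> (0 - of_real (0 + (-1) * y)) * \<psi> (0 + (-1) * y) \<partial>lborel)"
    unfolding heat_def by (rule lborel_integral_real_affine) simp
  also have "\<dots> = - heat \<tau> \<psi> 0"
    unfolding heat_def by (simp add: assms hk_def)
  finally show ?thesis by simp
qed

lemma odd_ext_minus: "odd_ext \<phi> (- y) = - odd_ext \<phi> y"
  by (auto simp: odd_ext_def)

text \<open>At real times the kernel is a probability density, so the sup norm does not grow. Unlike
  the estimate on the cone this one holds at every real z, the wall included.\<close>

lemma norm_heat_real_le: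
  assumes s: "0 < s" and \<psi>: "\<psi> \<in> borel_measurable borel" "\<And>y. norm (\<psi> y) \<le> K"
  shows "norm (heat (of_real s) \<psi> (of_real z)) \<le> K"
proof -
  have i: "integrable lborel (\<lambda>\<eta>. std_normal_density \<eta> * K)" by simp
  have m: "(\<lambda>\<eta>. std_normal_density \<eta> *\<^sub>R \<psi> (z + sqrt (2 * s) * \<eta>)) \<in> borel_measurable lborel"
    using \<psi>(1) by measurable
  have b: "norm (std_normal_density \<eta> *\<^sub>R \<psi> (z + sqrt (2 * s) * \<eta>)) \<le> std_normal_density \<eta> * K" for \<eta>
    using \<psi>(2) by (simp add: mult_left_mono)
  have i2: "integrable lborel (\<lambda>\<eta>. std_normal_density \<eta> *\<^sub>R \<psi> (z + sqrt (2 * s) * \<eta>))"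
    by (rule Bochner_Integration.integrable_bound[OF i m])
       (use b in \<open>auto intro!: AE_I2 order_trans[OF _ abs_ge_self] simp del: norm_scaleR\<close>)
  have "norm (heat (of_real s) \<psi> (of_real z)) \<le> (\<integral>\<eta>. std_normal_density \<eta> * K \<partial>lborel)"
    unfolding heat_real[OF s] by (rule Bochner_Integration.integral_norm_bound_integral[OF i2 i]) (rule b)
  also have "\<dots> = K" by simp
  finally show ?thesis .
qed

text \<open>Approximate identity with varying points and profiles. The hypothesis \<open>lim\<close>
  asks for convergence along every positive sequence tending to z0, which is what the arguments z k
  + sqrt (2 \<tau> k) \<eta> require; they are eventually positive because z0 is, so the reflected
  half is not seen in the limit.\<close>

lemma heat_tendsto_initial:
  fixes \<phi> :: "nat \<Rightarrow> complex \<Rightarrow> complex"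
  assumes \<tau>: "\<And>k. 0 < \<tau> k" "\<tau> \<longlonglongrightarrow> 0" and z: "z \<longlonglongrightarrow> z0" "0 < z0"
    and meas: "\<And>k. odd_ext (\<phi> k) \<in> borel_measurable borel"
    and bd: "\<And>k y. norm (odd_ext (\<phi> k) y) \<le> K"
    and lim: "\<And>y. (\<And>k. 0 < y k) \<Longrightarrow> y \<longlonglongrightarrow> z0 \<Longrightarrow> (\<lambda>k. \<phi> k (of_real (y k))) \<longlonglongrightarrow> c"
  shows "(\<lambda>k. heat (of_real (\<tau> k)) (odd_ext (\<phi> k)) (of_real (z k))) \<longlonglongrightarrow> c"
proof -
  have "(\<lambda>k. \<integral>\<eta>. std_normal_density \<eta> *\<^sub>R odd_ext (\<phi> k) (z k + sqrt (2 * \<tau> k) * \<eta>) \<partial>lborel)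
     \<longlonglongrightarrow> (\<integral>\<eta>. std_normal_density \<eta> *\<^sub>R c \<partial>lborel)"
  proof (rule integral_dominated_convergence[where w = "\<lambda>\<eta>. std_normal_density \<eta> * K"])
    show "(\<lambda>\<eta>. std_normal_density \<eta> *\<^sub>R odd_ext (\<phi> k) (z k + sqrt (2 * \<tau> k) * \<eta>)) \<in> borel_measurable lborel" for k
      using meas[of k] by measurable
    show "AE \<eta> in lborel. norm (std_normal_density \<eta> *\<^sub>R odd_ext (\<phi> k) (z k + sqrt (2 * \<tau> k) * \<eta>)) \<le> std_normal_density \<eta> * K" for k
      using bd by (simp add: mult_left_mono)
    have "(\<lambda>k. odd_ext (\<phi> k) (z k + sqrt (2 * \<tau> k) * \<eta>)) \<longlonglongrightarrow> c" for \<eta>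
    proof -
      define y where "y k = z k + sqrt (2 * \<tau> k) * \<eta>" for k
      have y: "y \<longlonglongrightarrow> z0" unfolding y_def
        by (rule tendsto_eq_intros z \<tau>(2) refl | simp)+
      then have ev: "eventually (\<lambda>k. 0 < y k) sequentially" using z(2) by (rule order_tendstoD)
      \<comment> \<open>\<open>lim\<close> wants positive arguments for all k, so the finitely many
        others are replaced by z0.\<close>
      define y' where "y' k = (if 0 < y k then y k else z0)" for k
      have "y' \<longlonglongrightarrow> z0"
        by (rule Lim_transform_eventually[OF y]) (use ev in eventually_elim, simp add: y'_def)
      then have "(\<lambda>k. \<phi> k (of_real (y' k))) \<longlonglongrightarrow> c"
      proof (rule lim[rotated])
        show "0 < y' k" for k using z(2) by (simp add: y'_def)
      qed
      then have "(\<lambda>k. odd_ext (\<phi> k) (y k)) \<longlonglongrightarrow> c"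
        by (rule Lim_transform_eventually) (use ev in eventually_elim, simp add: y'_def odd_ext_def)
      then show ?thesis by (simp add: y_def)
    qed
    then show "AE \<eta> in lborel. (\<lambda>k. std_normal_density \<eta> *\<^sub>R odd_ext (\<phi> k) (z k + sqrt (2 * \<tau> k) * \<eta>)) \<longlonglongrightarrow> std_normal_density \<eta> *\<^sub>R c"
      by (intro AE_I2 tendsto_intros)
  qed auto
  then show ?thesis by (simp add: heat_real[OF \<tau>(1)])
qed

section \<open>Mapping properties of the Duhamel integral\<close>

context
  fixes T B \<epsilon> :: real and n :: nat and f :: "complex \<Rightarrow> complex \<Rightarrow> complex"
  assumes T: "0 < T" and \<epsilon>: "0 < \<epsilon>" "\<epsilon> \<le> 1" and f: "duh_class T B n f"
begin

lemma duh_class_holomorphic: "t \<in> St T \<Longrightarrow> f t holomorphic_on Cone" "z \<in> Cone \<Longrightarrow> (\<lambda>t. f t z) holomorphic_on St T"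
  using f by (auto simp: duh_class_def sep_hol_def)

lemma duh_class_nonneg: "0 \<le> B" using f by (auto simp: duh_class_def)

lemma duh_class_bound: "t \<in> St T \<Longrightarrow> z \<in> Cone \<Longrightarrow> norm (f t z) \<le> B * Re t ^ n * exp (- Re z)"
  using f by (auto simp: duh_class_def)

lemma duh_class_bound_uniform:
  assumes "t \<in> St T" "z \<in> Cone" shows "norm (f t z) \<le> B * T ^ n * exp (- Re z)"
proof -
  have "B * Re t ^ n * exp (- Re z) \<le> B * T ^ n * exp (- Re z)"
    using assms(1) duh_class_nonneg by (intro mult_right_mono mult_left_mono power_mono) (auto simp: St_def)
  with duh_class_bound[OF assms] show ?thesis by linarith
qed

lemma duh_class_exp_decay: "t \<in> St T \<Longrightarrow> exp_decay (B * T ^ n) (odd_ext (f t))"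
  by (rule odd_ext_exp_decay[OF duh_class_holomorphic(1) duh_class_bound_uniform])

lemma holomorphic_odd_ext:
  assumes "s holomorphic_on L" "\<And>l. l \<in> L \<Longrightarrow> s l \<in> St T"
  shows "(\<lambda>l. odd_ext (f (s l)) y) holomorphic_on L"
proof -
  have c: "(\<lambda>l. f (s l) z) holomorphic_on L" if "z \<in> Cone" for z
  proof -
    have "((\<lambda>t. f t z) \<circ> s) holomorphic_on L"
      by (rule holomorphic_on_compose_gen[OF assms(1) duh_class_holomorphic(2)[OF that]]) (use assms(2) in auto)
    then show ?thesis by (simp add: o_def)
  qed
  show ?thesis unfolding odd_ext_def using c[of "of_real y"] c[of "of_real (-y)"]
    by (cases y "0::real" rule: linorder_cases) (auto intro!: holomorphic_intros)
qed

lemma duh_kernel_sep_hol: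
  assumes \<sigma>: "0 < \<sigma>" "\<sigma> < 1"
  shows "sep_hol (St T) UNIV (\<lambda>t z. duh_kernel \<epsilon> f t \<sigma> z)"
  unfolding duh_kernel_def
proof (rule heat_sep_hol(1)[OF open_St, where B = "B * T ^ n"])
  show "of_real (\<epsilon> * (1 - \<sigma>)) * t \<in> Sec" if "t \<in> St T" for t
    using that \<sigma> \<epsilon> by (intro Sec_scale St_Sec) auto
  show "(\<lambda>t. odd_ext (f (of_real \<sigma> * t)) y) holomorphic_on St T" for y
    by (rule holomorphic_odd_ext) (use \<sigma> St_scale in \<open>auto intro!: holomorphic_intros\<close>)
  show "exp_decay (B * T ^ n) (odd_ext (f (of_real \<sigma> * t)))" if "t \<in> St T" for t
    by (rule duh_class_exp_decay) (use \<sigma> St_scale that in auto)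
qed (auto intro!: holomorphic_intros)

lemma norm_duh_kernel_le:
  assumes \<sigma>: "0 < \<sigma>" "\<sigma> < 1" and t: "t \<in> St T" and z: "z \<in> Cone"
  shows "norm (duh_kernel \<epsilon> f t \<sigma> z) \<le> 3 * exp (4 * T) * B * (\<sigma> * Re t) ^ n * exp (- Re z)"
proof -
  have st: "of_real \<sigma> * t \<in> St T" using t \<sigma> St_scale by auto
  have Rt: "0 < Re t" "Re t < T" using t by (auto simp: St_def)
  have "norm (duh_kernel \<epsilon> f t \<sigma> z) \<le> 3 * exp (4 * Re (of_real (\<epsilon> * (1 - \<sigma>)) * t)) * (B * (\<sigma> * Re t) ^ n) * exp (- Re z)"
    unfolding duh_kernel_def
  proof (rule norm_heat_odd_ext_le)
    show "norm (f (of_real \<sigma> * t) w) \<le> B * (\<sigma> * Re t) ^ n * exp (- Re w)" if "w \<in> Cone" for w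
      using duh_class_bound[OF st that] by simp
    show "of_real (\<epsilon> * (1 - \<sigma>)) * t \<in> Sec" using t \<sigma> \<epsilon> by (intro Sec_scale St_Sec) auto
  qed (use st z duh_class_holomorphic in auto)
  also have "\<dots> \<le> 3 * exp (4 * T) * (B * (\<sigma> * Re t) ^ n) * exp (- Re z)"
  proof -
    have "\<epsilon> * (1 - \<sigma>) * Re t \<le> 1 * 1 * T" using \<sigma> \<epsilon> Rt by (intro mult_mono) auto
    then have "exp (4 * Re (of_real (\<epsilon> * (1 - \<sigma>)) * t)) \<le> exp (4 * T)" by simp
    then show ?thesis using Rt \<sigma> duh_class_nonneg by (intro mult_right_mono mult_left_mono) auto
  qed
  finally show ?thesis by (simp add: mult.assoc)
qed

lemma measurable_duh_kernel:
  assumes t: "t \<in> St T"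
  shows "(\<lambda>\<sigma>. duh_kernel \<epsilon> f t \<sigma> z) \<in> borel_measurable U01"
proof (rule borel_measurable_continuous_on_restrict_lborel)
  \<comment> \<open>The variable \<sigma> is made complex as well: on the open set L the kernel is
    holomorphic in \<sigma>, hence continuous on (0, 1).\<close>
  define L where "L = {\<sigma>. \<sigma> * t \<in> St T \<and> of_real \<epsilon> * (1 - \<sigma>) * t \<in> Sec}"
  have "open L"
  proof -
    have "L = (\<lambda>\<sigma>. \<sigma> * t) -` St T \<inter> (\<lambda>\<sigma>. of_real \<epsilon> * (1 - \<sigma>) * t) -` Sec" by (auto simp: L_def)
    then show ?thesis by (auto intro!: open_Int open_vimage open_St open_Sec continuous_intros)
  qed
  then have "sep_hol L UNIV (\<lambda>\<sigma> z. heat (of_real \<epsilon> * (1 - \<sigma>) * t) (odd_ext (f (\<sigma> * t))) z)"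
    by (rule heat_sep_hol(1)[where B = "B * T ^ n"])
       (auto intro!: holomorphic_intros holomorphic_odd_ext duh_class_exp_decay simp: L_def)
  then have "(\<lambda>\<sigma>. heat (of_real \<epsilon> * (1 - \<sigma>) * t) (odd_ext (f (\<sigma> * t))) z) holomorphic_on L"
    by (auto simp: sep_hol_def)
  then have c: "continuous_on L (\<lambda>\<sigma>. heat (of_real \<epsilon> * (1 - \<sigma>) * t) (odd_ext (f (\<sigma> * t))) z)"
    by (rule holomorphic_on_imp_continuous_on)
  have inL: "of_real \<sigma> \<in> L" if "\<sigma> \<in> {0<..<1}" for \<sigma>
  proof -
    have "of_real (\<epsilon> * (1 - \<sigma>)) * t \<in> Sec" using that \<epsilon> t by (intro Sec_scale St_Sec) auto
    then show ?thesis using that St_scale[OF t, of \<sigma>] by (auto simp: L_def)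
  qed
  have "continuous_on {0<..<1} (\<lambda>\<sigma>::real. heat (of_real \<epsilon> * (1 - of_real \<sigma>) * t) (odd_ext (f (of_real \<sigma> * t))) z)"
    by (rule continuous_on_compose2[OF c]) (use inL in \<open>auto intro!: continuous_intros\<close>)
  then show "continuous_on {0<..<1} (\<lambda>\<sigma>. duh_kernel \<epsilon> f t \<sigma> z)" by (simp add: duh_kernel_def)
qed

text \<open>In the sector |t| is at most 3/2 Re t, as sqrt 2 < 3/2, and the kernel bound has the
  factor 3; 9/2 is rounded up to 5. Integrating \<sigma>^n supplies 1 / (n + 1).\<close>

lemma norm_duh_le:
  assumes t: "t \<in> St T" and z: "z \<in> Cone"
  shows "norm (duh \<epsilon> f t z) \<le> 5 * exp (4 * T) * B / real (Suc n) * Re t ^ Suc n * exp (- Re z)"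
proof -
  have Rt: "0 < Re t" "Re t < T" "\<bar>Im t\<bar> < Re t" using t by (auto simp: St_def)
  have nt: "norm t \<le> 3 / 2 * Re t"
  proof (rule power2_le_imp_le)
    have "(Im t)\<^sup>2 \<le> (Re t)\<^sup>2" using Rt by (intro abs_le_square_iff[THEN iffD1]) auto
    moreover have "(3 / 2 * Re t)\<^sup>2 = 9 / 4 * (Re t)\<^sup>2" by (simp add: power_mult_distrib power_divide)
    ultimately show "(norm t)\<^sup>2 \<le> (3 / 2 * Re t)\<^sup>2" using zero_le_power2[of "Re t"] unfolding cmod_power2 by linarith
  qed (use Rt in auto)
  let ?g = "\<lambda>\<sigma>. (3 / 2 * Re t * (3 * exp (4 * T) * B * Re t ^ n * exp (- Re z))) * \<sigma> ^ n"
  have "norm (duh \<epsilon> f t z) \<le> (\<integral>\<sigma>. ?g \<sigma> \<partial>U01)"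
    unfolding duh_def
  proof (rule norm_integral_U01_le)
    show "norm (t * duh_kernel \<epsilon> f t \<sigma> z) \<le> ?g \<sigma>" if \<sigma>: "0 < \<sigma>" "\<sigma> < 1" for \<sigma>
    proof -
      have "norm (t * duh_kernel \<epsilon> f t \<sigma> z) \<le> (3 / 2 * Re t) * (3 * exp (4 * T) * B * (\<sigma> * Re t) ^ n * exp (- Re z))"
        unfolding norm_mult using nt norm_duh_kernel_le[OF \<sigma> t z] Rt by (intro mult_mono) auto
      then show ?thesis by (simp add: power_mult_distrib mult_ac)
    qed
    show "integrable U01 ?g" using integral_power_U01(1) by simp
  qed
  also have "\<dots> = (9 / 2) * (exp (4 * T) * B / real (Suc n) * Re t ^ Suc n * exp (- Re z))"
    using integral_power_U01(2)[of n] by (simp add: mult_ac)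
  also have "\<dots> \<le> 5 * (exp (4 * T) * B / real (Suc n) * Re t ^ Suc n * exp (- Re z))"
    using Rt duh_class_nonneg by (intro mult_right_mono) auto
  finally show ?thesis by (simp add: mult_ac)
qed

lemma duh_kernel_bound_uniform:
  assumes \<sigma>: "0 < \<sigma>" "\<sigma> < 1" and t: "t \<in> St T" and z: "z \<in> Cone"
  shows "norm (t * duh_kernel \<epsilon> f t \<sigma> z) \<le> 6 * T * exp (4 * T) * B * T ^ n"
proof -
  have Rt: "0 < Re t" "Re t < T" "\<bar>Im t\<bar> < Re t" using t by (auto simp: St_def)
  have nt: "norm t \<le> 2 * T" using cmod_le[of t] Rt by simp
  have "(\<sigma> * Re t) ^ n \<le> T ^ n"
  proof (rule power_mono)
    have "\<sigma> * Re t \<le> 1 * T" using \<sigma> Rt by (intro mult_mono) auto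
    then show "\<sigma> * Re t \<le> T" by simp
  qed (use \<sigma> Rt in auto)
  moreover have "exp (- Re z) \<le> 1" using z by (auto simp: Cone_def)
  ultimately have "3 * exp (4 * T) * B * (\<sigma> * Re t) ^ n * exp (- Re z) \<le> 3 * exp (4 * T) * B * T ^ n * 1"
    using \<sigma> Rt duh_class_nonneg T by (intro mult_mono) auto
  then have "norm (duh_kernel \<epsilon> f t \<sigma> z) \<le> 3 * exp (4 * T) * B * T ^ n"
    using norm_duh_kernel_le[OF \<sigma> t z] by linarith
  then have "norm (t * duh_kernel \<epsilon> f t \<sigma> z) \<le> (2 * T) * (3 * exp (4 * T) * B * T ^ n)"
    unfolding norm_mult using nt T by (intro mult_mono) auto
  then show ?thesis by (simp add: mult_ac)
qed

lemma duh_holomorphic: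
  shows "t \<in> St T \<Longrightarrow> duh \<epsilon> f t holomorphic_on Cone"
    and "t \<in> St T \<Longrightarrow> z \<in> Cone \<Longrightarrow> deriv (deriv (duh \<epsilon> f t)) z = (\<integral>\<sigma>. t * deriv (deriv (duh_kernel \<epsilon> f t \<sigma>)) z \<partial>U01)"
    and "t \<in> St T \<Longrightarrow> z \<in> Cone \<Longrightarrow> integrable U01 (\<lambda>\<sigma>. t * deriv (deriv (duh_kernel \<epsilon> f t \<sigma>)) z)"
    and "z \<in> Cone \<Longrightarrow> (\<lambda>t. duh \<epsilon> f t z) holomorphic_on St T"
proof -
  have hz: "(\<lambda>z. t * duh_kernel \<epsilon> f t \<sigma> z) holomorphic_on Cone" if "t \<in> St T" "\<sigma> \<in> space U01" for t \<sigma>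
  proof -
    have "duh_kernel \<epsilon> f t \<sigma> holomorphic_on UNIV"
      using duh_kernel_sep_hol[of \<sigma>] that unfolding sep_hol_def by auto
    then have "duh_kernel \<epsilon> f t \<sigma> holomorphic_on Cone" by (rule holomorphic_on_subset) auto
    then show ?thesis by (intro holomorphic_intros)
  qed
  have ht: "(\<lambda>t. t * duh_kernel \<epsilon> f t \<sigma> z) holomorphic_on St T" if "\<sigma> \<in> space U01" for \<sigma> z
  proof -
    have "(\<lambda>t. duh_kernel \<epsilon> f t \<sigma> z) holomorphic_on St T"
      using duh_kernel_sep_hol[of \<sigma>] that unfolding sep_hol_def by auto
    then show ?thesis by (intro holomorphic_intros)
  qed
  have m: "(\<lambda>\<sigma>. t * duh_kernel \<epsilon> f t \<sigma> z) \<in> borel_measurable U01" if "t \<in> St T" for t z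
    by (intro borel_measurable_times borel_measurable_const measurable_duh_kernel that)
  have lz: "\<exists>r>0. \<exists>g. integrable U01 g \<and> (\<forall>w\<in>ball z r \<inter> Cone. \<forall>\<sigma>\<in>space U01. norm (t * duh_kernel \<epsilon> f t \<sigma> w) \<le> g \<sigma>)"
    if "t \<in> St T" for t z
    using duh_kernel_bound_uniform that finite_measure.integrable_const[OF finite_measure_U01]
    by (intro exI[of _ 1] conjI exI[of _ "\<lambda>_. 6 * T * exp (4 * T) * B * T ^ n"]) auto
  have lt: "\<exists>r>0. \<exists>g. integrable U01 g \<and> (\<forall>t\<in>ball t' r \<inter> St T. \<forall>\<sigma>\<in>space U01. norm (t * duh_kernel \<epsilon> f t \<sigma> w) \<le> g \<sigma>)"
    if "w \<in> Cone" for t' w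
    using duh_kernel_bound_uniform that finite_measure.integrable_const[OF finite_measure_U01]
    by (intro exI[of _ 1] conjI exI[of _ "\<lambda>_. 6 * T * exp (4 * T) * B * T ^ n"]) auto
  show "duh \<epsilon> f t holomorphic_on Cone" if "t \<in> St T"
    unfolding duh_def by (rule holomorphic_integral_param(1)[OF open_Cone hz[OF that] m[OF that] lz[OF that]])
  show "(\<lambda>t. duh \<epsilon> f t z) holomorphic_on St T" if "z \<in> Cone"
    unfolding duh_def by (rule holomorphic_integral_param(1)[OF open_St ht m lt[OF that]])
  have dd: "deriv (deriv (\<lambda>z. t * duh_kernel \<epsilon> f t \<sigma> z)) z = t * deriv (deriv (duh_kernel \<epsilon> f t \<sigma>)) z"
    if "t \<in> St T" "\<sigma> \<in> space U01" for t \<sigma> z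
  proof -
    have h: "duh_kernel \<epsilon> f t \<sigma> holomorphic_on UNIV"
      using duh_kernel_sep_hol[of \<sigma>] that unfolding sep_hol_def by auto
    have h': "deriv (duh_kernel \<epsilon> f t \<sigma>) holomorphic_on UNIV" by (rule holomorphic_deriv[OF h open_UNIV])
    have "deriv (\<lambda>z. t * duh_kernel \<epsilon> f t \<sigma> z) = (\<lambda>z. t * deriv (duh_kernel \<epsilon> f t \<sigma>) z)"
      by (rule ext, rule DERIV_imp_deriv, rule DERIV_cmult, rule holomorphic_derivI[OF h open_UNIV]) simp
    then show ?thesis
      by (simp only:) (rule DERIV_imp_deriv, rule DERIV_cmult, rule holomorphic_derivI[OF h' open_UNIV], simp)
  qed
  show "deriv (deriv (duh \<epsilon> f t)) z = (\<integral>\<sigma>. t * deriv (deriv (duh_kernel \<epsilon> f t \<sigma>)) z \<partial>U01)" if "t \<in> St T" "z \<in> Cone"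
  proof -
    have "deriv (deriv (duh \<epsilon> f t)) z = (\<integral>\<sigma>. deriv (deriv (\<lambda>z. t * duh_kernel \<epsilon> f t \<sigma> z)) z \<partial>U01)"
      unfolding duh_def by (rule holomorphic_integral_param(4)[OF open_Cone hz[OF that(1)] m[OF that(1)] lz[OF that(1)] that(2)])
    also have "\<dots> = (\<integral>\<sigma>. t * deriv (deriv (duh_kernel \<epsilon> f t \<sigma>)) z \<partial>U01)"
      by (rule Bochner_Integration.integral_cong[OF refl dd[OF that(1)]])
    finally show ?thesis .
  qed
  show "integrable U01 (\<lambda>\<sigma>. t * deriv (deriv (duh_kernel \<epsilon> f t \<sigma>)) z)" if "t \<in> St T" "z \<in> Cone"
  proof -
    have "integrable U01 (\<lambda>\<sigma>. deriv (deriv (\<lambda>z. t * duh_kernel \<epsilon> f t \<sigma> z)) z)"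
      by (rule holomorphic_integral_param(5)[OF open_Cone hz[OF that(1)] m[OF that(1)] lz[OF that(1)] that(2)])
    then show ?thesis
      by (subst Bochner_Integration.integrable_cong[OF refl dd[OF that(1), symmetric]])
  qed
qed

lemma duh_class_duh: "duh_class T (5 * exp (4 * T) * B / real (Suc n)) (Suc n) (duh \<epsilon> f)"
  unfolding duh_class_def
proof (intro conjI ballI)
  show "sep_hol (St T) Cone (duh \<epsilon> f)"
    unfolding sep_hol_def
  proof (intro conjI ballI)
    fix t z assume tz: "t \<in> St T" "z \<in> Cone"
    have "norm (duh \<epsilon> f s y) \<le> 5 * exp (4 * T) * B / real (Suc n) * T ^ Suc n * 1" if "s \<in> St T" "y \<in> Cone" for s y
    proof (rule order_trans[OF norm_duh_le[OF that]], intro mult_mono power_mono)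
      show "0 \<le> 5 * exp (4 * T) * B / real (Suc n) * T ^ Suc n" "0 \<le> 5 * exp (4 * T) * B / real (Suc n)"
        using duh_class_nonneg T by auto
    qed (use that T in \<open>auto simp: St_def Cone_def\<close>)
    then show "\<exists>d>0. \<exists>K. \<forall>s\<in>ball t d \<inter> St T. \<forall>y\<in>ball z d \<inter> Cone. norm (duh \<epsilon> f s y) \<le> K"
      by (intro exI[of _ 1] conjI exI[of _ "5 * exp (4 * T) * B / real (Suc n) * T ^ Suc n * 1"]) auto
  qed (use duh_holomorphic in auto)
qed (use norm_duh_le duh_class_nonneg in auto)

lemma norm_duh_kernel_real_le:
  assumes "0 < \<sigma>" "\<sigma> < 1" "0 < t" "t < T"
  shows "norm (duh_kernel \<epsilon> f (of_real t) \<sigma> (of_real z)) \<le> B * T ^ n"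
proof -
  have st: "of_real \<sigma> * of_real t \<in> St T" using St_scale[of "of_real t" T \<sigma>] assms by auto
  have "norm (heat (of_real (\<epsilon> * (1 - \<sigma>) * t)) (odd_ext (f (of_real \<sigma> * of_real t))) (of_real z)) \<le> B * T ^ n"
  proof (rule norm_heat_real_le)
    have e: "exp_decay (B * T ^ n) (odd_ext (f (of_real \<sigma> * of_real t)))" by (rule duh_class_exp_decay[OF st])
    then show "odd_ext (f (of_real \<sigma> * of_real t)) \<in> borel_measurable borel" by (simp add: exp_decay_def)
    fix y
    have "norm (odd_ext (f (of_real \<sigma> * of_real t)) y) \<le> B * T ^ n * exp (- \<bar>y\<bar>)" using e by (simp add: exp_decay_def)
    also have "\<dots> \<le> B * T ^ n * 1" using exp_decay_nonneg[OF e] by (intro mult_left_mono) auto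
    finally show "norm (odd_ext (f (of_real \<sigma> * of_real t)) y) \<le> B * T ^ n" by simp
  qed (use assms \<epsilon> in auto)
  then show ?thesis by (simp add: duh_kernel_def)
qed

text \<open>Holomorphy on \<open>Cone\<close> says nothing about the wall. For fixed \<sigma> the
  kernel is entire in z, and at real points it is bounded independently of \<sigma>, so dominated
  convergence gives continuity across z = 0.\<close>

lemma continuous_on_duh_real:
  "continuous_on ({0<..<T} \<times> UNIV) (\<lambda>p. duh \<epsilon> f (of_real (fst p)) (of_real (snd p)))"
  unfolding continuous_on_sequentially
proof (intro allI ballI impI, elim conjE)
  fix X :: "nat \<Rightarrow> real \<times> real" and p
  assume p: "p \<in> {0<..<T} \<times> UNIV" and X: "\<forall>k. X k \<in> {0<..<T} \<times> UNIV" "X \<longlonglongrightarrow> p"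
  have Xk: "of_real (fst (X k)) \<in> St T" "0 < fst (X k)" "fst (X k) < T" for k using X(1) by (auto simp: mem_Times_iff)
  have pk: "of_real (fst p) \<in> St T" using p by (auto simp: mem_Times_iff)
  have m: "(\<lambda>\<sigma>. t * duh_kernel \<epsilon> f t \<sigma> z) \<in> borel_measurable U01" if "t \<in> St T" for t z
    by (intro borel_measurable_times borel_measurable_const measurable_duh_kernel that)
  have "(\<lambda>k. duh \<epsilon> f (of_real (fst (X k))) (of_real (snd (X k)))) \<longlonglongrightarrow> duh \<epsilon> f (of_real (fst p)) (of_real (snd p))"
    unfolding duh_def
  proof (rule integral_dominated_convergence[where w = "\<lambda>_. T * (B * T ^ n)"])
    show "integrable U01 (\<lambda>_. T * (B * T ^ n))" by (rule finite_measure.integrable_const[OF finite_measure_U01])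
    show "AE \<sigma> in U01. norm (of_real (fst (X k)) * duh_kernel \<epsilon> f (of_real (fst (X k))) \<sigma> (of_real (snd (X k)))) \<le> T * (B * T ^ n)" for k
    proof (rule AE_I2)
      fix \<sigma> assume "\<sigma> \<in> space U01"
      then have "norm (duh_kernel \<epsilon> f (of_real (fst (X k))) \<sigma> (of_real (snd (X k)))) \<le> B * T ^ n"
        by (intro norm_duh_kernel_real_le Xk) auto
      then show "norm (of_real (fst (X k)) * duh_kernel \<epsilon> f (of_real (fst (X k))) \<sigma> (of_real (snd (X k)))) \<le> T * (B * T ^ n)"
        unfolding norm_mult using Xk(2,3)[of k] T by (intro mult_mono) auto
    qed
    show "AE \<sigma> in U01. (\<lambda>k. of_real (fst (X k)) * duh_kernel \<epsilon> f (of_real (fst (X k))) \<sigma> (of_real (snd (X k))))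
       \<longlonglongrightarrow> of_real (fst p) * duh_kernel \<epsilon> f (of_real (fst p)) \<sigma> (of_real (snd p))"
    proof (rule AE_I2)
      fix \<sigma> assume "\<sigma> \<in> space U01"
      then have c: "continuous_on (St T \<times> UNIV) (\<lambda>p. duh_kernel \<epsilon> f (fst p) \<sigma> (snd p))"
        by (intro sep_hol_continuous_on duh_kernel_sep_hol open_St open_UNIV) auto
      have l: "(\<lambda>k. (complex_of_real (fst (X k)), complex_of_real (snd (X k)))) \<longlonglongrightarrow> (of_real (fst p), of_real (snd p))"
        by (intro tendsto_intros X(2))
      have "(\<lambda>k. duh_kernel \<epsilon> f (of_real (fst (X k))) \<sigma> (of_real (snd (X k)))) \<longlonglongrightarrow> duh_kernel \<epsilon> f (of_real (fst p)) \<sigma> (of_real (snd p))"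
        using continuous_on_tendsto_compose[OF c l] pk Xk(1) by simp
      then show "(\<lambda>k. of_real (fst (X k)) * duh_kernel \<epsilon> f (of_real (fst (X k))) \<sigma> (of_real (snd (X k))))
       \<longlonglongrightarrow> of_real (fst p) * duh_kernel \<epsilon> f (of_real (fst p)) \<sigma> (of_real (snd p))"
        by (intro tendsto_intros X(2))
    qed
  qed (use m Xk pk in auto)
  then show "((\<lambda>p. duh \<epsilon> f (of_real (fst p)) (of_real (snd p))) \<circ> X) \<longlonglongrightarrow> duh \<epsilon> f (of_real (fst p)) (of_real (snd p))"
    by (simp add: o_def)
qed

end

section \<open>Duhamel's principle\<close>

lemma set_integrable_affine_U01:
  fixes g :: "real \<Rightarrow> complex"
  assumes c: "0 < c"
  shows "set_integrable lborel {a<..<a+c} g \<longleftrightarrow> integrable U01 (\<lambda>\<sigma>. g (a + c * \<sigma>))"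
proof -
  have "integrable U01 (\<lambda>\<sigma>. g (a + c * \<sigma>)) \<longleftrightarrow> integrable lborel (\<lambda>x. indicator {0<..<1} x *\<^sub>R g (a + c * x))"
    by (rule integrable_restrict_space) simp
  also have "(\<lambda>x. indicator {0<..<1} x *\<^sub>R g (a + c * x)) = (\<lambda>x. indicator {a<..<a+c} (a + c * x) *\<^sub>R g (a + c * x))"
    using c by (auto simp: indicator_def zero_less_mult_iff fun_eq_iff)
  also have "integrable lborel (\<lambda>x. indicator {a<..<a+c} (a + c * x) *\<^sub>R g (a + c * x))
     \<longleftrightarrow> integrable lborel (\<lambda>x. indicator {a<..<a+c} x *\<^sub>R g x)"
    by (rule lborel_integrable_real_affine_iff) (use c in auto)
  finally show ?thesis by (simp add: set_integrable_def)
qed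

lemma set_integral_split_point:
  fixes g :: "real \<Rightarrow> complex"
  assumes g: "set_integrable lborel {a<..<c} g" and abc: "a < b" "b < c"
  shows "(LINT s:{a<..<c}|lborel. g s) = (LINT s:{a<..<b}|lborel. g s) + (LINT s:{b<..<c}|lborel. g s)"
    and "set_integrable lborel {a<..<b} g" "set_integrable lborel {b<..<c} g"
proof -
  show 1: "set_integrable lborel {a<..<b} g" "set_integrable lborel {b<..<c} g"
    by (rule set_integrable_subset[OF g]; use abc in auto)+
  have m: "set_borel_measurable lborel ({a<..<b} \<union> {b<..<c}) g"
    using set_integrable_Un[OF 1] by (auto simp: set_integrable_def set_borel_measurable_def)
  have "(LINT s:{a<..<c}|lborel. g s) = (LINT s:{a<..<b} \<union> {b<..<c}|lborel. g s)"
  proof (rule set_integral_cong_set)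
    show "set_borel_measurable lborel {a<..<c} g" using g by (auto simp: set_integrable_def set_borel_measurable_def)
    have "AE x in lborel. x \<noteq> b" by (rule AE_lborel_singleton)
    then show "AE x in lborel. (x \<in> {a<..<b} \<union> {b<..<c}) = (x \<in> {a<..<c})"
      by eventually_elim (use abc in auto)
  qed (rule m)
  also have "\<dots> = (LINT s:{a<..<b}|lborel. g s) + (LINT s:{b<..<c}|lborel. g s)"
    by (rule set_integral_Un) (use 1 in auto)
  finally show "(LINT s:{a<..<c}|lborel. g s) = (LINT s:{a<..<b}|lborel. g s) + (LINT s:{b<..<c}|lborel. g s)" .
qed

lemma deriv_deriv_bound_ball:
  assumes "g holomorphic_on ball z r" "0 < r" "\<And>w. w \<in> ball z r \<Longrightarrow> norm (g w) \<le> K"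
  shows "norm (deriv (deriv g) z) \<le> K / (r / 4) / (r / 4)"
proof -
  have "norm (deriv (deriv g) z) \<le> K / (r / 4) / ((r / 2) / 2)"
  proof (rule deriv_bound_ball)
    show "deriv g holomorphic_on ball z (r / 2)"
      by (rule holomorphic_on_subset[OF holomorphic_deriv[OF assms(1) open_ball]]) (use assms(2) in auto)
    fix w assume w: "w \<in> ball z (r / 2)"
    have sub: "ball w (r/2) \<subseteq> ball z r"
      by (rule subset_trans[OF _ ball_subset_ball_iff[THEN iffD2]])
         (use w assms(2) in \<open>auto simp: dist_norm norm_minus_commute\<close>)
    have "norm (deriv g w) \<le> K / ((r / 2) / 2)"
      by (rule deriv_bound_ball) (use sub assms holomorphic_on_subset in auto)
    then show "norm (deriv g w) \<le> K / (r / 4)" by simp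
  qed (use assms in auto)
  then show ?thesis by simp
qed

lemma quotient_tendsto:
  fixes G :: "complex \<Rightarrow> complex"
  assumes "(G has_field_derivative D) (at x)" "X \<longlonglongrightarrow> 0" "\<And>k. X k \<noteq> 0"
  shows "(\<lambda>k. (G (x + X k) - G x) / X k) \<longlonglongrightarrow> D"
  using assms unfolding DERIV_def by (subst (asm) tendsto_at_iff_sequentially) (auto simp: o_def)

text \<open>The integral over (0, t0 + h) is cut at t0: the old part gives difference quotients of
  the heat flow, which tend to \<epsilon> times the second z-derivative, and the new part is an
  average over heat times shrinking to 0, which tends to the source. Since \<open>duh\<close> is
  holomorphic in t, one sequence of increments determines the derivative.\<close>

lemma duh_pde:
  assumes T: "0 < T" and \<epsilon>: "0 < \<epsilon>" "\<epsilon> \<le> 1" and f: "duh_class T B n f"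
    and t0: "0 < t0" "t0 < T" and z0: "0 < z0"
  shows "deriv (\<lambda>t. duh \<epsilon> f t (of_real z0)) (of_real t0) =
     of_real \<epsilon> * deriv (deriv (duh \<epsilon> f (of_real t0))) (of_real z0) + f (of_real t0) (of_real z0)"
proof -
  define z where "z = complex_of_real z0"
  have z: "z \<in> Cone" using z0 by (simp add: z_def)
  note ctx = T \<epsilon> f
  have t0St: "of_real t0 \<in> St T" using t0 by simp
  \<comment> \<open>The contribution at time s0 of the source at time s, in unscaled time, so that
    varying s0 leaves s alone.\<close>
  define Q where "Q s0 s = heat (of_real (\<epsilon> * (s0 - s))) (odd_ext (f (of_real s))) z" for s0 s :: real
  define h where "h k = (T - t0) / 2 * inverse (real (Suc k))" for k
  have h: "0 < h k" "t0 + h k < T" "h \<longlonglongrightarrow> 0" for k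
  proof -
    show "0 < h k" using t0 by (simp add: h_def)
    have "h k \<le> (T - t0) / 2 * 1" unfolding h_def using t0 by (intro mult_left_mono) (auto simp: inverse_eq_divide)
    then show "t0 + h k < T" using t0 by simp
    show "h \<longlonglongrightarrow> 0" unfolding h_def using tendsto_mult[OF tendsto_const LIMSEQ_inverse_real_of_nat] by fastforce
  qed
  have kerQ: "duh_kernel \<epsilon> f (of_real s0) \<sigma> z = Q s0 (s0 * \<sigma>)" for s0 \<sigma>
    unfolding duh_kernel_def Q_def by (simp add: algebra_simps)
  have duhQ: "duh \<epsilon> f (of_real s0) z = (LINT s:{0<..<s0}|lborel. Q s0 s)" if "0 < s0" for s0
    using set_integral_affine_U01[OF that, of 0 "Q s0"] by (simp add: duh_def kerQ)
  have bdQ: "norm (Q s0 s) \<le> B * T ^ n" if "0 < s" "s < s0" "s < T" for s0 s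
  proof -
    have st: "of_real s \<in> St T" using that by simp
    have e: "exp_decay (B * T ^ n) (odd_ext (f (of_real s)))" by (rule duh_class_exp_decay[OF ctx st])
    show ?thesis unfolding Q_def z_def
    proof (rule norm_heat_real_le)
      show "0 < \<epsilon> * (s0 - s)" using that \<epsilon> by simp
      show "odd_ext (f (of_real s)) \<in> borel_measurable borel" using e by (simp add: exp_decay_def)
      fix y have "norm (odd_ext (f (of_real s)) y) \<le> B * T ^ n * exp (- \<bar>y\<bar>)" using e by (simp add: exp_decay_def)
      also have "\<dots> \<le> B * T ^ n * 1" using exp_decay_nonneg[OF e] by (intro mult_left_mono) auto
      finally show "norm (odd_ext (f (of_real s)) y) \<le> B * T ^ n" by simp
    qed
  qed
  have iQ: "set_integrable lborel {0<..<s0} (Q s0)" if "0 < s0" "s0 < T" for s0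
  proof -
    have st: "of_real s0 \<in> St T" using that by simp
    have "integrable U01 (\<lambda>\<sigma>. Q s0 (0 + s0 * \<sigma>))"
    proof (rule integrable_U01_bounded)
      show "(\<lambda>\<sigma>. Q s0 (0 + s0 * \<sigma>)) \<in> borel_measurable U01"
        using measurable_duh_kernel[OF ctx st, of z] by (simp add: kerQ)
      show "norm (Q s0 (0 + s0 * \<sigma>)) \<le> B * T ^ n" if "0 < \<sigma>" "\<sigma> < 1" for \<sigma>
      proof -
        have "s0 * \<sigma> < s0 * 1" using that \<open>0 < s0\<close> by (intro mult_strict_left_mono) auto
        then have "s0 * \<sigma> < s0" "s0 * \<sigma> < T" using \<open>s0 < T\<close> by auto
        then show ?thesis using bdQ[of "s0 * \<sigma>" s0] that \<open>0 < s0\<close> by simp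
      qed
    qed
    then show ?thesis using set_integrable_affine_U01[OF \<open>0 < s0\<close>, of 0 "Q s0"] by simp
  qed
  \<comment> \<open>\<open>A\<close> is the quotient of the old contributions and \<open>R\<close>
    the average of the new ones; \<open>quot\<close> shows that they add up to the difference
    quotient of \<open>duh\<close>.\<close>
  define A where "A k = (\<integral>\<sigma>. of_real t0 * ((Q (t0 + h k) (t0 * \<sigma>) - Q t0 (t0 * \<sigma>)) / of_real (h k)) \<partial>U01)" for k
  define R where "R k = (\<integral>\<sigma>. Q (t0 + h k) (t0 + h k * \<sigma>) \<partial>U01)" for k
  have i1: "integrable U01 (\<lambda>\<sigma>. Q (t0 + h k) (t0 * \<sigma>))"
    and i2: "integrable U01 (\<lambda>\<sigma>. Q (t0 + h k) (t0 + h k * \<sigma>))"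
    and i3: "integrable U01 (\<lambda>\<sigma>. Q t0 (t0 * \<sigma>))" for k
  proof -
    have i: "set_integrable lborel {0<..<t0 + h k} (Q (t0 + h k))" using h(1,2)[of k] t0 by (intro iQ) auto
    have S: "set_integrable lborel {0<..<t0} (Q (t0 + h k))" "set_integrable lborel {t0<..<t0 + h k} (Q (t0 + h k))"
      by (rule set_integral_split_point[OF i]; use h(1)[of k] t0 in simp)+
    show "integrable U01 (\<lambda>\<sigma>. Q (t0 + h k) (t0 * \<sigma>))"
      using S(1) set_integrable_affine_U01[OF t0(1), of 0] h(1)[of k] t0 by simp
    show "integrable U01 (\<lambda>\<sigma>. Q (t0 + h k) (t0 + h k * \<sigma>))"
      using S(2) set_integrable_affine_U01[OF h(1)[of k], of t0] h(1)[of k] t0 by simp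
    show "integrable U01 (\<lambda>\<sigma>. Q t0 (t0 * \<sigma>))"
      using iQ[OF t0] set_integrable_affine_U01[OF t0(1), of 0 "Q t0"] by simp
  qed
  have quot: "(duh \<epsilon> f (of_real t0 + of_real (h k)) z - duh \<epsilon> f (of_real t0) z) / of_real (h k) = A k + R k" for k
  proof -
    have i: "set_integrable lborel {0<..<t0 + h k} (Q (t0 + h k))" using h(1,2)[of k] t0 by (intro iQ) auto
    have "duh \<epsilon> f (of_real t0 + of_real (h k)) z = duh \<epsilon> f (of_real (t0 + h k)) z" by simp
    also have "\<dots> = (LINT s:{0<..<t0 + h k}|lborel. Q (t0 + h k) s)" using h(1,2)[of k] t0 by (intro duhQ) auto
    also have "\<dots> = (LINT s:{0<..<t0}|lborel. Q (t0 + h k) s) + (LINT s:{t0<..<t0 + h k}|lborel. Q (t0 + h k) s)"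
      by (rule set_integral_split_point(1)[OF i]) (use h(1,2)[of k] t0 in auto)
    also have "(LINT s:{0<..<t0}|lborel. Q (t0 + h k) s) = (\<integral>\<sigma>. of_real t0 * Q (t0 + h k) (t0 * \<sigma>) \<partial>U01)"
      using set_integral_affine_U01[OF t0(1), of 0 "Q (t0 + h k)"] by simp
    also have "(LINT s:{t0<..<t0 + h k}|lborel. Q (t0 + h k) s) = of_real (h k) * R k"
      unfolding R_def using set_integral_affine_U01[OF h(1)[of k], of t0 "Q (t0 + h k)"] by simp
    finally have 1: "duh \<epsilon> f (of_real t0 + of_real (h k)) z =
       (\<integral>\<sigma>. of_real t0 * Q (t0 + h k) (t0 * \<sigma>) \<partial>U01) + of_real (h k) * R k" .
    have 2: "duh \<epsilon> f (of_real t0) z = (\<integral>\<sigma>. of_real t0 * Q t0 (t0 * \<sigma>) \<partial>U01)" by (simp add: duh_def kerQ)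
    have "(\<integral>\<sigma>. of_real t0 * Q (t0 + h k) (t0 * \<sigma>) \<partial>U01) - (\<integral>\<sigma>. of_real t0 * Q t0 (t0 * \<sigma>) \<partial>U01)
       = (\<integral>\<sigma>. of_real t0 * Q (t0 + h k) (t0 * \<sigma>) - of_real t0 * Q t0 (t0 * \<sigma>) \<partial>U01)"
      using i1 i3 by (intro Bochner_Integration.integral_diff[symmetric]) auto
    moreover have "A k = (\<integral>\<sigma>. of_real t0 * Q (t0 + h k) (t0 * \<sigma>) - of_real t0 * Q t0 (t0 * \<sigma>) \<partial>U01) / of_real (h k)"
      unfolding A_def by (subst integral_divide_zero[symmetric]) (simp add: algebra_simps diff_divide_distrib)
    ultimately show ?thesis unfolding 1 2 using h(1)[of k] by (simp add: field_simps)
  qed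
  define G where "G s \<tau> = heat \<tau> (odd_ext (f (of_real s))) z" for s \<tau>
  define D where "D \<sigma> = deriv (deriv (duh_kernel \<epsilon> f (of_real t0) \<sigma>)) z" for \<sigma>
  obtain r where r: "0 < r" "ball z r \<subseteq> Cone" using open_Cone z open_contains_ball by blast
  \<comment> \<open>The bound of \<open>norm_heat_odd_ext_le\<close> on a ball inside the cone. Two
    Cauchy estimates make \<open>C\<close> a bound for second z-derivatives that does not
    deteriorate as the heat time tends to 0.\<close>
  define K where "K = 3 * exp (4 * T) * (B * T ^ n)"
  define C where "C = K / (r / 4) / (r / 4)"
  have \<sigma>0: "0 < t0 * \<sigma>" "t0 * \<sigma> < t0" if "0 < \<sigma>" "\<sigma> < 1" for \<sigma>
    using that t0 by auto
  have G: "G s holomorphic_on Sec" and G': "\<And>\<tau>. \<tau> \<in> Sec \<Longrightarrow> deriv (G s) \<tau> = deriv (deriv (heat \<tau> (odd_ext (f (of_real s))))) z"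
    and Gb: "\<And>\<tau>. \<tau> \<in> Sec \<Longrightarrow> Re \<tau> \<le> T \<Longrightarrow> norm (deriv (G s) \<tau>) \<le> C" if s: "0 < s" "s < T" for s
  proof -
    have st: "of_real s \<in> St T" using s by simp
    have e: "exp_decay (B * T ^ n) (odd_ext (f (of_real s)))" by (rule duh_class_exp_decay[OF ctx st])
    show "G s holomorphic_on Sec" using heat_sep_hol_const[OF e] unfolding sep_hol_def G_def by auto
    show d: "deriv (G s) \<tau> = deriv (deriv (heat \<tau> (odd_ext (f (of_real s))))) z" if "\<tau> \<in> Sec" for \<tau>
      unfolding G_def by (rule heat_equation[OF e that])
    show "norm (deriv (G s) \<tau>) \<le> C" if \<tau>: "\<tau> \<in> Sec" "Re \<tau> \<le> T" for \<tau>
      unfolding d[OF \<tau>(1)] C_def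
    proof (rule deriv_deriv_bound_ball[OF _ r(1)])
      have "heat \<tau> (odd_ext (f (of_real s))) holomorphic_on UNIV" using heat_sep_hol_const[OF e] \<tau> unfolding sep_hol_def by auto
      then show "heat \<tau> (odd_ext (f (of_real s))) holomorphic_on ball z r" by (rule holomorphic_on_subset) auto
      fix w assume "w \<in> ball z r"
      then have w: "w \<in> Cone" using r by auto
      have "norm (heat \<tau> (odd_ext (f (of_real s))) w) \<le> 3 * exp (4 * Re \<tau>) * (B * T ^ n) * exp (- Re w)"
        by (rule norm_heat_odd_ext_le[OF duh_class_holomorphic(1)[OF ctx st] duh_class_bound_uniform[OF ctx st] \<tau>(1) w])
      also have "\<dots> \<le> 3 * exp (4 * T) * (B * T ^ n) * 1"
        using \<tau> w duh_class_nonneg[OF ctx] T by (intro mult_mono) (auto simp: Cone_def)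
      finally show "norm (heat \<tau> (odd_ext (f (of_real s))) w) \<le> K" by (simp add: K_def)
    qed
  qed
  have QG: "Q s0 s = G s (of_real (\<epsilon> * (s0 - s)))" for s0 s by (simp add: Q_def G_def)
  have "A \<longlonglongrightarrow> (\<integral>\<sigma>. of_real t0 * (of_real \<epsilon> * D \<sigma>) \<partial>U01)"
    unfolding A_def
  proof (rule integral_dominated_convergence[where w = "\<lambda>_. t0 * (\<epsilon> * C)"])
    show "integrable U01 (\<lambda>_. t0 * (\<epsilon> * C))" by (rule finite_measure.integrable_const[OF finite_measure_U01])
    have "integrable U01 (\<lambda>\<sigma>. of_real t0 * D \<sigma>)" unfolding D_def by (rule duh_holomorphic(3)[OF ctx t0St z])
    then have "(\<lambda>\<sigma>. of_real \<epsilon> * (of_real t0 * D \<sigma>)) \<in> borel_measurable U01"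
      by (intro borel_measurable_times borel_measurable_const borel_measurable_integrable)
    then show "(\<lambda>\<sigma>. of_real t0 * (of_real \<epsilon> * D \<sigma>)) \<in> borel_measurable U01" by (simp only: mult.left_commute)
    show "(\<lambda>\<sigma>. of_real t0 * ((Q (t0 + h k) (t0 * \<sigma>) - Q t0 (t0 * \<sigma>)) / of_real (h k))) \<in> borel_measurable U01" for k
      using i1[of k] i3 by (intro borel_measurable_times borel_measurable_const borel_measurable_divide borel_measurable_diff borel_measurable_integrable)
    show "AE \<sigma> in U01. (\<lambda>k. of_real t0 * ((Q (t0 + h k) (t0 * \<sigma>) - Q t0 (t0 * \<sigma>)) / of_real (h k))) \<longlonglongrightarrow> of_real t0 * (of_real \<epsilon> * D \<sigma>)"
    proof (rule AE_I2)
      fix \<sigma> assume "\<sigma> \<in> space U01"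
      then have \<sigma>: "0 < \<sigma>" "\<sigma> < 1" by auto
      define a where "a = \<epsilon> * (t0 - t0 * \<sigma>)"
      have a: "0 < a" using \<epsilon> \<sigma>0[OF \<sigma>] by (simp add: a_def)
      have s: "0 < t0 * \<sigma>" "t0 * \<sigma> < T" using \<sigma>0[OF \<sigma>] t0 by linarith+
      have aS: "of_real a \<in> Sec" using a by simp
      have "(G (t0 * \<sigma>) has_field_derivative deriv (G (t0 * \<sigma>)) (of_real a)) (at (of_real a))"
        by (rule holomorphic_derivI[OF G[OF s] open_Sec]) (use a in simp)
      moreover have "deriv (G (t0 * \<sigma>)) (of_real a) = D \<sigma>"
        using G'[OF s aS] unfolding D_def duh_kernel_def[abs_def] a_def by (simp add: algebra_simps)
      ultimately have der: "(G (t0 * \<sigma>) has_field_derivative D \<sigma>) (at (of_real a))" by simp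
      have "(\<lambda>k. of_real (\<epsilon> * h k) :: complex) \<longlonglongrightarrow> of_real (\<epsilon> * 0)" by (intro tendsto_intros h)
      then have l: "(\<lambda>k. of_real (\<epsilon> * h k) :: complex) \<longlonglongrightarrow> 0" by simp
      have "of_real (\<epsilon> * h k) \<noteq> (0::complex)" for k using \<epsilon> h(1)[of k] by simp
      note q = quotient_tendsto[OF der l this]
      have "(G (t0 * \<sigma>) (of_real a + of_real (\<epsilon> * h k)) - G (t0 * \<sigma>) (of_real a)) / of_real (\<epsilon> * h k)
         = (Q (t0 + h k) (t0 * \<sigma>) - Q t0 (t0 * \<sigma>)) / of_real (h k) / of_real \<epsilon>" for k
      proof -
        have "of_real a + of_real (\<epsilon> * h k) = complex_of_real (\<epsilon> * (t0 + h k - t0 * \<sigma>))" by (simp add: a_def algebra_simps)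
        then show ?thesis by (simp add: QG a_def)
      qed
      then have "(\<lambda>k. (Q (t0 + h k) (t0 * \<sigma>) - Q t0 (t0 * \<sigma>)) / of_real (h k) / of_real \<epsilon>) \<longlonglongrightarrow> D \<sigma>" using q by simp
      from tendsto_mult[OF tendsto_const[of "of_real \<epsilon>"] this] \<epsilon>(1)
      have "(\<lambda>k. (Q (t0 + h k) (t0 * \<sigma>) - Q t0 (t0 * \<sigma>)) / of_real (h k)) \<longlonglongrightarrow> of_real \<epsilon> * D \<sigma>" by simp
      then show "(\<lambda>k. of_real t0 * ((Q (t0 + h k) (t0 * \<sigma>) - Q t0 (t0 * \<sigma>)) / of_real (h k))) \<longlonglongrightarrow> of_real t0 * (of_real \<epsilon> * D \<sigma>)"
        by (intro tendsto_intros)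
    qed
    show "AE \<sigma> in U01. norm (of_real t0 * ((Q (t0 + h k) (t0 * \<sigma>) - Q t0 (t0 * \<sigma>)) / of_real (h k))) \<le> t0 * (\<epsilon> * C)" for k
    proof (rule AE_I2)
      fix \<sigma> assume "\<sigma> \<in> space U01"
      then have \<sigma>: "0 < \<sigma>" "\<sigma> < 1" by auto
      have s: "0 < t0 * \<sigma>" "t0 * \<sigma> < T" using \<sigma>0[OF \<sigma>] t0 by linarith+
      define a b where "a = \<epsilon> * (t0 - t0 * \<sigma>)" and "b = \<epsilon> * (t0 + h k - t0 * \<sigma>)"
      have ab: "0 < a" "a \<le> b" using \<epsilon> \<sigma>0[OF \<sigma>] h(1)[of k] by (auto simp: a_def b_def)
      have "b \<le> 1 * (t0 + h k - t0 * \<sigma>)" unfolding b_def using \<epsilon> \<sigma>0[OF \<sigma>] h(1)[of k] by (intro mult_right_mono) auto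
      then have "b \<le> t0 + h k - t0 * \<sigma>" by (simp only: mult_1)
      also have "\<dots> \<le> t0 + h k" using s(1) by simp
      also have "\<dots> \<le> T" using h(2)[of k] by simp
      finally have bT: "b \<le> T" .
      \<comment> \<open>By the heat equation \<open>C\<close> also bounds the derivative in \<tau>,
        so the mean value inequality between the heat times a and b dominates the quotient uniformly
        in \<sigma> and k.\<close>
      have "norm (G (t0 * \<sigma>) (of_real b) - G (t0 * \<sigma>) (of_real a)) \<le> C * norm (complex_of_real b - of_real a)"
      proof (rule field_differentiable_bound[OF _ _ _ , of "of_real ` {a..b}" _ "deriv (G (t0 * \<sigma>))"])
        show "convex (of_real ` {a..b} :: complex set)"
          by (intro convex_linear_image convex_real_interval linear_of_real bounded_linear.linear[OF bounded_linear_of_real])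
        fix \<tau> assume "\<tau> \<in> (of_real ` {a..b} :: complex set)"
        then have \<tau>: "\<tau> \<in> Sec" "Re \<tau> \<le> T" using ab bT by auto
        show "(G (t0 * \<sigma>) has_field_derivative deriv (G (t0 * \<sigma>)) \<tau>) (at \<tau> within of_real ` {a..b})"
          by (rule has_field_derivative_at_within, rule holomorphic_derivI[OF G[OF s] open_Sec \<tau>(1)])
        show "norm (deriv (G (t0 * \<sigma>)) \<tau>) \<le> C" by (rule Gb[OF s \<tau>])
      qed (use ab in auto)
      also have "norm (complex_of_real b - of_real a) = \<epsilon> * h k"
        using \<epsilon> h(1)[of k] unfolding a_def b_def of_real_diff[symmetric] norm_of_real by (simp add: algebra_simps)
      finally have "norm (Q (t0 + h k) (t0 * \<sigma>) - Q t0 (t0 * \<sigma>)) \<le> \<epsilon> * C * h k"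
        by (simp add: QG a_def b_def mult_ac)
      then have "norm ((Q (t0 + h k) (t0 * \<sigma>) - Q t0 (t0 * \<sigma>)) / of_real (h k)) \<le> \<epsilon> * C"
        using h(1)[of k] by (simp add: norm_divide pos_divide_le_eq)
      then show "norm (of_real t0 * ((Q (t0 + h k) (t0 * \<sigma>) - Q t0 (t0 * \<sigma>)) / of_real (h k))) \<le> t0 * (\<epsilon> * C)"
        unfolding norm_mult using t0 by (intro mult_mono) auto
    qed
  qed
  also have "(\<integral>\<sigma>. of_real t0 * (of_real \<epsilon> * D \<sigma>) \<partial>U01) = of_real \<epsilon> * deriv (deriv (duh \<epsilon> f (of_real t0))) z"
    unfolding duh_holomorphic(2)[OF ctx t0St z] D_def by (simp add: mult.left_commute)
  finally have A: "A \<longlonglongrightarrow> of_real \<epsilon> * deriv (deriv (duh \<epsilon> f (of_real t0))) z" .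
  have "R \<longlonglongrightarrow> (\<integral>\<sigma>. f (of_real t0) z \<partial>U01)"
    unfolding R_def
  proof (rule integral_dominated_convergence[where w = "\<lambda>_. B * T ^ n"])
    show "integrable U01 (\<lambda>_. B * T ^ n)" by (rule finite_measure.integrable_const[OF finite_measure_U01])
    show "(\<lambda>\<sigma>. Q (t0 + h k) (t0 + h k * \<sigma>)) \<in> borel_measurable U01" for k
      using i2[of k] by (rule borel_measurable_integrable)
    have hs: "0 < h k * \<sigma>" "h k * \<sigma> < h k" "t0 + h k * \<sigma> < T" if "0 < \<sigma>" "\<sigma> < 1" for k \<sigma>
    proof -
      show 1: "0 < h k * \<sigma>" "h k * \<sigma> < h k" using h(1)[of k] that by auto
      show "t0 + h k * \<sigma> < T" using 1 h(2)[of k] by linarith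
    qed
    show "AE \<sigma> in U01. norm (Q (t0 + h k) (t0 + h k * \<sigma>)) \<le> B * T ^ n" for k
      using hs t0 by (intro AE_I2 bdQ) (auto intro: add_pos_pos)
    show "AE \<sigma> in U01. (\<lambda>k. Q (t0 + h k) (t0 + h k * \<sigma>)) \<longlonglongrightarrow> f (of_real t0) z"
    proof (rule AE_I2)
      fix \<sigma> assume "\<sigma> \<in> space U01"
      then have \<sigma>: "0 < \<sigma>" "\<sigma> < 1" by auto
      define s where "s k = t0 + h k * \<sigma>" for k
      have s: "of_real (s k) \<in> St T" for k unfolding of_real_St using hs[OF \<sigma>, of k] t0 by (auto simp: s_def)
      have sl: "s \<longlonglongrightarrow> t0" unfolding s_def by (rule tendsto_eq_intros h refl | simp)+
      have e: "exp_decay (B * T ^ n) (odd_ext (f (of_real (s k))))" for k by (rule duh_class_exp_decay[OF ctx s])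
      have "(\<lambda>k. heat (of_real (\<epsilon> * (h k - h k * \<sigma>))) (odd_ext (f (of_real (s k)))) (of_real z0)) \<longlonglongrightarrow> f (of_real t0) z"
      proof (rule heat_tendsto_initial[OF _ _ tendsto_const z0])
        show "0 < \<epsilon> * (h k - h k * \<sigma>)" for k using hs[OF \<sigma>, of k] \<epsilon> by simp
        show "(\<lambda>k. \<epsilon> * (h k - h k * \<sigma>)) \<longlonglongrightarrow> 0" by (rule tendsto_eq_intros h refl | simp)+
        show "odd_ext (f (of_real (s k))) \<in> borel_measurable borel" for k using e[of k] by (simp add: exp_decay_def)
        show "norm (odd_ext (f (of_real (s k))) y) \<le> B * T ^ n" for k y
        proof -
          have "norm (odd_ext (f (of_real (s k))) y) \<le> B * T ^ n * exp (- \<bar>y\<bar>)" using e[of k] by (simp add: exp_decay_def)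
          also have "\<dots> \<le> B * T ^ n * 1" using exp_decay_nonneg[OF e[of k]] by (intro mult_left_mono) auto
          finally show ?thesis by simp
        qed
        fix y assume y: "\<And>k. 0 < y k" "y \<longlonglongrightarrow> z0"
        have c: "continuous_on (St T \<times> Cone) (\<lambda>p. f (fst p) (snd p))"
          by (rule sep_hol_continuous_on[OF _ open_St open_Cone]) (use f in \<open>simp add: duh_class_def\<close>)
        have l: "(\<lambda>k. (complex_of_real (s k), complex_of_real (y k))) \<longlonglongrightarrow> (of_real t0, of_real z0)"
          by (intro tendsto_intros sl y(2))
        show "(\<lambda>k. f (of_real (s k)) (of_real (y k))) \<longlonglongrightarrow> f (of_real t0) z"
          using continuous_on_tendsto_compose[OF c l] s y(1) t0 z0 by (simp add: z_def)
      qed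
      then show "(\<lambda>k. Q (t0 + h k) (t0 + h k * \<sigma>)) \<longlonglongrightarrow> f (of_real t0) z"
        by (simp add: Q_def s_def z_def add_diff_add)
    qed
  qed simp
  then have R: "R \<longlonglongrightarrow> f (of_real t0) z" by (simp only: integral_const_U01)
  have "((\<lambda>t. duh \<epsilon> f t z) has_field_derivative deriv (\<lambda>t. duh \<epsilon> f t z) (of_real t0)) (at (of_real t0))"
    by (rule holomorphic_derivI[OF duh_holomorphic(4)[OF ctx z] open_St t0St])
  moreover have "(\<lambda>k. complex_of_real (h k)) \<longlonglongrightarrow> 0" using tendsto_of_real[OF h(3)] by simp
  moreover have "complex_of_real (h k) \<noteq> 0" for k using h(1)[of k] by simp
  ultimately have "(\<lambda>k. (duh \<epsilon> f (of_real t0 + of_real (h k)) z - duh \<epsilon> f (of_real t0) z) / of_real (h k))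
     \<longlonglongrightarrow> deriv (\<lambda>t. duh \<epsilon> f t z) (of_real t0)"
    by (rule quotient_tendsto)
  moreover have "(\<lambda>k. (duh \<epsilon> f (of_real t0 + of_real (h k)) z - duh \<epsilon> f (of_real t0) z) / of_real (h k))
     \<longlonglongrightarrow> of_real \<epsilon> * deriv (deriv (duh \<epsilon> f (of_real t0))) z + f (of_real t0) z"
    unfolding quot by (rule tendsto_add[OF A R])
  ultimately show ?thesis unfolding z_def by (rule LIMSEQ_unique)
qed

text \<open>As \<epsilon> tends to 0 the heat flow in the kernel becomes the identity, and only the
  time integral of the limit of the sources is left. Times and points move with k for the sake of
  the induction in \<open>w_tendsto\<close> and of
  \<open>uniform_smallness_sequentially\<close>.\<close>

lemma duh_tendsto:
  fixes f :: "nat \<Rightarrow> complex \<Rightarrow> complex \<Rightarrow> complex"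
  assumes T: "0 < T" and \<epsilon>: "\<And>k. 0 < \<epsilon> k" "\<And>k. \<epsilon> k \<le> 1" "\<epsilon> \<longlonglongrightarrow> 0"
    and f: "\<And>k. duh_class T B n (f k)"
    and t: "\<And>k. 0 < t k" "\<And>k. t k < T" "t \<longlonglongrightarrow> t0" and z: "z \<longlonglongrightarrow> z0" "0 < z0"
    and lim: "\<And>\<sigma> y. 0 < \<sigma> \<Longrightarrow> \<sigma> < 1 \<Longrightarrow> (\<And>k. 0 < y k) \<Longrightarrow> y \<longlonglongrightarrow> z0 \<Longrightarrow>
        (\<lambda>k. f k (of_real (\<sigma> * t k)) (of_real (y k))) \<longlonglongrightarrow> g \<sigma>"
    and g: "g \<in> borel_measurable U01"
  shows "(\<lambda>k. duh (\<epsilon> k) (f k) (of_real (t k)) (of_real (z k))) \<longlonglongrightarrow> (\<integral>\<sigma>. of_real t0 * g \<sigma> \<partial>U01)"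
  unfolding duh_def
proof (rule integral_dominated_convergence[where w = "\<lambda>_. T * (B * T ^ n)"])
  note ctx = T \<epsilon>(1,2) f
  have tk: "of_real (t k) \<in> St T" for k using t(1,2) by simp
  show "integrable U01 (\<lambda>_. T * (B * T ^ n))" by (rule finite_measure.integrable_const[OF finite_measure_U01])
  show "(\<lambda>\<sigma>. of_real t0 * g \<sigma>) \<in> borel_measurable U01" by (intro borel_measurable_times borel_measurable_const g)
  show "(\<lambda>\<sigma>. of_real (t k) * duh_kernel (\<epsilon> k) (f k) (of_real (t k)) \<sigma> (of_real (z k))) \<in> borel_measurable U01" for k
    by (intro borel_measurable_times borel_measurable_const measurable_duh_kernel[OF ctx] tk)
  show "AE \<sigma> in U01. norm (of_real (t k) * duh_kernel (\<epsilon> k) (f k) (of_real (t k)) \<sigma> (of_real (z k))) \<le> T * (B * T ^ n)" for k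
  proof (rule AE_I2)
    fix \<sigma> assume "\<sigma> \<in> space U01"
    then have "norm (duh_kernel (\<epsilon> k) (f k) (of_real (t k)) \<sigma> (of_real (z k))) \<le> B * T ^ n"
      by (intro norm_duh_kernel_real_le[OF ctx] t) auto
    then show "norm (of_real (t k) * duh_kernel (\<epsilon> k) (f k) (of_real (t k)) \<sigma> (of_real (z k))) \<le> T * (B * T ^ n)"
      unfolding norm_mult using t(1,2)[of k] T by (intro mult_mono) auto
  qed
  show "AE \<sigma> in U01. (\<lambda>k. of_real (t k) * duh_kernel (\<epsilon> k) (f k) (of_real (t k)) \<sigma> (of_real (z k))) \<longlonglongrightarrow> of_real t0 * g \<sigma>"
  proof (rule AE_I2)
    fix \<sigma> assume "\<sigma> \<in> space U01"
    then have \<sigma>: "0 < \<sigma>" "\<sigma> < 1" by auto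
    have st: "of_real (\<sigma> * t k) \<in> St T" for k using St_scale[OF tk[of k], of \<sigma>] \<sigma> by simp
    have e: "exp_decay (B * T ^ n) (odd_ext (f k (of_real (\<sigma> * t k))))" for k by (rule duh_class_exp_decay[OF ctx st])
    have "(\<lambda>k. heat (of_real (\<epsilon> k * (1 - \<sigma>) * t k)) (odd_ext (f k (of_real (\<sigma> * t k)))) (of_real (z k))) \<longlonglongrightarrow> g \<sigma>"
    proof (rule heat_tendsto_initial[OF _ _ z])
      show "0 < \<epsilon> k * (1 - \<sigma>) * t k" for k using \<epsilon>(1)[of k] t(1)[of k] \<sigma> by simp
      have "(\<lambda>k. \<epsilon> k * (1 - \<sigma>) * t k) \<longlonglongrightarrow> 0 * (1 - \<sigma>) * t0" by (intro tendsto_intros \<epsilon>(3) t(3))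
      then show "(\<lambda>k. \<epsilon> k * (1 - \<sigma>) * t k) \<longlonglongrightarrow> 0" by simp
      show "odd_ext (f k (of_real (\<sigma> * t k))) \<in> borel_measurable borel" for k using e[of k] by (simp add: exp_decay_def)
      show "norm (odd_ext (f k (of_real (\<sigma> * t k))) y) \<le> B * T ^ n" for k y
      proof -
        have "norm (odd_ext (f k (of_real (\<sigma> * t k))) y) \<le> B * T ^ n * exp (- \<bar>y\<bar>)" using e[of k] by (simp add: exp_decay_def)
        also have "\<dots> \<le> B * T ^ n * 1" using exp_decay_nonneg[OF e[of k]] by (intro mult_left_mono) auto
        finally show ?thesis by simp
      qed
    qed (rule lim[OF \<sigma>])
    then have "(\<lambda>k. duh_kernel (\<epsilon> k) (f k) (of_real (t k)) \<sigma> (of_real (z k))) \<longlonglongrightarrow> g \<sigma>"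
      by (simp add: duh_kernel_def)
    then show "(\<lambda>k. of_real (t k) * duh_kernel (\<epsilon> k) (f k) (of_real (t k)) \<sigma> (of_real (z k))) \<longlonglongrightarrow> of_real t0 * g \<sigma>"
      by (intro tendsto_intros t(3))
  qed
qed

subsection \<open>Exact solutions with product data\<close>

lemma norm_integral_le_integral:
  fixes f :: "'a \<Rightarrow> 'b::{banach, second_countable_topology}"
  assumes "integrable M f" "integrable M g" "\<And>x. x \<in> space M \<Longrightarrow> norm (f x) \<le> g x"
  shows "norm (\<integral>x. f x \<partial>M) \<le> (\<integral>x. g x \<partial>M)"
  using integral_norm_bound[of M f] integral_mono[OF integrable_norm[OF assms(1)] assms(2,3)] by linarith

definition compact_profile :: "(real \<Rightarrow> complex) \<Rightarrow> bool" where
  "compact_profile \<psi> \<longleftrightarrow> \<psi> \<in> borel_measurable borel \<and> (\<exists>M. \<forall>y. norm (\<psi> y) \<le> M) \<and> (\<exists>Y. \<forall>y. Y < \<bar>y\<bar> \<longrightarrow> \<psi> y = 0)"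

lemma compact_profile_exp_decay:
  assumes "compact_profile \<psi>" shows "\<exists>B. exp_decay B \<psi>"
proof -
  obtain M Y where M: "\<And>y. norm (\<psi> y) \<le> M" and Y: "\<And>y. Y < \<bar>y\<bar> \<Longrightarrow> \<psi> y = 0" and m: "\<psi> \<in> borel_measurable borel"
    using assms unfolding compact_profile_def by blast
  have M0: "0 \<le> M" using M[of 0] norm_ge_zero order_trans by blast
  have "norm (\<psi> y) \<le> (M * exp Y) * exp (- \<bar>y\<bar>)" for y
  proof (cases "Y < \<bar>y\<bar>")
    case False
    then have "1 \<le> exp Y * exp (- \<bar>y\<bar>)" by (simp add: exp_add[symmetric])
    then have "M * 1 \<le> M * (exp Y * exp (- \<bar>y\<bar>))" using M0 by (intro mult_left_mono)
    then show ?thesis using M[of y] by (simp add: mult.assoc)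
  qed (use Y M0 in auto)
  then show ?thesis using m unfolding exp_decay_def by blast
qed

text \<open>The region unites a double cone, needed for z, and a strip of any height, needed for
  Cauchy's estimate in x. For y in the support of the profile, z - y lies in a region of the same
  shape, and there the Gaussian beats exp (- |Re z|). The constant blows up as the lower bound a on
  Re \<tau> tends to 0.\<close>

lemma norm_heat_compact_le:
  assumes \<psi>: "compact_profile \<psi>" and a: "0 < a" "a \<le> A" and R: "0 \<le> R"
  shows "\<exists>C\<ge>0. \<forall>\<tau>\<in>Sec. \<forall>z. a \<le> Re \<tau> \<longrightarrow> Re \<tau> \<le> A \<longrightarrow> \<bar>Im z\<bar> \<le> \<bar>Re z\<bar> / 8 + R \<longrightarrow>
           norm (heat \<tau> \<psi> z) \<le> C * exp (- \<bar>Re z\<bar>)"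
proof -
  obtain M Y0 where M: "\<And>y. norm (\<psi> y) \<le> M" and Y0: "\<And>y. Y0 < \<bar>y\<bar> \<Longrightarrow> \<psi> y = 0" and m: "\<psi> \<in> borel_measurable borel"
    using \<psi> unfolding compact_profile_def by blast
  define Y where "Y = max 0 Y0"
  have Y: "0 \<le> Y" "\<And>y. Y < \<bar>y\<bar> \<Longrightarrow> \<psi> y = 0" using Y0 by (auto simp: Y_def)
  have M0: "0 \<le> M" using M[of 0] norm_ge_zero order_trans by blast
  \<comment> \<open>Shifting by y with |y| <= Y changes Re z by at most Y, hence the allowed height
    by at most Y / 8.\<close>
  define R' where "R' = Y / 8 + R"
  have R': "0 \<le> R'" using Y R by (simp add: R'_def)
  define C1 where "C1 = exp (5 * R'\<^sup>2 / (2 * a) + 4 * A + Y) / sqrt (4 * pi * a)"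
  have C1: "0 \<le> C1" using a by (simp add: C1_def)
  have ker: "norm (hk \<tau> (z - of_real y)) \<le> C1 * exp (- \<bar>Re z\<bar>)"
    if \<tau>: "\<tau> \<in> Sec" "a \<le> Re \<tau>" "Re \<tau> \<le> A" and z: "\<bar>Im z\<bar> \<le> \<bar>Re z\<bar> / 8 + R" and y: "\<bar>y\<bar> \<le> Y" for \<tau> z y
  proof -
    define X where "X = z - of_real y"
    define \<xi> \<upsilon> where "\<xi> = \<bar>Re X\<bar>" and "\<upsilon> = \<bar>Im X\<bar>"
    have \<xi>: "0 \<le> \<xi>" "\<bar>Re z\<bar> \<le> \<xi> + Y" using y by (auto simp: \<xi>_def X_def)
    have \<upsilon>: "0 \<le> \<upsilon>" "\<upsilon> \<le> \<xi> / 8 + R'" using z \<xi>(2) by (auto simp: \<upsilon>_def X_def R'_def)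
    define p where "p = Re \<tau> / (cmod \<tau>)\<^sup>2"
    have p: "0 < p" "p \<le> 1 / Re \<tau>" "1 / (2 * Re \<tau>) \<le> p" using Re_inverse_Sec[OF \<tau>(1)] by (auto simp: p_def)
    have pa: "p \<le> 1 / a" using p(2) a(1) \<tau>(2) by (meson frac_le order_refl order_trans zero_le_one)
    have pA: "1 / (2 * A) \<le> p" using p(3) a(1) \<tau>(2,3) by (smt (verit) frac_le)
    have q: "\<xi>\<^sup>2 / 2 - 10 * R'\<^sup>2 \<le> (Re X)\<^sup>2 - (Im X)\<^sup>2 - 2 * \<bar>Re X\<bar> * \<bar>Im X\<bar>"
    proof -
      have "\<upsilon>\<^sup>2 \<le> (\<xi> / 8 + R')\<^sup>2" using \<upsilon> by (intro power_mono) auto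
      then have 1: "\<upsilon>\<^sup>2 \<le> \<xi>\<^sup>2 / 64 + R'\<^sup>2 + \<xi> * R' / 4" by (simp add: power2_sum power_divide)
      have "\<xi> * \<upsilon> \<le> \<xi> * (\<xi> / 8 + R')" using \<upsilon> \<xi> by (intro mult_left_mono) auto
      then have 2: "\<xi> * \<upsilon> \<le> \<xi>\<^sup>2 / 8 + \<xi> * R'" by (simp add: power2_eq_square algebra_simps)
      have "0 \<le> (\<xi> / 8 - R')\<^sup>2" by simp
      then have 3: "\<xi> * R' / 4 \<le> \<xi>\<^sup>2 / 64 + R'\<^sup>2" by (simp add: power2_diff power_divide)
      have 4: "0 \<le> \<xi>\<^sup>2" by simp
      have 5: "(Re X)\<^sup>2 = \<xi>\<^sup>2" "(Im X)\<^sup>2 = \<upsilon>\<^sup>2" "2 * \<bar>Re X\<bar> * \<bar>Im X\<bar> = 2 * (\<xi> * \<upsilon>)" by (simp_all add: \<xi>_def \<upsilon>_def)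
      show ?thesis unfolding 5 using 1 2 3 4 by linarith
    qed
    have "p * (\<xi>\<^sup>2 / 2 - 10 * R'\<^sup>2) \<le> Re (X\<^sup>2 / \<tau>)"
      using Re_square_div_ge[OF \<tau>(1), of X] mult_left_mono[OF q less_imp_le[OF p(1)]] unfolding p_def[symmetric] by linarith
    moreover have "p * \<xi>\<^sup>2 \<ge> 1 / (2 * A) * \<xi>\<^sup>2" using pA by (intro mult_right_mono) auto
    moreover have "p * R'\<^sup>2 \<le> 1 / a * R'\<^sup>2" using pa by (intro mult_right_mono) auto
    ultimately have "- Re (X\<^sup>2 / \<tau>) / 4 \<le> - \<xi>\<^sup>2 / (16 * A) + 5 * R'\<^sup>2 / (2 * a)"
      by (simp add: field_simps)
    \<comment> \<open>The right-hand side is the tangent of slope -1 to this parabola; it touches at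
      \<xi> = 8 A and has intercept 4 A.\<close>
    moreover have "- \<xi>\<^sup>2 / (16 * A) \<le> - \<xi> + 4 * A"
    proof -
      have "0 \<le> (\<xi> - 8 * A)\<^sup>2" by simp
      then have "16 * A * \<xi> - 64 * A\<^sup>2 \<le> \<xi>\<^sup>2" by (simp add: power2_eq_square algebra_simps)
      then show ?thesis using a by (simp add: field_simps power2_eq_square)
    qed
    ultimately have e: "- Re (X\<^sup>2 / \<tau>) / 4 \<le> (5 * R'\<^sup>2 / (2 * a) + 4 * A + Y) + (- \<bar>Re z\<bar>)" using \<xi> by linarith
    have "sqrt (4 * pi * a) \<le> sqrt (4 * pi * norm \<tau>)"
      using \<tau> complex_Re_le_cmod[of \<tau>] by (intro real_sqrt_le_mono mult_left_mono) auto
    then have "norm (hk \<tau> X) \<le> exp ((5 * R'\<^sup>2 / (2 * a) + 4 * A + Y) + (- \<bar>Re z\<bar>)) / sqrt (4 * pi * a)"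
      unfolding norm_hk using e a by (intro frac_le) auto
    also have "\<dots> = C1 * exp (- \<bar>Re z\<bar>)" by (simp only: C1_def exp_add times_divide_eq_left)
    finally show ?thesis by (simp add: X_def)
  qed
  obtain B where B: "exp_decay B \<psi>" using compact_profile_exp_decay[OF \<psi>] by blast
  have "norm (heat \<tau> \<psi> z) \<le> (2 * Y * M * C1) * exp (- \<bar>Re z\<bar>)"
    if \<tau>: "\<tau> \<in> Sec" "a \<le> Re \<tau>" "Re \<tau> \<le> A" and z: "\<bar>Im z\<bar> \<le> \<bar>Re z\<bar> / 8 + R" for \<tau> z
  proof -
    have "integrable lborel (indicator {-Y..Y} :: real \<Rightarrow> real)"
      by (rule integrable_real_indicator) (auto simp: emeasure_lborel_Icc_eq)
    then have i: "integrable lborel (\<lambda>y. C1 * exp (- \<bar>Re z\<bar>) * M * indicator {-Y..Y} y)"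
      by (rule integrable_mult_right)
    have "norm (heat \<tau> \<psi> z) \<le> (\<integral>y. C1 * exp (- \<bar>Re z\<bar>) * M * indicator {-Y..Y} y \<partial>lborel)"
      unfolding heat_def
    proof (rule Bochner_Integration.integral_norm_bound_integral[OF exp_decay_integrable_hk[OF B \<tau>(1)] i])
      fix y
      show "norm (hk \<tau> (z - of_real y) * \<psi> y) \<le> C1 * exp (- \<bar>Re z\<bar>) * M * indicator {-Y..Y} y"
      proof (cases "\<bar>y\<bar> \<le> Y")
        case True
        then have "norm (hk \<tau> (z - of_real y) * \<psi> y) \<le> (C1 * exp (- \<bar>Re z\<bar>)) * M"
          unfolding norm_mult using ker[OF \<tau> z True] M C1 by (intro mult_mono) auto
        then show ?thesis using True by (auto simp: indicator_def)
      qed (use Y(2) in \<open>auto simp: indicator_def\<close>)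
    qed
    also have "\<dots> = (2 * Y * M * C1) * exp (- \<bar>Re z\<bar>)" using Y(1) by simp
    finally show ?thesis .
  qed
  then show ?thesis using Y(1) M0 C1 by (intro exI[of _ "2 * Y * M * C1"]) auto
qed

section \<open>x-derivatives of the heat flow\<close>

definition heat_dx :: "(real \<Rightarrow> complex) \<Rightarrow> nat \<Rightarrow> complex \<Rightarrow> complex \<Rightarrow> complex" where
  "heat_dx \<psi> n \<tau> = (deriv ^^ n) (heat \<tau> \<psi>)"

lemma heat_dx_sep_hol:
  assumes "exp_decay B \<psi>" shows "sep_hol Sec UNIV (heat_dx \<psi> n)"
proof (induction n)
  case 0 then show ?case using heat_sep_hol_const[OF assms] by (simp add: heat_dx_def)
next
  case (Suc n)
  from sep_hol_deriv[OF this open_Sec open_UNIV] show ?case by (simp add: heat_dx_def)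
qed

lemma heat_dx_deriv_x: "deriv (heat_dx \<psi> n \<tau>) = heat_dx \<psi> (Suc n) \<tau>"
  by (simp add: heat_dx_def)

text \<open>Induction on n; \<open>sep_hol_deriv_commute\<close> moves the time derivative past one
  more x-derivative.\<close>

lemma heat_dx_deriv_time:
  assumes \<psi>: "exp_decay B \<psi>" and \<tau>: "\<tau> \<in> Sec"
  shows "deriv (\<lambda>\<tau>. heat_dx \<psi> n \<tau> x) \<tau> = heat_dx \<psi> (Suc (Suc n)) \<tau> x"
proof (induction n arbitrary: x)
  case 0 then show ?case using heat_equation[OF \<psi> \<tau>] by (simp add: heat_dx_def)
next
  case (Suc n)
  have "deriv (\<lambda>\<tau>. heat_dx \<psi> (Suc n) \<tau> x) \<tau> = deriv (\<lambda>\<tau>. deriv (heat_dx \<psi> n \<tau>) x) \<tau>" by (simp add: heat_dx_deriv_x)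
  also have "\<dots> = deriv (\<lambda>y. deriv (\<lambda>\<tau>. heat_dx \<psi> n \<tau> y) \<tau>) x"
    by (rule sep_hol_deriv_commute[OF heat_dx_sep_hol[OF \<psi>] open_Sec open_UNIV \<tau>]) simp
  also have "\<dots> = deriv (heat_dx \<psi> (Suc (Suc n)) \<tau>) x" using Suc by simp
  finally show ?case by (simp add: heat_dx_deriv_x)
qed

text \<open>The heat flow of a compactly supported profile is entire with bounds on every strip, so
  Cauchy's inequality may be used with any radius r; the constant C depends on r but not on n.
  Moving along the circle costs the factor exp r in the exponential decay.\<close>

lemma norm_heat_dx_le:
  assumes \<psi>: "compact_profile \<psi>" and a: "0 < a" "a \<le> A" and R: "0 \<le> R" and r: "0 < r"
  shows "\<exists>C\<ge>0. \<forall>n. \<forall>\<tau>\<in>Sec. \<forall>x. a \<le> Re \<tau> \<longrightarrow> Re \<tau> \<le> A \<longrightarrow> \<bar>Im x\<bar> \<le> R \<longrightarrow>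
           norm (heat_dx \<psi> n \<tau> x) \<le> C * fact n / r ^ n * exp (- \<bar>Re x\<bar>)"
proof -
  obtain C where C: "C \<ge> 0" "\<forall>\<tau>\<in>Sec. \<forall>z. a \<le> Re \<tau> \<longrightarrow> Re \<tau> \<le> A \<longrightarrow> \<bar>Im z\<bar> \<le> \<bar>Re z\<bar> / 8 + (R + r) \<longrightarrow>
           norm (heat \<tau> \<psi> z) \<le> C * exp (- \<bar>Re z\<bar>)"
    using norm_heat_compact_le[OF \<psi> a, of "R + r"] R r by auto
  obtain B where B: "exp_decay B \<psi>" using compact_profile_exp_decay[OF \<psi>] by blast
  have "norm (heat_dx \<psi> n \<tau> x) \<le> (C * exp r) * fact n / r ^ n * exp (- \<bar>Re x\<bar>)"
    if \<tau>: "\<tau> \<in> Sec" "a \<le> Re \<tau>" "Re \<tau> \<le> A" and x: "\<bar>Im x\<bar> \<le> R" for n \<tau> x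
  proof -
    have h: "heat \<tau> \<psi> holomorphic_on UNIV" using heat_sep_hol_const[OF B] \<tau>(1) by (auto simp: sep_hol_def)
    have "norm ((deriv ^^ n) (heat \<tau> \<psi>) x) \<le> fact n * (C * exp r * exp (- \<bar>Re x\<bar>)) / r ^ n"
    proof (rule Cauchy_inequality[OF _ _ r])
      show "heat \<tau> \<psi> holomorphic_on ball x r" by (rule holomorphic_on_subset[OF h]) auto
      show "continuous_on (cball x r) (heat \<tau> \<psi>)"
        by (rule continuous_on_subset[OF holomorphic_on_imp_continuous_on[OF h]]) auto
      fix w assume w: "norm (x - w) = r"
      have im: "\<bar>Im w\<bar> \<le> R + r" using abs_Im_le_cmod[of "x - w"] w x by auto
      have re: "\<bar>Re x\<bar> \<le> \<bar>Re w\<bar> + r" using abs_Re_le_cmod[of "x - w"] w by auto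
      have "norm (heat \<tau> \<psi> w) \<le> C * exp (- \<bar>Re w\<bar>)" using C(2) \<tau> im by (smt (verit) divide_nonneg_pos)
      also have "\<dots> \<le> C * exp (r + - \<bar>Re x\<bar>)" using re C(1) by (intro mult_left_mono) auto
      finally show "norm (heat \<tau> \<psi> w) \<le> C * exp r * exp (- \<bar>Re x\<bar>)" by (simp only: exp_add mult.assoc)
    qed
    then show ?thesis by (simp add: heat_dx_def mult_ac)
  qed
  then show ?thesis using C(1) by (intro exI[of _ "C * exp r"]) auto
qed

section \<open>The series solution for one product datum\<close>

lemma DERIV_affine_time:
  assumes "sep_hol Sec UNIV P" "of_real a + of_real \<epsilon> * t \<in> Sec"
  shows "((\<lambda>t. P (of_real a + of_real \<epsilon> * t) x) has_field_derivative of_real \<epsilon> * deriv (\<lambda>\<tau>. P \<tau> x) (of_real a + of_real \<epsilon> * t)) (at t)"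
proof -
  have "(\<lambda>\<tau>. P \<tau> x) holomorphic_on Sec" using assms(1) by (auto simp: sep_hol_def)
  then have "((\<lambda>\<tau>. P \<tau> x) has_field_derivative deriv (\<lambda>\<tau>. P \<tau> x) (of_real a + of_real \<epsilon> * t)) (at (of_real a + of_real \<epsilon> * t))"
    by (rule holomorphic_derivI[OF _ open_Sec assms(2)])
  then have "((\<lambda>t. P (of_real a + of_real \<epsilon> * t) x) has_field_derivative deriv (\<lambda>\<tau>. P \<tau> x) (of_real a + of_real \<epsilon> * t) * of_real \<epsilon>) (at t)"
    by (rule DERIV_chain2[where g = "\<lambda>t. of_real a + of_real \<epsilon> * t"]) (auto intro!: derivative_eq_intros)
  then show ?thesis by (simp add: mult.commute)
qed

lemma time_shift_Sec:
  assumes "0 < a" "0 < \<epsilon>" "\<epsilon> \<le> 1" "t \<in> St T"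
  shows "of_real a + of_real \<epsilon> * t \<in> Sec" "a \<le> Re (of_real a + of_real \<epsilon> * t)" "Re (of_real a + of_real \<epsilon> * t) \<le> a + T"
proof -
  have "\<epsilon> * Re t \<le> 1 * T" using assms by (intro mult_mono) (auto simp: St_def)
  then show "Re (of_real a + of_real \<epsilon> * t) \<le> a + T" by simp
  show "of_real a + of_real \<epsilon> * t \<in> Sec"
    by (intro Sec_add Sec_scale[OF St_Sec[OF assms(4)] assms(2)]) (use assms in simp)
  show "a \<le> Re (of_real a + of_real \<epsilon> * t)" using assms by (simp add: St_def)
qed

text \<open>\<open>\<psi>u\<close> generates the velocity, \<open>\<psi>q\<close> the z-factor and
  \<open>\<psi>f\<close> the x-factor of one product datum; each is run through the heat flow for
  the time a. Oddness of the first two encodes the no-slip condition.\<close>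

locale model =
  fixes T a :: real and \<psi>u \<psi>q \<psi>f :: "real \<Rightarrow> complex"
  assumes T: "0 < T" and a: "0 < a"
    and cu: "compact_profile \<psi>u" and cq: "compact_profile \<psi>q" and cf: "compact_profile \<psi>f"
    and ou: "\<And>y. \<psi>u (- y) = - \<psi>u y" and oq: "\<And>y. \<psi>q (- y) = - \<psi>q y"
begin

definition u where "u \<epsilon> t z = heat (of_real a + of_real \<epsilon> * t) \<psi>u z"

primrec w where
  "w \<epsilon> 0 = (\<lambda>t z. heat (of_real a + of_real \<epsilon> * t) \<psi>q z)"
| "w \<epsilon> (Suc n) = duh \<epsilon> (\<lambda>t z. - u \<epsilon> t z * w \<epsilon> n t z)"

text \<open>Chosen once for all \<epsilon>: the Cauchy radius \<open>r\<close> is built from this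
  constant, and uniform estimates as \<epsilon> tends to 0 require it to be fixed
  beforehand.\<close>

definition M where "M = (SOME M. 0 \<le> M \<and> (\<forall>\<tau>\<in>Sec. \<forall>z. a \<le> Re \<tau> \<longrightarrow> Re \<tau> \<le> a + T \<longrightarrow> \<bar>Im z\<bar> \<le> \<bar>Re z\<bar> / 8 \<longrightarrow>
           norm (heat \<tau> \<psi>u z) \<le> M * exp (- \<bar>Re z\<bar>)))"
definition B0 where "B0 = (SOME M. 0 \<le> M \<and> (\<forall>\<tau>\<in>Sec. \<forall>z. a \<le> Re \<tau> \<longrightarrow> Re \<tau> \<le> a + T \<longrightarrow> \<bar>Im z\<bar> \<le> \<bar>Re z\<bar> / 8 \<longrightarrow>
           norm (heat \<tau> \<psi>q z) \<le> M * exp (- \<bar>Re z\<bar>)))"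

lemma M: "0 \<le> M" "\<And>\<tau> z. \<tau> \<in> Sec \<Longrightarrow> a \<le> Re \<tau> \<Longrightarrow> Re \<tau> \<le> a + T \<Longrightarrow> \<bar>Im z\<bar> \<le> \<bar>Re z\<bar> / 8 \<Longrightarrow> norm (heat \<tau> \<psi>u z) \<le> M * exp (- \<bar>Re z\<bar>)"
proof -
  have "\<exists>M. 0 \<le> M \<and> (\<forall>\<tau>\<in>Sec. \<forall>z. a \<le> Re \<tau> \<longrightarrow> Re \<tau> \<le> a + T \<longrightarrow> \<bar>Im z\<bar> \<le> \<bar>Re z\<bar> / 8 \<longrightarrow>
           norm (heat \<tau> \<psi>u z) \<le> M * exp (- \<bar>Re z\<bar>))"
    using norm_heat_compact_le[OF cu a, of "a + T" 0] T by simp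
  from someI_ex[OF this, folded M_def]
  show "0 \<le> M" "\<And>\<tau> z. \<tau> \<in> Sec \<Longrightarrow> a \<le> Re \<tau> \<Longrightarrow> Re \<tau> \<le> a + T \<Longrightarrow> \<bar>Im z\<bar> \<le> \<bar>Re z\<bar> / 8 \<Longrightarrow> norm (heat \<tau> \<psi>u z) \<le> M * exp (- \<bar>Re z\<bar>)"
    by blast+
qed

lemma B0: "0 \<le> B0" "\<And>\<tau> z. \<tau> \<in> Sec \<Longrightarrow> a \<le> Re \<tau> \<Longrightarrow> Re \<tau> \<le> a + T \<Longrightarrow> \<bar>Im z\<bar> \<le> \<bar>Re z\<bar> / 8 \<Longrightarrow> norm (heat \<tau> \<psi>q z) \<le> B0 * exp (- \<bar>Re z\<bar>)"
proof -
  have "\<exists>M. 0 \<le> M \<and> (\<forall>\<tau>\<in>Sec. \<forall>z. a \<le> Re \<tau> \<longrightarrow> Re \<tau> \<le> a + T \<longrightarrow> \<bar>Im z\<bar> \<le> \<bar>Re z\<bar> / 8 \<longrightarrow>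
           norm (heat \<tau> \<psi>q z) \<le> M * exp (- \<bar>Re z\<bar>))"
    using norm_heat_compact_le[OF cq a, of "a + T" 0] T by simp
  from someI_ex[OF this, folded B0_def]
  show "0 \<le> B0" "\<And>\<tau> z. \<tau> \<in> Sec \<Longrightarrow> a \<le> Re \<tau> \<Longrightarrow> Re \<tau> \<le> a + T \<Longrightarrow> \<bar>Im z\<bar> \<le> \<bar>Re z\<bar> / 8 \<Longrightarrow> norm (heat \<tau> \<psi>q z) \<le> B0 * exp (- \<bar>Re z\<bar>)"
    by blast+
qed

text \<open>The cost of one step of the recursion for \<open>w\<close>, apart from 1 / (n + 1):
  multiplication by u costs \<open>M\<close>, Duhamel's integral costs 5 exp (4 T).\<close>

definition q where "q = 5 * exp (4 * T) * M"
text \<open>The Cauchy radius in x. It exceeds 2 q T, so that the series is dominated by a geometric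
  series of ratio 1/2; the summand 1 keeps it positive when q = 0.\<close>

definition r where "r = 2 * q * T + 1"

lemma q0: "0 \<le> q" and r0: "0 < r" and qr: "q * T / r \<le> 1 / 2"
proof -
  show q: "0 \<le> q" using M(1) by (simp add: q_def)
  then show "0 < r" using T by (simp add: r_def add_nonneg_pos)
  then show "q * T / r \<le> 1 / 2" by (simp add: divide_simps) (simp add: r_def)
qed

lemma profile_sep_hol:
  assumes \<epsilon>: "0 < \<epsilon>" "\<epsilon> \<le> 1" and \<psi>: "compact_profile \<psi>"
  shows "sep_hol (St T) UNIV (\<lambda>t z. heat (of_real a + of_real \<epsilon> * t) \<psi> z)"
proof -
  obtain B where B: "exp_decay B \<psi>" using compact_profile_exp_decay[OF \<psi>] by blast
  show ?thesis
    by (rule heat_sep_hol(1)[OF open_St, where B = B])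
       (use time_shift_Sec[OF a \<epsilon>] B in \<open>auto intro!: holomorphic_intros\<close>)
qed

lemma Cone_Im: "z \<in> Cone \<Longrightarrow> \<bar>Im z\<bar> \<le> \<bar>Re z\<bar> / 8 \<and> \<bar>Re z\<bar> = Re z"
  by (auto simp: Cone_def)

lemma sep_hol_mult:
  assumes "sep_hol A B f" "sep_hol A B g" "open A" "open B"
  shows "sep_hol A B (\<lambda>t z. f t z * g t z)"
  unfolding sep_hol_def
proof (intro conjI ballI)
  show "(\<lambda>t. f t x * g t x) holomorphic_on A" if "x \<in> B" for x
    using assms that unfolding sep_hol_def by (auto intro!: holomorphic_intros)
  show "(\<lambda>x. f t x * g t x) holomorphic_on B" if "t \<in> A" for t
    using assms that unfolding sep_hol_def by (auto intro!: holomorphic_intros)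
  fix t x assume tx: "t \<in> A" "x \<in> B"
  obtain d1 K1 where 1: "d1 > 0" "K1 \<ge> 0" "\<And>s y. s \<in> cball t d1 \<Longrightarrow> y \<in> cball x d1 \<Longrightarrow> norm (f s y) \<le> K1"
    using sep_holE[OF assms(1,3,4) tx] by metis
  obtain d2 K2 where 2: "d2 > 0" "K2 \<ge> 0" "\<And>s y. s \<in> cball t d2 \<Longrightarrow> y \<in> cball x d2 \<Longrightarrow> norm (g s y) \<le> K2"
    using sep_holE[OF assms(2,3,4) tx] by metis
  have "norm (f s y * g s y) \<le> K1 * K2" if "s \<in> ball t (min d1 d2)" "y \<in> ball x (min d1 d2)" for s y
    unfolding norm_mult using 1(3)[of s y] 2(3)[of s y] 1(2) that by (intro mult_mono) auto
  then show "\<exists>d>0. \<exists>K. \<forall>s\<in>ball t d \<inter> A. \<forall>y\<in>ball x d \<inter> B. norm (f s y * g s y) \<le> K"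
    using 1(1) 2(1) by (intro exI[of _ "min d1 d2"] conjI exI[of _ "K1 * K2"]) auto
qed

lemma sep_hol_uminus: "sep_hol A B f \<Longrightarrow> sep_hol A B (\<lambda>t z. - f t z)"
  unfolding sep_hol_def by (simp add: holomorphic_on_minus)

lemma norm_u_le:
  assumes \<epsilon>: "0 < \<epsilon>" "\<epsilon> \<le> 1" and "t \<in> St T" "z \<in> Cone"
  shows "norm (u \<epsilon> t z) \<le> M"
proof -
  have "norm (u \<epsilon> t z) \<le> M * exp (- \<bar>Re z\<bar>)"
    unfolding u_def using time_shift_Sec[OF a \<epsilon> assms(3)] Cone_Im[OF assms(4)] by (intro M(2)) auto
  also have "\<dots> \<le> M * 1" using M(1) by (intro mult_left_mono) auto
  finally show ?thesis by simp
qed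

text \<open>Each step contributes q / (n + 1), which builds up q^n / n!. The second claim is the
  same bound for the next source, with one more factor \<open>M\<close>.\<close>

lemma w_class:
  assumes \<epsilon>: "0 < \<epsilon>" "\<epsilon> \<le> 1"
  shows "duh_class T (B0 * q ^ n / fact n) n (w \<epsilon> n)"
    and "duh_class T (M * (B0 * q ^ n / fact n)) n (\<lambda>t z. - u \<epsilon> t z * w \<epsilon> n t z)"
proof -
  have step: "duh_class T (M * B) n (\<lambda>t z. - u \<epsilon> t z * g t z)" if g: "duh_class T B n g" for B n g
    unfolding duh_class_def
  proof (intro conjI ballI)
    have "sep_hol (St T) Cone (u \<epsilon>)" unfolding u_def
      by (rule sep_hol_subset[OF profile_sep_hol[OF \<epsilon> cu]]) auto
    then show "sep_hol (St T) Cone (\<lambda>t z. - u \<epsilon> t z * g t z)"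
      using g unfolding duh_class_def by (intro sep_hol_mult sep_hol_uminus open_St open_Cone) auto
    show "0 \<le> M * B" using g M by (auto simp: duh_class_def)
    fix t z assume tz: "t \<in> St T" "z \<in> Cone"
    have "norm (- u \<epsilon> t z * g t z) \<le> M * (B * Re t ^ n * exp (- Re z))"
      unfolding norm_mult norm_minus_cancel using norm_u_le[OF \<epsilon> tz] g tz M by (intro mult_mono) (auto simp: duh_class_def)
    then show "norm (- u \<epsilon> t z * g t z) \<le> M * B * Re t ^ n * exp (- Re z)" by (simp add: mult.assoc)
  qed
  show 1: "duh_class T (B0 * q ^ n / fact n) n (w \<epsilon> n)"
  proof (induction n)
    case 0
    show ?case unfolding duh_class_def
    proof (intro conjI ballI)
      show "sep_hol (St T) Cone (w \<epsilon> 0)"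
        using sep_hol_subset[OF profile_sep_hol[OF \<epsilon> cq], of "St T" Cone] by simp
      fix t z assume tz: "t \<in> St T" "z \<in> Cone"
      show "norm (w \<epsilon> 0 t z) \<le> B0 * q ^ 0 / fact 0 * Re t ^ 0 * exp (- Re z)"
        using B0(2)[OF time_shift_Sec[OF a \<epsilon> tz(1)], of z] Cone_Im[OF tz(2)] by simp
    qed (use B0 in auto)
  next
    case (Suc n)
    from duh_class_duh[OF T \<epsilon> step[OF this]]
    show ?case by (simp add: q_def mult_ac)
  qed
  show "duh_class T (M * (B0 * q ^ n / fact n)) n (\<lambda>t z. - u \<epsilon> t z * w \<epsilon> n t z)" by (rule step[OF 1])
qed

lemma w_real_0: "w \<epsilon> n t 0 = 0"
proof (cases n)
  case 0 then show ?thesis by (simp add: heat_odd_0 oq)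
next
  case (Suc m)
  then show ?thesis by (simp add: duh_def duh_kernel_def heat_odd_0 odd_ext_minus)
qed

lemma continuous_on_w_real:
  assumes \<epsilon>: "0 < \<epsilon>" "\<epsilon> \<le> 1"
  shows "continuous_on ({0<..<T} \<times> UNIV) (\<lambda>p. w \<epsilon> n (of_real (fst p)) (of_real (snd p)))"
proof (cases n)
  case 0
  have c: "continuous_on (St T \<times> UNIV) (\<lambda>p. heat (of_real a + of_real \<epsilon> * fst p) \<psi>q (snd p))"
    by (rule sep_hol_continuous_on[OF profile_sep_hol[OF \<epsilon> cq] open_St open_UNIV])
  have "continuous_on ({0<..<T} \<times> UNIV) (\<lambda>p::real\<times>real. (\<lambda>p. heat (of_real a + of_real \<epsilon> * fst p) \<psi>q (snd p)) (of_real (fst p), of_real (snd p)))"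
    by (rule continuous_on_compose2[OF c]) (auto intro!: continuous_intros)
  then show ?thesis using 0 by simp
next
  case (Suc m)
  from continuous_on_duh_real[OF T \<epsilon> w_class(2)[OF \<epsilon>, of m]] show ?thesis using Suc by simp
qed

definition \<Phi> where "\<Phi> \<epsilon> n t x = heat_dx \<psi>f n (of_real a + of_real \<epsilon> * t) x"

text \<open>The series is written as an integral over counting measure, so that
  \<open>holomorphic_integral_param\<close> and dominated convergence apply to it directly.\<close>

definition V where "V \<epsilon> t x z = (\<integral>n. \<Phi> \<epsilon> n t x * w \<epsilon> n t z \<partial>count_space UNIV)"

lemma norm_\<Phi>_le:
  assumes "0 \<le> R"
  shows "\<exists>C\<ge>0. \<forall>n \<epsilon> t x. 0 < \<epsilon> \<longrightarrow> \<epsilon> \<le> 1 \<longrightarrow> t \<in> St T \<longrightarrow> \<bar>Im x\<bar> \<le> R \<longrightarrow>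
     norm (\<Phi> \<epsilon> n t x) \<le> C * fact n / r ^ n * exp (- \<bar>Re x\<bar>)"
proof -
  obtain C where C: "C \<ge> 0" "\<forall>n. \<forall>\<tau>\<in>Sec. \<forall>x. a \<le> Re \<tau> \<longrightarrow> Re \<tau> \<le> a + T \<longrightarrow> \<bar>Im x\<bar> \<le> R \<longrightarrow>
           norm (heat_dx \<psi>f n \<tau> x) \<le> C * fact n / r ^ n * exp (- \<bar>Re x\<bar>)"
    using norm_heat_dx_le[OF cf a _ assms r0, of "a + T"] T by auto
  show ?thesis
    by (intro exI[of _ C] conjI C(1) allI impI) (use C(2) time_shift_Sec[OF a] in \<open>auto simp: \<Phi>_def\<close>)
qed

lemma norm_w_le:
  assumes \<epsilon>: "0 < \<epsilon>" "\<epsilon> \<le> 1" and t: "t \<in> St T" and z: "z \<in> Cone"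
  shows "norm (w \<epsilon> n t z) \<le> B0 * (q * T) ^ n / fact n * exp (- Re z)"
  using duh_class_bound_uniform[OF T \<epsilon> w_class(1)[OF \<epsilon>] t z, of n] by (simp add: power_mult_distrib mult_ac)

text \<open>The n! from Cauchy's estimate cancels the n! in the bound of \<open>w\<close>, leaving
  (q T / r)^n. The exponential factors are kept: they become the L^p majorant in the inviscid
  limit.\<close>

lemma norm_term_le:
  assumes "0 \<le> R"
  shows "\<exists>C\<ge>0. \<forall>n \<epsilon> t x z. 0 < \<epsilon> \<longrightarrow> \<epsilon> \<le> 1 \<longrightarrow> t \<in> St T \<longrightarrow> \<bar>Im x\<bar> \<le> R \<longrightarrow> z \<in> Cone \<longrightarrow>
     norm (\<Phi> \<epsilon> n t x * w \<epsilon> n t z) \<le> C * (1/2) ^ n * (exp (- \<bar>Re x\<bar>) * exp (- Re z))"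
proof -
  obtain C where C: "C \<ge> 0" "\<And>n \<epsilon> t x. 0 < \<epsilon> \<Longrightarrow> \<epsilon> \<le> 1 \<Longrightarrow> t \<in> St T \<Longrightarrow> \<bar>Im x\<bar> \<le> R \<Longrightarrow>
     norm (\<Phi> \<epsilon> n t x) \<le> C * fact n / r ^ n * exp (- \<bar>Re x\<bar>)" using norm_\<Phi>_le[OF assms] by blast
  have "norm (\<Phi> \<epsilon> n t x * w \<epsilon> n t z) \<le> (C * B0) * (1/2) ^ n * (exp (- \<bar>Re x\<bar>) * exp (- Re z))"
    if *: "0 < \<epsilon>" "\<epsilon> \<le> 1" "t \<in> St T" "\<bar>Im x\<bar> \<le> R" "z \<in> Cone" for n \<epsilon> t x z
  proof -
    have "norm (\<Phi> \<epsilon> n t x * w \<epsilon> n t z) \<le> (C * fact n / r ^ n * exp (- \<bar>Re x\<bar>)) * (B0 * (q * T) ^ n / fact n * exp (- Re z))"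
      unfolding norm_mult using C(2)[OF *(1-4)] norm_w_le[OF *(1,2,3,5)] C(1) r0 by (intro mult_mono) auto
    also have "\<dots> = (C * B0) * (q * T / r) ^ n * (exp (- \<bar>Re x\<bar>) * exp (- Re z))"
      by (simp add: power_divide)
    also have "\<dots> \<le> (C * B0) * (1/2) ^ n * (exp (- \<bar>Re x\<bar>) * exp (- Re z))"
      using qr q0 T r0 C(1) B0(1) by (intro mult_right_mono mult_left_mono power_mono) auto
    finally show ?thesis .
  qed
  then show ?thesis using C(1) B0(1) by (intro exI[of _ "C * B0"]) auto
qed

lemma integrable_geometric: "integrable (count_space UNIV) (\<lambda>n. C * (1/2::real) ^ n)"
  by (simp add: integrable_count_space_nat_iff summable_mult abs_mult)

lemma \<Phi>_holomorphic:
  assumes \<epsilon>: "0 < \<epsilon>" "\<epsilon> \<le> 1"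
  shows "t \<in> St T \<Longrightarrow> \<Phi> \<epsilon> n t holomorphic_on UNIV"
    and "t \<in> St T \<Longrightarrow> deriv (\<Phi> \<epsilon> n t) = \<Phi> \<epsilon> (Suc n) t"
    and "t \<in> St T \<Longrightarrow> ((\<lambda>t. \<Phi> \<epsilon> n t x) has_field_derivative of_real \<epsilon> * \<Phi> \<epsilon> (Suc (Suc n)) t x) (at t)"
proof -
  obtain B where B: "exp_decay B \<psi>f" using compact_profile_exp_decay[OF cf] by blast
  note S = time_shift_Sec[OF a \<epsilon>]
  show "\<Phi> \<epsilon> n t holomorphic_on UNIV" if "t \<in> St T"
    using heat_dx_sep_hol[OF B, of n] S(1)[OF that] unfolding sep_hol_def \<Phi>_def by auto
  show "deriv (\<Phi> \<epsilon> n t) = \<Phi> \<epsilon> (Suc n) t" if "t \<in> St T"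
    unfolding \<Phi>_def by (simp add: heat_dx_deriv_x)
  show "((\<lambda>t. \<Phi> \<epsilon> n t x) has_field_derivative of_real \<epsilon> * \<Phi> \<epsilon> (Suc (Suc n)) t x) (at t)" if "t \<in> St T"
    using DERIV_affine_time[OF heat_dx_sep_hol[OF B] S(1)[OF that], of n x] heat_dx_deriv_time[OF B S(1)[OF that]]
    by (simp add: \<Phi>_def)
qed

lemma w_holomorphic:
  assumes \<epsilon>: "0 < \<epsilon>" "\<epsilon> \<le> 1"
  shows "t \<in> St T \<Longrightarrow> w \<epsilon> n t holomorphic_on Cone" "z \<in> Cone \<Longrightarrow> (\<lambda>t. w \<epsilon> n t z) holomorphic_on St T"
  using w_class(1)[OF \<epsilon>, of n] by (auto simp: duh_class_def sep_hol_def)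

lemma w_pde:
  assumes \<epsilon>: "0 < \<epsilon>" "\<epsilon> \<le> 1" and t: "0 < t" "t < T" and z: "0 < z"
  shows "deriv (\<lambda>t. w \<epsilon> n t (of_real z)) (of_real t) = of_real \<epsilon> * deriv (deriv (w \<epsilon> n (of_real t))) (of_real z)
     + (case n of 0 \<Rightarrow> 0 | Suc m \<Rightarrow> - u \<epsilon> (of_real t) (of_real z) * w \<epsilon> m (of_real t) (of_real z))"
proof (cases n)
  case 0
  obtain B where B: "exp_decay B \<psi>q" using compact_profile_exp_decay[OF cq] by blast
  have S: "of_real a + of_real \<epsilon> * of_real t \<in> Sec" using time_shift_Sec(1)[OF a \<epsilon>, of "of_real t" T] t by simp
  from DERIV_imp_deriv[OF DERIV_affine_time[OF heat_sep_hol_const[OF B] S]] heat_equation[OF B S]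
  show ?thesis using 0 by simp
next
  case (Suc m)
  from duh_pde[OF T \<epsilon> w_class(2)[OF \<epsilon>, of m] t z] show ?thesis using Suc by simp
qed

text \<open>The equation is checked term by term. The t-derivative of the n-th term yields
  \<epsilon> times the two second derivatives and a source term with \<open>w\<close> of index n -
  1; after a shift of the index the source terms sum to - u times the x-derivative of V.\<close>

lemma V_holomorphic:
  assumes \<epsilon>: "0 < \<epsilon>" "\<epsilon> \<le> 1"
  shows "sep_hol3 (St T) UNIV Cone (V \<epsilon>)"
    and "\<And>t x z. 0 < t \<Longrightarrow> t < T \<Longrightarrow> 0 < z \<Longrightarrow>
      deriv (\<lambda>t. V \<epsilon> t x (of_real z)) (of_real t) + u \<epsilon> (of_real t) (of_real z) * deriv (\<lambda>x. V \<epsilon> (of_real t) x (of_real z)) x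
        = of_real \<epsilon> * (deriv (deriv (\<lambda>x. V \<epsilon> (of_real t) x (of_real z))) x + deriv (deriv (V \<epsilon> (of_real t) x)) (of_real z))"
proof -
  let ?N = "count_space (UNIV :: nat set)"
  have bound: "\<exists>g. integrable ?N g \<and> (\<forall>t\<in>St T. \<forall>x. \<bar>Im x\<bar> \<le> R \<longrightarrow> (\<forall>z\<in>Cone. \<forall>n. norm (\<Phi> \<epsilon> n t x * w \<epsilon> n t z) \<le> g n))" if R0: "0 \<le> R" for R
  proof -
    obtain C where C: "C \<ge> 0" "\<And>n \<epsilon> t x z. 0 < \<epsilon> \<Longrightarrow> \<epsilon> \<le> 1 \<Longrightarrow> t \<in> St T \<Longrightarrow> \<bar>Im x\<bar> \<le> R \<Longrightarrow> z \<in> Cone \<Longrightarrow>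
       norm (\<Phi> \<epsilon> n t x * w \<epsilon> n t z) \<le> C * (1/2) ^ n * (exp (- \<bar>Re x\<bar>) * exp (- Re z))"
      using norm_term_le[OF R0] by blast
    have "norm (\<Phi> \<epsilon> n t x * w \<epsilon> n t z) \<le> C * (1/2) ^ n" if "t \<in> St T" "\<bar>Im x\<bar> \<le> R" "z \<in> Cone" for n t x z
    proof -
      have "exp (- \<bar>Re x\<bar>) * exp (- Re z) \<le> 1 * 1" using that(3) by (intro mult_mono) (auto simp: Cone_def)
      then have "C * (1/2) ^ n * (exp (- \<bar>Re x\<bar>) * exp (- Re z)) \<le> C * (1/2) ^ n * 1" using C(1) by (intro mult_left_mono) auto
      then show ?thesis using C(2)[OF \<epsilon> that, of n] by linarith
    qed
    then show ?thesis using integrable_geometric[of C] by blast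
  qed
  have ht: "(\<lambda>t. \<Phi> \<epsilon> n t x * w \<epsilon> n t z) holomorphic_on St T" if "z \<in> Cone" for n x z
  proof -
    have "(\<lambda>t. \<Phi> \<epsilon> n t x) holomorphic_on St T"
      using \<Phi>_holomorphic(3)[OF \<epsilon>] holomorphic_on_open[OF open_St] by blast
    then show ?thesis using w_holomorphic(2)[OF \<epsilon> that] by (intro holomorphic_intros)
  qed
  have hx: "(\<lambda>x. \<Phi> \<epsilon> n t x * w \<epsilon> n t z) holomorphic_on UNIV" if "t \<in> St T" for n t z
    using \<Phi>_holomorphic(1)[OF \<epsilon> that] by (intro holomorphic_intros)
  have hz: "(\<lambda>z. \<Phi> \<epsilon> n t x * w \<epsilon> n t z) holomorphic_on Cone" if "t \<in> St T" for n t x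
    using w_holomorphic(1)[OF \<epsilon> that] by (intro holomorphic_intros)
  have lt: "\<exists>r>0. \<exists>g. integrable ?N g \<and> (\<forall>t\<in>ball t' r \<inter> St T. \<forall>n\<in>space ?N. norm (\<Phi> \<epsilon> n t x * w \<epsilon> n t z) \<le> g n)"
    if "z \<in> Cone" for t' x z
    using bound[of "\<bar>Im x\<bar>"] that by (intro exI[of _ 1]) auto
  have lx: "\<exists>r>0. \<exists>g. integrable ?N g \<and> (\<forall>x\<in>ball x' r \<inter> UNIV. \<forall>n\<in>space ?N. norm (\<Phi> \<epsilon> n t x * w \<epsilon> n t z) \<le> g n)"
    if "t \<in> St T" "z \<in> Cone" for x' t z
  proof -
    have "\<bar>Im x\<bar> \<le> \<bar>Im x'\<bar> + 1" if "x \<in> ball x' 1" for x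
      using abs_Im_le_cmod[of "x' - x"] that by (auto simp: dist_norm)
    then show ?thesis using bound[of "\<bar>Im x'\<bar> + 1"] that by (intro exI[of _ 1]) auto
  qed
  have lz: "\<exists>r>0. \<exists>g. integrable ?N g \<and> (\<forall>z\<in>ball z' r \<inter> Cone. \<forall>n\<in>space ?N. norm (\<Phi> \<epsilon> n t x * w \<epsilon> n t z) \<le> g n)"
    if "t \<in> St T" for z' t x
    using bound[of "\<bar>Im x\<bar>"] that by (intro exI[of _ 1]) auto
  have m: "g \<in> borel_measurable ?N" for g :: "nat \<Rightarrow> complex" by simp
  show "sep_hol3 (St T) UNIV Cone (V \<epsilon>)"
    unfolding sep_hol3_def
  proof (intro conjI ballI)
    show "(\<lambda>t. V \<epsilon> t x z) holomorphic_on St T" if "z \<in> Cone" for x z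
      unfolding V_def by (rule holomorphic_integral_param(1)[OF open_St ht[OF that] m lt[OF that]])
    show "(\<lambda>x. V \<epsilon> t x z) holomorphic_on UNIV" if "t \<in> St T" "z \<in> Cone" for t z
      unfolding V_def by (rule holomorphic_integral_param(1)[OF open_UNIV hx[OF that(1)] m lx[OF that]])
    show "V \<epsilon> t x holomorphic_on Cone" if "t \<in> St T" for t x
      unfolding V_def by (rule holomorphic_integral_param(1)[OF open_Cone hz[OF that(1)] m lz[OF that]])
    fix t x z assume tz: "t \<in> St T" "z \<in> Cone"
    obtain d1 where d1: "d1 > 0" "ball t d1 \<subseteq> St T" using open_St tz(1) open_contains_ball by blast
    obtain d2 where d2: "d2 > 0" "ball z d2 \<subseteq> Cone" using open_Cone tz(2) open_contains_ball by blast
    obtain g where g: "integrable ?N g" "\<And>t y z n. t \<in> St T \<Longrightarrow> \<bar>Im y\<bar> \<le> \<bar>Im x\<bar> + 1 \<Longrightarrow> z \<in> Cone \<Longrightarrow> norm (\<Phi> \<epsilon> n t y * w \<epsilon> n t z) \<le> g n"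
      using bound[of "\<bar>Im x\<bar> + 1"] by auto
    have "norm (V \<epsilon> s y y') \<le> (\<integral>n. g n \<partial>?N)"
      if "s \<in> ball t (min 1 (min d1 d2))" "y \<in> ball x (min 1 (min d1 d2))" "y' \<in> ball z (min 1 (min d1 d2))" for s y y'
    proof -
      have iy: "\<bar>Im y\<bar> \<le> \<bar>Im x\<bar> + 1"
        using abs_Im_le_cmod[of "x - y"] that(2) by (auto simp: dist_norm)
      have s: "s \<in> St T" "y' \<in> Cone" using that d1 d2 by auto
      have b: "norm (\<Phi> \<epsilon> n s y * w \<epsilon> n s y') \<le> g n" for n by (rule g(2)[OF s(1) iy s(2)])
      have "integrable ?N (\<lambda>n. \<Phi> \<epsilon> n s y * w \<epsilon> n s y')"
        by (rule Bochner_Integration.integrable_bound[OF g(1) m]) (use b in \<open>auto intro: order_trans[OF _ abs_ge_self]\<close>)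
      from norm_integral_le_integral[OF this g(1) b] show ?thesis unfolding V_def .
    qed
    then show "\<exists>d>0. \<exists>K. \<forall>s\<in>ball t d. \<forall>y\<in>ball x d. \<forall>w\<in>ball z d. norm (V \<epsilon> s y w) \<le> K"
      using d1(1) d2(1) by (intro exI[of _ "min 1 (min d1 d2)"] conjI exI[of _ "\<integral>n. g n \<partial>?N"]) auto
  qed
  fix t z :: real and x :: complex assume t: "0 < t" "t < T" and z: "0 < z"
  define t' z' where "t' = complex_of_real t" and "z' = complex_of_real z"
  have tz: "t' \<in> St T" "z' \<in> Cone" using t z by (auto simp: t'_def z'_def)
  have d_t: "deriv (\<lambda>t. \<Phi> \<epsilon> n t x * w \<epsilon> n t z') t' = of_real \<epsilon> * (\<Phi> \<epsilon> (Suc (Suc n)) t' x * w \<epsilon> n t' z')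
     + of_real \<epsilon> * (\<Phi> \<epsilon> n t' x * deriv (deriv (w \<epsilon> n t')) z') + \<Phi> \<epsilon> n t' x * (case n of 0 \<Rightarrow> 0 | Suc m \<Rightarrow> - u \<epsilon> t' z' * w \<epsilon> m t' z')" for n
  proof -
    have "((\<lambda>t. \<Phi> \<epsilon> n t x * w \<epsilon> n t z') has_field_derivative
       (of_real \<epsilon> * \<Phi> \<epsilon> (Suc (Suc n)) t' x) * w \<epsilon> n t' z' + deriv (\<lambda>t. w \<epsilon> n t z') t' * \<Phi> \<epsilon> n t' x) (at t')"
      by (rule DERIV_mult[OF \<Phi>_holomorphic(3)[OF \<epsilon> tz(1)] holomorphic_derivI[OF w_holomorphic(2)[OF \<epsilon> tz(2)] open_St tz(1)]])
    from DERIV_imp_deriv[OF this] show ?thesis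
      unfolding w_pde[OF \<epsilon> t z, folded t'_def z'_def] by (simp add: algebra_simps)
  qed
  have d_x: "deriv (\<lambda>x. \<Phi> \<epsilon> n t' x * w \<epsilon> n t' z') = (\<lambda>x. \<Phi> \<epsilon> (Suc n) t' x * w \<epsilon> n t' z')" for n
  proof (rule ext, rule DERIV_imp_deriv, rule DERIV_cmult_right)
    fix x show "(\<Phi> \<epsilon> n t' has_field_derivative \<Phi> \<epsilon> (Suc n) t' x) (at x)"
      using holomorphic_derivI[OF \<Phi>_holomorphic(1)[OF \<epsilon> tz(1), of n] open_UNIV, of x] \<Phi>_holomorphic(2)[OF \<epsilon> tz(1), of n] by simp
  qed
  have d_xx: "deriv (deriv (\<lambda>x. \<Phi> \<epsilon> n t' x * w \<epsilon> n t' z')) x = \<Phi> \<epsilon> (Suc (Suc n)) t' x * w \<epsilon> n t' z'" for n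
    unfolding d_x
  proof (rule DERIV_imp_deriv, rule DERIV_cmult_right)
    show "(\<Phi> \<epsilon> (Suc n) t' has_field_derivative \<Phi> \<epsilon> (Suc (Suc n)) t' x) (at x)"
      using holomorphic_derivI[OF \<Phi>_holomorphic(1)[OF \<epsilon> tz(1), of "Suc n"] open_UNIV, of x] \<Phi>_holomorphic(2)[OF \<epsilon> tz(1), of "Suc n"] by simp
  qed
  have d_zz: "deriv (deriv (\<lambda>z. \<Phi> \<epsilon> n t' x * w \<epsilon> n t' z)) z' = \<Phi> \<epsilon> n t' x * deriv (deriv (w \<epsilon> n t')) z'" for n
  proof -
    note h = w_holomorphic(1)[OF \<epsilon> tz(1), of n]
    have "deriv (\<lambda>z. \<Phi> \<epsilon> n t' x * w \<epsilon> n t' z) y = \<Phi> \<epsilon> n t' x * deriv (w \<epsilon> n t') y" if "y \<in> Cone" for y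
      by (rule DERIV_imp_deriv, rule DERIV_cmult, rule holomorphic_derivI[OF h open_Cone that])
    then have "deriv (deriv (\<lambda>z. \<Phi> \<epsilon> n t' x * w \<epsilon> n t' z)) z' = deriv (\<lambda>y. \<Phi> \<epsilon> n t' x * deriv (w \<epsilon> n t') y) z'"
      using eventually_nhds_in_open[OF open_Cone tz(2)] by (intro deriv_cong_ev) (auto elim: eventually_mono)
    also have "\<dots> = \<Phi> \<epsilon> n t' x * deriv (deriv (w \<epsilon> n t')) z'"
      by (rule DERIV_imp_deriv, rule DERIV_cmult, rule holomorphic_derivI[OF holomorphic_deriv[OF h open_Cone] open_Cone tz(2)])
    finally show ?thesis .
  qed
  note P_t = holomorphic_integral_param(2,3)[OF open_St ht[OF tz(2), where x = x] m lt[OF tz(2)] tz(1), unfolded d_t]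
  have Ux: "x \<in> UNIV" by simp
  have Vx: "deriv (\<lambda>x. V \<epsilon> t' x z') x = (\<integral>n. \<Phi> \<epsilon> (Suc n) t' x * w \<epsilon> n t' z' \<partial>?N)"
    and Vx_i: "integrable ?N (\<lambda>n. \<Phi> \<epsilon> (Suc n) t' x * w \<epsilon> n t' z')"
    and Vxx: "deriv (deriv (\<lambda>x. V \<epsilon> t' x z')) x = (\<integral>n. \<Phi> \<epsilon> (Suc (Suc n)) t' x * w \<epsilon> n t' z' \<partial>?N)"
    and Vxx_i: "integrable ?N (\<lambda>n. \<Phi> \<epsilon> (Suc (Suc n)) t' x * w \<epsilon> n t' z')"
    and Vzz: "deriv (deriv (V \<epsilon> t' x)) z' = (\<integral>n. \<Phi> \<epsilon> n t' x * deriv (deriv (w \<epsilon> n t')) z' \<partial>?N)"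
    and Vzz_i: "integrable ?N (\<lambda>n. \<Phi> \<epsilon> n t' x * deriv (deriv (w \<epsilon> n t')) z')"
    using holomorphic_integral_param(2,3,4,5)[OF open_UNIV hx[OF tz(1), where z = z'] m lx[OF tz] Ux, unfolded d_xx]
      holomorphic_integral_param(4,5)[OF open_Cone hz[OF tz(1), where x = x] m lz[OF tz(1)] tz(2), unfolded d_zz]
    unfolding V_def[abs_def] by (simp_all add: d_x)
  have Vt: "deriv (\<lambda>t. V \<epsilon> t x z') t' = (\<integral>n. of_real \<epsilon> * (\<Phi> \<epsilon> (Suc (Suc n)) t' x * w \<epsilon> n t' z')
     + of_real \<epsilon> * (\<Phi> \<epsilon> n t' x * deriv (deriv (w \<epsilon> n t')) z') + \<Phi> \<epsilon> n t' x * (case n of 0 \<Rightarrow> 0 | Suc m \<Rightarrow> - u \<epsilon> t' z' * w \<epsilon> m t' z') \<partial>?N)"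
    unfolding V_def by (rule P_t(1))
  \<comment> \<open>The source terms. The one with index 0 vanishes, and \<open>S (Suc n)\<close> is
    - u times the n-th term of the x-derivative of V, so dropping the head of the series gives the
    transport term.\<close>
  define S where "S n = \<Phi> \<epsilon> n t' x * (case n of 0 \<Rightarrow> 0 | Suc m \<Rightarrow> - u \<epsilon> t' z' * w \<epsilon> m t' z')" for n
  have SS: "S (Suc n) = - u \<epsilon> t' z' * (\<Phi> \<epsilon> (Suc n) t' x * w \<epsilon> n t' z')" "S 0 = 0" for n by (simp_all add: S_def)
  have S1: "integrable ?N (\<lambda>n. S (Suc n))" unfolding SS using Vx_i by simp
  have S_i: "integrable ?N S"
    using S1 by (simp add: integrable_count_space_nat_iff summable_Suc_iff[of "\<lambda>n. norm (S n)"])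
  have S_sum: "(\<integral>n. S n \<partial>?N) = - u \<epsilon> t' z' * (\<integral>n. \<Phi> \<epsilon> (Suc n) t' x * w \<epsilon> n t' z' \<partial>?N)"
  proof -
    have "(\<integral>n. S n \<partial>?N) = suminf S" by (rule integral_count_space_nat[OF S_i])
    also have "\<dots> = (\<Sum>n. S (Suc n))"
    proof -
      have "summable S" using S_i by (auto simp: integrable_count_space_nat_iff intro: summable_norm_cancel)
      from suminf_split_head[OF this] SS(2) show ?thesis by simp
    qed
    also have "\<dots> = (\<integral>n. S (Suc n) \<partial>?N)" by (rule integral_count_space_nat[OF S1, symmetric])
    finally show ?thesis unfolding SS by simp
  qed
  have "deriv (\<lambda>t. V \<epsilon> t x z') t' = of_real \<epsilon> * (\<integral>n. \<Phi> \<epsilon> (Suc (Suc n)) t' x * w \<epsilon> n t' z' \<partial>?N)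
     + of_real \<epsilon> * (\<integral>n. \<Phi> \<epsilon> n t' x * deriv (deriv (w \<epsilon> n t')) z' \<partial>?N) + (\<integral>n. S n \<partial>?N)"
    unfolding Vt S_def[symmetric] using Vxx_i Vzz_i S_i by simp
  then show "deriv (\<lambda>t. V \<epsilon> t x (of_real z)) (of_real t) + u \<epsilon> (of_real t) (of_real z) * deriv (\<lambda>x. V \<epsilon> (of_real t) x (of_real z)) x
        = of_real \<epsilon> * (deriv (deriv (\<lambda>x. V \<epsilon> (of_real t) x (of_real z))) x + deriv (deriv (V \<epsilon> (of_real t) x)) (of_real z))"
    unfolding t'_def[symmetric] z'_def[symmetric] Vx Vxx Vzz S_sum by (simp add: algebra_simps)
qed

end

text \<open>The velocity of the locale \<open>model\<close>, stated outside it because solutions for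
  different product data must share it in order to be added.\<close>

definition heat_flow :: "real \<Rightarrow> (real \<Rightarrow> complex) \<Rightarrow> real \<Rightarrow> complex \<Rightarrow> complex \<Rightarrow> complex" where
  "heat_flow a \<psi> \<epsilon> t z = heat (of_real a + of_real \<epsilon> * t) \<psi> z"

text \<open>Holomorphic extension of a solution of the second depleted equation with velocity \<open>U\<close>.\<close>

definition hol_solution :: "real \<Rightarrow> real \<Rightarrow> (complex \<Rightarrow> complex \<Rightarrow> complex) \<Rightarrow> (complex \<Rightarrow> complex \<Rightarrow> complex \<Rightarrow> complex) \<Rightarrow> bool" where
  "hol_solution \<epsilon> T U V \<longleftrightarrow> sep_hol3 (St T) UNIV Cone V \<and>
     (\<forall>t x z. 0 < t \<longrightarrow> t < T \<longrightarrow> 0 < z \<longrightarrow>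
      deriv (\<lambda>t. V t (of_real x) (of_real z)) (of_real t) + U (of_real t) (of_real z) * deriv (\<lambda>x. V (of_real t) x (of_real z)) (of_real x)
        = of_real \<epsilon> * (deriv (deriv (\<lambda>x. V (of_real t) x (of_real z))) (of_real x) + deriv (deriv (V (of_real t) (of_real x))) (of_real z))) \<and>
     continuous_on ({0<..<T} \<times> (UNIV \<times> {0..})) (\<lambda>p. V (of_real (fst p)) (of_real (fst (snd p))) (of_real (snd (snd p)))) \<and>
     (\<forall>t x. V t x 0 = 0)"

text \<open>Everything about a family of solutions that survives linear combination: the equation
  for each \<epsilon>, an exponential majorant uniform in \<epsilon> and t, the same for the
  inviscid flow G, and convergence along sequences in which t may vary too.\<close>

definition model_family :: "real \<Rightarrow> real \<Rightarrow> (real \<Rightarrow> complex) \<Rightarrow> (real \<Rightarrow> complex \<Rightarrow> complex \<Rightarrow> complex \<Rightarrow> complex) \<Rightarrow>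
    (real \<Rightarrow> real \<Rightarrow> real \<Rightarrow> complex) \<Rightarrow> bool" where
  "model_family T a \<psi>u V G \<longleftrightarrow>
     (\<forall>\<epsilon>. 0 < \<epsilon> \<longrightarrow> \<epsilon> \<le> 1 \<longrightarrow> hol_solution \<epsilon> T (heat_flow a \<psi>u \<epsilon>) (V \<epsilon>)) \<and>
     (\<exists>K. \<forall>\<epsilon> t x z. 0 < \<epsilon> \<longrightarrow> \<epsilon> \<le> 1 \<longrightarrow> 0 < t \<longrightarrow> t < T \<longrightarrow> 0 < z \<longrightarrow>
        norm (V \<epsilon> (of_real t) (of_real x) (of_real z)) \<le> K * (exp (- \<bar>x\<bar>) * exp (- z))) \<and>
     (\<exists>K. \<forall>t x z. 0 < t \<longrightarrow> t < T \<longrightarrow> 0 < z \<longrightarrow> norm (G t x z) \<le> K * (exp (- \<bar>x\<bar>) * exp (- z))) \<and>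
     continuous_on UNIV (\<lambda>p. G (fst p) (fst (snd p)) (snd (snd p))) \<and>
     (\<forall>\<epsilon> t t0 x z. (\<forall>k. 0 < \<epsilon> k \<and> \<epsilon> k \<le> 1 \<and> 0 < t k \<and> t k < T) \<longrightarrow> \<epsilon> \<longlonglongrightarrow> 0 \<longrightarrow> t \<longlonglongrightarrow> t0 \<longrightarrow> 0 < z \<longrightarrow>
        (\<lambda>k. V (\<epsilon> k) (of_real (t k)) (of_real x) (of_real z)) \<longlonglongrightarrow> G t0 x z)"

section \<open>The inviscid limit of the series\<close>

lemma heat_dx_tendsto:
  assumes \<psi>: "compact_profile \<psi>" and a: "0 < a"
    and \<tau>: "\<And>k. \<tau> k \<in> Sec" "\<tau> \<longlonglongrightarrow> of_real a" and z: "z \<longlonglongrightarrow> z0"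
  shows "(\<lambda>k. heat_dx \<psi> n (\<tau> k) (z k)) \<longlonglongrightarrow> heat_dx \<psi> n (of_real a) z0"
proof -
  obtain B where B: "exp_decay B \<psi>" using compact_profile_exp_decay[OF \<psi>] by blast
  have c: "continuous_on (Sec \<times> UNIV) (\<lambda>p. heat_dx \<psi> n (fst p) (snd p))"
    by (rule sep_hol_continuous_on[OF heat_dx_sep_hol[OF B] open_Sec open_UNIV])
  have l: "(\<lambda>k. (\<tau> k, z k)) \<longlonglongrightarrow> (of_real a, z0)" by (intro tendsto_intros \<tau> z)
  show ?thesis using continuous_on_tendsto_compose[OF c l] \<tau>(1) a by simp
qed

lemma heat_tendsto:
  assumes \<psi>: "compact_profile \<psi>" and a: "0 < a"
    and \<tau>: "\<And>k. \<tau> k \<in> Sec" "\<tau> \<longlonglongrightarrow> of_real a" and z: "z \<longlonglongrightarrow> z0"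
  shows "(\<lambda>k. heat (\<tau> k) \<psi> (z k)) \<longlonglongrightarrow> heat (of_real a) \<psi> z0"
  using heat_dx_tendsto[OF assms, of 0] by (simp add: heat_dx_def)

lemma continuous_on_heat_real:
  assumes \<psi>: "compact_profile \<psi>" and a: "0 < a" and g: "continuous_on A g"
  shows "continuous_on A (\<lambda>p. heat (of_real a) \<psi> (g p))"
proof -
  obtain B where B: "exp_decay B \<psi>" using compact_profile_exp_decay[OF \<psi>] by blast
  have "heat (of_real a) \<psi> holomorphic_on UNIV" using heat_sep_hol_const[OF B] a by (auto simp: sep_hol_def)
  then have c: "continuous_on UNIV (heat (of_real a) \<psi>)" by (rule holomorphic_on_imp_continuous_on)
  show ?thesis by (rule continuous_on_compose2[OF c g]) auto
qed

lemma heat_real_valued: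
  assumes s: "0 < s" and real: "\<And>y. Im (\<psi> y) = 0"
  shows "heat (of_real s) \<psi> (of_real z) = of_real (Re (heat (of_real s) \<psi> (of_real z)))"
proof -
  have "\<psi> y = of_real (Re (\<psi> y))" for y using real[of y] by (simp add: complex_eq_iff)
  then have "heat (of_real s) \<psi> (of_real z) = (\<integral>\<eta>. complex_of_real (std_normal_density \<eta> * Re (\<psi> (z + sqrt (2 * s) * \<eta>))) \<partial>lborel)"
    unfolding heat_real[OF s] by (intro Bochner_Integration.integral_cong refl) (simp add: scaleR_conv_of_real)
  also have "\<dots> = of_real (\<integral>\<eta>. std_normal_density \<eta> * Re (\<psi> (z + sqrt (2 * s) * \<eta>)) \<partial>lborel)"
    by (rule integral_complex_of_real)
  finally show ?thesis by simp
qed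

context model begin

lemma time_tendsto:
  assumes "\<epsilon> \<longlonglongrightarrow> 0" "t \<longlonglongrightarrow> t0"
  shows "(\<lambda>k. of_real a + of_real (\<epsilon> k) * of_real (t k) :: complex) \<longlonglongrightarrow> of_real a"
proof -
  have "(\<lambda>k. of_real a + of_real (\<epsilon> k) * of_real (t k) :: complex) \<longlonglongrightarrow> of_real a + of_real 0 * of_real t0"
    by (intro tendsto_intros assms)
  then show ?thesis by simp
qed

text \<open>In the limit, at fixed z, the time derivative of each function is - U times the
  preceding one, which integrates to (- t U)^n / n!. The induction quantifies over the sequences t
  and z, because Duhamel's formula evaluates the previous function at \<sigma> t k and at displaced
  points.\<close>

lemma w_tendsto:
  assumes \<epsilon>: "\<And>k. 0 < \<epsilon> k" "\<And>k. \<epsilon> k \<le> 1" "\<epsilon> \<longlonglongrightarrow> 0"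
    and t: "\<And>k. 0 < t k" "\<And>k. t k < T" "t \<longlonglongrightarrow> t0" and z: "z \<longlonglongrightarrow> z0" "0 < z0"
  shows "(\<lambda>k. w (\<epsilon> k) n (of_real (t k)) (of_real (z k))) \<longlonglongrightarrow>
     (- (of_real t0 * heat (of_real a) \<psi>u (of_real z0))) ^ n / fact n * heat (of_real a) \<psi>q (of_real z0)"
  using t z
proof (induction n arbitrary: t z t0)
  case (0 t z t0)
  have S: "of_real a + of_real (\<epsilon> k) * of_real (t k) \<in> Sec" for k
    using time_shift_Sec(1)[OF a \<epsilon>(1,2), of "of_real (t k)" T k] 0(1,2) by simp
  show ?case using heat_tendsto[OF cq a S time_tendsto[OF \<epsilon>(3) 0(3)] tendsto_of_real[OF 0(4)]] by simp
next
  case (Suc n t z t0)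
  let ?U = "heat (of_real a) \<psi>u (of_real z0)"
  let ?C = "- ?U * ((- (of_real t0 * ?U)) ^ n / fact n * heat (of_real a) \<psi>q (of_real z0))"
  let ?g = "\<lambda>\<sigma>. - ?U * ((- (of_real (\<sigma> * t0) * ?U)) ^ n / fact n * heat (of_real a) \<psi>q (of_real z0))"
  \<comment> \<open>The limit source at time \<sigma> t0 is \<sigma>^n times a constant, so the
    integral over \<sigma> gives 1 / (n + 1).\<close>
  have g: "?g = (\<lambda>\<sigma>. of_real (\<sigma> ^ n) * ?C)"
    by (rule ext) (simp add: power_minus[of "of_real _ * _"] power_mult_distrib mult_ac)
  have "(\<lambda>k. duh (\<epsilon> k) (\<lambda>t z. - u (\<epsilon> k) t z * w (\<epsilon> k) n t z) (of_real (t k)) (of_real (z k))) \<longlonglongrightarrow> (\<integral>\<sigma>. of_real t0 * ?g \<sigma> \<partial>U01)"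
  proof (rule duh_tendsto[OF T \<epsilon> w_class(2)[OF \<epsilon>(1,2)] Suc.prems])
    fix \<sigma> :: real and y assume \<sigma>: "0 < \<sigma>" "\<sigma> < 1" and y: "\<And>k. 0 < y k" "y \<longlonglongrightarrow> z0"
    have st: "0 < \<sigma> * t k" "\<sigma> * t k < T" for k
      using St_scale[of "of_real (t k)" T \<sigma>] \<sigma> Suc.prems(1,2)[of k] unfolding of_real_mult[symmetric] of_real_St by auto
    have sl: "(\<lambda>k. \<sigma> * t k) \<longlonglongrightarrow> \<sigma> * t0" by (intro tendsto_intros Suc.prems)
    have S: "of_real a + of_real (\<epsilon> k) * of_real (\<sigma> * t k) \<in> Sec" for k
      using time_shift_Sec(1)[OF a \<epsilon>(1,2), of "of_real (\<sigma> * t k)" T k] st unfolding of_real_St by blast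
    have 1: "(\<lambda>k. u (\<epsilon> k) (of_real (\<sigma> * t k)) (of_real (y k))) \<longlonglongrightarrow> ?U"
      unfolding u_def by (rule heat_tendsto[OF cu a S time_tendsto[OF \<epsilon>(3) sl] tendsto_of_real[OF y(2)]])
    have 2: "(\<lambda>k. w (\<epsilon> k) n (of_real (\<sigma> * t k)) (of_real (y k))) \<longlonglongrightarrow> (- (of_real (\<sigma> * t0) * ?U)) ^ n / fact n * heat (of_real a) \<psi>q (of_real z0)"
      by (rule Suc.IH[OF st sl y(2) Suc.prems(5)])
    show "(\<lambda>k. - u (\<epsilon> k) (of_real (\<sigma> * t k)) (of_real (y k)) * w (\<epsilon> k) n (of_real (\<sigma> * t k)) (of_real (y k))) \<longlonglongrightarrow> ?g \<sigma>"
      by (intro tendsto_mult tendsto_minus 1 2)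
  next
    have "continuous_on {0<..<1} (\<lambda>\<sigma>::real. of_real (\<sigma> ^ n) * ?C)" by (intro continuous_intros)
    then show "?g \<in> borel_measurable U01" unfolding g by (rule borel_measurable_continuous_on_restrict_lborel)
  qed
  also have "(\<integral>\<sigma>. of_real t0 * ?g \<sigma> \<partial>U01) = (\<integral>\<sigma>. of_real (\<sigma> ^ n) * (of_real t0 * ?C) \<partial>U01)"
    unfolding fun_cong[OF g] by (simp only: mult.left_commute)
  also have "\<dots> = of_real (1 / real (Suc n)) * (of_real t0 * ?C)"
  proof -
    have "(\<integral>\<sigma>. complex_of_real (\<sigma> ^ n) \<partial>U01) = of_real (1 / real (Suc n))"
      unfolding integral_complex_of_real integral_power_U01(2) ..
    then show ?thesis by (simp only: integral_mult_left_zero)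
  qed
  also have "\<dots> = (- (of_real t0 * ?U)) ^ Suc n / fact (Suc n) * heat (of_real a) \<psi>q (of_real z0)"
    by (simp add: divide_simps)
  finally show ?case by simp
qed

lemma V_tendsto:
  assumes \<epsilon>: "\<And>k. 0 < \<epsilon> k" "\<And>k. \<epsilon> k \<le> 1" "\<epsilon> \<longlonglongrightarrow> 0"
    and t: "\<And>k. 0 < t k" "\<And>k. t k < T" "t \<longlonglongrightarrow> t0" and z: "0 < z"
  shows "(\<lambda>k. V (\<epsilon> k) (of_real (t k)) (of_real x) (of_real z)) \<longlonglongrightarrow>
     heat (of_real a) \<psi>f (of_real x - of_real t0 * heat (of_real a) \<psi>u (of_real z)) * heat (of_real a) \<psi>q (of_real z)"
proof -
  let ?N = "count_space (UNIV :: nat set)"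
  let ?s = "- (of_real t0 * heat (of_real a) \<psi>u (of_real z))"
  let ?Q = "heat (of_real a) \<psi>q (of_real z)"
  let ?l = "\<lambda>n. heat_dx \<psi>f n (of_real a) (of_real x) * (?s ^ n / fact n * ?Q)"
  obtain C where C: "C \<ge> 0" "\<And>n \<epsilon> t x z. 0 < \<epsilon> \<Longrightarrow> \<epsilon> \<le> 1 \<Longrightarrow> t \<in> St T \<Longrightarrow> \<bar>Im x\<bar> \<le> 0 \<Longrightarrow> z \<in> Cone \<Longrightarrow>
       norm (\<Phi> \<epsilon> n t x * w \<epsilon> n t z) \<le> C * (1/2) ^ n * (exp (- \<bar>Re x\<bar>) * exp (- Re z))"
    using norm_term_le[of 0] by blast
  have b: "norm (\<Phi> (\<epsilon> k) n (of_real (t k)) (of_real x) * w (\<epsilon> k) n (of_real (t k)) (of_real z)) \<le> C * (1/2) ^ n" for k n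
  proof -
    have "exp (- \<bar>x\<bar>) * exp (- z) \<le> 1 * 1" using z by (intro mult_mono) auto
    then have "C * (1/2) ^ n * (exp (- \<bar>x\<bar>) * exp (- z)) \<le> C * (1/2) ^ n * 1" using C(1) by (intro mult_left_mono) auto
    then show ?thesis using C(2)[OF \<epsilon>(1,2), of "of_real (t k)" "of_real x" "of_real z" k n] t(1,2) z by simp
  qed
  have S: "of_real a + of_real (\<epsilon> k) * of_real (t k) \<in> Sec" for k
    using time_shift_Sec(1)[OF a \<epsilon>(1,2), of "of_real (t k)" T k] t by simp
  have lim: "(\<lambda>k. \<Phi> (\<epsilon> k) n (of_real (t k)) (of_real x) * w (\<epsilon> k) n (of_real (t k)) (of_real z)) \<longlonglongrightarrow> ?l n" for n
    unfolding \<Phi>_def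
    by (intro tendsto_mult heat_dx_tendsto[OF cf a S time_tendsto[OF \<epsilon>(3) t(3)]] tendsto_const w_tendsto[OF \<epsilon> t _ z])
  have m: "h \<in> borel_measurable ?N" for h :: "nat \<Rightarrow> complex" by simp
  have lim': "AE n in ?N. (\<lambda>k. \<Phi> (\<epsilon> k) n (of_real (t k)) (of_real x) * w (\<epsilon> k) n (of_real (t k)) (of_real z)) \<longlonglongrightarrow> ?l n"
    using lim by simp
  have b': "AE n in ?N. norm (\<Phi> (\<epsilon> k) n (of_real (t k)) (of_real x) * w (\<epsilon> k) n (of_real (t k)) (of_real z)) \<le> C * (1/2) ^ n" for k
    using b[of k] by simp
  note D = m m integrable_geometric lim' b'
  have i: "integrable ?N ?l" by (rule integrable_dominated_convergence[OF D])
  have "(\<lambda>k. V (\<epsilon> k) (of_real (t k)) (of_real x) (of_real z)) \<longlonglongrightarrow> (\<integral>n. ?l n \<partial>?N)"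
    unfolding V_def by (rule integral_dominated_convergence[OF D])
  also have "(\<integral>n. ?l n \<partial>?N) = suminf ?l" by (rule integral_count_space_nat[OF i])
  also have "\<dots> = heat (of_real a) \<psi>f (of_real x + ?s) * ?Q"
  proof -
    obtain B where B: "exp_decay B \<psi>f" using compact_profile_exp_decay[OF cf] by blast
    \<comment> \<open>The function is entire, so the Taylor expansion at x may be used on a ball
      that exceeds the displacement.\<close>
    have h: "heat (of_real a) \<psi>f holomorphic_on ball (of_real x) (norm ?s + 1)"
      by (rule holomorphic_on_subset[of _ UNIV]) (use heat_sep_hol_const[OF B] a in \<open>auto simp: sep_hol_def\<close>)
    have "(\<lambda>n. (deriv ^^ n) (heat (of_real a) \<psi>f) (of_real x) / fact n * (of_real x + ?s - of_real x) ^ n) sums heat (of_real a) \<psi>f (of_real x + ?s)"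
      by (rule holomorphic_power_series[OF h]) (simp add: dist_norm)
    from sums_mult2[OF this, of ?Q]
    have "?l sums (heat (of_real a) \<psi>f (of_real x + ?s) * ?Q)" by (simp add: heat_dx_def field_simps)
    then show ?thesis by (rule sums_unique[symmetric])
  qed
  finally show ?thesis by simp
qed

lemma continuous_on_V_real:
  assumes \<epsilon>: "0 < \<epsilon>" "\<epsilon> \<le> 1"
  shows "continuous_on ({0<..<T} \<times> (UNIV \<times> {0..})) (\<lambda>p. V \<epsilon> (of_real (fst p)) (of_real (fst (snd p))) (of_real (snd (snd p))))"
  unfolding continuous_on_sequentially
proof (intro allI ballI impI, elim conjE)
  let ?N = "count_space (UNIV :: nat set)"
  fix X :: "nat \<Rightarrow> real \<times> real \<times> real" and p
  assume p: "p \<in> {0<..<T} \<times> (UNIV \<times> {0..})" and X: "\<forall>k. X k \<in> {0<..<T} \<times> (UNIV \<times> {0..})" "X \<longlonglongrightarrow> p"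
  define t x z where "t k = fst (X k)" and "x k = fst (snd (X k))" and "z k = snd (snd (X k))" for k
  have in_d: "0 < t k" "t k < T" "0 \<le> z k" for k using X(1) by (auto simp: t_def z_def mem_Times_iff)
  have pd: "0 < fst p" "fst p < T" using p by (auto simp: mem_Times_iff)
  have lims: "t \<longlonglongrightarrow> fst p" "x \<longlonglongrightarrow> fst (snd p)" "z \<longlonglongrightarrow> snd (snd p)"
    unfolding t_def x_def z_def by (intro tendsto_intros X(2))+
  obtain C where C: "C \<ge> 0" "\<And>n \<epsilon> t x z. 0 < \<epsilon> \<Longrightarrow> \<epsilon> \<le> 1 \<Longrightarrow> t \<in> St T \<Longrightarrow> \<bar>Im x\<bar> \<le> 0 \<Longrightarrow> z \<in> Cone \<Longrightarrow>
       norm (\<Phi> \<epsilon> n t x * w \<epsilon> n t z) \<le> C * (1/2) ^ n * (exp (- \<bar>Re x\<bar>) * exp (- Re z))"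
    using norm_term_le[of 0] by blast
  have b: "norm (\<Phi> \<epsilon> n (of_real (t k)) (of_real (x k)) * w \<epsilon> n (of_real (t k)) (of_real (z k))) \<le> C * (1/2) ^ n" for k n
  \<comment> \<open>\<open>norm_term_le\<close> speaks about the open cone, which excludes the wall;
    there every term is 0.\<close>
  proof (cases "z k = 0")
    case True then show ?thesis using C(1) by (simp add: w_real_0)
  next
    case False
    then have zk: "0 < z k" using in_d(3)[of k] by simp
    have "exp (- \<bar>x k\<bar>) * exp (- z k) \<le> 1 * 1" using zk by (intro mult_mono) auto
    then have "C * (1/2) ^ n * (exp (- \<bar>x k\<bar>) * exp (- z k)) \<le> C * (1/2) ^ n * 1" using C(1) by (intro mult_left_mono) auto
    then show ?thesis using C(2)[OF \<epsilon>, of "of_real (t k)" "of_real (x k)" "of_real (z k)" n] in_d(1,2)[of k] zk by simp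
  qed
  have lim: "(\<lambda>k. \<Phi> \<epsilon> n (of_real (t k)) (of_real (x k)) * w \<epsilon> n (of_real (t k)) (of_real (z k))) \<longlonglongrightarrow>
      \<Phi> \<epsilon> n (of_real (fst p)) (of_real (fst (snd p))) * w \<epsilon> n (of_real (fst p)) (of_real (snd (snd p)))" for n
  proof (rule tendsto_mult)
    obtain B where B: "exp_decay B \<psi>f" using compact_profile_exp_decay[OF cf] by blast
    have c: "continuous_on (Sec \<times> UNIV) (\<lambda>p. heat_dx \<psi>f n (fst p) (snd p))"
      by (rule sep_hol_continuous_on[OF heat_dx_sep_hol[OF B] open_Sec open_UNIV])
    have l: "(\<lambda>k. (of_real a + of_real \<epsilon> * of_real (t k), of_real (x k))) \<longlonglongrightarrow> (complex_of_real a + of_real \<epsilon> * of_real (fst p), complex_of_real (fst (snd p)))"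
      by (intro tendsto_intros lims)
    have S: "of_real a + of_real \<epsilon> * of_real t \<in> Sec" if "0 < t" "t < T" for t
      using time_shift_Sec(1)[OF a \<epsilon>, of "of_real t" T] that by simp
    show "(\<lambda>k. \<Phi> \<epsilon> n (of_real (t k)) (of_real (x k))) \<longlonglongrightarrow> \<Phi> \<epsilon> n (of_real (fst p)) (of_real (fst (snd p)))"
      unfolding \<Phi>_def using continuous_on_tendsto_compose[OF c l] S[OF pd] S[OF in_d(1,2)] by simp
    have l: "(\<lambda>k. (t k, z k)) \<longlonglongrightarrow> (fst p, snd (snd p))" by (intro tendsto_intros lims)
    show "(\<lambda>k. w \<epsilon> n (of_real (t k)) (of_real (z k))) \<longlonglongrightarrow> w \<epsilon> n (of_real (fst p)) (of_real (snd (snd p)))"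
      using continuous_on_tendsto_compose[OF continuous_on_w_real[OF \<epsilon>, of n] l] pd in_d by simp
  qed
  have m: "h \<in> borel_measurable ?N" for h :: "nat \<Rightarrow> complex" by simp
  have "(\<lambda>k. V \<epsilon> (of_real (t k)) (of_real (x k)) (of_real (z k))) \<longlonglongrightarrow> V \<epsilon> (of_real (fst p)) (of_real (fst (snd p))) (of_real (snd (snd p)))"
    unfolding V_def by (rule integral_dominated_convergence[OF m m integrable_geometric[of C]]) (use lim b in auto)
  then show "((\<lambda>p. V \<epsilon> (of_real (fst p)) (of_real (fst (snd p))) (of_real (snd (snd p)))) \<circ> X) \<longlonglongrightarrow>
     V \<epsilon> (of_real (fst p)) (of_real (fst (snd p))) (of_real (snd (snd p)))"
    by (simp add: o_def t_def x_def z_def)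
qed

lemma norm_V_le:
  "\<exists>K. \<forall>\<epsilon> t x z. 0 < \<epsilon> \<longrightarrow> \<epsilon> \<le> 1 \<longrightarrow> 0 < t \<longrightarrow> t < T \<longrightarrow> 0 < z \<longrightarrow>
        norm (V \<epsilon> (of_real t) (of_real x) (of_real z)) \<le> K * (exp (- \<bar>x\<bar>) * exp (- z))"
proof -
  let ?N = "count_space (UNIV :: nat set)"
  obtain C where C: "C \<ge> 0" "\<And>n \<epsilon> t x z. 0 < \<epsilon> \<Longrightarrow> \<epsilon> \<le> 1 \<Longrightarrow> t \<in> St T \<Longrightarrow> \<bar>Im x\<bar> \<le> 0 \<Longrightarrow> z \<in> Cone \<Longrightarrow>
       norm (\<Phi> \<epsilon> n t x * w \<epsilon> n t z) \<le> C * (1/2) ^ n * (exp (- \<bar>Re x\<bar>) * exp (- Re z))"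
    using norm_term_le[of 0] by blast
  have "norm (V \<epsilon> (of_real t) (of_real x) (of_real z)) \<le> (\<integral>n. C * (1/2) ^ n \<partial>?N) * (exp (- \<bar>x\<bar>) * exp (- z))"
    if *: "0 < \<epsilon>" "\<epsilon> \<le> 1" "0 < t" "t < T" "0 < z" for \<epsilon> t x z
  proof -
    let ?E = "exp (- \<bar>x\<bar>) * exp (- z)"
    have gi: "integrable ?N (\<lambda>n. C * (1/2) ^ n * ?E)" by (intro integrable_mult_left integrable_geometric)
    have b: "norm (\<Phi> \<epsilon> n (of_real t) (of_real x) * w \<epsilon> n (of_real t) (of_real z)) \<le> C * (1/2) ^ n * ?E" for n
      using C(2)[OF *(1,2), of "of_real t" "of_real x" "of_real z" n] * by simp
    have "integrable ?N (\<lambda>n. \<Phi> \<epsilon> n (of_real t) (of_real x) * w \<epsilon> n (of_real t) (of_real z))"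
      by (rule Bochner_Integration.integrable_bound[OF gi]) (use b in \<open>auto intro: order_trans[OF _ abs_ge_self]\<close>)
    from norm_integral_le_integral[OF this gi b]
    have "norm (V \<epsilon> (of_real t) (of_real x) (of_real z)) \<le> (\<integral>n. C * (1/2) ^ n * ?E \<partial>?N)" unfolding V_def .
    then show ?thesis by (simp only: integral_mult_left_zero)
  qed
  then show ?thesis by blast
qed

lemma V_0: "V \<epsilon> t x 0 = 0" by (simp add: V_def w_real_0)

lemma hol_solution_V:
  assumes \<epsilon>: "0 < \<epsilon>" "\<epsilon> \<le> 1" shows "hol_solution \<epsilon> T (heat_flow a \<psi>u \<epsilon>) (V \<epsilon>)"
  unfolding hol_solution_def
  using V_holomorphic[OF \<epsilon>] continuous_on_V_real[OF \<epsilon>] V_0 by (simp add: u_def heat_flow_def)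

text \<open>A real profile \<open>\<psi>u\<close> makes the displacement t U real, so the x-factor
  is evaluated on the real line, where its decay is known. Since |t U| is at most T M, the shift
  costs at most the factor exp (T M).\<close>

lemma model_family_V:
  assumes real: "\<And>y. Im (\<psi>u y) = 0"
  shows "model_family T a \<psi>u V (\<lambda>t x z. heat (of_real a) \<psi>f (of_real x - of_real t * heat (of_real a) \<psi>u (of_real z)) * heat (of_real a) \<psi>q (of_real z))"
proof -
  have imU: "heat (of_real a) \<psi>u (of_real z) = of_real (Re (heat (of_real a) \<psi>u (of_real z)))" for z
    by (rule heat_real_valued[where \<psi> = \<psi>u, OF a real])
  obtain Cf where Cf: "Cf \<ge> 0" "\<And>\<tau> z. \<tau> \<in> Sec \<Longrightarrow> a \<le> Re \<tau> \<Longrightarrow> Re \<tau> \<le> a \<Longrightarrow> \<bar>Im z\<bar> \<le> \<bar>Re z\<bar> / 8 + 0 \<Longrightarrow> norm (heat \<tau> \<psi>f z) \<le> Cf * exp (- \<bar>Re z\<bar>)"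
    using norm_heat_compact_le[OF cf a, of a 0] by auto
  have Gb: "norm (heat (of_real a) \<psi>f (of_real x - of_real t * heat (of_real a) \<psi>u (of_real z)) * heat (of_real a) \<psi>q (of_real z))
     \<le> (Cf * exp (T * M) * B0) * (exp (- \<bar>x\<bar>) * exp (- z))" if t: "0 < t" "t < T" and z: "0 < z" for t x z
  proof -
    define U where "U = Re (heat (of_real a) \<psi>u (of_real z))"
    have aS: "of_real a \<in> Sec" using a by simp
    have "norm (heat (of_real a) \<psi>u (of_real z)) \<le> M * exp (- \<bar>Re (of_real z)\<bar>)"
      by (rule M(2)[OF aS]) (use T in auto)
    also have "\<dots> \<le> M * 1" using M(1) by (intro mult_left_mono) auto
    finally have U: "\<bar>U\<bar> \<le> M" using abs_Re_le_cmod[of "heat (of_real a) \<psi>u (of_real z)"] by (simp add: U_def)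
    have "\<bar>t * U\<bar> \<le> T * M" unfolding abs_mult using t U by (intro mult_mono) auto
    then have "\<bar>x\<bar> \<le> \<bar>x - t * U\<bar> + T * M" by linarith
    then have e: "exp (- \<bar>x - t * U\<bar>) \<le> exp (T * M + - \<bar>x\<bar>)" by simp
    have eq: "of_real x - of_real t * heat (of_real a) \<psi>u (of_real z) = of_real (x - t * U)" using imU[of z] by (simp add: U_def)
    have "norm (heat (of_real a) \<psi>f (of_real (x - t * U))) \<le> Cf * exp (- \<bar>Re (of_real (x - t * U))\<bar>)"
      by (rule Cf(2)[OF aS]) (use a in \<open>auto simp del: of_real_diff of_real_mult\<close>)
    also have "\<dots> \<le> Cf * exp (T * M + - \<bar>x\<bar>)" using e Cf(1) by (intro mult_left_mono) auto
    finally have 1: "norm (heat (of_real a) \<psi>f (of_real (x - t * U))) \<le> Cf * exp (T * M + - \<bar>x\<bar>)" .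
    have 2: "norm (heat (of_real a) \<psi>q (of_real z)) \<le> B0 * exp (- z)"
      using B0(2)[OF aS, of "of_real z"] T z by simp
    have "norm (heat (of_real a) \<psi>f (of_real (x - t * U)) * heat (of_real a) \<psi>q (of_real z)) \<le> (Cf * exp (T * M + - \<bar>x\<bar>)) * (B0 * exp (- z))"
      unfolding norm_mult using 1 2 Cf(1) by (intro mult_mono) auto
    also have "\<dots> = (Cf * exp (T * M) * B0) * (exp (- \<bar>x\<bar>) * exp (- z))" by (simp only: exp_add mult_ac)
    finally show ?thesis unfolding eq .
  qed
  show ?thesis
    unfolding model_family_def
  proof (intro conjI)
    show "\<forall>\<epsilon>. 0 < \<epsilon> \<longrightarrow> \<epsilon> \<le> 1 \<longrightarrow> hol_solution \<epsilon> T (heat_flow a \<psi>u \<epsilon>) (V \<epsilon>)"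
      by (intro allI impI hol_solution_V)
    show "\<exists>K. \<forall>t x z. 0 < t \<longrightarrow> t < T \<longrightarrow> 0 < z \<longrightarrow> norm (heat (of_real a) \<psi>f (of_real x - of_real t * heat (of_real a) \<psi>u (of_real z)) * heat (of_real a) \<psi>q (of_real z))
       \<le> K * (exp (- \<bar>x\<bar>) * exp (- z))"
      by (intro exI[of _ "Cf * exp (T * M) * B0"] allI impI Gb)
    show "continuous_on UNIV (\<lambda>p :: real \<times> real \<times> real. heat (of_real a) \<psi>f (of_real (fst (snd p)) - of_real (fst p) * heat (of_real a) \<psi>u (of_real (snd (snd p)))) * heat (of_real a) \<psi>q (of_real (snd (snd p))))"
      by (intro continuous_intros continuous_on_heat_real[OF _ a] cu cq cf)
    show "\<forall>\<epsilon> t t0 x z. (\<forall>k. 0 < \<epsilon> k \<and> \<epsilon> k \<le> 1 \<and> 0 < t k \<and> t k < T) \<longrightarrow> \<epsilon> \<longlonglongrightarrow> 0 \<longrightarrow> t \<longlonglongrightarrow> t0 \<longrightarrow> 0 < z \<longrightarrow>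
        (\<lambda>k. V (\<epsilon> k) (of_real (t k)) (of_real x) (of_real z)) \<longlonglongrightarrow>
          heat (of_real a) \<psi>f (of_real x - of_real t0 * heat (of_real a) \<psi>u (of_real z)) * heat (of_real a) \<psi>q (of_real z)"
    proof (intro allI impI)
      fix \<epsilon> t :: "nat \<Rightarrow> real" and t0 x z :: real
      assume *: "\<forall>k. 0 < \<epsilon> k \<and> \<epsilon> k \<le> 1 \<and> 0 < t k \<and> t k < T" "\<epsilon> \<longlonglongrightarrow> 0" "t \<longlonglongrightarrow> t0" "0 < z"
      have 1: "0 < \<epsilon> k" "\<epsilon> k \<le> 1" "0 < t k" "t k < T" for k using *(1) by blast+
      show "(\<lambda>k. V (\<epsilon> k) (of_real (t k)) (of_real x) (of_real z)) \<longlonglongrightarrow>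
          heat (of_real a) \<psi>f (of_real x - of_real t0 * heat (of_real a) \<psi>u (of_real z)) * heat (of_real a) \<psi>q (of_real z)"
        by (rule V_tendsto[OF 1(1,2) *(2) 1(3,4) *(3,4)])
    qed
  qed (rule norm_V_le)
qed

end

section \<open>Superposition of solutions\<close>

lemma sep_hol3_lincomb:
  assumes V: "sep_hol3 A B C V" and W: "sep_hol3 A B C W"
  shows "sep_hol3 A B C (\<lambda>t x z. V t x z + c * W t x z)"
  unfolding sep_hol3_def
proof (intro conjI ballI)
  fix t x z assume *: "t \<in> A" "x \<in> B" "z \<in> C"
  obtain d1 K1 where 1: "d1 > 0" "\<forall>s\<in>ball t d1. \<forall>y\<in>ball x d1. \<forall>w\<in>ball z d1. norm (V s y w) \<le> K1"
    using V * unfolding sep_hol3_def by blast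
  obtain d2 K2 where 2: "d2 > 0" "\<forall>s\<in>ball t d2. \<forall>y\<in>ball x d2. \<forall>w\<in>ball z d2. norm (W s y w) \<le> K2"
    using W * unfolding sep_hol3_def by blast
  have "norm (V s y w + c * W s y w) \<le> K1 + norm c * K2"
    if "s \<in> ball t (min d1 d2)" "y \<in> ball x (min d1 d2)" "w \<in> ball z (min d1 d2)" for s y w
  proof -
    have "norm (V s y w) \<le> K1" "norm (W s y w) \<le> K2" using 1 2 that by auto
    then show ?thesis by (intro order_trans[OF norm_triangle_ineq] add_mono) (auto simp: norm_mult intro: mult_left_mono)
  qed
  then show "\<exists>d>0. \<exists>K. \<forall>s\<in>ball t d. \<forall>y\<in>ball x d. \<forall>w\<in>ball z d. norm (V s y w + c * W s y w) \<le> K"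
    using 1(1) 2(1) by (intro exI[of _ "min d1 d2"] conjI exI[of _ "K1 + norm c * K2"]) auto
qed (use V W in \<open>auto simp: sep_hol3_def intro!: holomorphic_intros\<close>)

lemma deriv_lincomb:
  assumes "f holomorphic_on S" "g holomorphic_on S" "open S" "z \<in> S"
  shows "deriv (\<lambda>z. f z + c * g z) z = deriv f z + c * deriv g z"
  by (rule DERIV_imp_deriv, rule DERIV_add, rule holomorphic_derivI[OF assms(1,3,4)],
      rule DERIV_cmult, rule holomorphic_derivI[OF assms(2,3,4)])

lemma deriv_deriv_lincomb:
  assumes "f holomorphic_on S" "g holomorphic_on S" "open S" "z \<in> S"
  shows "deriv (deriv (\<lambda>z. f z + c * g z)) z = deriv (deriv f) z + c * deriv (deriv g) z"
proof -
  have "deriv (deriv (\<lambda>z. f z + c * g z)) z = deriv (\<lambda>z. deriv f z + c * deriv g z) z"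
    using eventually_nhds_in_open[OF assms(3,4)] deriv_lincomb[OF assms(1,2,3)]
    by (intro deriv_cong_ev) (auto elim: eventually_mono)
  also have "\<dots> = deriv (deriv f) z + c * deriv (deriv g) z"
    by (rule deriv_lincomb[OF holomorphic_deriv[OF assms(1,3)] holomorphic_deriv[OF assms(2,3)] assms(3,4)])
  finally show ?thesis .
qed

lemma hol_solution_lincomb:
  assumes V: "hol_solution \<epsilon> T U V" and W: "hol_solution \<epsilon> T U W"
  shows "hol_solution \<epsilon> T U (\<lambda>t x z. V t x z + c * W t x z)"
  unfolding hol_solution_def
proof (intro conjI allI impI)
  show "sep_hol3 (St T) UNIV Cone (\<lambda>t x z. V t x z + c * W t x z)"
    using V W by (intro sep_hol3_lincomb) (auto simp: hol_solution_def)
  show "continuous_on ({0<..<T} \<times> UNIV \<times> {0..})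
     (\<lambda>p. V (of_real (fst p)) (of_real (fst (snd p))) (of_real (snd (snd p))) + c * W (of_real (fst p)) (of_real (fst (snd p))) (of_real (snd (snd p))))"
    using V W by (intro continuous_intros) (auto simp: hol_solution_def)
  show "V t x 0 + c * W t x 0 = 0" for t x using V W by (auto simp: hol_solution_def)
  fix t x z :: real assume *: "0 < t" "t < T" "0 < z"
  have tz: "complex_of_real t \<in> St T" "complex_of_real z \<in> Cone" using * by auto
  have h: "(\<lambda>t. V t (of_real x) (of_real z)) holomorphic_on St T" "(\<lambda>t. W t (of_real x) (of_real z)) holomorphic_on St T"
     "(\<lambda>x. V (of_real t) x (of_real z)) holomorphic_on UNIV" "(\<lambda>x. W (of_real t) x (of_real z)) holomorphic_on UNIV"
     "V (of_real t) (of_real x) holomorphic_on Cone" "W (of_real t) (of_real x) holomorphic_on Cone"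
    using V W tz unfolding hol_solution_def sep_hol3_def by auto
  have e: "deriv (\<lambda>t. V t (of_real x) (of_real z)) (of_real t) + U (of_real t) (of_real z) * deriv (\<lambda>x. V (of_real t) x (of_real z)) (of_real x)
        = of_real \<epsilon> * (deriv (deriv (\<lambda>x. V (of_real t) x (of_real z))) (of_real x) + deriv (deriv (V (of_real t) (of_real x))) (of_real z))"
    "deriv (\<lambda>t. W t (of_real x) (of_real z)) (of_real t) + U (of_real t) (of_real z) * deriv (\<lambda>x. W (of_real t) x (of_real z)) (of_real x)
        = of_real \<epsilon> * (deriv (deriv (\<lambda>x. W (of_real t) x (of_real z))) (of_real x) + deriv (deriv (W (of_real t) (of_real x))) (of_real z))"
    using V W * unfolding hol_solution_def by blast+
  have lin: "a1 + c * b1 + u * (a2 + c * b2) = e * ((a3 + c * b3) + (a4 + c * b4))"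
    if "a1 + u * a2 = e * (a3 + a4)" "b1 + u * b2 = e * (b3 + b4)" for a1 a2 a3 a4 b1 b2 b3 b4 u e :: complex
  proof -
    have "a1 + c * b1 + u * (a2 + c * b2) = (a1 + u * a2) + c * (b1 + u * b2)" by (simp add: algebra_simps)
    then show ?thesis unfolding that by (simp add: algebra_simps)
  qed
  show "deriv (\<lambda>t. V t (of_real x) (of_real z) + c * W t (of_real x) (of_real z)) (of_real t) + U (of_real t) (of_real z) *
        deriv (\<lambda>x. V (of_real t) x (of_real z) + c * W (of_real t) x (of_real z)) (of_real x)
        = of_real \<epsilon> * (deriv (deriv (\<lambda>x. V (of_real t) x (of_real z) + c * W (of_real t) x (of_real z))) (of_real x) +
        deriv (deriv (\<lambda>z. V (of_real t) (of_real x) z + c * W (of_real t) (of_real x) z)) (of_real z))"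
    unfolding deriv_lincomb[OF h(1,2) open_St tz(1)] deriv_lincomb[OF h(3,4) open_UNIV UNIV_I]
      deriv_deriv_lincomb[OF h(3,4) open_UNIV UNIV_I] deriv_deriv_lincomb[OF h(5,6) open_Cone tz(2)]
    by (rule lin[OF e])
qed

lemma model_family_lincomb:
  assumes V: "model_family T a \<psi>u V G" and W: "model_family T a \<psi>u W H"
  shows "model_family T a \<psi>u (\<lambda>\<epsilon> t x z. V \<epsilon> t x z + c * W \<epsilon> t x z) (\<lambda>t x z. G t x z + c * H t x z)"
  unfolding model_family_def
proof (intro conjI)
  show "\<forall>\<epsilon>. 0 < \<epsilon> \<longrightarrow> \<epsilon> \<le> 1 \<longrightarrow> hol_solution \<epsilon> T (heat_flow a \<psi>u \<epsilon>) (\<lambda>t x z. V \<epsilon> t x z + c * W \<epsilon> t x z)"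
    using V W unfolding model_family_def by (auto intro: hol_solution_lincomb)
  have comb: "norm (v + c * w) \<le> (K1 + norm c * K2) * E" if "norm v \<le> K1 * E" "norm w \<le> K2 * E" for v w K1 K2 E
  proof -
    have "norm (v + c * w) \<le> norm v + norm c * norm w" by (metis norm_triangle_ineq norm_mult)
    also have "\<dots> \<le> K1 * E + norm c * (K2 * E)" using that by (intro add_mono mult_left_mono) auto
    finally show ?thesis by (simp add: algebra_simps)
  qed
  obtain K1 where K1: "\<forall>\<epsilon> t x z. 0 < \<epsilon> \<longrightarrow> \<epsilon> \<le> 1 \<longrightarrow> 0 < t \<longrightarrow> t < T \<longrightarrow> 0 < z \<longrightarrow>
        norm (V \<epsilon> (of_real t) (of_real x) (of_real z)) \<le> K1 * (exp (- \<bar>x\<bar>) * exp (- z))"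
    using V[unfolded model_family_def, THEN conjunct2, THEN conjunct1] by (rule exE)
  obtain K2 where K2: "\<forall>\<epsilon> t x z. 0 < \<epsilon> \<longrightarrow> \<epsilon> \<le> 1 \<longrightarrow> 0 < t \<longrightarrow> t < T \<longrightarrow> 0 < z \<longrightarrow>
        norm (W \<epsilon> (of_real t) (of_real x) (of_real z)) \<le> K2 * (exp (- \<bar>x\<bar>) * exp (- z))"
    using W[unfolded model_family_def, THEN conjunct2, THEN conjunct1] by (rule exE)
  show "\<exists>K. \<forall>\<epsilon> t x z. 0 < \<epsilon> \<longrightarrow> \<epsilon> \<le> 1 \<longrightarrow> 0 < t \<longrightarrow> t < T \<longrightarrow> 0 < z \<longrightarrow>
        norm (V \<epsilon> (of_real t) (of_real x) (of_real z) + c * W \<epsilon> (of_real t) (of_real x) (of_real z)) \<le> K * (exp (- \<bar>x\<bar>) * exp (- z))"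
    by (intro exI[of _ "K1 + norm c * K2"] allI impI comb) (use K1 K2 in auto)
  obtain L1 where L1: "\<forall>t x z. 0 < t \<longrightarrow> t < T \<longrightarrow> 0 < z \<longrightarrow> norm (G t x z) \<le> L1 * (exp (- \<bar>x\<bar>) * exp (- z))"
    using V[unfolded model_family_def, THEN conjunct2, THEN conjunct2, THEN conjunct1] by (rule exE)
  obtain L2 where L2: "\<forall>t x z. 0 < t \<longrightarrow> t < T \<longrightarrow> 0 < z \<longrightarrow> norm (H t x z) \<le> L2 * (exp (- \<bar>x\<bar>) * exp (- z))"
    using W[unfolded model_family_def, THEN conjunct2, THEN conjunct2, THEN conjunct1] by (rule exE)
  show "\<exists>K. \<forall>t x z. 0 < t \<longrightarrow> t < T \<longrightarrow> 0 < z \<longrightarrow> norm (G t x z + c * H t x z) \<le> K * (exp (- \<bar>x\<bar>) * exp (- z))"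
    by (intro exI[of _ "L1 + norm c * L2"] allI impI comb) (use L1 L2 in auto)
  show "continuous_on UNIV (\<lambda>p. G (fst p) (fst (snd p)) (snd (snd p)) + c * H (fst p) (fst (snd p)) (snd (snd p)))"
    using V W unfolding model_family_def by (intro continuous_intros) auto
  show "\<forall>\<epsilon> t t0 x z. (\<forall>k. 0 < \<epsilon> k \<and> \<epsilon> k \<le> 1 \<and> 0 < t k \<and> t k < T) \<longrightarrow> \<epsilon> \<longlonglongrightarrow> 0 \<longrightarrow> t \<longlonglongrightarrow> t0 \<longrightarrow> 0 < z \<longrightarrow>
        (\<lambda>k. V (\<epsilon> k) (of_real (t k)) (of_real x) (of_real z) + c * W (\<epsilon> k) (of_real (t k)) (of_real x) (of_real z)) \<longlonglongrightarrow> G t0 x z + c * H t0 x z"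
  proof (intro allI impI)
    fix \<epsilon> t :: "nat \<Rightarrow> real" and t0 x z :: real
    assume *: "\<forall>k. 0 < \<epsilon> k \<and> \<epsilon> k \<le> 1 \<and> 0 < t k \<and> t k < T" "\<epsilon> \<longlonglongrightarrow> 0" "t \<longlonglongrightarrow> t0" "0 < z"
    have "(\<lambda>k. V (\<epsilon> k) (of_real (t k)) (of_real x) (of_real z)) \<longlonglongrightarrow> G t0 x z"
         "(\<lambda>k. W (\<epsilon> k) (of_real (t k)) (of_real x) (of_real z)) \<longlonglongrightarrow> H t0 x z"
      using V[unfolded model_family_def, THEN conjunct2, THEN conjunct2, THEN conjunct2, THEN conjunct2, rule_format, OF *(1)[rule_format] *(2-4)]
        W[unfolded model_family_def, THEN conjunct2, THEN conjunct2, THEN conjunct2, THEN conjunct2, rule_format, OF *(1)[rule_format] *(2-4)]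
      by blast+
    then show "(\<lambda>k. V (\<epsilon> k) (of_real (t k)) (of_real x) (of_real z) + c * W (\<epsilon> k) (of_real (t k)) (of_real x) (of_real z)) \<longlonglongrightarrow> G t0 x z + c * H t0 x z"
      by (intro tendsto_intros)
  qed
qed

lemma model_family_zero: "model_family T a \<psi>u (\<lambda>\<epsilon> t x z. 0) (\<lambda>t x z. 0)"
  unfolding model_family_def hol_solution_def sep_hol3_def
  by (auto intro!: exI[of _ 1])

section \<open>Real parts of holomorphic solutions\<close>

lemma deriv_Re_of_real:
  assumes f: "f holomorphic_on S" "open S" "of_real x \<in> S"
  shows "deriv (\<lambda>s. Re (f (of_real s))) x = Re (deriv f (of_real x))"
proof -
  have "(f has_field_derivative deriv f (of_real x)) (at (of_real x))" by (rule holomorphic_derivI[OF f])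
  from has_vector_derivative_real_field[OF this]
  have "((\<lambda>s. Re (f (of_real s))) has_vector_derivative Re (deriv f (of_real x))) (at x)"
    by (rule bounded_linear.has_vector_derivative[OF bounded_linear_Re])
  then show ?thesis by (intro DERIV_imp_deriv) (simp add: has_real_derivative_iff_has_vector_derivative)
qed

lemma deriv_deriv_Re_of_real:
  assumes f: "f holomorphic_on S" "open S" "of_real x \<in> S"
  shows "deriv (deriv (\<lambda>s. Re (f (of_real s)))) x = Re (deriv (deriv f) (of_real x))"
proof -
  have "open (of_real -` S :: real set)" by (rule open_vimage[OF f(2)]) (auto intro!: continuous_intros)
  then have "eventually (\<lambda>s. s \<in> of_real -` S) (nhds x)" using f(3) by (intro eventually_nhds_in_open) auto
  then have "eventually (\<lambda>s. deriv (\<lambda>s. Re (f (of_real s))) s = Re (deriv f (of_real s))) (nhds x)"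
    by eventually_elim (use deriv_Re_of_real[OF f(1,2)] in auto)
  then have "deriv (deriv (\<lambda>s. Re (f (of_real s)))) x = deriv (\<lambda>s. Re (deriv f (of_real s))) x"
    by (rule deriv_cong_ev) simp
  also have "\<dots> = Re (deriv (deriv f) (of_real x))"
    by (rule deriv_Re_of_real[OF holomorphic_deriv[OF f(1,2)] f(2,3)])
  finally show ?thesis .
qed

text \<open>The velocity is real at real points, so it can be pulled out of the real part, and Re V
  solves the same linear equation. Smoothness comes from \<open>smooth_on_sep_hol2\<close> and
  \<open>smooth_on_sep_hol3\<close>, the wall value of u from oddness.\<close>

lemma depleted_NS_sol_Re:
  assumes T: "0 < T" and a: "0 < a" and \<epsilon>: "0 < \<epsilon>" "\<epsilon> \<le> 1"
    and \<psi>: "compact_profile \<psi>u" and odd: "\<And>y. \<psi>u (- y) = - \<psi>u y" and real: "\<And>y. Im (\<psi>u y) = 0"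
    and V: "hol_solution \<epsilon> T (heat_flow a \<psi>u \<epsilon>) V"
  shows "depleted_NS_sol \<epsilon> T (\<lambda>t z. Re (heat_flow a \<psi>u \<epsilon> (of_real t) (of_real z)))
     (\<lambda>t x z. Re (V (of_real t) (of_real x) (of_real z)))"
proof -
  obtain B where B: "exp_decay B \<psi>u" using compact_profile_exp_decay[OF \<psi>] by blast
  have S: "sep_hol (St T) UNIV (heat_flow a \<psi>u \<epsilon>)" unfolding heat_flow_def[abs_def]
    by (rule heat_sep_hol(1)[OF open_St, where B = B])
       (use time_shift_Sec[OF a \<epsilon>] B in \<open>auto intro!: holomorphic_intros\<close>)
  have Sh: "(\<lambda>t. heat_flow a \<psi>u \<epsilon> t z) holomorphic_on St T" "t \<in> St T \<Longrightarrow> heat_flow a \<psi>u \<epsilon> t holomorphic_on UNIV" for t z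
    using S by (auto simp: sep_hol_def)
  have Vs: "sep_hol3 (St T) UNIV Cone V" using V by (simp add: hol_solution_def)
  have Vh: "z \<in> Cone \<Longrightarrow> (\<lambda>t. V t x z) holomorphic_on St T" "t \<in> St T \<Longrightarrow> z \<in> Cone \<Longrightarrow> (\<lambda>x. V t x z) holomorphic_on UNIV"
      "t \<in> St T \<Longrightarrow> V t x holomorphic_on Cone" for t x z
    using Vs by (auto simp: sep_hol3_def)
  have o1: "open ({0<..<T} \<times> {0::real<..})" "open ({0<..<T} \<times> ((UNIV::real set) \<times> {0::real<..}))"
    by (intro open_Times open_greaterThanLessThan open_greaterThan open_UNIV)+
  show ?thesis
    unfolding depleted_NS_sol_def
  proof (intro conjI ballI allI impI)
    show "smooth_on ({0<..<T} \<times> {0<..}) (\<lambda>(t, z). Re (heat_flow a \<psi>u \<epsilon> (of_real t) (of_real z)))"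
      by (rule smooth_on_sep_hol2[OF S open_St open_UNIV o1(1)]) auto
    show "smooth_on ({0<..<T} \<times> UNIV \<times> {0<..}) (\<lambda>(t, x, z). Re (V (of_real t) (of_real x) (of_real z)))"
      by (rule smooth_on_sep_hol3[OF Vs open_St open_UNIV open_Cone o1(2)]) auto
    have cr: "continuous_on ({0<..<T} \<times> {0..}) (\<lambda>p::real\<times>real. (complex_of_real (fst p), complex_of_real (snd p)))"
      by (intro continuous_intros)
    have "continuous_on ({0<..<T} \<times> {0..}) (\<lambda>p::real\<times>real. heat_flow a \<psi>u \<epsilon> (fst (complex_of_real (fst p), complex_of_real (snd p))) (snd (complex_of_real (fst p), complex_of_real (snd p))))"
      by (rule continuous_on_compose2[OF sep_hol_continuous_on[OF S open_St open_UNIV] cr]) auto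
    then show "continuous_on ({0<..<T} \<times> {0..}) (\<lambda>(t, z). Re (heat_flow a \<psi>u \<epsilon> (of_real t) (of_real z)))"
      unfolding split_def by (intro continuous_intros) simp
    show "continuous_on ({0<..<T} \<times> UNIV \<times> {0..}) (\<lambda>(t, x, z). Re (V (of_real t) (of_real x) (of_real z)))"
      using V unfolding hol_solution_def split_def by (intro continuous_intros) auto
  next
    fix t z :: real assume t: "t \<in> {0<..<T}" and z: "0 < z"
    have tS: "of_real t \<in> St T" using t by simp
    have \<tau>: "of_real a + of_real \<epsilon> * of_real t \<in> Sec" by (rule time_shift_Sec(1)[OF a \<epsilon> tS])
    have "deriv (\<lambda>s. Re (heat_flow a \<psi>u \<epsilon> (of_real s) (of_real z))) t = Re (deriv (\<lambda>s. heat_flow a \<psi>u \<epsilon> s (of_real z)) (of_real t))"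
      by (rule deriv_Re_of_real[OF Sh(1) open_St tS])
    also have "deriv (\<lambda>s. heat_flow a \<psi>u \<epsilon> s (of_real z)) (of_real t) = of_real \<epsilon> * deriv (deriv (heat_flow a \<psi>u \<epsilon> (of_real t))) (of_real z)"
      unfolding heat_flow_def[abs_def] using DERIV_imp_deriv[OF DERIV_affine_time[OF heat_sep_hol_const[OF B] \<tau>]] heat_equation[OF B \<tau>] by simp
    also have "Re \<dots> = \<epsilon> * Re (deriv (deriv (heat_flow a \<psi>u \<epsilon> (of_real t))) (of_real z))" by simp
    also have "Re (deriv (deriv (heat_flow a \<psi>u \<epsilon> (of_real t))) (of_real z)) = deriv (deriv (\<lambda>y. Re (heat_flow a \<psi>u \<epsilon> (of_real t) (of_real y)))) z"
      by (rule deriv_deriv_Re_of_real[OF Sh(2)[OF tS] open_UNIV UNIV_I, symmetric])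
    finally show "deriv (\<lambda>s. Re (heat_flow a \<psi>u \<epsilon> (of_real s) (of_real z))) t = \<epsilon> * deriv (deriv (\<lambda>y. Re (heat_flow a \<psi>u \<epsilon> (of_real t) (of_real y)))) z" .
    fix x
    have zC: "of_real z \<in> Cone" using z by simp
    have U: "heat_flow a \<psi>u \<epsilon> (of_real t) (of_real z) = of_real (Re (heat_flow a \<psi>u \<epsilon> (of_real t) (of_real z)))"
    proof -
      have "0 < a + \<epsilon> * t" using a \<epsilon> t by (simp add: add_pos_pos)
      from heat_real_valued[where \<psi> = \<psi>u, OF this real, of z] show ?thesis by (simp add: heat_flow_def)
    qed
    have pde: "deriv (\<lambda>t. V t (of_real x) (of_real z)) (of_real t) + heat_flow a \<psi>u \<epsilon> (of_real t) (of_real z) * deriv (\<lambda>x. V (of_real t) x (of_real z)) (of_real x)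
        = of_real \<epsilon> * (deriv (deriv (\<lambda>x. V (of_real t) x (of_real z))) (of_real x) + deriv (deriv (V (of_real t) (of_real x))) (of_real z))"
      using V t z unfolding hol_solution_def by auto
    have re: "Re A + Re u * Re B = \<epsilon> * (Re C + Re D)" if "A + u * B = of_real \<epsilon> * (C + D)" "u = of_real (Re u)" for A u B C D
    proof -
      have "Im u = 0" using that(2) by (metis Im_complex_of_real)
      then show ?thesis using arg_cong[OF that(1), of Re] by simp
    qed
    show "deriv (\<lambda>s. Re (V (of_real s) (of_real x) (of_real z))) t + Re (heat_flow a \<psi>u \<epsilon> (of_real t) (of_real z)) * deriv (\<lambda>y. Re (V (of_real t) (of_real y) (of_real z))) x
        = \<epsilon> * (deriv (deriv (\<lambda>y. Re (V (of_real t) (of_real y) (of_real z)))) x + deriv (deriv (\<lambda>y. Re (V (of_real t) (of_real x) (of_real y)))) z)"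
      unfolding deriv_Re_of_real[OF Vh(1)[OF zC] open_St tS] deriv_Re_of_real[OF Vh(2)[OF tS zC] open_UNIV UNIV_I]
        deriv_deriv_Re_of_real[OF Vh(2)[OF tS zC] open_UNIV UNIV_I] deriv_deriv_Re_of_real[OF Vh(3)[OF tS] open_Cone zC]
      by (rule re[OF pde U])
  next
    fix t :: real
    show "Re (heat_flow a \<psi>u \<epsilon> (of_real t) (of_real 0)) = 0" by (simp add: heat_flow_def heat_odd_0 odd)
    show "Re (V (of_real t) (of_real x) (of_real 0)) = 0" for x using V by (simp add: hol_solution_def)
  qed
qed

subsection \<open>Density of step functions\<close>

lemma Lp_pow_alt:
  "Lp_pow p U f = (\<integral>\<^sup>+ x. ennreal (\<bar>indicator U x *\<^sub>R f x\<bar> powr p) \<partial>lborel)"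
  unfolding Lp_pow_def by (intro nn_integral_cong) (auto simp: indicator_def)

lemma Lp_pow_tendsto_0:
  fixes f :: "nat \<Rightarrow> 'a::euclidean_space \<Rightarrow> real"
  assumes p: "0 < p" and f: "\<And>k. (\<lambda>x. indicator U x *\<^sub>R f k x) \<in> borel_measurable borel"
    and h: "(\<lambda>x. indicator U x *\<^sub>R h x) \<in> borel_measurable borel" "Lp_pow p U h < \<infinity>"
    and bd: "\<And>k x. x \<in> U \<Longrightarrow> \<bar>f k x\<bar> \<le> h x"
    and lim: "AE x in lborel. x \<in> U \<longrightarrow> (\<lambda>k. f k x) \<longlonglongrightarrow> 0"
  shows "(\<lambda>k. Lp_pow p U (f k)) \<longlonglongrightarrow> 0"
proof -
  have "(\<lambda>k. \<integral>\<^sup>+ x. ennreal (\<bar>indicator U x *\<^sub>R f k x\<bar> powr p) \<partial>lborel) \<longlonglongrightarrow> (\<integral>\<^sup>+ x. 0 \<partial>(lborel :: 'a measure))"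
  proof (rule nn_integral_dominated_convergence[where w = "\<lambda>x. ennreal (\<bar>indicator U x *\<^sub>R h x\<bar> powr p)"])
    show "(\<lambda>x. ennreal (\<bar>indicator U x *\<^sub>R f k x\<bar> powr p)) \<in> borel_measurable lborel" for k
      using f[of k] by measurable
    show "(\<lambda>x. ennreal (\<bar>indicator U x *\<^sub>R h x\<bar> powr p)) \<in> borel_measurable lborel"
      using h(1) by measurable
    show "(\<integral>\<^sup>+ x. ennreal (\<bar>indicator U x *\<^sub>R h x\<bar> powr p) \<partial>lborel) < \<infinity>"
      using h(2) by (simp add: Lp_pow_alt)
    show "AE x in lborel. ennreal (\<bar>indicator U x *\<^sub>R f k x\<bar> powr p) \<le> ennreal (\<bar>indicator U x *\<^sub>R h x\<bar> powr p)" for k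
    proof (rule AE_I2)
      fix x :: 'a
      have "\<bar>indicator U x *\<^sub>R f k x\<bar> \<le> \<bar>indicator U x *\<^sub>R h x\<bar>"
        using bd[of x k] by (auto simp: indicator_def)
      then show "ennreal (\<bar>indicator U x *\<^sub>R f k x\<bar> powr p) \<le> ennreal (\<bar>indicator U x *\<^sub>R h x\<bar> powr p)"
        using p by (intro ennreal_leI powr_mono2) auto
    qed
    show "AE x in lborel. (\<lambda>k. ennreal (\<bar>indicator U x *\<^sub>R f k x\<bar> powr p)) \<longlonglongrightarrow> 0"
      using lim
    proof eventually_elim
      case (elim x)
      have "(\<lambda>k. indicator U x *\<^sub>R f k x) \<longlonglongrightarrow> 0"
        using elim by (cases "x \<in> U") auto
      then have "(\<lambda>k. \<bar>indicator U x *\<^sub>R f k x\<bar>) \<longlonglongrightarrow> 0" by (rule tendsto_rabs_zero)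
      then have "(\<lambda>k. \<bar>indicator U x *\<^sub>R f k x\<bar> powr p) \<longlonglongrightarrow> 0 powr p"
        by (rule tendsto_powr') (use p in auto)
      then have "(\<lambda>k. ennreal (\<bar>indicator U x *\<^sub>R f k x\<bar> powr p)) \<longlonglongrightarrow> ennreal 0"
        using p by (intro tendsto_ennrealI) simp
      then show ?case by simp
    qed
  qed auto
  then show ?thesis by (simp add: Lp_pow_alt)
qed

lemma powr_add_le:
  fixes a b :: real
  assumes "0 < p" shows "\<bar>a + b\<bar> powr p \<le> 2 powr p * (\<bar>a\<bar> powr p + \<bar>b\<bar> powr p)"
proof -
  have "\<bar>a + b\<bar> powr p \<le> (2 * max \<bar>a\<bar> \<bar>b\<bar>) powr p"
    using assms by (intro powr_mono2) auto
  also have "\<dots> = 2 powr p * (max \<bar>a\<bar> \<bar>b\<bar>) powr p" by (simp add: powr_mult)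
  also have "\<dots> \<le> 2 powr p * (\<bar>a\<bar> powr p + \<bar>b\<bar> powr p)"
    by (intro mult_left_mono) (auto simp: max_def)
  finally show ?thesis .
qed

lemma Lp_pow_add_le:
  fixes f g :: "'a::euclidean_space \<Rightarrow> real"
  assumes p: "0 < p" and f: "(\<lambda>x. indicator U x *\<^sub>R f x) \<in> borel_measurable borel"
    and g: "(\<lambda>x. indicator U x *\<^sub>R g x) \<in> borel_measurable borel"
  shows "Lp_pow p U (\<lambda>x. f x + g x) \<le> ennreal (2 powr p) * (Lp_pow p U f + Lp_pow p U g)"
proof -
  have mf: "(\<lambda>x. ennreal (\<bar>indicator U x *\<^sub>R f x\<bar> powr p)) \<in> borel_measurable lborel" using f by measurable
  have mg: "(\<lambda>x. ennreal (\<bar>indicator U x *\<^sub>R g x\<bar> powr p)) \<in> borel_measurable lborel" using g by measurable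
  have "Lp_pow p U (\<lambda>x. f x + g x) \<le> (\<integral>\<^sup>+ x. ennreal (2 powr p) * (ennreal (\<bar>indicator U x *\<^sub>R f x\<bar> powr p) + ennreal (\<bar>indicator U x *\<^sub>R g x\<bar> powr p)) \<partial>lborel)"
    unfolding Lp_pow_alt
  proof (rule nn_integral_mono)
    fix x :: 'a
    have "\<bar>indicator U x *\<^sub>R (f x + g x)\<bar> powr p \<le> 2 powr p * (\<bar>indicator U x *\<^sub>R f x\<bar> powr p + \<bar>indicator U x *\<^sub>R g x\<bar> powr p)"
      unfolding scaleR_add_right by (rule powr_add_le[OF p])
    then have "ennreal (\<bar>indicator U x *\<^sub>R (f x + g x)\<bar> powr p) \<le> ennreal (2 powr p * (\<bar>indicator U x *\<^sub>R f x\<bar> powr p + \<bar>indicator U x *\<^sub>R g x\<bar> powr p))"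
      by (rule ennreal_leI)
    then show "ennreal (\<bar>indicator U x *\<^sub>R (f x + g x)\<bar> powr p) \<le> ennreal (2 powr p) * (ennreal (\<bar>indicator U x *\<^sub>R f x\<bar> powr p) + ennreal (\<bar>indicator U x *\<^sub>R g x\<bar> powr p))"
      by (simp add: ennreal_mult ennreal_plus)
  qed
  also have "\<dots> = ennreal (2 powr p) * (Lp_pow p U f + Lp_pow p U g)"
    unfolding Lp_pow_alt by (subst nn_integral_cmult, use mf mg in measurable, subst nn_integral_add[OF mf mg], rule refl)
  finally show ?thesis .
qed

lemma Lp_pow_cmult:
  assumes "(\<lambda>x. indicator U x *\<^sub>R f x) \<in> borel_measurable borel"
  shows "Lp_pow p U (\<lambda>x. c * f x) = ennreal (\<bar>c\<bar> powr p) * Lp_pow p U f"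
proof -
  have mf: "(\<lambda>x. ennreal (\<bar>indicator U x *\<^sub>R f x\<bar> powr p)) \<in> borel_measurable lborel" using assms by measurable
  have "Lp_pow p U (\<lambda>x. c * f x) = (\<integral>\<^sup>+ x. ennreal (\<bar>c\<bar> powr p) * ennreal (\<bar>indicator U x *\<^sub>R f x\<bar> powr p) \<partial>lborel)"
    unfolding Lp_pow_alt by (intro nn_integral_cong) (simp add: abs_mult powr_mult ennreal_mult[symmetric] mult.left_commute)
  also have "\<dots> = ennreal (\<bar>c\<bar> powr p) * Lp_pow p U f" unfolding Lp_pow_alt by (rule nn_integral_cmult[OF mf])
  finally show ?thesis .
qed

lemma Lp_pow_cong: "(\<And>x. x \<in> U \<Longrightarrow> f x = g x) \<Longrightarrow> Lp_pow p U f = Lp_pow p U g"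
  unfolding Lp_pow_def by (intro nn_integral_cong) (auto simp: indicator_def)

lemma Lp_pow_minus: "Lp_pow p U (\<lambda>x. f x - g x) = Lp_pow p U (\<lambda>x. g x - f x)"
  unfolding Lp_pow_def by (intro nn_integral_cong) (simp add: abs_minus_commute)

text \<open>A step function is a list of coefficients and corner points of open boxes.\<close>

definition stepf :: "(real \<times> 'a \<times> 'a) list \<Rightarrow> 'a::euclidean_space \<Rightarrow> real" where
  "stepf L x = (\<Sum>(c, a, b)\<leftarrow>L. c * indicator (box a b) x)"

lemma stepf_Nil [simp]: "stepf [] x = 0" by (simp add: stepf_def)
lemma stepf_Cons [simp]: "stepf ((c, a, b) # L) x = c * indicator (box a b) x + stepf L x" by (simp add: stepf_def)
lemma stepf_append: "stepf (L @ L') x = stepf L x + stepf L' x" by (simp add: stepf_def)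
lemma stepf_scale: "stepf (map (\<lambda>(c, a, b). (k * c, a, b)) L) x = k * stepf L x"
  by (induction L) (auto simp: algebra_simps)

lemma measurable_stepf [measurable]: "stepf L \<in> borel_measurable borel"
proof (induction L)
  case (Cons l L)
  obtain c a b where l: "l = (c, a, b)" by (cases l)
  have "(\<lambda>x. c * indicator (box a b) x + stepf L x) \<in> borel_measurable borel"
    using Cons by measurable
  then show ?case by (simp add: l)
qed simp

definition step_approx :: "real \<Rightarrow> ('a::euclidean_space \<Rightarrow> real) \<Rightarrow> bool" where
  "step_approx p f \<longleftrightarrow> f \<in> borel_measurable borel \<and> (\<forall>\<delta>>0. \<exists>L. Lp_pow p UNIV (\<lambda>x. f x - stepf L x) \<le> ennreal \<delta>)"

lemma Lp_pow_UNIV_add_le: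
  fixes f g :: "'a::euclidean_space \<Rightarrow> real"
  assumes "0 < p" "f \<in> borel_measurable borel" "g \<in> borel_measurable borel"
    and "Lp_pow p UNIV f \<le> ennreal (\<delta> / (2 * 2 powr p))" "Lp_pow p UNIV g \<le> ennreal (\<delta> / (2 * 2 powr p))" "0 < \<delta>"
  shows "Lp_pow p UNIV (\<lambda>x. f x + g x) \<le> ennreal \<delta>"
proof -
  have "Lp_pow p UNIV (\<lambda>x. f x + g x) \<le> ennreal (2 powr p) * (Lp_pow p UNIV f + Lp_pow p UNIV g)"
    by (rule Lp_pow_add_le) (use assms in auto)
  also have "\<dots> \<le> ennreal (2 powr p) * (ennreal (\<delta> / (2 * 2 powr p)) + ennreal (\<delta> / (2 * 2 powr p)))"
    using assms by (intro mult_left_mono add_mono) auto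
  also have "\<dots> = ennreal \<delta>"
    using assms(6) by (simp add: ennreal_plus[symmetric] ennreal_mult[symmetric] del: ennreal_plus)
  finally show ?thesis .
qed

lemma step_approx_add:
  assumes p: "0 < p" and f: "step_approx p f" and g: "step_approx p g"
  shows "step_approx p (\<lambda>x. f x + g x)"
  unfolding step_approx_def
proof (intro conjI allI impI)
  show "(\<lambda>x. f x + g x) \<in> borel_measurable borel" using f g by (auto simp: step_approx_def)
  fix \<delta> :: real assume \<delta>: "\<delta> > 0"
  have \<delta>': "\<delta> / (2 * 2 powr p) > 0" using \<delta> by simp
  obtain L L' where L: "Lp_pow p UNIV (\<lambda>x. f x - stepf L x) \<le> ennreal (\<delta> / (2 * 2 powr p))"
    "Lp_pow p UNIV (\<lambda>x. g x - stepf L' x) \<le> ennreal (\<delta> / (2 * 2 powr p))"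
    using f g \<delta>' unfolding step_approx_def by meson
  have "Lp_pow p UNIV (\<lambda>x. (f x - stepf L x) + (g x - stepf L' x)) \<le> ennreal \<delta>"
    by (rule Lp_pow_UNIV_add_le[OF p _ _ L \<delta>]) (use f g in \<open>auto simp: step_approx_def\<close>)
  then show "\<exists>L. Lp_pow p UNIV (\<lambda>x. f x + g x - stepf L x) \<le> ennreal \<delta>"
    by (intro exI[of _ "L @ L'"]) (simp add: stepf_append algebra_simps)
qed

lemma step_approx_limit:
  assumes p: "0 < p" and f: "f \<in> borel_measurable borel" and g: "\<And>k. step_approx p (g k)"
    and lim: "(\<lambda>k. Lp_pow p UNIV (\<lambda>x. f x - g k x)) \<longlonglongrightarrow> 0"
  shows "step_approx p f"
  unfolding step_approx_def
proof (intro conjI allI impI f)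
  fix \<delta> :: real assume \<delta>: "\<delta> > 0"
  have \<delta>': "\<delta> / (2 * 2 powr p) > 0" using \<delta> by simp
  then have "0 < ennreal (\<delta> / (2 * 2 powr p))" by simp
  from order_tendstoD(2)[OF lim this] obtain k where k: "Lp_pow p UNIV (\<lambda>x. f x - g k x) < ennreal (\<delta> / (2 * 2 powr p))"
    by (auto simp: eventually_sequentially)
  obtain L where L: "Lp_pow p UNIV (\<lambda>x. g k x - stepf L x) \<le> ennreal (\<delta> / (2 * 2 powr p))"
    using g[of k] \<delta>' unfolding step_approx_def by meson
  have "Lp_pow p UNIV (\<lambda>x. (f x - g k x) + (g k x - stepf L x)) \<le> ennreal \<delta>"
    by (rule Lp_pow_UNIV_add_le[OF p _ _ less_imp_le[OF k] L \<delta>]) (use f g[of k] in \<open>auto simp: step_approx_def\<close>)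
  then show "\<exists>L. Lp_pow p UNIV (\<lambda>x. f x - stepf L x) \<le> ennreal \<delta>" by (intro exI[of _ L]) simp
qed

lemma step_approx_cmult:
  assumes p: "0 < p" and f: "step_approx p f"
  shows "step_approx p (\<lambda>x. c * f x)"
  unfolding step_approx_def
proof (intro conjI allI impI)
  show "(\<lambda>x. c * f x) \<in> borel_measurable borel" using f by (auto simp: step_approx_def)
  fix \<delta> :: real assume \<delta>: "\<delta> > 0"
  define K where "K = \<bar>c\<bar> powr p + 1"
  have K: "K > 0" by (simp add: K_def add_nonneg_pos)
  then obtain L where L: "Lp_pow p UNIV (\<lambda>x. f x - stepf L x) \<le> ennreal (\<delta> / K)"
    using f \<delta> unfolding step_approx_def by (meson divide_pos_pos)
  have m: "(\<lambda>x. f x - stepf L x) \<in> borel_measurable borel" using f by (auto simp: step_approx_def)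
  have "Lp_pow p UNIV (\<lambda>x. c * (f x - stepf L x)) = ennreal (\<bar>c\<bar> powr p) * Lp_pow p UNIV (\<lambda>x. f x - stepf L x)"
    by (rule Lp_pow_cmult) (use m in simp)
  also have "\<dots> \<le> ennreal K * ennreal (\<delta> / K)" using L by (intro mult_mono) (auto simp: K_def intro!: ennreal_leI)
  also have "\<dots> = ennreal \<delta>" using K \<delta> by (simp add: ennreal_mult[symmetric])
  finally show "\<exists>L. Lp_pow p UNIV (\<lambda>x. c * f x - stepf L x) \<le> ennreal \<delta>"
    by (intro exI[of _ "map (\<lambda>(k, a, b). (c * k, a, b)) L"]) (simp only: stepf_scale right_diff_distrib)
qed

lemma step_approx_box: "step_approx p (indicator (box a b))"
  unfolding step_approx_def
  by (auto intro!: exI[of _ "[(1, a, b)]"] simp: Lp_pow_def)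

lemma step_approx_zero: "step_approx p (\<lambda>x. 0)"
  unfolding step_approx_def by (auto intro!: exI[of _ "[]"] simp: Lp_pow_def)

lemma step_approx_sum:
  assumes p: "0 < p" and "finite I" "\<And>i. i \<in> I \<Longrightarrow> step_approx p (f i)"
  shows "step_approx p (\<lambda>x. \<Sum>i\<in>I. f i x)"
  using assms(2,3) by (induction I rule: finite_induct) (auto intro: step_approx_zero step_approx_add[OF p])

lemma Lp_pow_indicator_box:
  assumes "0 < p" shows "Lp_pow p UNIV (indicator (box a b)) < \<infinity>"
proof -
  have "Lp_pow p UNIV (indicator (box a b)) = (\<integral>\<^sup>+ x. indicator (box a b) x \<partial>lborel)"
    unfolding Lp_pow_def using assms by (intro nn_integral_cong) (auto simp: indicator_def)
  also have "\<dots> = emeasure lborel (box a b)" by (rule nn_integral_indicator) simp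
  also have "\<dots> < \<infinity>" by (rule emeasure_lborel_box_finite)
  finally show ?thesis .
qed

text \<open>Dynkin's argument: boxes are closed under intersection and generate the Borel sets.
  Intersecting with a fixed box keeps all measures finite, and the complement becomes a difference
  of indicators inside that box.\<close>

lemma step_approx_indicator:
  fixes A :: "'a::euclidean_space set"
  assumes p: "0 < p" and A: "A \<in> sets borel"
  shows "step_approx p (indicator (A \<inter> box a b))"
proof -
  let ?E = "range (\<lambda>(a, b). box a b :: 'a set)"
  have E: "Int_stable ?E" by (auto simp: Int_stable_def box_Int_box)
  have A': "A \<in> sigma_sets UNIV ?E" using A by (simp add: borel_eq_box)
  have E2: "?E \<subseteq> Pow UNIV" by simp
  from E E2 A' show ?thesis
  proof (induction rule: sigma_sets_induct_disjoint)
    case (basic A)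
    then obtain c d where "A \<inter> box a b = box c d" by (auto simp: box_Int_box)
    then show ?case by (simp add: step_approx_box)
  next
    case empty then show ?case using step_approx_zero[of p] by simp
  next
    case (compl A)
    have "indicator ((UNIV - A) \<inter> box a b) = (\<lambda>x. indicator (box a b) x + (-1) * (indicator (A \<inter> box a b) x :: real))"
      by (auto simp: indicator_def)
    then show ?case using step_approx_add[OF p step_approx_box step_approx_cmult[OF p compl(2), of "-1"]] by simp
  next
    case (union A)
    have mA: "A i \<in> sets borel" for i using union(2) by (auto simp: borel_eq_box)
    show ?case
    proof (rule step_approx_limit[OF p])
      show "indicator ((\<Union>i. A i) \<inter> box a b) \<in> borel_measurable borel" using mA by auto
      show "step_approx p (\<lambda>x. \<Sum>i<k. indicator (A i \<inter> box a b) x)" for k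
        by (rule step_approx_sum[OF p]) (use union in auto)
      have e: "(\<Sum>i<k. indicator (A i \<inter> box a b) x) = (indicator ((\<Union>i<k. A i) \<inter> box a b) x :: real)" for k x
      proof -
        have "indicator ((\<Union>i<k. A i) \<inter> box a b) x = (indicator (\<Union>i<k. A i \<inter> box a b) x :: real)"
          by (simp add: indicator_def)
        also have "\<dots> = (\<Sum>i<k. indicator (A i \<inter> box a b) x)"
          by (rule indicator_UN_disjoint) (use union(1) in \<open>auto simp: disjoint_family_on_def\<close>)
        finally show ?thesis by simp
      qed
      show "(\<lambda>k. Lp_pow p UNIV (\<lambda>x. indicator ((\<Union>i. A i) \<inter> box a b) x - (\<Sum>i<k. indicator (A i \<inter> box a b) x))) \<longlonglongrightarrow> 0"
        unfolding e
      proof (rule Lp_pow_tendsto_0[OF p _ _ Lp_pow_indicator_box[OF p, of a b]])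
        show "(\<lambda>x. indicator UNIV x *\<^sub>R (indicator ((\<Union>i. A i) \<inter> box a b) x - indicator ((\<Union>i<k. A i) \<inter> box a b) x :: real)) \<in> borel_measurable borel" for k
          using mA by (intro borel_measurable_scaleR borel_measurable_diff borel_measurable_indicator) auto
        show "\<bar>indicator ((\<Union>i. A i) \<inter> box a b) x - indicator ((\<Union>i<k. A i) \<inter> box a b) x\<bar> \<le> (indicator (box a b) x :: real)" for k x
          by (auto simp: indicator_def)
        have "(\<lambda>k. indicator ((\<Union>i. A i) \<inter> box a b) x - indicator ((\<Union>i<k. A i) \<inter> box a b) x :: real) \<longlonglongrightarrow> 0" for x
        proof (cases "\<exists>i. x \<in> A i")
          case True
          then obtain i where i: "x \<in> A i" by blast
          have "eventually (\<lambda>k. 0 = (indicator ((\<Union>i. A i) \<inter> box a b) x - indicator ((\<Union>i<k. A i) \<inter> box a b) x :: real)) sequentially"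
            using eventually_gt_at_top[of i] by eventually_elim (use i in \<open>auto simp: indicator_def\<close>)
          then show ?thesis by (rule Lim_transform_eventually[OF tendsto_const])
        next
          case False
          then have "x \<notin> (\<Union>i. A i)" "\<And>k. x \<notin> (\<Union>i<k. A i)" by auto
          then show ?thesis by simp
        qed
        then show "AE x in lborel. x \<in> UNIV \<longrightarrow> (\<lambda>k. indicator ((\<Union>i. A i) \<inter> box a b) x - indicator ((\<Union>i<k. A i) \<inter> box a b) x :: real) \<longlonglongrightarrow> 0"
          by simp
      qed auto
    qed
  qed
qed

lemma step_approx_nonneg:
  fixes f :: "'a::euclidean_space \<Rightarrow> real"
  assumes p: "0 < p" and f: "f \<in> borel_measurable borel" "\<And>x. 0 \<le> f x" "Lp_pow p UNIV f < \<infinity>"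
  shows "step_approx p f"
proof -
  obtain s where s: "\<And>i. simple_function lborel (s i)" "incseq s" "\<And>i x. bdd_above (range (\<lambda>i. s i x))"
      "\<And>i x. 0 \<le> s i x" "f = (SUP i. s i)"
    using borel_measurable_implies_simple_function_sequence_real[of f lborel] f by (auto simp: le_fun_def)
  have fx: "f x = (SUP i. s i x)" for x using s(5) by (metis SUP_apply)
  have le: "s i x \<le> f x" for i x unfolding fx by (rule cSUP_upper[OF UNIV_I s(3)])
  have lim: "(\<lambda>i. s i x) \<longlonglongrightarrow> f x" for x unfolding fx
    by (rule LIMSEQ_incseq_SUP[OF s(3)]) (use s(2) in \<open>auto simp: incseq_def le_fun_def\<close>)
  \<comment> \<open>Growing cubes: cutting the simple functions off there turns their level sets
    into sets of the form treated by \<open>step_approx_indicator\<close>.\<close>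
  define Bx where "Bx i = box (- real i *\<^sub>R One) (real i *\<^sub>R One :: 'a)" for i
  show ?thesis
  proof (rule step_approx_limit[OF p f(1)])
    fix i
    have fin: "finite (range (s i))" using simple_functionD(1)[OF s(1), of i] by simp
    have m: "s i -` {y} \<in> sets borel" for y using simple_functionD(2)[OF s(1), of i "{y}"] by simp
    have "s i x * indicator (Bx i) x = (\<Sum>y\<in>range (s i). y * indicator (s i -` {y} \<inter> Bx i) x)" for x
    proof -
      have "(\<Sum>y\<in>range (s i). y * indicator (s i -` {y} \<inter> Bx i) x) = (\<Sum>y\<in>range (s i). if y = s i x then y * indicator (Bx i) x else 0)"
        by (intro sum.cong) (auto simp: indicator_def)
      also have "\<dots> = s i x * indicator (Bx i) x" by (simp add: sum.delta[OF fin])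
      finally show ?thesis by simp
    qed
    then have e: "(\<lambda>x. s i x * indicator (Bx i) x) = (\<lambda>x. \<Sum>y\<in>range (s i). y * indicator (s i -` {y} \<inter> Bx i) x)" by auto
    show "step_approx p (\<lambda>x. s i x * indicator (Bx i) x)" unfolding e unfolding Bx_def
      by (intro step_approx_sum[OF p fin] step_approx_cmult[OF p] step_approx_indicator[OF p] m)
  next
    have ms: "s i \<in> borel_measurable borel" for i using borel_measurable_simple_function[OF s(1), of i] by simp
    show "(\<lambda>k. Lp_pow p UNIV (\<lambda>x. f x - s k x * indicator (Bx k) x)) \<longlonglongrightarrow> 0"
    proof (rule Lp_pow_tendsto_0[OF p _ _ f(3)])
      show "(\<lambda>x. indicator UNIV x *\<^sub>R (f x - s k x * indicator (Bx k) x)) \<in> borel_measurable borel" for k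
        unfolding Bx_def using f(1) ms by measurable
      show "(\<lambda>x. indicator UNIV x *\<^sub>R f x) \<in> borel_measurable borel" using f(1) by simp
      show "\<bar>f x - s k x * indicator (Bx k) x\<bar> \<le> f x" for k x
        using le[of k x] s(4)[of k x] f(2)[of x] by (auto simp: indicator_def)
      have "(\<lambda>k. f x - s k x * indicator (Bx k) x) \<longlonglongrightarrow> 0" for x
      proof -
        obtain i0 :: nat where i0: "norm x < real i0" using reals_Archimedean2 by blast
        have "eventually (\<lambda>k. f x - s k x = f x - s k x * indicator (Bx k) x) sequentially"
          using eventually_ge_at_top[of i0]
        proof eventually_elim
          case (elim k)
          have "\<bar>x \<bullet> b\<bar> < real k" if "b \<in> Basis" for b using Basis_le_norm[OF that, of x] i0 elim by linarith
          then have "x \<in> Bx k" unfolding Bx_def mem_box by (auto simp: abs_less_iff) (metis minus_less_iff)+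
          then show ?case by simp
        qed
        moreover have "(\<lambda>k. f x - s k x) \<longlonglongrightarrow> 0" using tendsto_diff[OF tendsto_const lim[of x], of "f x"] by simp
        ultimately show ?thesis by (rule Lim_transform_eventually[rotated])
      qed
      then show "AE x in lborel. x \<in> UNIV \<longrightarrow> (\<lambda>k. f x - s k x * indicator (Bx k) x) \<longlonglongrightarrow> 0" by simp
    qed
  qed
qed

lemma Lp_pow_mono:
  assumes "0 < p" "\<And>x. x \<in> U \<Longrightarrow> \<bar>f x\<bar> \<le> \<bar>g x\<bar>"
  shows "Lp_pow p U f \<le> Lp_pow p U g"
  unfolding Lp_pow_def
  by (intro nn_integral_mono) (use assms in \<open>auto simp: indicator_def intro!: ennreal_leI powr_mono2\<close>)

lemma step_dense:
  fixes f :: "'a::euclidean_space \<Rightarrow> real"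
  assumes p: "0 < p" and f: "f \<in> borel_measurable borel" "Lp_pow p UNIV f < \<infinity>"
  shows "step_approx p f"
proof -
  have "Lp_pow p UNIV (\<lambda>x. max 0 (f x)) \<le> Lp_pow p UNIV f" "Lp_pow p UNIV (\<lambda>x. max 0 (- f x)) \<le> Lp_pow p UNIV f"
    by (rule Lp_pow_mono[OF p]; simp)+
  then have fin: "Lp_pow p UNIV (\<lambda>x. max 0 (f x)) < \<infinity>" "Lp_pow p UNIV (\<lambda>x. max 0 (- f x)) < \<infinity>"
    using f(2) by (auto intro: le_less_trans)
  have "step_approx p (\<lambda>x. max 0 (f x))" by (rule step_approx_nonneg[OF p _ _ fin(1)]) (use f(1) in auto)
  moreover have "step_approx p (\<lambda>x. max 0 (- f x))" by (rule step_approx_nonneg[OF p _ _ fin(2)]) (use f(1) in auto)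
  ultimately have "step_approx p (\<lambda>x. max 0 (f x))" "step_approx p (\<lambda>x. max 0 (- f x))" by auto
  from step_approx_add[OF p this(1) step_approx_cmult[OF p this(2), of "-1"]]
  have "step_approx p (\<lambda>x. max 0 (f x) + (- 1) * max 0 (- f x))" .
  moreover have "max 0 (f x) + (- 1) * max 0 (- f x) = f x" for x by (auto simp: max_def)
  ultimately show ?thesis by simp
qed

subsection \<open>The inviscid limit for smooth data\<close>

text \<open>If smallness failed, there would be \<epsilon> k < 1 / (k + 1) and times t k with error
  above \<delta>; a subsequence of the times converges in [0, T] and contradicts \<open>seq\<close>.
  The limit t0 may be an endpoint, hence \<open>seq\<close> puts no restriction on it.\<close>

lemma uniform_smallness_sequentially:
  fixes E :: "real \<Rightarrow> real \<Rightarrow> ennreal"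
  assumes seq: "\<And>\<epsilon> t t0. (\<And>k. 0 < \<epsilon> k \<and> \<epsilon> k \<le> 1 \<and> 0 < t k \<and> t k < T) \<Longrightarrow> \<epsilon> \<longlonglongrightarrow> 0 \<Longrightarrow> t \<longlonglongrightarrow> t0 \<Longrightarrow>
      (\<lambda>k. E (\<epsilon> k) (t k)) \<longlonglongrightarrow> 0"
    and \<delta>: "0 < \<delta>"
  shows "\<exists>\<epsilon>0>0. \<epsilon>0 \<le> 1 \<and> (\<forall>\<epsilon> t. 0 < \<epsilon> \<longrightarrow> \<epsilon> < \<epsilon>0 \<longrightarrow> 0 < t \<longrightarrow> t < T \<longrightarrow> E \<epsilon> t \<le> ennreal \<delta>)"
proof (rule ccontr)
  assume "\<not> ?thesis"
  then have "\<forall>\<epsilon>0. 0 < \<epsilon>0 \<and> \<epsilon>0 \<le> 1 \<longrightarrow> (\<exists>\<epsilon> t. 0 < \<epsilon> \<and> \<epsilon> < \<epsilon>0 \<and> 0 < t \<and> t < T \<and> \<not> E \<epsilon> t \<le> ennreal \<delta>)" by blast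
  then have "\<forall>k. \<exists>\<epsilon> t. 0 < \<epsilon> \<and> \<epsilon> < inverse (real (Suc k)) \<and> 0 < t \<and> t < T \<and> \<not> E \<epsilon> t \<le> ennreal \<delta>"
    by (simp add: inverse_le_1_iff)
  then obtain \<epsilon> t where et: "\<And>k. 0 < \<epsilon> k" "\<And>k. \<epsilon> k < inverse (real (Suc k))" "\<And>k. 0 < t k" "\<And>k. t k < T"
     "\<And>k. \<not> E (\<epsilon> k) (t k) \<le> ennreal \<delta>" by metis
  have e0: "\<epsilon> \<longlonglongrightarrow> 0"
    by (rule tendsto_sandwich[OF _ _ tendsto_const LIMSEQ_inverse_real_of_nat])
       (intro always_eventually allI less_imp_le et(1,2))+
  have "seq_compact {0..T}" using compact_Icc by (simp add: compact_eq_seq_compact_metric)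
  moreover have "\<forall>k. t k \<in> {0..T}" using et(3,4) by (auto intro: less_imp_le)
  ultimately obtain t0 r where r: "strict_mono r" "(t \<circ> r) \<longlonglongrightarrow> t0" unfolding seq_compact_def by metis
  have "(\<lambda>k. E ((\<epsilon> \<circ> r) k) ((t \<circ> r) k)) \<longlonglongrightarrow> 0"
  proof (rule seq[OF _ _ r(2)])
    show "(\<epsilon> \<circ> r) \<longlonglongrightarrow> 0" by (rule LIMSEQ_subseq_LIMSEQ[OF e0 r(1)])
    fix k
    have "inverse (real (Suc (r k))) \<le> 1" by (simp add: inverse_le_1_iff)
    then have "\<epsilon> (r k) \<le> 1" using et(2)[of "r k"] by linarith
    then show "0 < (\<epsilon> \<circ> r) k \<and> (\<epsilon> \<circ> r) k \<le> 1 \<and> 0 < (t \<circ> r) k \<and> (t \<circ> r) k < T"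
      using et(1,3,4) by simp
  qed
  moreover have "0 < ennreal \<delta>" using \<delta> by simp
  ultimately have "eventually (\<lambda>k. E ((\<epsilon> \<circ> r) k) ((t \<circ> r) k) < ennreal \<delta>) sequentially" by (rule order_tendstoD(2))
  then obtain k where "E ((\<epsilon> \<circ> r) k) ((t \<circ> r) k) < ennreal \<delta>" by (auto simp: eventually_sequentially)
  then show False using et(5)[of "r k"] by (simp add: less_imp_le)
qed

lemma Lp_pow_exp_finite:
  assumes p: "1 \<le> p"
  shows "Lp_pow p {0<..} (\<lambda>z::real. K * exp (- \<bar>z\<bar>)) < \<infinity>"
    and "Lp_pow p (UNIV \<times> {0<..}) (\<lambda>q::real \<times> real. K * (exp (- \<bar>fst q\<bar>) * exp (- \<bar>snd q\<bar>))) < \<infinity>"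
proof -
  \<comment> \<open>Since p is at least 1, exp (- p s) is at most exp (- s), which reduces both
    claims to the integrability of the exponential itself.\<close>
  have pw: "\<bar>K * exp (- s)\<bar> powr p \<le> \<bar>K\<bar> powr p * exp (- s)" if "0 \<le> s" for s
  proof -
    have "\<bar>K * exp (- s)\<bar> powr p = \<bar>K\<bar> powr p * exp (- s) powr p" by (simp add: abs_mult powr_mult)
    also have "exp (- s) powr p = exp (- (p * s))" by (simp add: powr_def)
    also have "\<bar>K\<bar> powr p * exp (- (p * s)) \<le> \<bar>K\<bar> powr p * exp (- s)"
      using mult_right_mono[OF p that] by (intro mult_left_mono) auto
    finally show ?thesis .
  qed
  have I: "(\<integral>\<^sup>+ x. ennreal (exp (- \<bar>x\<bar>)) \<partial>lborel) < \<infinity>"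
    using integrable_exp_abs by (simp add: nn_integral_eq_integral)
  have m: "(\<lambda>x::real. ennreal (exp (- \<bar>x\<bar>))) \<in> borel_measurable lborel" by measurable
  have "Lp_pow p {0<..} (\<lambda>z::real. K * exp (- \<bar>z\<bar>)) \<le> (\<integral>\<^sup>+ x. ennreal (\<bar>K\<bar> powr p) * ennreal (exp (- \<bar>x\<bar>)) \<partial>lborel)"
    unfolding Lp_pow_def
  proof (rule nn_integral_mono)
    fix x :: real
    have "ennreal (\<bar>K * exp (- \<bar>x\<bar>)\<bar> powr p) \<le> ennreal (\<bar>K\<bar> powr p * exp (- \<bar>x\<bar>))" by (rule ennreal_leI[OF pw]) simp
    then show "indicator {0<..} x * ennreal (\<bar>K * exp (- \<bar>x\<bar>)\<bar> powr p) \<le> ennreal (\<bar>K\<bar> powr p) * ennreal (exp (- \<bar>x\<bar>))"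
      by (auto simp: ennreal_mult indicator_def)
  qed
  also have "\<dots> = ennreal (\<bar>K\<bar> powr p) * (\<integral>\<^sup>+ x. ennreal (exp (- \<bar>x\<bar>)) \<partial>lborel)" by (rule nn_integral_cmult[OF m])
  also have "\<dots> < \<infinity>" using I by (simp add: ennreal_mult_less_top)
  finally show "Lp_pow p {0<..} (\<lambda>z::real. K * exp (- \<bar>z\<bar>)) < \<infinity>" .
  have m2: "(\<lambda>q::real\<times>real. ennreal (exp (- \<bar>fst q\<bar>)) * ennreal (exp (- \<bar>snd q\<bar>))) \<in> borel_measurable (lborel \<Otimes>\<^sub>M lborel)" by measurable
  have "Lp_pow p (UNIV \<times> {0<..}) (\<lambda>q::real \<times> real. K * (exp (- \<bar>fst q\<bar>) * exp (- \<bar>snd q\<bar>)))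
     \<le> (\<integral>\<^sup>+ q. ennreal (\<bar>K\<bar> powr p) * (ennreal (exp (- \<bar>fst q\<bar>)) * ennreal (exp (- \<bar>snd q\<bar>))) \<partial>(lborel \<Otimes>\<^sub>M lborel))"
    unfolding Lp_pow_def lborel_prod
  proof (rule nn_integral_mono)
    fix q :: "real \<times> real"
    have e: "exp (- \<bar>fst q\<bar>) * exp (- \<bar>snd q\<bar>) = exp (- (\<bar>fst q\<bar> + \<bar>snd q\<bar>))" by (simp add: exp_add[symmetric])
    have "ennreal (\<bar>K * (exp (- \<bar>fst q\<bar>) * exp (- \<bar>snd q\<bar>))\<bar> powr p) \<le> ennreal (\<bar>K\<bar> powr p * (exp (- \<bar>fst q\<bar>) * exp (- \<bar>snd q\<bar>)))"
      unfolding e by (rule ennreal_leI[OF pw]) simp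
    then show "indicator (UNIV \<times> {0<..}) q * ennreal (\<bar>K * (exp (- \<bar>fst q\<bar>) * exp (- \<bar>snd q\<bar>))\<bar> powr p) \<le> ennreal (\<bar>K\<bar> powr p) * (ennreal (exp (- \<bar>fst q\<bar>)) * ennreal (exp (- \<bar>snd q\<bar>)))"
      by (auto simp: ennreal_mult indicator_def)
  qed
  also have "\<dots> = ennreal (\<bar>K\<bar> powr p) * (\<integral>\<^sup>+ q. ennreal (exp (- \<bar>fst q\<bar>)) * ennreal (exp (- \<bar>snd q\<bar>)) \<partial>(lborel \<Otimes>\<^sub>M lborel))"
    by (rule nn_integral_cmult[OF m2])
  also have "(\<integral>\<^sup>+ q. ennreal (exp (- \<bar>fst q\<bar>)) * ennreal (exp (- \<bar>snd q\<bar>)) \<partial>(lborel \<Otimes>\<^sub>M lborel)) =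
     (\<integral>\<^sup>+ x. (\<integral>\<^sup>+ z. ennreal (exp (- \<bar>x\<bar>)) * ennreal (exp (- \<bar>z\<bar>)) \<partial>lborel) \<partial>lborel)"
    using lborel.nn_integral_fst[OF m2] by simp
  also have "\<dots> = (\<integral>\<^sup>+ x. ennreal (exp (- \<bar>x\<bar>)) \<partial>lborel) * (\<integral>\<^sup>+ z. ennreal (exp (- \<bar>z\<bar>)) \<partial>lborel)"
    by (simp add: nn_integral_cmult nn_integral_multc)
  also have "ennreal (\<bar>K\<bar> powr p) * \<dots> < \<infinity>" using I by (simp add: ennreal_mult_less_top)
  finally show "Lp_pow p (UNIV \<times> {0<..}) (\<lambda>q::real \<times> real. K * (exp (- \<bar>fst q\<bar>) * exp (- \<bar>snd q\<bar>))) < \<infinity>" .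
qed

lemma measurable_indicator_times_continuous:
  fixes f :: "'a::euclidean_space \<Rightarrow> real"
  assumes "continuous_on U f" "open U"
  shows "(\<lambda>x. indicator U x *\<^sub>R f x) \<in> borel_measurable borel"
  by (rule borel_measurable_continuous_on_indicator[OF _ assms(1)]) (use assms(2) in auto)

lemma open_half_plane: "open (UNIV \<times> {0<..} :: (real \<times> real) set)"
  by (intro open_Times open_UNIV open_greaterThan)

lemma model_family_converges:
  assumes T: "0 < T" and p: "1 \<le> p" and mf: "model_family T a \<psi>u V G" and \<delta>: "0 < \<delta>"
  shows "\<exists>\<epsilon>0>0. \<epsilon>0 \<le> 1 \<and> (\<forall>\<epsilon> t. 0 < \<epsilon> \<longrightarrow> \<epsilon> < \<epsilon>0 \<longrightarrow> 0 < t \<longrightarrow> t < T \<longrightarrow>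
     Lp_pow p (UNIV \<times> {0<..}) (\<lambda>q. Re (V \<epsilon> (of_real t) (of_real (fst q)) (of_real (snd q))) - Re (G t (fst q) (snd q))) \<le> ennreal \<delta>)"
proof (rule uniform_smallness_sequentially[OF _ \<delta>])
  fix \<epsilon> t :: "nat \<Rightarrow> real" and t0 :: real
  assume et: "\<And>k. 0 < \<epsilon> k \<and> \<epsilon> k \<le> 1 \<and> 0 < t k \<and> t k < T" and lim: "\<epsilon> \<longlonglongrightarrow> 0" "t \<longlonglongrightarrow> t0"
  note MF = mf[unfolded model_family_def]
  have hs: "hol_solution (\<epsilon> k) T (heat_flow a \<psi>u (\<epsilon> k)) (V (\<epsilon> k))" for k using MF et by blast
  obtain K1 where K1: "\<forall>\<epsilon> t x z. 0 < \<epsilon> \<longrightarrow> \<epsilon> \<le> 1 \<longrightarrow> 0 < t \<longrightarrow> t < T \<longrightarrow> 0 < z \<longrightarrow>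
        norm (V \<epsilon> (of_real t) (of_real x) (of_real z)) \<le> K1 * (exp (- \<bar>x\<bar>) * exp (- z))"
    using MF[THEN conjunct2, THEN conjunct1] by (rule exE)
  obtain K2 where K2: "\<forall>t x z. 0 < t \<longrightarrow> t < T \<longrightarrow> 0 < z \<longrightarrow> norm (G t x z) \<le> K2 * (exp (- \<bar>x\<bar>) * exp (- z))"
    using MF[THEN conjunct2, THEN conjunct2, THEN conjunct1] by (rule exE)
  have Gc: "continuous_on UNIV (\<lambda>p. G (fst p) (fst (snd p)) (snd (snd p)))"
    using MF[THEN conjunct2, THEN conjunct2, THEN conjunct2, THEN conjunct1] .
  have Vl: "(\<lambda>k. V (\<epsilon> k) (of_real (t k)) (of_real x) (of_real z)) \<longlonglongrightarrow> G t0 x z" if "0 < z" for x z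
    using MF[THEN conjunct2, THEN conjunct2, THEN conjunct2, THEN conjunct2, rule_format, OF et lim that] .
  show "(\<lambda>k. Lp_pow p (UNIV \<times> {0<..}) (\<lambda>q. Re (V (\<epsilon> k) (of_real (t k)) (of_real (fst q)) (of_real (snd q))) - Re (G (t k) (fst q) (snd q)))) \<longlonglongrightarrow> 0"
  proof (rule Lp_pow_tendsto_0[where h = "\<lambda>q. (K1 + K2) * (exp (- \<bar>fst q\<bar>) * exp (- \<bar>snd q\<bar>))"])
    show "0 < p" using p by simp
    show "(\<lambda>q. indicator (UNIV \<times> {0<..}) q *\<^sub>R (Re (V (\<epsilon> k) (of_real (t k)) (of_real (fst q)) (of_real (snd q))) - Re (G (t k) (fst q) (snd q)))) \<in> borel_measurable borel" for k
    proof (rule measurable_indicator_times_continuous[OF _ open_half_plane])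
      have c: "continuous_on ({0<..<T} \<times> (UNIV \<times> {0..})) (\<lambda>p. V (\<epsilon> k) (of_real (fst p)) (of_real (fst (snd p))) (of_real (snd (snd p))))"
        using hs[of k] by (simp add: hol_solution_def)
      have c1: "continuous_on (UNIV \<times> {0<..}) (\<lambda>q::real\<times>real. (t k, fst q, snd q))" by (intro continuous_intros)
      have sub: "(\<lambda>q::real\<times>real. (t k, fst q, snd q)) ` (UNIV \<times> {0<..}) \<subseteq> {0<..<T} \<times> (UNIV \<times> {0..})" using et[of k] by auto
      have "continuous_on (UNIV \<times> {0<..}) (\<lambda>q::real\<times>real. V (\<epsilon> k) (of_real (t k)) (of_real (fst q)) (of_real (snd q)))"
        using continuous_on_compose2[OF c c1] sub by simp
      moreover have "continuous_on (UNIV \<times> {0<..}) (\<lambda>q::real\<times>real. G (t k) (fst q) (snd q))"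
        using continuous_on_compose2[OF Gc c1] by auto
      ultimately show "continuous_on (UNIV \<times> {0<..}) (\<lambda>q::real\<times>real. Re (V (\<epsilon> k) (of_real (t k)) (of_real (fst q)) (of_real (snd q))) - Re (G (t k) (fst q) (snd q)))"
        by (intro continuous_intros)
    qed
    show "(\<lambda>q. indicator (UNIV \<times> {0<..}) q *\<^sub>R ((K1 + K2) * (exp (- \<bar>fst q\<bar>) * exp (- \<bar>snd q\<bar>)))) \<in> borel_measurable (borel :: (real\<times>real) measure)"
      by (rule measurable_indicator_times_continuous[OF _ open_half_plane]) (intro continuous_intros)
    show "Lp_pow p (UNIV \<times> {0<..}) (\<lambda>q. (K1 + K2) * (exp (- \<bar>fst q\<bar>) * exp (- \<bar>snd q\<bar>))) < \<infinity>"
      by (rule Lp_pow_exp_finite(2)[OF p])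
    show "\<bar>Re (V (\<epsilon> k) (of_real (t k)) (of_real (fst q)) (of_real (snd q))) - Re (G (t k) (fst q) (snd q))\<bar> \<le> (K1 + K2) * (exp (- \<bar>fst q\<bar>) * exp (- \<bar>snd q\<bar>))"
      if "q \<in> UNIV \<times> {0<..}" for k q
    proof -
      have q: "0 < snd q" using that by (auto simp: mem_Times_iff)
      have "norm (V (\<epsilon> k) (of_real (t k)) (of_real (fst q)) (of_real (snd q))) \<le> K1 * (exp (- \<bar>fst q\<bar>) * exp (- snd q))"
        "norm (G (t k) (fst q) (snd q)) \<le> K2 * (exp (- \<bar>fst q\<bar>) * exp (- snd q))"
        using K1 K2 et[of k] q by auto
      moreover have "\<bar>Re v - Re g\<bar> \<le> norm v + norm g" for v g :: complex
        using abs_Re_le_cmod[of v] abs_Re_le_cmod[of g] by linarith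
      ultimately have "\<bar>Re (V (\<epsilon> k) (of_real (t k)) (of_real (fst q)) (of_real (snd q))) - Re (G (t k) (fst q) (snd q))\<bar> \<le> K1 * (exp (- \<bar>fst q\<bar>) * exp (- snd q)) + K2 * (exp (- \<bar>fst q\<bar>) * exp (- snd q))"
        by (meson add_mono order_trans)
      then show ?thesis using q by (simp add: distrib_right)
    qed
    have "(\<lambda>k. Re (V (\<epsilon> k) (of_real (t k)) (of_real (fst q)) (of_real (snd q))) - Re (G (t k) (fst q) (snd q))) \<longlonglongrightarrow> 0"
      if "q \<in> UNIV \<times> {0<..}" for q
    proof -
      have q: "0 < snd q" using that by (auto simp: mem_Times_iff)
      have l: "(\<lambda>k. (t k, fst q, snd q)) \<longlonglongrightarrow> (t0, fst q, snd q)" by (intro tendsto_intros lim)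
      \<comment> \<open>The inviscid flow is taken at the moving time t k; by continuity of G it has
        the same limit, the value at t0, as the viscous solution.\<close>
      have "(\<lambda>k. G (t k) (fst q) (snd q)) \<longlonglongrightarrow> G t0 (fst q) (snd q)"
        using continuous_on_tendsto_compose[OF Gc l] by simp
      from tendsto_diff[OF tendsto_Re[OF Vl[OF q, of "fst q"]] tendsto_Re[OF this]] show ?thesis by simp
    qed
    then show "AE q in lborel. q \<in> UNIV \<times> {0<..} \<longrightarrow> (\<lambda>k. Re (V (\<epsilon> k) (of_real (t k)) (of_real (fst q)) (of_real (snd q))) - Re (G (t k) (fst q) (snd q))) \<longlonglongrightarrow> 0"
      by simp
  qed
qed

lemma heat_flow_converges:
  assumes T: "0 < T" and p: "1 \<le> p" and a: "0 < a" and \<psi>: "compact_profile \<psi>" and \<delta>: "0 < \<delta>"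
  shows "\<exists>\<epsilon>0>0. \<epsilon>0 \<le> 1 \<and> (\<forall>\<epsilon> t. 0 < \<epsilon> \<longrightarrow> \<epsilon> < \<epsilon>0 \<longrightarrow> 0 < t \<longrightarrow> t < T \<longrightarrow>
     Lp_pow p {0<..} (\<lambda>z. Re (heat_flow a \<psi> \<epsilon> (of_real t) (of_real z)) - Re (heat (of_real a) \<psi> (of_real z))) \<le> ennreal \<delta>)"
proof (rule uniform_smallness_sequentially[OF _ \<delta>])
  fix \<epsilon> t :: "nat \<Rightarrow> real" and t0 :: real
  assume et: "\<And>k. 0 < \<epsilon> k \<and> \<epsilon> k \<le> 1 \<and> 0 < t k \<and> t k < T" and lim: "\<epsilon> \<longlonglongrightarrow> 0" "t \<longlonglongrightarrow> t0"
  obtain C where C: "C \<ge> 0" "\<And>\<tau> z. \<tau> \<in> Sec \<Longrightarrow> a \<le> Re \<tau> \<Longrightarrow> Re \<tau> \<le> a + T \<Longrightarrow> \<bar>Im z\<bar> \<le> \<bar>Re z\<bar> / 8 + 0 \<Longrightarrow> norm (heat \<tau> \<psi> z) \<le> C * exp (- \<bar>Re z\<bar>)"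
    using norm_heat_compact_le[OF \<psi> a, of "a + T" 0] T by auto
  define b where "b k = a + \<epsilon> k * t k" for k
  have b: "0 < b k" "a \<le> b k" "b k \<le> a + T" for k
  proof -
    have "\<epsilon> k * t k \<le> 1 * T" using et[of k] by (intro mult_mono) auto
    then show "b k \<le> a + T" by (simp add: b_def)
    show "a \<le> b k" using et[of k] by (simp add: b_def)
    then show "0 < b k" using a by linarith
  qed
  have hf: "heat_flow a \<psi> (\<epsilon> k) (of_real (t k)) z = heat (of_real (b k)) \<psi> z" for k z by (simp add: heat_flow_def b_def)
  have "(\<lambda>k. a + \<epsilon> k * t k) \<longlonglongrightarrow> a + 0 * t0" by (intro tendsto_intros lim)
  then have bl: "b \<longlonglongrightarrow> a" by (simp add: b_def[abs_def])
  show "(\<lambda>k. Lp_pow p {0<..} (\<lambda>z. Re (heat_flow a \<psi> (\<epsilon> k) (of_real (t k)) (of_real z)) - Re (heat (of_real a) \<psi> (of_real z)))) \<longlonglongrightarrow> 0"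
    unfolding hf
  proof (rule Lp_pow_tendsto_0[where h = "\<lambda>z. (2 * C) * exp (- \<bar>z\<bar>)"])
    show "0 < p" using p by simp
    show "(\<lambda>x. indicator {0<..} x *\<^sub>R (Re (heat (of_real (b k)) \<psi> (of_real x)) - Re (heat (of_real a) \<psi> (of_real x)))) \<in> borel_measurable borel" for k
      by (rule measurable_indicator_times_continuous) (intro continuous_intros continuous_on_heat_real \<psi> a b, simp)
    show "(\<lambda>x. indicator {0<..} x *\<^sub>R ((2 * C) * exp (- \<bar>x\<bar>))) \<in> borel_measurable (borel :: real measure)"
      by (rule measurable_indicator_times_continuous) (intro continuous_intros, simp)
    show "Lp_pow p {0<..} (\<lambda>z. (2 * C) * exp (- \<bar>z\<bar>)) < \<infinity>" by (rule Lp_pow_exp_finite(1)[OF p])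
    show "\<bar>Re (heat (of_real (b k)) \<psi> (of_real x)) - Re (heat (of_real a) \<psi> (of_real x))\<bar> \<le> (2 * C) * exp (- \<bar>x\<bar>)" for k x
    proof -
      have "norm (heat (of_real (b k)) \<psi> (of_real x)) \<le> C * exp (- \<bar>x\<bar>)" using C(2)[of "of_real (b k)" "of_real x"] b by simp
      moreover have "norm (heat (of_real a) \<psi> (of_real x)) \<le> C * exp (- \<bar>x\<bar>)" using C(2)[of "of_real a" "of_real x"] a T by simp
      ultimately show ?thesis using abs_Re_le_cmod[of "heat (of_real (b k)) \<psi> (of_real x)"] abs_Re_le_cmod[of "heat (of_real a) \<psi> (of_real x)"] by linarith
    qed
    have "(\<lambda>k. Re (heat (of_real (b k)) \<psi> (of_real x)) - Re (heat (of_real a) \<psi> (of_real x))) \<longlonglongrightarrow> 0" for x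
    proof -
      have "(\<lambda>k. heat (of_real (b k)) \<psi> (of_real x)) \<longlonglongrightarrow> heat (of_real a) \<psi> (of_real x)"
        by (rule heat_tendsto[OF \<psi> a _ tendsto_of_real[OF bl] tendsto_const]) (use b in simp)
      from tendsto_diff[OF tendsto_Re[OF this] tendsto_const[of "Re (heat (of_real a) \<psi> (of_real x))"]] show ?thesis by simp
    qed
    then show "AE x in lborel. x \<in> {0<..} \<longrightarrow> (\<lambda>k. Re (heat (of_real (b k)) \<psi> (of_real x)) - Re (heat (of_real a) \<psi> (of_real x))) \<longlonglongrightarrow> 0" by simp
  qed
qed

section \<open>Small smoothing times and shears\<close>

lemma integrable_std_normal_exp_abs: "integrable lborel (\<lambda>\<eta>. std_normal_density \<eta> * exp (c * \<bar>\<eta>\<bar>))"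
proof -
  have *: "integrable lborel (\<lambda>\<eta>. std_normal_density \<eta> * exp (c * \<eta>))" for c
  proof -
    have "std_normal_density \<eta> * exp (c * \<eta>) = exp (c\<^sup>2 / 2) * normal_density c 1 \<eta>" for \<eta>
    proof -
      have "- \<eta>\<^sup>2 / 2 + c * \<eta> = c\<^sup>2 / 2 + - (\<eta> - c)\<^sup>2 / 2" by (simp add: power2_eq_square algebra_simps) (simp add: field_simps)
      then have "exp (- \<eta>\<^sup>2 / 2) * exp (c * \<eta>) = exp (c\<^sup>2 / 2) * exp (- (\<eta> - c)\<^sup>2 / 2)" by (simp only: exp_add[symmetric])
      then show ?thesis by (simp add: std_normal_density_def normal_density_def)
    qed
    then show ?thesis by simp
  qed
  show ?thesis
  proof (rule Bochner_Integration.integrable_bound[OF Bochner_Integration.integrable_add[OF *[of c] *[of "-c"]]])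
    have "norm (std_normal_density \<eta> * exp (c * \<bar>\<eta>\<bar>)) \<le> norm (std_normal_density \<eta> * exp (c * \<eta>) + std_normal_density \<eta> * exp (- c * \<eta>))" for \<eta>
      by (cases "0 \<le> \<eta>") (auto simp: abs_mult)
    then show "AE \<eta> in lborel. norm (std_normal_density \<eta> * exp (c * \<bar>\<eta>\<bar>)) \<le> norm (std_normal_density \<eta> * exp (c * \<eta>) + std_normal_density \<eta> * exp (- c * \<eta>))"
      by simp
  qed simp
qed

text \<open>The constant of \<open>norm_heat_compact_le\<close> degenerates as the time tends to 0,
  so the normal average is used instead: a displacement sqrt (2 s) \<eta> costs at most exp (2
  |\<eta>|), which is integrable against the normal law. The majorant is uniform in s <= 1.\<close>

lemma norm_heat_small_time_le:
  assumes \<psi>: "exp_decay B \<psi>"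
  shows "\<exists>C\<ge>0. \<forall>s z. 0 < s \<longrightarrow> s \<le> 1 \<longrightarrow> norm (heat (of_real s) \<psi> (of_real z)) \<le> C * exp (- \<bar>z\<bar>)"
proof -
  let ?C = "\<integral>\<eta>. std_normal_density \<eta> * exp (2 * \<bar>\<eta>\<bar>) \<partial>lborel"
  have \<psi>m [measurable]: "\<psi> \<in> borel_measurable borel" using \<psi> by (simp add: exp_decay_def)
  have B0: "0 \<le> B" by (rule exp_decay_nonneg[OF \<psi>])
  have C0: "0 \<le> ?C" by (rule Bochner_Integration.integral_nonneg) simp
  have "norm (heat (of_real s) \<psi> (of_real z)) \<le> (?C * B) * exp (- \<bar>z\<bar>)" if s: "0 < s" "s \<le> 1" for s z
  proof -
    have m: "(\<lambda>\<eta>. std_normal_density \<eta> *\<^sub>R \<psi> (z + sqrt (2 * s) * \<eta>)) \<in> borel_measurable lborel"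
      using \<psi>m by measurable
    have i: "integrable lborel (\<lambda>\<eta>. std_normal_density \<eta> * exp (2 * \<bar>\<eta>\<bar>) * (B * exp (- \<bar>z\<bar>)))"
      by (intro integrable_mult_left integrable_std_normal_exp_abs)
    have b: "norm (std_normal_density \<eta> *\<^sub>R \<psi> (z + sqrt (2 * s) * \<eta>)) \<le> std_normal_density \<eta> * exp (2 * \<bar>\<eta>\<bar>) * (B * exp (- \<bar>z\<bar>))" for \<eta>
    proof -
      have "sqrt (2 * s) \<le> sqrt (2\<^sup>2)" using s by (intro real_sqrt_le_mono) auto
      then have "\<bar>sqrt (2 * s) * \<eta>\<bar> \<le> 2 * \<bar>\<eta>\<bar>" unfolding abs_mult using s by (intro mult_right_mono) auto
      then have "exp (- \<bar>z + sqrt (2 * s) * \<eta>\<bar>) \<le> exp (2 * \<bar>\<eta>\<bar> + - \<bar>z\<bar>)" by simp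
      then have "B * exp (- \<bar>z + sqrt (2 * s) * \<eta>\<bar>) \<le> B * (exp (2 * \<bar>\<eta>\<bar>) * exp (- \<bar>z\<bar>))"
        unfolding exp_add[symmetric] by (rule mult_left_mono[OF _ B0])
      moreover have "norm (\<psi> (z + sqrt (2 * s) * \<eta>)) \<le> B * exp (- \<bar>z + sqrt (2 * s) * \<eta>\<bar>)" using \<psi> by (simp add: exp_decay_def)
      ultimately have "norm (\<psi> (z + sqrt (2 * s) * \<eta>)) \<le> exp (2 * \<bar>\<eta>\<bar>) * (B * exp (- \<bar>z\<bar>))" by (simp add: mult_ac)
      then show ?thesis by (simp add: mult_left_mono mult.assoc)
    qed
    have i2: "integrable lborel (\<lambda>\<eta>. std_normal_density \<eta> *\<^sub>R \<psi> (z + sqrt (2 * s) * \<eta>))"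
      by (rule Bochner_Integration.integrable_bound[OF i m])
         (use b in \<open>auto intro!: AE_I2 order_trans[OF _ abs_ge_self] simp del: norm_scaleR\<close>)
    have "norm (heat (of_real s) \<psi> (of_real z)) \<le> (\<integral>\<eta>. std_normal_density \<eta> * exp (2 * \<bar>\<eta>\<bar>) * (B * exp (- \<bar>z\<bar>)) \<partial>lborel)"
      unfolding heat_real[OF s(1)] by (rule norm_integral_le_integral[OF i2 i]) (rule b)
    then show ?thesis unfolding integral_mult_left_zero by (simp only: mult.assoc)
  qed
  then show ?thesis using C0 B0 by (intro exI[of _ "?C * B"]) auto
qed

lemma heat_initial_tendsto:
  assumes \<psi>: "exp_decay B \<psi>" and c: "isCont \<psi> z" and s: "\<And>k. 0 < s k" "s \<longlonglongrightarrow> 0"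
  shows "(\<lambda>k. heat (of_real (s k)) \<psi> (of_real z)) \<longlonglongrightarrow> \<psi> z"
proof -
  have \<psi>m [measurable]: "\<psi> \<in> borel_measurable borel" using \<psi> by (simp add: exp_decay_def)
  have "(\<lambda>k. \<integral>\<eta>. std_normal_density \<eta> *\<^sub>R \<psi> (z + sqrt (2 * s k) * \<eta>) \<partial>lborel) \<longlonglongrightarrow> (\<integral>\<eta>. std_normal_density \<eta> *\<^sub>R \<psi> z \<partial>lborel)"
  proof (rule integral_dominated_convergence[where w = "\<lambda>\<eta>. std_normal_density \<eta> * B"])
    show "(\<lambda>\<eta>. std_normal_density \<eta> *\<^sub>R \<psi> (z + sqrt (2 * s k) * \<eta>)) \<in> borel_measurable lborel" for k
      using \<psi>m by measurable
    have "norm (\<psi> y) \<le> B" for y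
    proof -
      have "norm (\<psi> y) \<le> B * exp (- \<bar>y\<bar>)" using \<psi> by (simp add: exp_decay_def)
      also have "\<dots> \<le> B * 1" using exp_decay_nonneg[OF \<psi>] by (intro mult_left_mono) auto
      finally show ?thesis by simp
    qed
    then show "AE \<eta> in lborel. norm (std_normal_density \<eta> *\<^sub>R \<psi> (z + sqrt (2 * s k) * \<eta>)) \<le> std_normal_density \<eta> * B" for k
      by (simp add: mult_left_mono)
    have "(\<lambda>k. \<psi> (z + sqrt (2 * s k) * \<eta>)) \<longlonglongrightarrow> \<psi> z" for \<eta>
      by (rule isCont_tendsto_compose[OF c]) (rule tendsto_eq_intros s(2) refl | simp)+
    then show "AE \<eta> in lborel. (\<lambda>k. std_normal_density \<eta> *\<^sub>R \<psi> (z + sqrt (2 * s k) * \<eta>)) \<longlonglongrightarrow> std_normal_density \<eta> *\<^sub>R \<psi> z"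
      by (intro AE_I2 tendsto_intros)
  qed auto
  then show ?thesis by (simp add: heat_real[OF s(1)])
qed

text \<open>At fixed z the map is a translation in x, and Tonelli with the x-integral inside gives
  the invariance. Inviscid transport up to time t is such a shear, with \<alpha> equal to t times
  the velocity.\<close>

lemma Lp_pow_shear:
  fixes f :: "real \<times> real \<Rightarrow> real"
  assumes f: "f \<in> borel_measurable borel" and \<alpha>: "\<alpha> \<in> borel_measurable borel"
  shows "Lp_pow p (UNIV \<times> {0<..}) (\<lambda>q. f (fst q - \<alpha> (snd q), snd q)) = Lp_pow p (UNIV \<times> {0<..}) f"
proof -
  have m0: "(\<lambda>q. (fst q - \<alpha> (snd q), snd q)) \<in> borel_measurable (borel :: (real \<times> real) measure)"
    using \<alpha> unfolding borel_prod[symmetric] by measurable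
  have f': "(\<lambda>q. f (fst q - \<alpha> (snd q), snd q)) \<in> borel_measurable borel" using measurable_compose[OF m0 f] .
  have U: "UNIV \<times> {0<..} \<in> sets (borel :: (real \<times> real) measure)" using open_half_plane by simp
  have m: "(\<lambda>q. indicator (UNIV \<times> {0<..}) q * ennreal (\<bar>g q\<bar> powr p)) \<in> borel_measurable (lborel \<Otimes>\<^sub>M lborel)"
    if "g \<in> borel_measurable (borel :: (real\<times>real) measure)" for g
    unfolding lborel_prod using that U by measurable
  have I: "Lp_pow p (UNIV \<times> {0<..}) g = (\<integral>\<^sup>+ z. (\<integral>\<^sup>+ x. indicator {0<..} z * ennreal (\<bar>g (x, z)\<bar> powr p) \<partial>lborel) \<partial>lborel)"
    if "g \<in> borel_measurable (borel :: (real\<times>real) measure)" for g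
  proof -
    have "Lp_pow p (UNIV \<times> {0<..}) g = (\<integral>\<^sup>+ q. indicator (UNIV \<times> {0<..}) q * ennreal (\<bar>g q\<bar> powr p) \<partial>(lborel \<Otimes>\<^sub>M lborel))"
      by (simp add: Lp_pow_def lborel_prod)
    also have "\<dots> = (\<integral>\<^sup>+ z. (\<integral>\<^sup>+ x. indicator (UNIV \<times> {0<..}) (x, z) * ennreal (\<bar>g (x, z)\<bar> powr p) \<partial>lborel) \<partial>lborel)"
      by (rule lborel_pair.nn_integral_snd[OF m[OF that], symmetric])
    finally show ?thesis by (simp add: indicator_def)
  qed
  have m1: "(\<lambda>x. f (x, z)) \<in> borel_measurable borel" for z
    using f by (rule measurable_compose[rotated]) (auto simp: borel_prod[symmetric])
  have "(\<integral>\<^sup>+ x. indicator {0<..} z * ennreal (\<bar>f (x - \<alpha> z, z)\<bar> powr p) \<partial>lborel) = (\<integral>\<^sup>+ x. indicator {0<..} z * ennreal (\<bar>f (x, z)\<bar> powr p) \<partial>lborel)" for z :: real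
  proof -
    have "(\<integral>\<^sup>+ x. indicator {0<..} z * ennreal (\<bar>f (x, z)\<bar> powr p) \<partial>lborel) = ennreal \<bar>1\<bar> * (\<integral>\<^sup>+ x. indicator {0<..} z * ennreal (\<bar>f (- \<alpha> z + 1 * x, z)\<bar> powr p) \<partial>lborel)"
      by (rule nn_integral_real_affine) (use m1 in auto)
    then show ?thesis by simp
  qed
  then show ?thesis unfolding I[OF f] I[OF f'] by simp
qed

subsection \<open>Smoothed step functions\<close>

text \<open>The real part is taken because \<open>odd_ext\<close> expects a function of a complex
  variable; it evaluates that function on the positive axis.\<close>

definition odd_profile :: "(real \<Rightarrow> real) \<Rightarrow> real \<Rightarrow> complex" where
  "odd_profile h = odd_ext (\<lambda>z. of_real (h (Re z)))"

lemma odd_profile_simps: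
  "0 < y \<Longrightarrow> odd_profile h y = of_real (h y)" "odd_profile h (- y) = - odd_profile h y" "Im (odd_profile h y) = 0"
  by (auto simp: odd_profile_def odd_ext_def)

lemma stepf_compact:
  fixes L :: "(real \<times> real \<times> real) list"
  shows "\<exists>M Y. \<forall>x. \<bar>stepf L x\<bar> \<le> M \<and> (Y < \<bar>x\<bar> \<longrightarrow> stepf L x = 0)"
proof (induction L)
  case (Cons l L)
  obtain c a b where l: "l = (c, a, b)" by (cases l)
  obtain M Y where MY: "\<And>x. \<bar>stepf L x\<bar> \<le> M" "\<And>x. Y < \<bar>x\<bar> \<Longrightarrow> stepf L x = 0" using Cons by blast
  have "\<bar>stepf (l # L) x\<bar> \<le> \<bar>c\<bar> + M \<and> (max Y (\<bar>a\<bar> + \<bar>b\<bar>) < \<bar>x\<bar> \<longrightarrow> stepf (l # L) x = 0)" for x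
    using MY(1)[of x] MY(2)[of x] by (auto simp: l indicator_def box_real)
  then show ?case by blast
qed auto

lemma compact_profile_stepf:
  "compact_profile (\<lambda>x. of_real (stepf L x))" "compact_profile (odd_profile (stepf L))"
proof -
  obtain M Y where MY: "\<And>x. \<bar>stepf L x\<bar> \<le> M" "\<And>x. Y < \<bar>x\<bar> \<Longrightarrow> stepf L x = 0" using stepf_compact[of L] by blast
  have M0: "0 \<le> M" using MY(1)[of 0] by linarith
  show "compact_profile (\<lambda>x. of_real (stepf L x))" unfolding compact_profile_def
    using MY by (intro conjI exI[of _ M] exI[of _ Y]) auto
  have e: "odd_profile (stepf L) = (\<lambda>y. indicator {0<..} y *\<^sub>R complex_of_real (stepf L y) - indicator {..<0} y *\<^sub>R complex_of_real (stepf L (- y)))"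
    by (auto simp: odd_profile_def odd_ext_def fun_eq_iff)
  have "odd_profile (stepf L) \<in> borel_measurable borel" unfolding e by measurable
  then show "compact_profile (odd_profile (stepf L))" unfolding compact_profile_def
    using MY M0 by (intro conjI exI[of _ M] exI[of _ Y]) (auto simp: odd_profile_def odd_ext_def)
qed

lemma isCont_stepf_interval:
  fixes a b x :: real
  assumes "x \<noteq> a" "x \<noteq> b"
  shows "isCont (stepf [(1, a, b)]) x"
proof -
  have "eventually (\<lambda>y. (indicator (box a b) x :: real) = stepf [(1, a, b)] y) (nhds x)"
  proof (cases "x \<in> box a b")
    case True
    then have "eventually (\<lambda>y. y \<in> box a b) (nhds x)" by (intro eventually_nhds_in_open) auto
    then show ?thesis by eventually_elim (use True in simp)
  next
    case False
    then have x: "x \<in> - {a..b}" using assms by (auto simp: box_real)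
    have "open (- {a..b})" by (intro open_Compl closed_atLeastAtMost)
    from eventually_nhds_in_open[OF this x] show ?thesis by eventually_elim (use False in \<open>auto simp: box_real\<close>)
  qed
  moreover have "isCont (\<lambda>y. indicator (box a b) x :: real) x" by simp
  ultimately show ?thesis by (rule iffD1[OF isCont_cong])
qed

lemma AE_isCont_stepf: "AE z in lborel. isCont (stepf L :: real \<Rightarrow> real) z"
proof (induction L)
  case Nil
  have "stepf [] = (\<lambda>x::real. 0)" by auto
  then show ?case by simp
next
  case (Cons l L)
  obtain c a b where l: "l = (c, a, b)" by (cases l)
  have e: "stepf (l # L) = (\<lambda>x. c * stepf [(1, a, b)] x + stepf L x)" by (auto simp: l)
  have "AE z in lborel. z \<noteq> a" "AE z in lborel. z \<noteq> b" by (rule AE_lborel_singleton)+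
  with Cons show ?case
  proof eventually_elim
    case (elim z)
    show ?case unfolding e
      by (intro continuous_intros isCont_stepf_interval elim)
  qed
qed

lemma odd_profile_converges:
  assumes p: "1 \<le> p" and s: "\<And>k. 0 < s k" "\<And>k. s k \<le> 1" "s \<longlonglongrightarrow> 0"
  shows "(\<lambda>k. Lp_pow p {0<..} (\<lambda>z. Re (heat (of_real (s k)) (odd_profile (stepf L)) (of_real z)) - stepf L z)) \<longlonglongrightarrow> 0"
proof -
  obtain B where B: "exp_decay B (odd_profile (stepf L))" using compact_profile_exp_decay[OF compact_profile_stepf(2)] by blast
  obtain C where C: "C \<ge> 0" "\<And>s z. 0 < s \<Longrightarrow> s \<le> 1 \<Longrightarrow> norm (heat (of_real s) (odd_profile (stepf L)) (of_real z)) \<le> C * exp (- \<bar>z\<bar>)"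
    using norm_heat_small_time_le[OF B] by blast
  show ?thesis
  proof (rule Lp_pow_tendsto_0[where h = "\<lambda>z. (C + B) * exp (- \<bar>z\<bar>)"])
    show "0 < p" using p by simp
    show "(\<lambda>x. indicator {0<..} x *\<^sub>R (Re (heat (of_real (s k)) (odd_profile (stepf L)) (of_real x)) - stepf L x)) \<in> borel_measurable borel" for k
    proof -
      have "continuous_on UNIV (\<lambda>x::real. Re (heat (of_real (s k)) (odd_profile (stepf L)) (of_real x)))"
        by (intro continuous_intros continuous_on_heat_real compact_profile_stepf s)
      then have "(\<lambda>x. Re (heat (of_real (s k)) (odd_profile (stepf L)) (of_real x))) \<in> borel_measurable borel" by (rule borel_measurable_continuous_onI)
      then show ?thesis by measurable
    qed
    show "(\<lambda>x. indicator {0<..} x *\<^sub>R ((C + B) * exp (- \<bar>x\<bar>))) \<in> borel_measurable (borel :: real measure)" by measurable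
    show "Lp_pow p {0<..} (\<lambda>z. (C + B) * exp (- \<bar>z\<bar>)) < \<infinity>" by (rule Lp_pow_exp_finite(1)[OF p])
    show "\<bar>Re (heat (of_real (s k)) (odd_profile (stepf L)) (of_real x)) - stepf L x\<bar> \<le> (C + B) * exp (- \<bar>x\<bar>)" if "x \<in> {0<..}" for k x
    proof -
      have "norm (odd_profile (stepf L) x) \<le> B * exp (- \<bar>x\<bar>)" using B by (simp add: exp_decay_def)
      then have "\<bar>stepf L x\<bar> \<le> B * exp (- \<bar>x\<bar>)" using that by (simp add: odd_profile_simps)
      moreover have "\<bar>Re (heat (of_real (s k)) (odd_profile (stepf L)) (of_real x))\<bar> \<le> C * exp (- \<bar>x\<bar>)"
        using C(2)[OF s(1,2), of k x] abs_Re_le_cmod order_trans by blast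
      ultimately show ?thesis by (simp add: distrib_right)
    qed
    show "AE x in lborel. x \<in> {0<..} \<longrightarrow> (\<lambda>k. Re (heat (of_real (s k)) (odd_profile (stepf L)) (of_real x)) - stepf L x) \<longlonglongrightarrow> 0"
      using AE_isCont_stepf[of L]
    proof eventually_elim
      case (elim x)
      show ?case
      proof
        assume x: "x \<in> {0<..}"
        have "eventually (\<lambda>y. complex_of_real (stepf L y) = odd_profile (stepf L) y) (nhds x)"
          using eventually_nhds_in_open[OF open_greaterThan x] by eventually_elim (simp add: odd_profile_simps)
        moreover have "isCont (\<lambda>y. complex_of_real (stepf L y)) x" using elim by (intro continuous_intros)
        ultimately have "isCont (odd_profile (stepf L)) x" by (rule iffD1[OF isCont_cong])
        from tendsto_Re[OF heat_initial_tendsto[OF B this s(1,3)]]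
        have "(\<lambda>k. Re (heat (of_real (s k)) (odd_profile (stepf L)) (of_real x))) \<longlonglongrightarrow> stepf L x" using x by (simp add: odd_profile_simps)
        from tendsto_diff[OF this tendsto_const[of "stepf L x"]]
        show "(\<lambda>k. Re (heat (of_real (s k)) (odd_profile (stepf L)) (of_real x)) - stepf L x) \<longlonglongrightarrow> 0" by simp
      qed
    qed
  qed
qed

lemma indicator_box_prod:
  fixes lo hi q :: "real \<times> real"
  shows "indicator (box lo hi) q = (indicator (box (fst lo) (fst hi)) (fst q) * indicator (box (snd lo) (snd hi)) (snd q) :: real)"
  by (cases lo; cases hi; cases q) (auto simp: box_prod indicator_def)

abbreviation "interval_x l \<equiv> (\<lambda>x. complex_of_real (stepf [(1::real, fst (fst (snd l)), fst (snd (snd l)))] x))"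
abbreviation "interval_z l \<equiv> odd_profile (stepf [(1::real, snd (fst (snd l)), snd (snd (snd l)))])"

text \<open>The indicator of a box is a product of interval indicators. Each factor is smoothed by
  its own heat flow, in z after odd reflection, which is precisely a product datum of
  \<open>model\<close>.\<close>

primrec smooth_step :: "real \<Rightarrow> (real \<times> (real \<times> real) \<times> (real \<times> real)) list \<Rightarrow> real \<times> real \<Rightarrow> real" where
  "smooth_step s [] q = 0"
| "smooth_step s (l # L) q = fst l * (Re (heat (of_real s) (interval_x l) (of_real (fst q))) *
      Re (heat (of_real s) (interval_z l) (of_real (snd q)))) + smooth_step s L q"

lemma heat_profile_real:
  assumes "0 < s"
  shows "heat (of_real s) (\<lambda>x. complex_of_real (g x)) (of_real y) = of_real (Re (heat (of_real s) (\<lambda>x. complex_of_real (g x)) (of_real y)))"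
    and "heat (of_real s) (odd_profile g) (of_real y) = of_real (Re (heat (of_real s) (odd_profile g) (of_real y)))"
  by (rule heat_real_valued[OF assms]; simp add: odd_profile_simps)+

text \<open>Induction on the list: each box is one instance of \<open>model\<close>, and
  \<open>model_family_lincomb\<close> adds it with its coefficient. All instances share the
  smoothing time a and the velocity generated by L1.\<close>

lemma smooth_step_family:
  assumes T: "0 < T" and a: "0 < a"
  shows "\<exists>V G. model_family T a (odd_profile (stepf L1)) V G \<and>
     (\<forall>t x z. Re (G t x z) = smooth_step a L (x - t * Re (heat (of_real a) (odd_profile (stepf L1)) (of_real z)), z))"
proof (induction L)
  case Nil
  show ?case using model_family_zero[of T a "odd_profile (stepf L1)"] by (intro exI[of _ "\<lambda>\<epsilon> t x z. 0"] exI[of _ "\<lambda>t x z. 0"]) auto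
next
  case (Cons l L)
  then obtain V G where VG: "model_family T a (odd_profile (stepf L1)) V G"
    "\<And>t x z. Re (G t x z) = smooth_step a L (x - t * Re (heat (of_real a) (odd_profile (stepf L1)) (of_real z)), z)" by blast
  interpret M: model T a "odd_profile (stepf L1)" "interval_z l" "interval_x l"
    by unfold_locales (rule T a compact_profile_stepf odd_profile_simps(2))+
  let ?U = "\<lambda>z. Re (heat (of_real a) (odd_profile (stepf L1)) (of_real z))"
  have e: "of_real x - of_real t * heat (of_real a) (odd_profile (stepf L1)) (of_real z) = complex_of_real (x - t * ?U z)" for x t z
    using heat_profile_real(2)[OF a, of "stepf L1" z] by simp
  have re: "Re (heat (of_real a) (interval_x l) (of_real y) * heat (of_real a) (interval_z l) (of_real z)) =
     Re (heat (of_real a) (interval_x l) (of_real y)) * Re (heat (of_real a) (interval_z l) (of_real z))" for y z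
  proof -
    have "Im (heat (of_real a) (interval_z l) (of_real z)) = 0"
      by (subst heat_profile_real(2)[OF a]) simp
    then show ?thesis by simp
  qed
  have "model_family T a (odd_profile (stepf L1)) M.V (\<lambda>t x z. heat (of_real a) (interval_x l) (of_real (x - t * ?U z)) * heat (of_real a) (interval_z l) (of_real z))"
    using M.model_family_V unfolding e by (simp add: odd_profile_simps)
  from model_family_lincomb[OF VG(1) this, of "of_real (fst l)"]
  have "model_family T a (odd_profile (stepf L1)) (\<lambda>\<epsilon> t x z. V \<epsilon> t x z + of_real (fst l) * M.V \<epsilon> t x z)
    (\<lambda>t x z. G t x z + of_real (fst l) * (heat (of_real a) (interval_x l) (of_real (x - t * ?U z)) * heat (of_real a) (interval_z l) (of_real z)))" .
  moreover have "Re (G t x z + of_real (fst l) * (heat (of_real a) (interval_x l) (of_real (x - t * ?U z)) * heat (of_real a) (interval_z l) (of_real z)))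
     = smooth_step a (l # L) (x - t * ?U z, z)" for t x z
  proof -
    have "Re (g + of_real c * w) = c * Re w + Re g" for g w c by simp
    from this[of "G t x z" "fst l"] show ?thesis by (simp only: re VG(2) smooth_step.simps fst_conv snd_conv)
  qed
  ultimately show ?case by blast
qed

lemma smooth_step_continuous: "0 < s \<Longrightarrow> continuous_on UNIV (smooth_step s L)"
proof (induction L)
  case Nil
  have "smooth_step s [] = (\<lambda>q. 0)" by auto
  then show ?case by simp
next
  case (Cons l L)
  have "smooth_step s (l # L) = (\<lambda>q. fst l * (Re (heat (of_real s) (interval_x l) (of_real (fst q))) *
      Re (heat (of_real s) (interval_z l) (of_real (snd q)))) + smooth_step s L q)" by auto
  then show ?case using Cons by (simp only:) (intro continuous_intros continuous_on_heat_real compact_profile_stepf; simp)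
qed

text \<open>One constant for the smoothed and the sharp step function gives a majorant for their
  difference that is uniform in s. The restriction to positive z comes from the odd
  reflection.\<close>

lemma smooth_step_bound:
  "\<exists>K\<ge>0. \<forall>s q. 0 < s \<longrightarrow> s \<le> 1 \<longrightarrow> 0 < snd q \<longrightarrow>
      \<bar>smooth_step s L q\<bar> \<le> K * (exp (- \<bar>fst q\<bar>) * exp (- \<bar>snd q\<bar>)) \<and> \<bar>stepf L q\<bar> \<le> K * (exp (- \<bar>fst q\<bar>) * exp (- \<bar>snd q\<bar>))"
proof (induction L)
  case (Cons l L)
  obtain K where K0: "K \<ge> 0" and KK: "\<forall>s q. 0 < s \<longrightarrow> s \<le> 1 \<longrightarrow> 0 < snd q \<longrightarrow>
      \<bar>smooth_step s L q\<bar> \<le> K * (exp (- \<bar>fst q\<bar>) * exp (- \<bar>snd q\<bar>)) \<and> \<bar>stepf L q\<bar> \<le> K * (exp (- \<bar>fst q\<bar>) * exp (- \<bar>snd q\<bar>))"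
    using Cons by (elim exE conjE)
  note K = K0 KK[rule_format, THEN conjunct1] KK[rule_format, THEN conjunct2]
  obtain Bx where Bx: "exp_decay Bx (interval_x l)"
    using compact_profile_exp_decay[OF compact_profile_stepf(1)] by (rule exE)
  obtain Bz where Bz: "exp_decay Bz (interval_z l)"
    using compact_profile_exp_decay[OF compact_profile_stepf(2)] by (rule exE)
  note B = Bx Bz
  obtain Cx where Cx: "Cx \<ge> 0" "\<And>s z. 0 < s \<Longrightarrow> s \<le> 1 \<Longrightarrow> norm (heat (of_real s) (interval_x l) (of_real z)) \<le> Cx * exp (- \<bar>z\<bar>)"
    using norm_heat_small_time_le[OF B(1)] by blast
  obtain Cz where Cz: "Cz \<ge> 0" "\<And>s z. 0 < s \<Longrightarrow> s \<le> 1 \<Longrightarrow> norm (heat (of_real s) (interval_z l) (of_real z)) \<le> Cz * exp (- \<bar>z\<bar>)"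
    using norm_heat_small_time_le[OF B(2)] by blast
  have B0: "0 \<le> Bx" "0 \<le> Bz" using B exp_decay_nonneg by auto
  define K' where "K' = \<bar>fst l\<bar> * (Cx * Cz) + \<bar>fst l\<bar> * (Bx * Bz) + K"
  have "\<bar>smooth_step s (l # L) q\<bar> \<le> K' * (exp (- \<bar>fst q\<bar>) * exp (- \<bar>snd q\<bar>)) \<and> \<bar>stepf (l # L) q\<bar> \<le> K' * (exp (- \<bar>fst q\<bar>) * exp (- \<bar>snd q\<bar>))"
    if s: "0 < s" "s \<le> 1" "0 < snd q" for s q
  proof
    let ?E = "exp (- \<bar>fst q\<bar>) * exp (- \<bar>snd q\<bar>)"
    let ?hx = "Re (heat (of_real s) (interval_x l) (of_real (fst q)))" and ?hz = "Re (heat (of_real s) (interval_z l) (of_real (snd q)))"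
    have "\<bar>?hx\<bar> \<le> Cx * exp (- \<bar>fst q\<bar>)" "\<bar>?hz\<bar> \<le> Cz * exp (- \<bar>snd q\<bar>)"
      using Cx(2)[OF s(1,2), of "fst q"] Cz(2)[OF s(1,2), of "snd q"] abs_Re_le_cmod order_trans by blast+
    then have "\<bar>?hx * ?hz\<bar> \<le> (Cx * exp (- \<bar>fst q\<bar>)) * (Cz * exp (- \<bar>snd q\<bar>))" unfolding abs_mult using Cx(1) by (intro mult_mono) auto
    then have "\<bar>fst l * (?hx * ?hz)\<bar> \<le> \<bar>fst l\<bar> * ((Cx * exp (- \<bar>fst q\<bar>)) * (Cz * exp (- \<bar>snd q\<bar>)))" unfolding abs_mult[of "fst l"] by (rule mult_left_mono) simp
    then have "\<bar>smooth_step s (l # L) q\<bar> \<le> \<bar>fst l\<bar> * ((Cx * exp (- \<bar>fst q\<bar>)) * (Cz * exp (- \<bar>snd q\<bar>))) + K * ?E"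
      using K(2)[OF s] by (simp only: smooth_step.simps) linarith
    also have "\<dots> = (\<bar>fst l\<bar> * (Cx * Cz) + K) * ?E" by (simp add: algebra_simps)
    also have "\<dots> \<le> K' * ?E" using B0 by (intro mult_right_mono) (auto simp: K'_def)
    finally show "\<bar>smooth_step s (l # L) q\<bar> \<le> K' * ?E" .
    obtain c lo hi where l: "l = (c, lo, hi)" by (cases l)
    have ix: "indicator (box (fst lo) (fst hi)) (fst q) \<le> Bx * exp (- \<bar>fst q\<bar>)"
    proof -
      have "norm (interval_x l (fst q)) \<le> Bx * exp (- \<bar>fst q\<bar>)" using B(1) unfolding exp_decay_def by blast
      then show ?thesis by (simp add: l)
    qed
    have iz: "indicator (box (snd lo) (snd hi)) (snd q) \<le> Bz * exp (- \<bar>snd q\<bar>)"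
    proof -
      have "norm (interval_z l (snd q)) \<le> Bz * exp (- \<bar>snd q\<bar>)" using B(2) unfolding exp_decay_def by blast
      then show ?thesis using s(3) by (simp add: l odd_profile_simps)
    qed
    have "indicator (box lo hi) q \<le> (Bx * exp (- \<bar>fst q\<bar>)) * (Bz * exp (- \<bar>snd q\<bar>))"
      unfolding indicator_box_prod using ix iz B0 by (intro mult_mono) auto
    then have "\<bar>c\<bar> * indicator (box lo hi) q \<le> \<bar>c\<bar> * ((Bx * exp (- \<bar>fst q\<bar>)) * (Bz * exp (- \<bar>snd q\<bar>)))" by (rule mult_left_mono) simp
    then have "\<bar>stepf (l # L) q\<bar> \<le> \<bar>c\<bar> * ((Bx * exp (- \<bar>fst q\<bar>)) * (Bz * exp (- \<bar>snd q\<bar>))) + K * ?E"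
      using K(3)[OF s] abs_triangle_ineq[of "c * indicator (box lo hi) q" "stepf L q"] by (simp add: l abs_mult)
    also have "\<dots> = (\<bar>fst l\<bar> * (Bx * Bz) + K) * ?E" by (simp add: algebra_simps l)
    also have "\<dots> \<le> K' * ?E" using Cx(1) Cz(1) by (intro mult_right_mono) (auto simp: K'_def)
    finally show "\<bar>stepf (l # L) q\<bar> \<le> K' * ?E" .
  qed
  moreover have "0 \<le> K'" using K(1) Cx(1) Cz(1) B0 by (simp add: K'_def)
  ultimately show ?case by blast
qed (auto intro: exI[of _ 0])

lemma smooth_step_tendsto:
  assumes s: "\<And>k. 0 < s k" "\<And>k. s k \<le> 1" "s \<longlonglongrightarrow> 0"
  shows "AE q in lborel. 0 < snd q \<longrightarrow> (\<lambda>k. smooth_step (s k) L q) \<longlonglongrightarrow> stepf L q"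
proof (induction L)
  case (Cons l L)
  obtain c lo hi where l: "l = (c, lo, hi)" by (cases l)
  obtain Bx where Bx: "exp_decay Bx (interval_x l)"
    using compact_profile_exp_decay[OF compact_profile_stepf(1)] by (rule exE)
  obtain Bz where Bz: "exp_decay Bz (interval_z l)"
    using compact_profile_exp_decay[OF compact_profile_stepf(2)] by (rule exE)
  note B = Bx Bz
  \<comment> \<open>The exceptional points lie on the lines carrying the sides of the box, which are
    null sets; elsewhere both interval indicators are continuous.\<close>
  have bx: "(1, 0) \<in> (Basis :: (real \<times> real) set)" "(0, 1) \<in> (Basis :: (real \<times> real) set)" by (auto simp: Basis_prod_def)
  have n: "AE q :: real \<times> real in lborel. fst q \<noteq> fst lo" "AE q :: real \<times> real in lborel. fst q \<noteq> fst hi"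
      "AE q :: real \<times> real in lborel. snd q \<noteq> snd lo" "AE q :: real \<times> real in lborel. snd q \<noteq> snd hi"
    using AE_lborel_inner_neq[OF bx(1), of "fst lo"] AE_lborel_inner_neq[OF bx(1), of "fst hi"]
      AE_lborel_inner_neq[OF bx(2), of "snd lo"] AE_lborel_inner_neq[OF bx(2), of "snd hi"] by (simp_all add: inner_prod_def)
  note ci = isCont_stepf_interval
  show ?case using Cons n
  proof eventually_elim
    case (elim q)
    show ?case
    proof
      assume z: "0 < snd q"
      have cx: "isCont (interval_x l) (fst q)"
        unfolding l fst_conv snd_conv by (intro continuous_intros ci elim)
      have "eventually (\<lambda>y. complex_of_real (stepf [(1, snd lo, snd hi)] y) = interval_z l y) (nhds (snd q))"
      proof -
        have "snd q \<in> {0<..}" using z by simp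
        from eventually_nhds_in_open[OF open_greaterThan this] show ?thesis
          by eventually_elim (simp add: odd_profile_simps l)
      qed
      moreover have "isCont (\<lambda>y. complex_of_real (stepf [(1, snd lo, snd hi)] y)) (snd q)"
        by (intro continuous_intros ci elim)
      ultimately have cz: "isCont (interval_z l) (snd q)" by (rule iffD1[OF isCont_cong])
      have "(\<lambda>k. fst l * (Re (heat (of_real (s k)) (interval_x l) (of_real (fst q))) * Re (heat (of_real (s k)) (interval_z l) (of_real (snd q)))) + smooth_step (s k) L q)
         \<longlonglongrightarrow> fst l * (Re (interval_x l (fst q)) * Re (interval_z l (snd q))) + stepf L q"
        using elim(1) z by (intro tendsto_intros tendsto_Re heat_initial_tendsto[OF B(1) cx s(1,3)] heat_initial_tendsto[OF B(2) cz s(1,3)]) auto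
      moreover have "fst l * (Re (interval_x l (fst q)) * Re (interval_z l (snd q))) + stepf L q = stepf (l # L) q"
        using z by (simp add: l odd_profile_simps indicator_box_prod)
      ultimately show "(\<lambda>k. smooth_step (s k) (l # L) q) \<longlonglongrightarrow> stepf (l # L) q"
        by (simp only: smooth_step.simps)
    qed
  qed
qed simp

lemma smooth_step_converges:
  assumes p: "1 \<le> p" and s: "\<And>k. 0 < s k" "\<And>k. s k \<le> 1" "s \<longlonglongrightarrow> 0"
  shows "(\<lambda>k. Lp_pow p (UNIV \<times> {0<..}) (\<lambda>q. smooth_step (s k) L q - stepf L q)) \<longlonglongrightarrow> 0"
proof -
  obtain K where K0: "K \<ge> 0" and KK: "\<forall>s q. 0 < s \<longrightarrow> s \<le> 1 \<longrightarrow> 0 < snd q \<longrightarrow>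
      \<bar>smooth_step s L q\<bar> \<le> K * (exp (- \<bar>fst q\<bar>) * exp (- \<bar>snd q\<bar>)) \<and> \<bar>stepf L q\<bar> \<le> K * (exp (- \<bar>fst q\<bar>) * exp (- \<bar>snd q\<bar>))"
    using smooth_step_bound[of L] by (elim exE conjE)
  note K = K0 KK[rule_format, THEN conjunct1] KK[rule_format, THEN conjunct2]
  show ?thesis
  proof (rule Lp_pow_tendsto_0[where h = "\<lambda>q. (2 * K) * (exp (- \<bar>fst q\<bar>) * exp (- \<bar>snd q\<bar>))"])
    show "0 < p" using p by simp
    have U [measurable]: "UNIV \<times> {0<..} \<in> sets (borel :: (real \<times> real) measure)" using open_half_plane by simp
    show "(\<lambda>x. indicator (UNIV \<times> {0<..}) x *\<^sub>R (smooth_step (s k) L x - stepf L x)) \<in> borel_measurable borel" for k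
    proof -
      have "smooth_step (s k) L \<in> borel_measurable borel" by (rule borel_measurable_continuous_onI[OF smooth_step_continuous[OF s(1)]])
      then show ?thesis by measurable
    qed
    show "(\<lambda>q. indicator (UNIV \<times> {0<..}) q *\<^sub>R ((2 * K) * (exp (- \<bar>fst q\<bar>) * exp (- \<bar>snd q\<bar>)))) \<in> borel_measurable (borel :: (real\<times>real) measure)"
      by (rule measurable_indicator_times_continuous[OF _ open_half_plane]) (intro continuous_intros)
    show "Lp_pow p (UNIV \<times> {0<..}) (\<lambda>q. (2 * K) * (exp (- \<bar>fst q\<bar>) * exp (- \<bar>snd q\<bar>))) < \<infinity>"
      by (rule Lp_pow_exp_finite(2)[OF p])
    show "\<bar>smooth_step (s k) L q - stepf L q\<bar> \<le> (2 * K) * (exp (- \<bar>fst q\<bar>) * exp (- \<bar>snd q\<bar>))" if "q \<in> UNIV \<times> {0<..}" for k q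
    proof -
      have q: "0 < snd q" using that by (auto simp: mem_Times_iff)
      show ?thesis using K(2)[OF s(1,2) q, of k] K(3)[OF s(1,2) q] by linarith
    qed
    show "AE x in lborel. x \<in> UNIV \<times> {0<..} \<longrightarrow> (\<lambda>k. smooth_step (s k) L x - stepf L x) \<longlonglongrightarrow> 0"
      using smooth_step_tendsto[OF s, of L]
      by eventually_elim (auto simp: mem_Times_iff LIM_zero_iff)
  qed
qed

subsection \<open>General data\<close>

text \<open>Two translates of an interval differ only at points between corresponding endpoints, and
  each of these two gaps has length |\<alpha> - \<beta>|.\<close>

lemma nn_integral_interval_shift_le:
  fixes a b \<alpha> \<beta> :: real
  shows "(\<integral>\<^sup>+ x. ennreal \<bar>indicator (box a b) (x - \<alpha>) - indicator (box a b) (x - \<beta>)\<bar> \<partial>lborel) \<le> ennreal (2 * \<bar>\<alpha> - \<beta>\<bar>)"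
proof -
  define m M where "m = min \<alpha> \<beta>" and "M = max \<alpha> \<beta>"
  have "(\<integral>\<^sup>+ x. ennreal \<bar>indicator (box a b) (x - \<alpha>) - indicator (box a b) (x - \<beta>)\<bar> \<partial>lborel)
     \<le> (\<integral>\<^sup>+ x. indicator {a + m..a + M} x + indicator {b + m..b + M} x \<partial>lborel)"
  proof (rule nn_integral_mono)
    fix x :: real
    show "ennreal \<bar>indicator (box a b) (x - \<alpha>) - indicator (box a b) (x - \<beta>)\<bar> \<le> indicator {a + m..a + M} x + indicator {b + m..b + M} x"
      by (auto simp: indicator_def box_real m_def M_def)
  qed
  also have "\<dots> = emeasure lborel {a + m..a + M} + emeasure lborel {b + m..b + M}"
    by (subst nn_integral_add) (auto simp: nn_integral_indicator)
  also have "\<dots> = ennreal (M - m) + ennreal (M - m)" by (simp add: m_def M_def)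
  also have "\<dots> = ennreal (2 * \<bar>\<alpha> - \<beta>\<bar>)"
    by (simp add: m_def M_def ennreal_plus[symmetric] max_def min_def del: ennreal_plus)
  finally show ?thesis .
qed

text \<open>Trades the first power for the square: on a z-interval of finite length it bounds an L^1
  norm by a multiple of \<kappa> plus the squared L^2 norm divided by \<kappa>.\<close>

lemma le_add_square_div:
  fixes y \<kappa> :: real
  assumes "0 \<le> y" "0 < \<kappa>" shows "y \<le> \<kappa> + 1 / \<kappa> * y powr 2"
proof (cases "y \<le> \<kappa>")
  case True then show ?thesis using assms by (simp add: add_increasing2)
next
  case False
  then have "\<kappa> * y \<le> y * y" using assms by (intro mult_right_mono) auto
  then have "y \<le> 1 / \<kappa> * (y * y)" using assms by (simp add: field_simps)
  then show ?thesis using assms by (simp add: powr_numeral power2_eq_square add_increasing)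
qed

lemma ennreal_affine:
  assumes "0 \<le> a" "0 \<le> b" "0 \<le> d" "0 \<le> e"
  shows "ennreal (a * (b + d * e)) = ennreal a * (ennreal b + ennreal d * ennreal e)"
  using assms by (simp add: ennreal_mult ennreal_plus)

lemma measurable_shear:
  fixes \<alpha> :: "real \<Rightarrow> real" and f :: "real \<times> real \<Rightarrow> real"
  assumes "f \<in> borel_measurable borel" "\<alpha> \<in> borel_measurable borel"
  shows "(\<lambda>q. f (fst q - \<alpha> (snd q), snd q)) \<in> borel_measurable borel"
proof -
  have "(\<lambda>q. (fst q - \<alpha> (snd q), snd q)) \<in> borel_measurable (borel :: (real \<times> real) measure)"
    using assms(2) unfolding borel_prod[symmetric] by measurable
  from measurable_compose[OF this assms(1)] show ?thesis .
qed

lemma sets_half_plane [measurable]: "UNIV \<times> {0<..} \<in> sets (borel :: (real \<times> real) measure)"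
  using open_half_plane by simp

text \<open>Stability of the transport under the velocity, for one box. The difference of the
  sheared indicators takes the values -1, 0 and 1, so its p-th power is its modulus, and its
  x-integral is at most 2 t |\<alpha> z - \<beta> z|. As the velocities are compared in L^2,
  \<open>le_add_square_div\<close> converts this first power, the box being bounded in z.\<close>

lemma Lp_pow_box_shear_le:
  fixes \<alpha> \<beta> :: "real \<Rightarrow> real"
  assumes p: "1 \<le> p" and \<kappa>: "0 < \<kappa>" and t: "0 \<le> t" "t \<le> T"
    and \<alpha>: "\<alpha> \<in> borel_measurable borel" and \<beta>: "\<beta> \<in> borel_measurable borel"
  shows "Lp_pow p (UNIV \<times> {0<..}) (\<lambda>q. c * indicator (box lo hi) (fst q - t * \<alpha> (snd q), snd q) - c * indicator (box lo hi) (fst q - t * \<beta> (snd q), snd q))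
     \<le> ennreal (\<bar>c\<bar> powr p * (2 * T) * (\<bar>snd hi - snd lo\<bar> + 1)) * (ennreal \<kappa> + ennreal (1 / \<kappa>) * Lp_pow 2 {0<..} (\<lambda>z. \<alpha> z - \<beta> z))"
proof -
  let ?U = "UNIV \<times> {0<..} :: (real \<times> real) set"
  let ?d = "\<lambda>x z. indicator (box (fst lo) (fst hi)) (x - t * \<alpha> z) - indicator (box (fst lo) (fst hi)) (x - t * \<beta> z) :: real"
  let ?J = "indicator (box (snd lo) (snd hi)) :: real \<Rightarrow> real"
  let ?C = "\<bar>c\<bar> powr p * (2 * T)"
  define f where "f q = c * indicator (box lo hi) (fst q - t * \<alpha> (snd q), snd q) - c * indicator (box lo hi) (fst q - t * \<beta> (snd q), snd q)" for q
  have fe: "f (x, z) = c * (?J z * ?d x z)" for x z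
    by (simp add: f_def indicator_box_prod algebra_simps)
  have fm: "f \<in> borel_measurable borel" unfolding f_def[abs_def]
    by (intro borel_measurable_diff borel_measurable_times borel_measurable_const measurable_shear borel_measurable_indicator)
       (use \<alpha> \<beta> in auto)
  have T0: "0 \<le> T" using t by simp
  have m: "(\<lambda>q. indicator ?U q * ennreal (\<bar>f q\<bar> powr p)) \<in> borel_measurable (lborel \<Otimes>\<^sub>M lborel)"
    unfolding lborel_prod using fm by measurable
  have pw: "\<bar>f (x, z)\<bar> powr p = \<bar>c\<bar> powr p * ?J z * \<bar>?d x z\<bar>" for x z
    unfolding fe by (auto simp: indicator_def abs_mult powr_mult)
  have "Lp_pow p ?U f = (\<integral>\<^sup>+ q. indicator ?U q * ennreal (\<bar>f q\<bar> powr p) \<partial>(lborel \<Otimes>\<^sub>M lborel))"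
    by (simp add: Lp_pow_def lborel_prod)
  also have "\<dots> = (\<integral>\<^sup>+ z. (\<integral>\<^sup>+ x. indicator ?U (x, z) * ennreal (\<bar>f (x, z)\<bar> powr p) \<partial>lborel) \<partial>lborel)"
    by (rule lborel_pair.nn_integral_snd[OF m, symmetric])
  also have "\<dots> \<le> (\<integral>\<^sup>+ z. ennreal ?C * (ennreal \<kappa> * indicator (box (snd lo) (snd hi)) z + ennreal (1 / \<kappa>) * (indicator {0<..} z * ennreal (\<bar>\<alpha> z - \<beta> z\<bar> powr 2))) \<partial>lborel)"
  proof (rule nn_integral_mono)
    fix z :: real
    show "(\<integral>\<^sup>+ x. indicator ?U (x, z) * ennreal (\<bar>f (x, z)\<bar> powr p) \<partial>lborel)
      \<le> ennreal ?C * (ennreal \<kappa> * indicator (box (snd lo) (snd hi)) z + ennreal (1 / \<kappa>) * (indicator {0<..} z * ennreal (\<bar>\<alpha> z - \<beta> z\<bar> powr 2)))"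
    proof (cases "0 < z \<and> z \<in> box (snd lo) (snd hi)")
      case False
      then have "indicator ?U (x, z) * ennreal (\<bar>f (x, z)\<bar> powr p) = 0" for x
        by (auto simp: indicator_def pw)
      then show ?thesis by (simp only: nn_integral_const) simp
    next
      case True
      have "(\<integral>\<^sup>+ x. indicator ?U (x, z) * ennreal (\<bar>f (x, z)\<bar> powr p) \<partial>lborel) = (\<integral>\<^sup>+ x. ennreal (\<bar>c\<bar> powr p) * ennreal \<bar>?d x z\<bar> \<partial>lborel)"
        using True by (intro nn_integral_cong) (simp add: pw ennreal_mult)
      also have "\<dots> = ennreal (\<bar>c\<bar> powr p) * (\<integral>\<^sup>+ x. ennreal \<bar>?d x z\<bar> \<partial>lborel)" by (rule nn_integral_cmult) measurable
      also have "\<dots> \<le> ennreal (\<bar>c\<bar> powr p) * ennreal (2 * \<bar>t * \<alpha> z - t * \<beta> z\<bar>)"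
        by (intro mult_left_mono nn_integral_interval_shift_le) simp
      also have "\<dots> = ennreal (\<bar>c\<bar> powr p * (2 * \<bar>t * \<alpha> z - t * \<beta> z\<bar>))" by (simp add: ennreal_mult)
      also have "\<dots> \<le> ennreal (?C * (\<kappa> + 1 / \<kappa> * \<bar>\<alpha> z - \<beta> z\<bar> powr 2))"
      proof (rule ennreal_leI)
        have "\<bar>t * \<alpha> z - t * \<beta> z\<bar> = t * \<bar>\<alpha> z - \<beta> z\<bar>" using t by (simp add: abs_mult right_diff_distrib[symmetric])
        also have "\<dots> \<le> T * (\<kappa> + 1 / \<kappa> * \<bar>\<alpha> z - \<beta> z\<bar> powr 2)"
          using t le_add_square_div[OF _ \<kappa>, of "\<bar>\<alpha> z - \<beta> z\<bar>"] by (intro mult_mono) auto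
        finally have "\<bar>c\<bar> powr p * (2 * \<bar>t * \<alpha> z - t * \<beta> z\<bar>) \<le> \<bar>c\<bar> powr p * (2 * (T * (\<kappa> + 1 / \<kappa> * \<bar>\<alpha> z - \<beta> z\<bar> powr 2)))"
          by (intro mult_left_mono) auto
        then show "\<bar>c\<bar> powr p * (2 * \<bar>t * \<alpha> z - t * \<beta> z\<bar>) \<le> ?C * (\<kappa> + 1 / \<kappa> * \<bar>\<alpha> z - \<beta> z\<bar> powr 2)" by (simp only: mult.assoc)
      qed
      also have "\<dots> = ennreal ?C * (ennreal \<kappa> + ennreal (1 / \<kappa>) * ennreal (\<bar>\<alpha> z - \<beta> z\<bar> powr 2))"
        by (intro ennreal_affine) (use \<kappa> T0 in auto)
      finally show ?thesis using True by simp
    qed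
  qed
  also have "\<dots> = ennreal ?C * (ennreal \<kappa> * emeasure lborel (box (snd lo) (snd hi)) + ennreal (1 / \<kappa>) * Lp_pow 2 {0<..} (\<lambda>z. \<alpha> z - \<beta> z))"
    using \<alpha> \<beta> by (simp add: nn_integral_cmult nn_integral_add Lp_pow_def)
  \<comment> \<open>The added 1 makes the factor at least 1, so it can be put in front of both
    summands.\<close>
  also have "\<dots> \<le> ennreal ?C * (ennreal (\<bar>snd hi - snd lo\<bar> + 1) * (ennreal \<kappa> + ennreal (1 / \<kappa>) * Lp_pow 2 {0<..} (\<lambda>z. \<alpha> z - \<beta> z)))"
  proof (rule mult_left_mono)
    let ?e = "ennreal (1 / \<kappa>) * Lp_pow 2 {0<..} (\<lambda>z. \<alpha> z - \<beta> z)"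
    have "emeasure lborel (box (snd lo) (snd hi)) \<le> ennreal (\<bar>snd hi - snd lo\<bar> + 1)"
      by (cases "snd lo \<le> snd hi") (auto simp: box_real intro!: ennreal_leI)
    then have "ennreal \<kappa> * emeasure lborel (box (snd lo) (snd hi)) \<le> ennreal (\<bar>snd hi - snd lo\<bar> + 1) * ennreal \<kappa>"
      by (subst mult.commute) (rule mult_right_mono, auto)
    moreover have "?e \<le> ennreal (\<bar>snd hi - snd lo\<bar> + 1) * ?e"
      using mult_right_mono[of 1 "ennreal (\<bar>snd hi - snd lo\<bar> + 1)" ?e] by simp
    ultimately show "ennreal \<kappa> * emeasure lborel (box (snd lo) (snd hi)) + ?e \<le> ennreal (\<bar>snd hi - snd lo\<bar> + 1) * (ennreal \<kappa> + ?e)"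
      by (simp only: distrib_left add_mono)
  qed simp
  also have "\<dots> = ennreal (?C * (\<bar>snd hi - snd lo\<bar> + 1)) * (ennreal \<kappa> + ennreal (1 / \<kappa>) * Lp_pow 2 {0<..} (\<lambda>z. \<alpha> z - \<beta> z))"
    using T0 by (simp add: ennreal_mult mult.assoc)
  finally show ?thesis unfolding f_def[abs_def] .
qed

text \<open>The constant C depends on the step function, p and T alone; \<kappa> and the accuracy of
  the velocity are chosen after it in \<open>approximate_solutions\<close>.\<close>

lemma Lp_pow_stepf_shear_le:
  fixes L :: "(real \<times> (real \<times> real) \<times> (real \<times> real)) list"
  assumes p: "1 \<le> p" and T: "0 \<le> T"
  shows "\<exists>C\<ge>0. \<forall>\<kappa> t \<alpha> \<beta>. 0 < \<kappa> \<longrightarrow> 0 \<le> t \<longrightarrow> t \<le> T \<longrightarrow> \<alpha> \<in> borel_measurable borel \<longrightarrow> \<beta> \<in> borel_measurable borel \<longrightarrow>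
     Lp_pow p (UNIV \<times> {0<..}) (\<lambda>q. stepf L (fst q - t * \<alpha> (snd q), snd q) - stepf L (fst q - t * \<beta> (snd q), snd q))
     \<le> ennreal C * (ennreal \<kappa> + ennreal (1 / \<kappa>) * Lp_pow 2 {0<..} (\<lambda>z. \<alpha> z - \<beta> z))"
proof (induction L)
  case Nil
  show ?case by (intro exI[of _ 0]) (simp add: Lp_pow_def)
next
  case (Cons l L)
  obtain c lo hi where l: "l = (c, lo, hi)" by (cases l)
  obtain C where C0: "0 \<le> C" and C: "\<forall>\<kappa> t \<alpha> \<beta>. 0 < \<kappa> \<longrightarrow> 0 \<le> t \<longrightarrow> t \<le> T \<longrightarrow> \<alpha> \<in> borel_measurable borel \<longrightarrow> \<beta> \<in> borel_measurable borel \<longrightarrow>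
     Lp_pow p (UNIV \<times> {0<..}) (\<lambda>q. stepf L (fst q - t * \<alpha> (snd q), snd q) - stepf L (fst q - t * \<beta> (snd q), snd q))
     \<le> ennreal C * (ennreal \<kappa> + ennreal (1 / \<kappa>) * Lp_pow 2 {0<..} (\<lambda>z. \<alpha> z - \<beta> z))"
    using Cons by (elim exE conjE)
  define D where "D = \<bar>c\<bar> powr p * (2 * T) * (\<bar>snd hi - snd lo\<bar> + 1)"
  have D0: "0 \<le> D" using T by (simp add: D_def)
  show ?case
  proof (intro exI[of _ "2 powr p * (D + C)"] conjI allI impI)
    show "0 \<le> 2 powr p * (D + C)" using D0 C0 by simp
    fix \<kappa> t :: real and \<alpha> \<beta> :: "real \<Rightarrow> real"
    assume a: "0 < \<kappa>" "0 \<le> t" "t \<le> T" "\<alpha> \<in> borel_measurable borel" "\<beta> \<in> borel_measurable borel"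
    let ?E = "ennreal \<kappa> + ennreal (1 / \<kappa>) * Lp_pow 2 {0<..} (\<lambda>z. \<alpha> z - \<beta> z)"
    let ?f = "\<lambda>q. c * indicator (box lo hi) (fst q - t * \<alpha> (snd q), snd q) - c * indicator (box lo hi) (fst q - t * \<beta> (snd q), snd q)"
    let ?g = "\<lambda>q. stepf L (fst q - t * \<alpha> (snd q), snd q) - stepf L (fst q - t * \<beta> (snd q), snd q)"
    have ta: "(\<lambda>z. t * \<alpha> z) \<in> borel_measurable borel" "(\<lambda>z. t * \<beta> z) \<in> borel_measurable borel" using a by auto
    have im: "indicator (box lo hi) \<in> borel_measurable (borel :: (real \<times> real) measure)"
      by (rule borel_measurable_indicator) simp
    have fm: "?f \<in> borel_measurable borel"
      by (rule borel_measurable_diff; rule borel_measurable_times[OF borel_measurable_const]; rule measurable_shear[OF im])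
         (rule ta)+
    have gm: "?g \<in> borel_measurable borel"
      by (intro borel_measurable_diff measurable_shear measurable_stepf ta)
    have eq: "(\<lambda>q. stepf (l # L) (fst q - t * \<alpha> (snd q), snd q) - stepf (l # L) (fst q - t * \<beta> (snd q), snd q)) = (\<lambda>q. ?f q + ?g q)"
      by (rule ext) (simp add: l)
    have "Lp_pow p (UNIV \<times> {0<..}) (\<lambda>q. ?f q + ?g q) \<le> ennreal (2 powr p) * (Lp_pow p (UNIV \<times> {0<..}) ?f + Lp_pow p (UNIV \<times> {0<..}) ?g)"
      by (rule Lp_pow_add_le[OF less_le_trans[OF zero_less_one p] borel_measurable_scaleR[OF borel_measurable_indicator fm] borel_measurable_scaleR[OF borel_measurable_indicator gm]])
        (rule sets_half_plane)+
    also have "\<dots> \<le> ennreal (2 powr p) * (ennreal D * ?E + ennreal C * ?E)"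
      using Lp_pow_box_shear_le[OF p a(1-5), of c lo hi] C a by (intro mult_left_mono add_mono) (auto simp: D_def)
    also have "\<dots> = ennreal (2 powr p * (D + C)) * ?E"
      using C0 D0 by (simp add: ennreal_mult ennreal_plus distrib_right mult.assoc)
    finally show "Lp_pow p (UNIV \<times> {0<..}) (\<lambda>q. stepf (l # L) (fst q - t * \<alpha> (snd q), snd q) - stepf (l # L) (fst q - t * \<beta> (snd q), snd q)) \<le> ennreal (2 powr p * (D + C)) * ?E"
      unfolding eq .
  qed
qed

text \<open>Three applications of the quasi-triangle inequality for p-th powers, each at the cost 2
  powr p; as this is at least 1, all four terms can be given the worst factor.\<close>

lemma Lp_pow_add4_le:
  fixes f1 :: "'a::euclidean_space \<Rightarrow> real"
  assumes p: "1 \<le> p" and \<eta>: "0 \<le> \<eta>"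
    and m: "(\<lambda>x. indicator U x *\<^sub>R f1 x) \<in> borel_measurable borel" "(\<lambda>x. indicator U x *\<^sub>R f2 x) \<in> borel_measurable borel"
       "(\<lambda>x. indicator U x *\<^sub>R f3 x) \<in> borel_measurable borel" "(\<lambda>x. indicator U x *\<^sub>R f4 x) \<in> borel_measurable borel"
    and b: "Lp_pow p U f1 \<le> ennreal \<eta>" "Lp_pow p U f2 \<le> ennreal \<eta>" "Lp_pow p U f3 \<le> ennreal \<eta>" "Lp_pow p U f4 \<le> ennreal \<eta>"
  shows "Lp_pow p U (\<lambda>x. f1 x + (f2 x + (f3 x + f4 x))) \<le> ennreal (4 * (2 powr p) ^ 3 * \<eta>)"
proof -
  let ?P = "2 powr p"
  have P: "1 \<le> ?P" using p ge_one_powr_ge_zero[of 2 p] by simp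
  have step: "Lp_pow p U (\<lambda>x. f x + g x) \<le> ennreal (?P * (c + d))"
    if "(\<lambda>x. indicator U x *\<^sub>R f x) \<in> borel_measurable borel" "(\<lambda>x. indicator U x *\<^sub>R g x) \<in> borel_measurable borel"
       "Lp_pow p U f \<le> ennreal c" "Lp_pow p U g \<le> ennreal d" "0 \<le> c" "0 \<le> d" for f g c d
  proof -
    have "Lp_pow p U (\<lambda>x. f x + g x) \<le> ennreal ?P * (Lp_pow p U f + Lp_pow p U g)"
      by (rule Lp_pow_add_le) (use that p in auto)
    also have "\<dots> \<le> ennreal ?P * (ennreal c + ennreal d)" using that by (intro mult_left_mono add_mono) auto
    finally show ?thesis using that(5,6) by (simp add: ennreal_mult ennreal_plus)
  qed
  have m34: "(\<lambda>x. indicator U x *\<^sub>R (f3 x + f4 x)) \<in> borel_measurable borel"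
    unfolding scaleR_add_right by (intro borel_measurable_add m)
  have m234: "(\<lambda>x. indicator U x *\<^sub>R (f2 x + (f3 x + f4 x))) \<in> borel_measurable borel"
    unfolding scaleR_add_right[of _ "f2 _"] by (intro borel_measurable_add m m34)
  have n1: "0 \<le> ?P * (\<eta> + \<eta>)" using \<eta> by simp
  have n2: "0 \<le> ?P * (\<eta> + ?P * (\<eta> + \<eta>))" using \<eta> n1 by simp
  have "Lp_pow p U (\<lambda>x. f1 x + (f2 x + (f3 x + f4 x))) \<le> ennreal (?P * (\<eta> + ?P * (\<eta> + ?P * (\<eta> + \<eta>))))"
    by (intro step m m34 m234 b \<eta> n1 n2)
  also have "\<dots> \<le> ennreal (4 * ?P ^ 3 * \<eta>)"
  proof (rule ennreal_leI)
    have "?P * \<eta> \<le> ?P ^ 3 * \<eta>" "?P ^ 2 * \<eta> \<le> ?P ^ 3 * \<eta>"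
      using \<eta> power_increasing[OF _ P, of 1 3] power_increasing[OF _ P, of 2 3] by (auto intro!: mult_right_mono)
    then show "?P * (\<eta> + ?P * (\<eta> + ?P * (\<eta> + \<eta>))) \<le> 4 * ?P ^ 3 * \<eta>"
      by (simp add: power2_eq_square power3_eq_cube algebra_simps)
  qed
  finally show ?thesis .
qed

section \<open>Measurability of the error in time\<close>

lemma depleted_NS_sol_measurable:
  assumes "depleted_NS_sol \<epsilon> T u v"
  shows "(\<lambda>r::real\<times>real. indicator ({0<..<T} \<times> {0<..}) r *\<^sub>R u (fst r) (snd r)) \<in> borel_measurable borel"
    and "(\<lambda>r::real\<times>real\<times>real. indicator ({0<..<T} \<times> (UNIV \<times> {0<..})) r *\<^sub>R v (fst r) (fst (snd r)) (snd (snd r))) \<in> borel_measurable borel"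
proof -
  have c: "continuous_on ({0<..<T} \<times> {0..}) (\<lambda>r. u (fst r) (snd r))"
    "continuous_on ({0<..<T} \<times> (UNIV \<times> {0..})) (\<lambda>r. v (fst r) (fst (snd r)) (snd (snd r)))"
    using assms unfolding depleted_NS_sol_def split_def by blast+
  have o1: "open ({0<..<T} \<times> {0::real<..})" "open ({0<..<T} \<times> ((UNIV::real set) \<times> {0::real<..}))"
    by (intro open_Times open_greaterThanLessThan open_greaterThan open_UNIV)+
  show "(\<lambda>r::real\<times>real. indicator ({0<..<T} \<times> {0<..}) r *\<^sub>R u (fst r) (snd r)) \<in> borel_measurable borel"
    by (rule measurable_indicator_times_continuous[OF continuous_on_subset[OF c(1)] o1(1)]) auto
  show "(\<lambda>r::real\<times>real\<times>real. indicator ({0<..<T} \<times> (UNIV \<times> {0<..})) r *\<^sub>R v (fst r) (fst (snd r)) (snd (snd r))) \<in> borel_measurable borel"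
    by (rule measurable_indicator_times_continuous[OF continuous_on_subset[OF c(2)] o1(2)]) auto
qed

text \<open>\<open>esssup_I\<close> asks for an error that is measurable in t. By Tonelli this
  follows from joint measurability in time and space, and the norm is a Borel function of the p-th
  power.\<close>

lemma measurable_Lp_norm_param:
  fixes F :: "real \<Rightarrow> 'a::euclidean_space \<Rightarrow> real"
  assumes J: "(\<lambda>r::real\<times>'a. indicator ({0<..<T} \<times> U) r *\<^sub>R F (fst r) (snd r)) \<in> borel_measurable borel"
  shows "(\<lambda>t. Lp_norm p U (F t)) \<in> borel_measurable (restrict_space lborel {0<..<T})"
proof -
  define g where "g t = (\<integral>\<^sup>+ x. ennreal (\<bar>indicator ({0<..<T} \<times> U) (t, x) *\<^sub>R F t x\<bar> powr p) \<partial>lborel)" for t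
  have "(\<lambda>r. ennreal (\<bar>indicator ({0<..<T} \<times> U) r *\<^sub>R F (fst r) (snd r)\<bar> powr p)) \<in> borel_measurable (lborel \<Otimes>\<^sub>M lborel)"
    unfolding lborel_prod using J by measurable
  then have "case_prod (\<lambda>t x. ennreal (\<bar>indicator ({0<..<T} \<times> U) (t, x) *\<^sub>R F t x\<bar> powr p)) \<in> borel_measurable (lborel \<Otimes>\<^sub>M lborel)"
    by (simp add: split_def)
  then have gm: "g \<in> borel_measurable lborel" unfolding g_def[abs_def] by (rule lborel.borel_measurable_nn_integral)
  have "(\<lambda>P::ennreal. if P < \<top> then ennreal (enn2real P powr (1 / p)) else \<top>) \<in> borel_measurable borel" by measurable
  from measurable_compose[OF gm this]
  have "(\<lambda>t. if g t < \<top> then ennreal (enn2real (g t) powr (1 / p)) else \<top>) \<in> borel_measurable (restrict_space lborel {0<..<T})"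
    by (rule measurable_restrict_space1)
  moreover have "g t = Lp_pow p U (F t)" if "t \<in> {0<..<T}" for t
    unfolding g_def Lp_pow_alt using that by (intro nn_integral_cong) (auto simp: indicator_def)
  then have "(if g t < \<top> then ennreal (enn2real (g t) powr (1 / p)) else \<top>) = Lp_norm p U (F t)" if "t \<in> space (restrict_space lborel {0<..<T})" for t
    using that by (simp add: Lp_norm_def space_restrict_space)
  ultimately show ?thesis by (rule iffD1[OF measurable_cong, rotated])
qed

lemma Lp_norm_le:
  assumes "Lp_pow p U f \<le> ennreal (c powr p)" "0 < p" "0 \<le> c"
  shows "Lp_norm p U f \<le> ennreal c"
proof -
  have "Lp_pow p U f < \<top>" using assms(1) by (rule le_less_trans) simp
  moreover have "enn2real (Lp_pow p U f) powr (1 / p) \<le> (c powr p) powr (1 / p)"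
    using assms enn2real_mono[OF assms(1)] by (intro powr_mono2) auto
  moreover have "(c powr p) powr (1 / p) = c" using assms by (simp add: powr_powr)
  ultimately show ?thesis by (simp add: Lp_norm_def ennreal_leI)
qed

lemma smooth_on_zero: "smooth_on (U :: 'a::euclidean_space set) (\<lambda>x. 0)"
  unfolding smooth_on_def
proof
  fix k show "Ck k U (\<lambda>x. 0)"
  proof (induction k)
    case (Suc k)
    have "pd (\<lambda>x::'a. 0) = (\<lambda>i x. 0)" by (auto simp: pd_def fun_eq_iff)
    then show ?case using Suc by simp
  qed simp
qed

text \<open>The fallback in \<open>vanishing_viscosity\<close>: a solution must be named for every
  positive \<epsilon>, also where no finite error is attained.\<close>

lemma depleted_NS_sol_zero: "depleted_NS_sol \<epsilon> T (\<lambda>t z. 0) (\<lambda>t x z. 0)"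
  unfolding depleted_NS_sol_def split_def by (simp add: smooth_on_zero)

section \<open>Approximation of the given data\<close>

context
  fixes p T :: real and u0 :: "real \<Rightarrow> real" and v0 :: "real \<times> real \<Rightarrow> real"
  assumes p: "1 < p" and T: "0 < T" and u0: "Lp 2 {0<..} u0" and v0: "Lp p (UNIV \<times> {0<..}) v0"
begin

text \<open>Extension by zero: membership in \<open>Lp\<close> controls u0 on the half-line, whereas
  \<open>step_dense\<close> and the shears want Borel functions on the whole space.\<close>

definition u0' where "u0' z = indicator {0<..} z *\<^sub>R u0 z"
definition v0' where "v0' q = indicator (UNIV \<times> {0<..}) q *\<^sub>R v0 q"

lemma u0'_measurable: "u0' \<in> borel_measurable borel" and v0'_measurable: "v0' \<in> borel_measurable borel"
  using u0 v0 by (simp_all add: Lp_def set_borel_measurable_def u0'_def[abs_def] v0'_def[abs_def])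

lemma Lp_pow_u0': "Lp_pow 2 UNIV u0' < \<infinity>" and Lp_pow_v0': "Lp_pow p UNIV v0' < \<infinity>"
proof -
  have "Lp_pow 2 UNIV u0' = Lp_pow 2 {0<..} u0" unfolding Lp_pow_alt by (simp add: u0'_def)
  then show "Lp_pow 2 UNIV u0' < \<infinity>" using u0 by (simp add: Lp_def)
  have "Lp_pow p UNIV v0' = Lp_pow p (UNIV \<times> {0<..}) v0" unfolding Lp_pow_alt by (simp add: v0'_def)
  then show "Lp_pow p UNIV v0' < \<infinity>" using v0 by (simp add: Lp_def)
qed

lemma Lp_pow_subset: "Lp_pow r U f \<le> Lp_pow r UNIV f"
  unfolding Lp_pow_def by (intro nn_integral_mono) (auto simp: indicator_def)

text \<open>The error in v is split into four parts: viscosity for smoothed data, smoothing,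
  replacing the smoothed velocity by u0 in the transport of a fixed step function, and approximating
  v0 by that step function. The second and the fourth are invariant under the shear. The third
  couples the accuracies: it forces the step function for v0 to be fixed before the one for
  u0.\<close>

lemma approximate_solutions:
  assumes \<delta>: "0 < \<delta>"
  shows "\<exists>\<epsilon>0>0. \<forall>\<epsilon>. 0 < \<epsilon> \<longrightarrow> \<epsilon> < \<epsilon>0 \<longrightarrow> (\<exists>u v. depleted_NS_sol \<epsilon> T u v \<and> (\<forall>t. 0 < t \<longrightarrow> t < T \<longrightarrow>
     Lp_pow 2 {0<..} (\<lambda>z. u t z - u0 z) \<le> ennreal \<delta> \<and>
     Lp_pow p (UNIV \<times> {0<..}) (\<lambda>(x, z). v t x z - v0 (x - t * u0 z, z)) \<le> ennreal \<delta>))"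
proof -
  let ?U = "UNIV \<times> {0<..} :: (real \<times> real) set"
  \<comment> \<open>The divisor is the cost of adding four errors in
    \<open>Lp_pow_add4_le\<close>.\<close>
  define \<eta> where "\<eta> = \<delta> / (4 * (2 powr p) ^ 3)"
  have \<eta>: "0 < \<eta>" "4 * (2 powr p) ^ 3 * \<eta> = \<delta>" using \<delta> by (auto simp: \<eta>_def)
  have p': "0 < p" "1 \<le> p" using p by auto
  obtain L2 where L2: "Lp_pow p UNIV (\<lambda>q. v0' q - stepf L2 q) \<le> ennreal \<eta>"
    using step_dense[OF p'(1) v0'_measurable Lp_pow_v0'] \<eta>(1) unfolding step_approx_def by blast
  obtain C where C0: "0 \<le> C" and C: "\<forall>\<kappa> t \<alpha> \<beta>. 0 < \<kappa> \<longrightarrow> 0 \<le> t \<longrightarrow> t \<le> T \<longrightarrow> \<alpha> \<in> borel_measurable borel \<longrightarrow> \<beta> \<in> borel_measurable borel \<longrightarrow>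
     Lp_pow p ?U (\<lambda>q. stepf L2 (fst q - t * \<alpha> (snd q), snd q) - stepf L2 (fst q - t * \<beta> (snd q), snd q))
     \<le> ennreal C * (ennreal \<kappa> + ennreal (1 / \<kappa>) * Lp_pow 2 {0<..} (\<lambda>z. \<alpha> z - \<beta> z))"
    using Lp_pow_stepf_shear_le[OF p'(2) less_imp_le[OF T], of L2] by (elim exE conjE)
  \<comment> \<open>With \<mu> / \<kappa> <= \<kappa> the shear error is at most 2 C \<kappa>, which
    this choice keeps below \<eta>; the 1 covers C = 0.\<close>
  define \<kappa> where "\<kappa> = \<eta> / (2 * C + 1)"
  have \<kappa>: "0 < \<kappa>" "C * (\<kappa> + \<kappa>) \<le> \<eta>"
  proof -
    show "0 < \<kappa>" using \<eta>(1) C0 by (simp add: \<kappa>_def)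
    have "C * (\<kappa> + \<kappa>) = \<eta> * (2 * C / (2 * C + 1))" by (simp add: \<kappa>_def)
    also have "\<dots> \<le> \<eta> * 1" using \<eta>(1) C0 by (intro mult_left_mono) (auto simp: divide_le_eq)
    finally show "C * (\<kappa> + \<kappa>) \<le> \<eta>" by simp
  qed
  \<comment> \<open>The first entry serves the error in u itself, the second makes \<mu> / \<kappa>
    at most \<kappa> in the shear estimate.\<close>
  define \<mu> where "\<mu> = min (\<delta> / 8) (\<kappa> * \<kappa>)"
  have \<mu>: "0 < \<mu>" "\<mu> \<le> \<delta> / 8" "1 / \<kappa> * \<mu> \<le> \<kappa>" using \<delta> \<kappa>(1) by (auto simp: \<mu>_def min_def field_simps)
  \<comment> \<open>Two errors of \<mu> / 8, one from this approximation and one from smoothing, add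
    up to \<mu>, since adding squares costs the factor 2 powr 2 = 4.\<close>
  obtain L1 where L1: "Lp_pow 2 UNIV (\<lambda>z. u0' z - stepf L1 z) \<le> ennreal (\<mu> / 8)"
    using step_dense[OF _ u0'_measurable Lp_pow_u0'] \<mu>(1) unfolding step_approx_def by (metis divide_pos_pos zero_less_numeral)
  define s where "s k = inverse (real (Suc k))" for k
  have s: "0 < s k" "s k \<le> 1" "s \<longlonglongrightarrow> 0" for k
    using LIMSEQ_inverse_real_of_nat by (auto simp: s_def[abs_def] inverse_le_1_iff)
  have "eventually (\<lambda>k. Lp_pow 2 {0<..} (\<lambda>z. Re (heat (of_real (s k)) (odd_profile (stepf L1)) (of_real z)) - stepf L1 z) < ennreal (\<mu> / 8)) sequentially"
    by (rule order_tendstoD(2)[OF odd_profile_converges[OF _ s]]) (use \<mu> in auto)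
  moreover have "eventually (\<lambda>k. Lp_pow p ?U (\<lambda>q. smooth_step (s k) L2 q - stepf L2 q) < ennreal \<eta>) sequentially"
    by (rule order_tendstoD(2)[OF smooth_step_converges[OF p'(2) s]]) (use \<eta> in auto)
  ultimately have "eventually (\<lambda>k. Lp_pow 2 {0<..} (\<lambda>z. Re (heat (of_real (s k)) (odd_profile (stepf L1)) (of_real z)) - stepf L1 z) < ennreal (\<mu> / 8) \<and>
     Lp_pow p ?U (\<lambda>q. smooth_step (s k) L2 q - stepf L2 q) < ennreal \<eta>) sequentially"
    by (rule eventually_conj)
  then obtain k where k: "Lp_pow 2 {0<..} (\<lambda>z. Re (heat (of_real (s k)) (odd_profile (stepf L1)) (of_real z)) - stepf L1 z) < ennreal (\<mu> / 8)"
     "Lp_pow p ?U (\<lambda>q. smooth_step (s k) L2 q - stepf L2 q) < ennreal \<eta>"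
    by (auto simp: eventually_sequentially)
  define a where "a = s k"
  have a: "0 < a" using s(1) by (simp add: a_def)
  define U0 where "U0 z = Re (heat (of_real a) (odd_profile (stepf L1)) (of_real z))" for z
  have U0m: "U0 \<in> borel_measurable borel" unfolding U0_def[abs_def]
    by (intro borel_measurable_continuous_onI continuous_intros continuous_on_heat_real compact_profile_stepf a)
  have ms: "smooth_step a L2 \<in> borel_measurable borel" by (rule borel_measurable_continuous_onI[OF smooth_step_continuous[OF a]])
  have im: "(\<lambda>z. indicator {0<..} z *\<^sub>R f z) \<in> borel_measurable borel" if "f \<in> borel_measurable borel" for f :: "real \<Rightarrow> real"
    using that by measurable
  have imU: "(\<lambda>z. indicator ?U z *\<^sub>R f z) \<in> borel_measurable borel" if "f \<in> borel_measurable borel" for f :: "real \<times> real \<Rightarrow> real"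
    using that by measurable
  have two: "(2::real) powr 2 = 4" by (simp add: powr_numeral)
  have U0u0: "Lp_pow 2 {0<..} (\<lambda>z. U0 z - u0' z) \<le> ennreal \<mu>"
  proof -
    have "Lp_pow 2 {0<..} (\<lambda>z. (U0 z - stepf L1 z) + (stepf L1 z - u0' z)) \<le> ennreal (2 powr 2) * (Lp_pow 2 {0<..} (\<lambda>z. U0 z - stepf L1 z) + Lp_pow 2 {0<..} (\<lambda>z. stepf L1 z - u0' z))"
      by (rule Lp_pow_add_le) (use U0m u0'_measurable in \<open>auto intro!: im\<close>)
    also have "\<dots> \<le> ennreal (2 powr 2) * (ennreal (\<mu> / 8) + ennreal (\<mu> / 8))"
    proof (intro mult_left_mono add_mono)
      show "Lp_pow 2 {0<..} (\<lambda>z. U0 z - stepf L1 z) \<le> ennreal (\<mu> / 8)" using k(1) by (simp add: U0_def a_def)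
      show "Lp_pow 2 {0<..} (\<lambda>z. stepf L1 z - u0' z) \<le> ennreal (\<mu> / 8)"
        using order_trans[OF Lp_pow_subset L1] Lp_pow_minus by metis
    qed simp
    also have "\<dots> = ennreal (2 powr 2 * (\<mu> / 8 + \<mu> / 8))"
      by (subst ennreal_plus[symmetric]; (subst ennreal_mult)?) (use \<mu>(1) in simp_all)
    also have "\<dots> = ennreal \<mu>" unfolding two by simp
    finally show ?thesis by simp
  qed
  obtain V G where VG: "model_family T a (odd_profile (stepf L1)) V G"
     "\<And>t x z. Re (G t x z) = smooth_step a L2 (x - t * U0 z, z)"
    using smooth_step_family[OF T a, of L1 L2] unfolding U0_def by blast
  obtain \<epsilon>1 where e1: "\<epsilon>1 > 0" "\<epsilon>1 \<le> 1" "\<And>\<epsilon> t. 0 < \<epsilon> \<Longrightarrow> \<epsilon> < \<epsilon>1 \<Longrightarrow> 0 < t \<Longrightarrow> t < T \<Longrightarrow>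
     Lp_pow p ?U (\<lambda>q. Re (V \<epsilon> (of_real t) (of_real (fst q)) (of_real (snd q))) - Re (G t (fst q) (snd q))) \<le> ennreal \<eta>"
    using model_family_converges[OF T p'(2) VG(1) \<eta>(1)] by blast
  have d8: "0 < \<delta> / 8" using \<delta> by simp
  obtain \<epsilon>2 where e2: "\<epsilon>2 > 0" "\<And>\<epsilon> t. 0 < \<epsilon> \<Longrightarrow> \<epsilon> < \<epsilon>2 \<Longrightarrow> 0 < t \<Longrightarrow> t < T \<Longrightarrow>
     Lp_pow 2 {0<..} (\<lambda>z. Re (heat_flow a (odd_profile (stepf L1)) \<epsilon> (of_real t) (of_real z)) - U0 z) \<le> ennreal (\<delta> / 8)"
    using heat_flow_converges[OF T _ a compact_profile_stepf(2) d8, of 2 L1] unfolding U0_def by auto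
  show ?thesis
  proof (intro exI[of _ "min \<epsilon>1 \<epsilon>2"] conjI allI impI)
    show "0 < min \<epsilon>1 \<epsilon>2" using e1 e2 by simp
    fix \<epsilon> :: real assume \<epsilon>: "0 < \<epsilon>" "\<epsilon> < min \<epsilon>1 \<epsilon>2"
    then have \<epsilon>1: "\<epsilon> \<le> 1" using e1(2) by simp
    define u where "u t z = Re (heat_flow a (odd_profile (stepf L1)) \<epsilon> (of_real t) (of_real z))" for t z :: real
    define v where "v t x z = Re (V \<epsilon> (of_real t) (of_real x) (of_real z))" for t x z :: real
    have "hol_solution \<epsilon> T (heat_flow a (odd_profile (stepf L1)) \<epsilon>) (V \<epsilon>)"
      using VG(1) \<epsilon>(1) \<epsilon>1 unfolding model_family_def by blast
    from depleted_NS_sol_Re[OF T a \<epsilon>(1) \<epsilon>1 compact_profile_stepf(2) odd_profile_simps(2,3) this]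
    have NS: "depleted_NS_sol \<epsilon> T u v" unfolding u_def[abs_def] v_def[abs_def] .
    have "Lp_pow 2 {0<..} (\<lambda>z. u t z - u0 z) \<le> ennreal \<delta> \<and>
       Lp_pow p ?U (\<lambda>(x, z). v t x z - v0 (x - t * u0 z, z)) \<le> ennreal \<delta>" if t: "0 < t" "t < T" for t
    proof
      have um: "(\<lambda>z. indicator {0<..} z *\<^sub>R u t z) \<in> borel_measurable borel"
      proof -
        have "(\<lambda>z::real. (t, z)) \<in> borel_measurable borel" by (intro borel_measurable_continuous_onI continuous_intros)
        from measurable_compose[OF this depleted_NS_sol_measurable(1)[OF NS]] t show ?thesis by (simp add: indicator_def)
      qed
      have vm: "(\<lambda>q. indicator ?U q *\<^sub>R v t (fst q) (snd q)) \<in> borel_measurable borel"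
      proof -
        have "(\<lambda>q::real\<times>real. (t, q)) \<in> borel_measurable borel" by (intro borel_measurable_continuous_onI continuous_intros)
        from measurable_compose[OF this depleted_NS_sol_measurable(2)[OF NS]] t show ?thesis by (simp add: indicator_def mem_Times_iff)
      qed
      have "Lp_pow 2 {0<..} (\<lambda>z. u t z - u0 z) = Lp_pow 2 {0<..} (\<lambda>z. (u t z - U0 z) + (U0 z - u0' z))"
        by (rule Lp_pow_cong) (simp add: u0'_def)
      also have "\<dots> \<le> ennreal (2 powr 2) * (Lp_pow 2 {0<..} (\<lambda>z. u t z - U0 z) + Lp_pow 2 {0<..} (\<lambda>z. U0 z - u0' z))"
        by (rule Lp_pow_add_le) (use um im[OF U0m] im[OF u0'_measurable] in \<open>auto simp: right_diff_distrib\<close>)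
      also have "\<dots> \<le> ennreal (2 powr 2) * (ennreal (\<delta> / 8) + ennreal (\<delta> / 8))"
      proof (intro mult_left_mono add_mono)
        show "Lp_pow 2 {0<..} (\<lambda>z. u t z - U0 z) \<le> ennreal (\<delta> / 8)" using e2(2)[of \<epsilon> t] \<epsilon> t by (simp add: u_def)
        show "Lp_pow 2 {0<..} (\<lambda>z. U0 z - u0' z) \<le> ennreal (\<delta> / 8)" by (rule order_trans[OF U0u0 ennreal_leI[OF \<mu>(2)]])
      qed simp
      also have "\<dots> = ennreal (2 powr 2 * (\<delta> / 8 + \<delta> / 8))"
        by (subst ennreal_plus[symmetric]; (subst ennreal_mult)?) (use \<delta> in simp_all)
      also have "\<dots> = ennreal \<delta>" unfolding two by simp
      finally show "Lp_pow 2 {0<..} (\<lambda>z. u t z - u0 z) \<le> ennreal \<delta>" .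
      have tU: "(\<lambda>z. t * U0 z) \<in> borel_measurable borel" "(\<lambda>z. t * u0' z) \<in> borel_measurable borel" using U0m u0'_measurable by auto
      let ?f1 = "\<lambda>q. v t (fst q) (snd q) - smooth_step a L2 (fst q - t * U0 (snd q), snd q)"
      let ?f2 = "\<lambda>q. smooth_step a L2 (fst q - t * U0 (snd q), snd q) - stepf L2 (fst q - t * U0 (snd q), snd q)"
      let ?f3 = "\<lambda>q. stepf L2 (fst q - t * U0 (snd q), snd q) - stepf L2 (fst q - t * u0' (snd q), snd q)"
      let ?f4 = "\<lambda>q. stepf L2 (fst q - t * u0' (snd q), snd q) - v0' (fst q - t * u0' (snd q), snd q)"
      have "Lp_pow p ?U (\<lambda>(x, z). v t x z - v0 (x - t * u0 z, z)) = Lp_pow p ?U (\<lambda>q. ?f1 q + (?f2 q + (?f3 q + ?f4 q)))"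
        by (rule Lp_pow_cong) (auto simp: u0'_def v0'_def)
      also have "\<dots> \<le> ennreal (4 * (2 powr p) ^ 3 * \<eta>)"
      proof (rule Lp_pow_add4_le[OF p'(2) less_imp_le[OF \<eta>(1)]])
        show "(\<lambda>q. indicator ?U q *\<^sub>R ?f1 q) \<in> borel_measurable borel"
          unfolding scaleR_diff_right by (intro borel_measurable_diff vm imU measurable_shear[OF ms tU(1)])
        show "(\<lambda>q. indicator ?U q *\<^sub>R ?f2 q) \<in> borel_measurable borel"
          by (intro imU borel_measurable_diff measurable_shear[OF ms tU(1)] measurable_shear[OF measurable_stepf tU(1)])
        show "(\<lambda>q. indicator ?U q *\<^sub>R ?f3 q) \<in> borel_measurable borel"
          by (intro imU borel_measurable_diff measurable_shear[OF measurable_stepf tU(1)] measurable_shear[OF measurable_stepf tU(2)])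
        show "(\<lambda>q. indicator ?U q *\<^sub>R ?f4 q) \<in> borel_measurable borel"
          by (intro imU borel_measurable_diff measurable_shear[OF measurable_stepf tU(2)] measurable_shear[OF v0'_measurable tU(2)])
        show "Lp_pow p ?U ?f1 \<le> ennreal \<eta>" using e1(3)[of \<epsilon> t] \<epsilon> t by (simp add: v_def VG(2))
        have "(\<lambda>q. smooth_step a L2 q - stepf L2 q) \<in> borel_measurable borel" using ms by measurable
        from Lp_pow_shear[OF this tU(1), of p] k(2) show "Lp_pow p ?U ?f2 \<le> ennreal \<eta>" by (simp add: a_def)
        have "(\<lambda>q. stepf L2 q - v0' q) \<in> borel_measurable borel" using v0'_measurable by measurable
        from Lp_pow_shear[OF this tU(2), of p] order_trans[OF Lp_pow_subset L2]
        show "Lp_pow p ?U ?f4 \<le> ennreal \<eta>" using Lp_pow_minus[of p ?U "stepf L2" v0'] by simp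
        have "Lp_pow p ?U ?f3 \<le> ennreal C * (ennreal \<kappa> + ennreal (1 / \<kappa>) * Lp_pow 2 {0<..} (\<lambda>z. U0 z - u0' z))"
          using C \<kappa>(1) t U0m u0'_measurable by auto
        also have "\<dots> \<le> ennreal C * (ennreal \<kappa> + ennreal (1 / \<kappa>) * ennreal \<mu>)"
          by (intro mult_left_mono add_left_mono U0u0) auto
        also have "\<dots> = ennreal (C * (\<kappa> + 1 / \<kappa> * \<mu>))"
          by (rule ennreal_affine[symmetric]) (use C0 \<kappa>(1) \<mu>(1) in auto)
        also have "\<dots> \<le> ennreal (C * (\<kappa> + \<kappa>))" using C0 \<mu>(3) by (intro ennreal_leI mult_left_mono) auto
        also have "\<dots> \<le> ennreal \<eta>" by (rule ennreal_leI[OF \<kappa>(2)])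
        finally show "Lp_pow p ?U ?f3 \<le> ennreal \<eta>" .
      qed
      finally show "Lp_pow p ?U (\<lambda>(x, z). v t x z - v0 (x - t * u0 z, z)) \<le> ennreal \<delta>" using \<eta>(2) by simp
    qed
    with NS show "\<exists>u v. depleted_NS_sol \<epsilon> T u v \<and> (\<forall>t. 0 < t \<longrightarrow> t < T \<longrightarrow>
     Lp_pow 2 {0<..} (\<lambda>z. u t z - u0 z) \<le> ennreal \<delta> \<and>
     Lp_pow p ?U (\<lambda>(x, z). v t x z - v0 (x - t * u0 z, z)) \<le> ennreal \<delta>)" by blast
  qed
qed

definition sup_error where
  "sup_error u v = esssup (restrict_space lborel {0<..<T}) (\<lambda>t. Lp_norm 2 {0<..} (\<lambda>z. u t z - u0 z)
                   + Lp_norm p (UNIV \<times> {0<..}) (\<lambda>(x, z). v t x z - v0 (x - t * u0 z, z)))"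

lemma measurable_error:
  assumes NS: "depleted_NS_sol \<epsilon> T u v"
  shows "(\<lambda>t. Lp_norm 2 {0<..} (\<lambda>z. u t z - u0 z) + Lp_norm p (UNIV \<times> {0<..}) (\<lambda>(x, z). v t x z - v0 (x - t * u0 z, z)))
     \<in> borel_measurable (restrict_space lborel {0<..<T})"
proof (rule borel_measurable_add)
  have o1: "{0<..<T} \<times> {0::real<..} \<in> sets borel" "{0<..<T} \<times> ((UNIV::real set) \<times> {0::real<..}) \<in> sets borel"
    by (intro borel_open open_Times open_greaterThanLessThan open_greaterThan open_UNIV)+
  have f: "fst \<in> borel_measurable (borel :: (real\<times>real) measure)" "snd \<in> borel_measurable (borel :: (real\<times>real) measure)"
    by (intro borel_measurable_continuous_onI continuous_intros)+
  show "(\<lambda>t. Lp_norm 2 {0<..} (\<lambda>z. u t z - u0 z)) \<in> borel_measurable (restrict_space lborel {0<..<T})"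
  proof (rule measurable_Lp_norm_param)
    have "(\<lambda>r::real\<times>real. indicator ({0<..<T} \<times> {0<..}) r *\<^sub>R u (fst r) (snd r) - indicator ({0<..<T} \<times> {0<..}) r *\<^sub>R u0' (snd r)) \<in> borel_measurable borel"
      by (intro borel_measurable_diff depleted_NS_sol_measurable[OF NS] borel_measurable_scaleR borel_measurable_indicator o1
            measurable_compose[OF f(2) u0'_measurable])
    also have "(\<lambda>r::real\<times>real. indicator ({0<..<T} \<times> {0<..}) r *\<^sub>R u (fst r) (snd r) - indicator ({0<..<T} \<times> {0<..}) r *\<^sub>R u0' (snd r))
       = (\<lambda>r. indicator ({0<..<T} \<times> {0<..}) r *\<^sub>R (u (fst r) (snd r) - u0 (snd r)))"
      by (auto simp: u0'_def indicator_def fun_eq_iff)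
    finally show "(\<lambda>r::real\<times>real. indicator ({0<..<T} \<times> {0<..}) r *\<^sub>R (u (fst r) (snd r) - u0 (snd r))) \<in> borel_measurable borel" .
  qed
  show "(\<lambda>t. Lp_norm p (UNIV \<times> {0<..}) (\<lambda>(x, z). v t x z - v0 (x - t * u0 z, z))) \<in> borel_measurable (restrict_space lborel {0<..<T})"
  proof (rule measurable_Lp_norm_param)
    have g: "fst \<in> borel_measurable (borel :: (real\<times>real\<times>real) measure)" "(\<lambda>r. fst (snd r)) \<in> borel_measurable (borel :: (real\<times>real\<times>real) measure)"
      "(\<lambda>r. snd (snd r)) \<in> borel_measurable (borel :: (real\<times>real\<times>real) measure)"
      by (intro borel_measurable_continuous_onI continuous_intros)+
    have "(\<lambda>r::real\<times>real\<times>real. (fst (snd r) - fst r * u0' (snd (snd r)), snd (snd r))) \<in> borel_measurable borel"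
      using g u0'_measurable by (intro borel_measurable_Pair borel_measurable_diff borel_measurable_times measurable_compose[OF g(3) u0'_measurable])
    from measurable_compose[OF this v0'_measurable]
    have vm: "(\<lambda>r::real\<times>real\<times>real. v0' (fst (snd r) - fst r * u0' (snd (snd r)), snd (snd r))) \<in> borel_measurable borel" .
    have "(\<lambda>r::real\<times>real\<times>real. indicator ({0<..<T} \<times> (UNIV \<times> {0<..})) r *\<^sub>R v (fst r) (fst (snd r)) (snd (snd r))
        - indicator ({0<..<T} \<times> (UNIV \<times> {0<..})) r *\<^sub>R v0' (fst (snd r) - fst r * u0' (snd (snd r)), snd (snd r))) \<in> borel_measurable borel"
      by (intro borel_measurable_diff depleted_NS_sol_measurable[OF NS] borel_measurable_scaleR borel_measurable_indicator o1 vm)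
    also have "(\<lambda>r::real\<times>real\<times>real. indicator ({0<..<T} \<times> (UNIV \<times> {0<..})) r *\<^sub>R v (fst r) (fst (snd r)) (snd (snd r))
        - indicator ({0<..<T} \<times> (UNIV \<times> {0<..})) r *\<^sub>R v0' (fst (snd r) - fst r * u0' (snd (snd r)), snd (snd r)))
       = (\<lambda>r. indicator ({0<..<T} \<times> (UNIV \<times> {0<..})) r *\<^sub>R (case snd r of (x, z) \<Rightarrow> v (fst r) x z - v0 (x - fst r * u0 z, z)))"
      by (auto simp: u0'_def v0'_def indicator_def fun_eq_iff)
    finally show "(\<lambda>r::real\<times>real\<times>real. indicator ({0<..<T} \<times> (UNIV \<times> {0<..})) r *\<^sub>R (case snd r of (x, z) \<Rightarrow> v (fst r) x z - v0 (x - fst r * u0 z, z))) \<in> borel_measurable borel" .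
  qed
qed

lemma sup_error_small:
  assumes \<delta>: "0 < \<delta>"
  shows "\<exists>\<epsilon>0>0. \<forall>\<epsilon>. 0 < \<epsilon> \<longrightarrow> \<epsilon> < \<epsilon>0 \<longrightarrow> (\<exists>u v. depleted_NS_sol \<epsilon> T u v \<and> sup_error u v \<le> ennreal \<delta>)"
proof -
  \<comment> \<open>Each of the two norms may contribute \<delta> / 2; they are controlled through
    their powers 2 and p.\<close>
  define \<delta>' where "\<delta>' = min ((\<delta> / 2) powr 2) ((\<delta> / 2) powr p)"
  have \<delta>': "0 < \<delta>'" using \<delta> by (simp add: \<delta>'_def)
  obtain \<epsilon>0 where e0: "\<epsilon>0 > 0" and e: "\<forall>\<epsilon>. 0 < \<epsilon> \<longrightarrow> \<epsilon> < \<epsilon>0 \<longrightarrow> (\<exists>u v. depleted_NS_sol \<epsilon> T u v \<and> (\<forall>t. 0 < t \<longrightarrow> t < T \<longrightarrow>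
     Lp_pow 2 {0<..} (\<lambda>z. u t z - u0 z) \<le> ennreal \<delta>' \<and>
     Lp_pow p (UNIV \<times> {0<..}) (\<lambda>(x, z). v t x z - v0 (x - t * u0 z, z)) \<le> ennreal \<delta>'))"
    using approximate_solutions[OF \<delta>'] by (elim exE conjE)
  show ?thesis
  proof (intro exI[of _ \<epsilon>0] conjI e0 allI impI)
    fix \<epsilon> assume eps: "0 < \<epsilon>" "\<epsilon> < \<epsilon>0"
    obtain u v where NS: "depleted_NS_sol \<epsilon> T u v" and uv: "\<forall>t. 0 < t \<longrightarrow> t < T \<longrightarrow>
     Lp_pow 2 {0<..} (\<lambda>z. u t z - u0 z) \<le> ennreal \<delta>' \<and>
     Lp_pow p (UNIV \<times> {0<..}) (\<lambda>(x, z). v t x z - v0 (x - t * u0 z, z)) \<le> ennreal \<delta>'"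
      using mp[OF mp[OF spec[OF e, of \<epsilon>] eps(1)] eps(2)] by (elim exE conjE)
    have "sup_error u v \<le> ennreal \<delta>" unfolding sup_error_def
    proof (rule esssup_I[OF measurable_error[OF NS]], rule AE_I2)
      fix t assume "t \<in> space (restrict_space lborel {0<..<T})"
      then have t: "0 < t" "t < T" by (auto simp: space_restrict_space)
      have "Lp_norm 2 {0<..} (\<lambda>z. u t z - u0 z) \<le> ennreal (\<delta> / 2)"
        using uv t \<delta> by (intro Lp_norm_le) (auto simp: \<delta>'_def intro: order_trans[OF _ ennreal_leI[OF min.cobounded1]])
      moreover have "Lp_norm p (UNIV \<times> {0<..}) (\<lambda>(x, z). v t x z - v0 (x - t * u0 z, z)) \<le> ennreal (\<delta> / 2)"
        using uv t \<delta> p by (intro Lp_norm_le) (auto simp: \<delta>'_def intro: order_trans[OF _ ennreal_leI[OF min.cobounded2]])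
      ultimately have "Lp_norm 2 {0<..} (\<lambda>z. u t z - u0 z) + Lp_norm p (UNIV \<times> {0<..}) (\<lambda>(x, z). v t x z - v0 (x - t * u0 z, z)) \<le> ennreal (\<delta> / 2) + ennreal (\<delta> / 2)"
        by (rule add_mono)
      also have "\<dots> = ennreal \<delta>" using \<delta> by (simp add: ennreal_plus[symmetric] del: ennreal_plus)
      finally show "Lp_norm 2 {0<..} (\<lambda>z. u t z - u0 z) + Lp_norm p (UNIV \<times> {0<..}) (\<lambda>(x, z). v t x z - v0 (x - t * u0 z, z)) \<le> ennreal \<delta>" .
    qed
    with NS show "\<exists>u v. depleted_NS_sol \<epsilon> T u v \<and> sup_error u v \<le> ennreal \<delta>" by blast
  qed
qed

text \<open>For every \<open>\<epsilon>\<close> a nearly optimal solution is chosen; this diagonalises over the data approximations.\<close>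

lemma vanishing_viscosity:
  "\<exists>u v. (\<forall>\<epsilon>>0. depleted_NS_sol \<epsilon> T (u \<epsilon>) (v \<epsilon>)) \<and> ((\<lambda>\<epsilon>. sup_error (u \<epsilon>) (v \<epsilon>)) \<longlongrightarrow> 0) (at_right 0)"
proof -
  define I where "I \<epsilon> = Inf {sup_error u v | u v. depleted_NS_sol \<epsilon> T u v}" for \<epsilon>
  have "\<exists>u v. depleted_NS_sol \<epsilon> T u v \<and> sup_error u v \<le> I \<epsilon> + ennreal \<epsilon>" if \<epsilon>: "0 < \<epsilon>" for \<epsilon>
  proof (cases "I \<epsilon> = \<top>")
    \<comment> \<open>An infinite infimum makes the requirement void, so the zero solution will
      do.\<close>
    case True
    then show ?thesis using depleted_NS_sol_zero by (intro exI conjI) auto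
  next
    case False
    then have "I \<epsilon> < I \<epsilon> + ennreal \<epsilon>" using \<epsilon> by (simp add: ennreal_add_left_cancel_less[of "I \<epsilon>" 0, simplified] less_top)
    then obtain s where "s \<in> {sup_error u v | u v. depleted_NS_sol \<epsilon> T u v}" "s < I \<epsilon> + ennreal \<epsilon>"
      using Inf_less_iff[of "{sup_error u v | u v. depleted_NS_sol \<epsilon> T u v}"] unfolding I_def by blast
    then show ?thesis by (auto intro: less_imp_le)
  qed
  then obtain u v where uv: "\<And>\<epsilon>. 0 < \<epsilon> \<Longrightarrow> depleted_NS_sol \<epsilon> T (u \<epsilon>) (v \<epsilon>)" "\<And>\<epsilon>. 0 < \<epsilon> \<Longrightarrow> sup_error (u \<epsilon>) (v \<epsilon>) \<le> I \<epsilon> + ennreal \<epsilon>"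
    by metis
  have "((\<lambda>\<epsilon>. sup_error (u \<epsilon>) (v \<epsilon>)) \<longlongrightarrow> 0) (at_right 0)"
  proof (rule order_tendstoI)
    fix c :: ennreal assume "0 < c"
    \<comment> \<open>A finite positive threshold below c, which itself may be infinite.\<close>
    then obtain r where r: "0 < ennreal (real_of_rat r)" "ennreal (real_of_rat r) < c"
      using ennreal_rat_dense[of 0 c] by blast
    define d where "d = real_of_rat r"
    have d: "0 < d" "ennreal d < c" using r unfolding d_def by simp_all
    have "0 < d / 2" using d by simp
    then obtain \<epsilon>0 where e0: "\<epsilon>0 > 0" "\<And>\<epsilon>. 0 < \<epsilon> \<Longrightarrow> \<epsilon> < \<epsilon>0 \<Longrightarrow> \<exists>u v. depleted_NS_sol \<epsilon> T u v \<and> sup_error u v \<le> ennreal (d / 2)"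
      using sup_error_small by blast
    have "sup_error (u \<epsilon>) (v \<epsilon>) < c" if \<epsilon>: "0 < \<epsilon>" "\<epsilon> < min \<epsilon>0 (d / 2)" for \<epsilon>
    proof -
      obtain u' v' where "depleted_NS_sol \<epsilon> T u' v'" "sup_error u' v' \<le> ennreal (d / 2)" using e0(2)[of \<epsilon>] \<epsilon> by auto
      then have I: "I \<epsilon> \<le> ennreal (d / 2)" unfolding I_def by (intro Inf_lower2) auto
      have "sup_error (u \<epsilon>) (v \<epsilon>) \<le> ennreal (d / 2) + ennreal (d / 2)"
        by (rule order_trans[OF uv(2)[OF \<epsilon>(1)] add_mono[OF I ennreal_leI]]) (use \<epsilon>(2) in simp)
      also have "\<dots> = ennreal d" using d by (simp add: ennreal_plus[symmetric] del: ennreal_plus)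
      finally show ?thesis using d(2) by (rule le_less_trans)
    qed
    then show "eventually (\<lambda>\<epsilon>. sup_error (u \<epsilon>) (v \<epsilon>) < c) (at_right 0)"
      using e0(1) d(1) by (intro eventually_at_rightI[of 0 "min \<epsilon>0 (d / 2)"]) auto
  qed simp
  with uv(1) show ?thesis by blast
qed

end

theorem theorem1:
  fixes p T :: real
    and u0 :: "real \<Rightarrow> real"
    and v0p v0m v0 :: "real \<times> real \<Rightarrow> real"
  assumes "1 < p" "p < 2" "0 < T"
    and "Sobolev 2 2 {0<..} u0"
    and "Sobolev 2 p ({0<..} \<times> {0<..}) v0p"
    and "Sobolev 2 p ({..<0} \<times> {0<..}) v0m"
    and "\<And>x z. x > 0 \<Longrightarrow> v0 (x, z) = v0p (x, z)"
    and "\<And>x z. x < 0 \<Longrightarrow> v0 (x, z) = v0m (x, z)"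
    and "Lp p (UNIV \<times> {0<..}) v0"
    and "\<exists>gp gm. trace_right p v0 gp \<and> trace_left p v0 gm \<and>
            \<not> (AE z in lborel. z > 0 \<longrightarrow> gp z = gm z)"
    and "\<exists>wp wm gp gm.
            weak_pd ({0<..} \<times> {0<..}) (1, 0) v0p wp \<and>
            weak_pd ({..<0} \<times> {0<..}) (1, 0) v0m wm \<and>
            trace_right p wp gp \<and> trace_left p wm gm \<and>
            (AE z in lborel. z > 0 \<longrightarrow> gp z = gm z)"
  shows "\<exists>u v :: real \<Rightarrow> real \<Rightarrow> real \<Rightarrow> real \<Rightarrow> _.
           (\<forall>\<epsilon>>0. depleted_NS_sol \<epsilon> T (u \<epsilon>) (v \<epsilon>)) \<and>
           ((\<lambda>\<epsilon>. esssup (restrict_space lborel {0<..<T})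
                (\<lambda>t. Lp_norm 2 {0<..} (\<lambda>z. u \<epsilon> t z - u0 z)
                   + Lp_norm p (UNIV \<times> {0<..})
                       (\<lambda>(x, z). v \<epsilon> t x z - v0 (x - t * u0 z, z))))
             \<longlongrightarrow> 0) (at_right 0)"
proof -
  have u0: "Lp 2 {0<..} u0" using assms(4) by (simp add: numeral_2_eq_2)
  show ?thesis
    using vanishing_viscosity[OF assms(1,3) u0 assms(9)] unfolding sup_error_def[OF assms(1,3) u0 assms(9)] .
qed

end
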